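(* Let $(T,m)$ be a flow tree with flow Laplacian $\mathcal{L}$. Let $F\in L^2_{3/2+\varepsilon}(\mathbb{R})$ for some $\varepsilon>0$. Then, for all $p\in[1,\infty]$, $$\|F(\mathcal{L})\|_{L^p(m)\to L^p(m)}\le\liminf_{q\to\infty}\|F(\mathcal{L}_{\mathbb{T}_q})\|_{L^p(m_{\mathbb{T}_q})\to L^p(m_{\mathbb{T}_q})}.$$ Moreover, for every weight $w:\mathbb{N}\times\mathbb{Z}\times\mathbb{Z}\to[0,\infty)$ which is increasing in the first variable, $$\sup_{y\in T}\sum_{x\in T}w(d(x,y),\ell(x),\ell(y))\,|K_{F(\mathcal{L})}(x,y)|\,m(x)\le\liminf_{q\to\infty}\sup_{y\in\mathbb{T}_q}\sum_{x\in\mathbb{T}_q}w(d_{\mathbb{T}_q}(x,y),\ell(x),\ell(y))\,|K_{F(\mathcal{L}_{\mathbb{T}_q})}(x,y)|\,m_{\mathbb{T}_q}(x).$$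
   Context: Trees. A tree $T$ is an infinite connected graph without cycles, locally finite, identified with its set of vertices and equipped with the graph distance $d$. A tree with root at infinity is such a tree with a fixed boundary point (end) $\omega_*\in\partial T$. For $x\in T$, the predecessor $\mathfrak{p}(x)$ is the neighbour of $x$ lying on the semi-infinite geodesic from $x$ to $\omega_*$; the remaining neighbours form the set $\mathfrak{s}(x)$ of successors. A level function $\ell:T\to\mathbb{Z}$ with $\ell(\mathfrak{p}(x))=\ell(x)+1$ is fixed on each tree (unique up to an additive constant). A flow measure on $T$ is a function $m:T\to(0,\infty)$ with $m(x)=\sum_{y\in\mathfrak{s}(x)}m(y)$ for all $x\in T$, identified with the measure of density $m$ with respect to counting measure; $(T,m)$ is then a flow tree. For a positive integer $q$, $\mathbb{T}_q$ is the homogeneous tree with root at infinity in which every vertex has exactly $q$ successors; it carries the canonical flow measure $m_{\mathbb{T}_q}(x)=q^{\ell(x)}$. The flow Laplacian of $(T,m)$ is $\mathcal{L}=\frac12\nabla^*\nabla$, where $\nabla f(x)=f(x)-f(\mathfrak{p}(x))$ and $\nabla^*$ is the adjoint on $L^2(m)$; it is bounded and selfadjoint on $L^2(m)$ with spectrum $[0,2]$, and $F(\mathcal{L})$ is defined by the Borel functional calculus (it extends to a bounded operator on all $L^p(m)$, $1\le p\le\infty$, for $F$ as in the claim; for $p=\infty$ as the adjoint of $\overline F(\mathcal{L})$ on $L^1(m)$). $\mathcal{L}_{\mathbb{T}_q}$ is the flow Laplacian of $(\mathbb{T}_q,m_{\mathbb{T}_q})$. The integral kernel of an operator $\mathcal{O}$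 on $(T,m)$ is defined by $\mathcal{O}f(x)=\sum_yK_{\mathcal{O}}(x,y)f(y)m(y)$ for finitely supported $f$ (with $m_{\mathbb{T}_q}$ in place of $m$ on $\mathbb{T}_q$). $L^2_s(\mathbb{R})$ is the inhomogeneous $L^2$ Sobolev space of order $s$. Increasing means nondecreasing; $\mathbb{N}$ includes $0$. *)

theory Defs
  imports "HOL-Analysis.Analysis"
begin

section \<open>Trees with root at infinity\<close>

text \<open>
  The vertex set of a tree is the whole type \<open>'a\<close>.  The field \<open>root_end\<close> is the distinguished
  boundary point, as an equivalence class of geodesic rays.
\<close>

record 'a rooted_tree =
  edges :: "('a \<times> 'a) set"
  root_end :: "(nat \<Rightarrow> 'a) set"
  level :: "'a \<Rightarrow> int"

definition is_tree :: "('a \<times> 'a) set \<Rightarrow> bool" where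
  "is_tree E \<longleftrightarrow>
     infinite (UNIV :: 'a set) \<and> sym E \<and> irrefl E \<and>
     (\<forall>x. finite (E `` {x})) \<and>
     (\<forall>x y. (x, y) \<in> E\<^sup>*) \<and>
     \<not> (\<exists>xs. 3 \<le> length xs \<and> distinct xs \<and>
            successively (\<lambda>x y. (x, y) \<in> E) xs \<and> (last xs, hd xs) \<in> E)"

text \<open>\<open>(x, y) \<in> E ^^ n\<close> says that there is a walk of length \<open>n\<close> from \<open>x\<close> to \<open>y\<close>.\<close>

definition graph_dist :: "('a \<times> 'a) set \<Rightarrow> 'a \<Rightarrow> 'a \<Rightarrow> nat" where
  "graph_dist E x y = (LEAST n. (x, y) \<in> E ^^ n)"

definition geodesic_rays :: "('a \<times> 'a) set \<Rightarrow> (nat \<Rightarrow> 'a) set" where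
  "geodesic_rays E = {\<rho>. \<forall>i j. i \<le> j \<longrightarrow> graph_dist E (\<rho> i) (\<rho> j) = j - i}"

definition cofinal_rays :: "('a \<times> 'a) set \<Rightarrow> ((nat \<Rightarrow> 'a) \<times> (nat \<Rightarrow> 'a)) set" where
  "cofinal_rays E =
     {(\<rho>, \<sigma>). \<rho> \<in> geodesic_rays E \<and> \<sigma> \<in> geodesic_rays E \<and>
              (\<exists>i j. \<forall>n. \<rho> (i + n) = \<sigma> (j + n))}"

definition tree_boundary :: "('a \<times> 'a) set \<Rightarrow> (nat \<Rightarrow> 'a) set set" where
  "tree_boundary E = geodesic_rays E // cofinal_rays E"

definition pred :: "'a rooted_tree \<Rightarrow> 'a \<Rightarrow> 'a" where
  "pred T x = (THE z. \<exists>\<rho>\<in>root_end T. \<rho> 0 = x \<and> \<rho> 1 = z)"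

definition succs :: "'a rooted_tree \<Rightarrow> 'a \<Rightarrow> 'a set" where
  "succs T x = edges T `` {x} - {pred T x}"

definition is_rooted_tree :: "'a rooted_tree \<Rightarrow> bool" where
  "is_rooted_tree T \<longleftrightarrow>
     is_tree (edges T) \<and> root_end T \<in> tree_boundary (edges T) \<and>
     (\<forall>x. level T (pred T x) = level T x + 1)"

definition is_flow :: "'a rooted_tree \<Rightarrow> ('a \<Rightarrow> real) \<Rightarrow> bool" where
  "is_flow T m \<longleftrightarrow> (\<forall>x. 0 < m x \<and> m x = (\<Sum>y\<in>succs T x. m y))"

definition is_flow_tree :: "'a rooted_tree \<Rightarrow> ('a \<Rightarrow> real) \<Rightarrow> bool" where
  "is_flow_tree T m \<longleftrightarrow> is_rooted_tree T \<and> is_flow T m"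

definition is_homogeneous_tree :: "nat \<Rightarrow> 'a rooted_tree \<Rightarrow> bool" where
  "is_homogeneous_tree q T \<longleftrightarrow> is_rooted_tree T \<and> (\<forall>x. card (succs T x) = q)"

definition canonical_flow :: "nat \<Rightarrow> 'a rooted_tree \<Rightarrow> 'a \<Rightarrow> real" where
  "canonical_flow q T x = real q powi level T x"


section \<open>Lebesgue spaces and their operators\<close>

definition flow_measure :: "('a \<Rightarrow> real) \<Rightarrow> 'a measure" where
  "flow_measure m = density (count_space UNIV) (\<lambda>x. ennreal (m x))"

text \<open>
  Here \<open>m\<close> is a strictly positive density, so that no two distinct functions agree almost
  everywhere and the essential supremum is a supremum.
\<close>

definition Lp_norm :: "('a \<Rightarrow> real) \<Rightarrow> ennreal \<Rightarrow> ('a \<Rightarrow> complex) \<Rightarrow> ennreal" where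
  "Lp_norm m p f =
     (if p = \<infinity> then (SUP x. ennreal (cmod (f x)))
      else let r = enn2real p; I = (\<integral>\<^sup>+ x. ennreal (cmod (f x) powr r) \<partial>flow_measure m)
           in if I = \<infinity> then \<infinity> else ennreal (enn2real I powr (1 / r)))"

definition Lp :: "('a \<Rightarrow> real) \<Rightarrow> ennreal \<Rightarrow> ('a \<Rightarrow> complex) set" where
  "Lp m p = {f. Lp_norm m p f < \<infinity>}"

definition pairing :: "('a \<Rightarrow> real) \<Rightarrow> ('a \<Rightarrow> complex) \<Rightarrow> ('a \<Rightarrow> complex) \<Rightarrow> complex" where
  "pairing m f g = (\<integral>x. f x * cnj (g x) \<partial>flow_measure m)"

type_synonym 'a operator = "('a \<Rightarrow> complex) \<Rightarrow> 'a \<Rightarrow> complex"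

definition bounded_op :: "('a \<Rightarrow> real) \<Rightarrow> ennreal \<Rightarrow> 'a operator \<Rightarrow> bool" where
  "bounded_op m p A \<longleftrightarrow>
     A \<in> Lp m p \<rightarrow> Lp m p \<and>
     (\<forall>f\<in>Lp m p. \<forall>g\<in>Lp m p. A (\<lambda>x. f x + g x) = (\<lambda>x. A f x + A g x)) \<and>
     (\<forall>f\<in>Lp m p. \<forall>c. A (\<lambda>x. c * f x) = (\<lambda>x. c * A f x)) \<and>
     (\<exists>C::real. \<forall>f\<in>Lp m p. Lp_norm m p (A f) \<le> ennreal C * Lp_norm m p f)"

definition op_norm :: "('a \<Rightarrow> real) \<Rightarrow> ennreal \<Rightarrow> 'a operator \<Rightarrow> ennreal" where
  "op_norm m p A = (SUP f\<in>{f \<in> Lp m p. Lp_norm m p f \<le> 1}. Lp_norm m p (A f))"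

definition L2_adjoint :: "('a \<Rightarrow> real) \<Rightarrow> 'a operator \<Rightarrow> 'a operator" where
  "L2_adjoint m A g =
     (THE h. h \<in> Lp m 2 \<and> (\<forall>f\<in>Lp m 2. pairing m (A f) g = pairing m f h))"

definition kernel :: "('a \<Rightarrow> real) \<Rightarrow> 'a operator \<Rightarrow> 'a \<Rightarrow> 'a \<Rightarrow> complex" where
  "kernel m A =
     (THE K. \<forall>f. finite {y. f y \<noteq> 0} \<longrightarrow>
        (\<forall>x. A f x = (\<Sum>y | f y \<noteq> 0. K x y * f y * of_real (m y))))"


section \<open>Borel functional calculus\<close>

text \<open>
  The scalar spectral measure of a bounded selfadjoint operator \<open>A\<close> at \<open>f\<close> is the compactly
  supported finite Borel measure \<open>\<mu>\<close> with \<open>\<langle>p(A) f, f\<rangle> = \<integral> p d\<mu>\<close> for all polynomials \<open>p\<close>;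
  then \<open>F(A)\<close> is given by \<open>\<langle>F(A) f, f\<rangle> = \<integral> F d\<mu>\<close>, from which \<open>\<langle>F(A) f, g\<rangle>\<close> is recovered by
  polarization.  An operator on a Lebesgue space is \<open>undefined\<close> outside it, to make the
  description definite.
\<close>

definition spectral_measure ::
    "('a \<Rightarrow> real) \<Rightarrow> 'a operator \<Rightarrow> ('a \<Rightarrow> complex) \<Rightarrow> real measure" where
  "spectral_measure m A f =
     (THE \<mu>. sets \<mu> = sets borel \<and> finite_measure \<mu> \<and>
        (\<exists>R. emeasure \<mu> (- {-R..R}) = 0) \<and>
        (\<forall>n. pairing m ((A ^^ n) f) f = (\<integral>t. of_real (t ^ n) \<partial>\<mu>)))"

definition borel_calculus :: "('a \<Rightarrow> real) \<Rightarrow> 'a operator \<Rightarrow> (real \<Rightarrow> complex) \<Rightarrow> 'a operator" where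
  "borel_calculus m A F =
     (THE B. B \<in> extensional (Lp m 2) \<and> bounded_op m 2 B \<and>
        (\<forall>f\<in>Lp m 2. pairing m (B f) f = (\<integral>t. F t \<partial>spectral_measure m A f)))"

text \<open>
  For \<open>p < \<infinity>\<close>, the bounded extension of \<open>F(A)\<close> from \<open>L\<^sup>2 \<inter> L\<^sup>p\<close> to \<open>L\<^sup>p\<close>; for \<open>p = \<infinity>\<close>, the
  adjoint of the extension to \<open>L\<^sup>1\<close> of \<open>G(A)\<close>, where \<open>G\<close> is the complex conjugate of \<open>F\<close>.
\<close>

definition Lp_extension :: "('a \<Rightarrow> real) \<Rightarrow> ennreal \<Rightarrow> 'a operator \<Rightarrow> 'a operator" where
  "Lp_extension m p A =
     (THE B. B \<in> extensional (Lp m p) \<and> bounded_op m p B \<and>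
        (\<forall>f\<in>Lp m 2 \<inter> Lp m p. B f = A f))"

definition L1_adjoint :: "('a \<Rightarrow> real) \<Rightarrow> 'a operator \<Rightarrow> 'a operator" where
  "L1_adjoint m A =
     (THE B. B \<in> extensional (Lp m \<infinity>) \<and> bounded_op m \<infinity> B \<and>
        (\<forall>f\<in>Lp m \<infinity>. \<forall>g\<in>Lp m 1. pairing m (B f) g = pairing m f (A g)))"

definition Lp_calculus ::
    "('a \<Rightarrow> real) \<Rightarrow> ennreal \<Rightarrow> 'a operator \<Rightarrow> (real \<Rightarrow> complex) \<Rightarrow> 'a operator" where
  "Lp_calculus m p A F =
     (if p = \<infinity> then L1_adjoint m (Lp_extension m 1 (borel_calculus m A (\<lambda>t. cnj (F t))))
      else Lp_extension m p (borel_calculus m A F))"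


section \<open>The flow Laplacian\<close>

definition flow_gradient :: "'a rooted_tree \<Rightarrow> 'a operator" where
  "flow_gradient T f x = f x - f (pred T x)"

definition flow_laplacian :: "'a rooted_tree \<Rightarrow> ('a \<Rightarrow> real) \<Rightarrow> 'a operator" where
  "flow_laplacian T m f x = L2_adjoint m (flow_gradient T) (flow_gradient T f) x / 2"

definition calculus_norm ::
    "'a rooted_tree \<Rightarrow> ('a \<Rightarrow> real) \<Rightarrow> ennreal \<Rightarrow> (real \<Rightarrow> complex) \<Rightarrow> ennreal" where
  "calculus_norm T m p F = op_norm m p (Lp_calculus m p (flow_laplacian T m) F)"

definition calculus_kernel ::
    "'a rooted_tree \<Rightarrow> ('a \<Rightarrow> real) \<Rightarrow> (real \<Rightarrow> complex) \<Rightarrow> 'a \<Rightarrow> 'a \<Rightarrow> complex" where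
  "calculus_kernel T m F = kernel m (borel_calculus m (flow_laplacian T m) F)"

definition weighted_kernel_sup ::
    "'a rooted_tree \<Rightarrow> ('a \<Rightarrow> real) \<Rightarrow> (nat \<Rightarrow> int \<Rightarrow> int \<Rightarrow> real) \<Rightarrow> (real \<Rightarrow> complex) \<Rightarrow> ennreal" where
  "weighted_kernel_sup T m w F =
     (SUP y. \<integral>\<^sup>+ x. ennreal (w (graph_dist (edges T) x y) (level T x) (level T y)
                            * cmod (calculus_kernel T m F x y)) \<partial>flow_measure m)"


section \<open>Sobolev spaces\<close>

text \<open>
  \<open>G\<close> is the Fourier--Plancherel transform of the square-integrable function \<open>F\<close>, as the
  \<open>L\<^sup>2\<close>-limit of the transforms of the truncations of \<open>F\<close>.
\<close>

definition is_fourier_transform :: "(real \<Rightarrow> complex) \<Rightarrow> (real \<Rightarrow> complex) \<Rightarrow> bool" where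
  "is_fourier_transform F G \<longleftrightarrow>
     G \<in> borel_measurable borel \<and>
     ((\<lambda>N::real. \<integral>\<^sup>+ \<xi>. ennreal ((cmod (G \<xi> - (LINT x:{-N..N}|lborel. F x * cis (- (x * \<xi>)))))\<^sup>2)
                 \<partial>lborel) \<longlongrightarrow> 0) at_top"

text \<open>
  The elements are functions rather than classes modulo null sets.  For \<open>s > 1/2\<close> each class
  has exactly one continuous representative, which is the one to be used in the functional
  calculus.
\<close>

definition L2_sobolev :: "real \<Rightarrow> (real \<Rightarrow> complex) set" where
  "L2_sobolev s =
     {F. F \<in> borel_measurable borel \<and> (\<integral>\<^sup>+ x. ennreal ((cmod (F x))\<^sup>2) \<partial>lborel) < \<infinity> \<and>
         (\<exists>G. is_fourier_transform F G \<and>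
              (\<integral>\<^sup>+ \<xi>. ennreal ((1 + \<xi>\<^sup>2) powr s * (cmod (G \<xi>))\<^sup>2) \<partial>lborel) < \<infinity>)}"

end

(* Expand F(1 - x) = sum_n c_n U_n(x) in Chebyshev polynomials of the second kind; the Sobolev
   hypothesis gives sum_n (n + 1) |c_n| < infinity.  With A = (S + R)/2 the average of the shift
   (S f)(x) = f(p(x)) and its adjoint R, one has R S = 1, so that U_n(A) is the sum over a <= n of
   S^a R^(n - a), a sum of n + 1 contractions of every L^p.  Hence F(L) is the
   operator sum_n c_n U_n(A), and it is given by averages of f over the descendants of the
   ancestors of x.

   To compare (T, m) with the homogeneous tree of degree q, distribute the q successors of a vertex
   above z among the successors y of z in numbers approximately proportional to m(y)/m(z).  This
   defines a map from the descendants of a vertex of the homogeneous tree onto descendants of a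
   high vertex of T that respects predecessors and levels and does not increase distances.  As q
   tends to infinity the averages of the pullback of a finitely supported f tend to those of f, and
   the normalized masses of the fibres tend to m; every inequality on finite sets passes to the
   limit. *)

theory Submission
  imports Defs "HOL-Probability.Probability" "HOL-Real_Asymp.Real_Asymp"
begin

section \<open>Chebyshev expansions of Sobolev functions\<close>

text \<open>The exponent 3/2 is read off from frequency blocks. A block at frequency
  \<open>R\<close> adds at most a constant times \<open>R^(3/2)\<close> times its L^2 norm to the
  sum of \<open>n |alpha_n|\<close>, where \<open>alpha_n\<close> are the cosine coefficients:
  \<open>R\<close> for the weight \<open>n\<close>, and \<open>R^(1/2)\<close> for Cauchy-Schwarz
  over roughly \<open>R\<close> relevant indices. The surplus \<epsilon> makes dyadic blocks
  summable.

  The operators, measures and kernels of the statement are definite descriptions, so each needs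
  existence and uniqueness. The obstacle is the spectral measure. With \<open>B = L/2\<close> and
  \<open>C = 1 - L/2\<close>, the numbers \<open><B^k C^j f, f>\<close> are nonnegative and behave
  like integrals of \<open>t^k (1 - t)^j\<close>, so the Hausdorff moment problem supplies the
  measure; compact support makes it unique.

  Operators on different trees act on different spaces, so there is no limit operator. What is
  compared are values at finitely many vertices, and a liminf only provides bounds for infinitely
  many \<open>q\<close>, not for all large ones; the transfer is therefore phrased with
  \<open>frequently\<close>. For \<open>p = \<infinity>\<close> finitely supported functions are not
  dense, which forces a truncation that controls values at prescribed vertices instead of
  norms.\<close>

definition angle :: "real measure" where
  "angle = restrict_space lborel {0..pi}"

lemma space_angle [simp]: "space angle = {0..pi}"
  by (simp add: angle_def space_restrict_space)

lemma finite_measure_angle: "finite_measure angle"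
  by (intro finite_measureI) (simp add: angle_def emeasure_restrict_space space_restrict_space)

interpretation angle: finite_measure angle
  by (rule finite_measure_angle)

lemma measurable_angle [measurable (raw)]: "f \<in> measurable borel N \<Longrightarrow> f \<in> measurable angle N"
  unfolding angle_def by (intro measurable_restrict_space1) simp

lemma integrable_angle:
  fixes f :: "real \<Rightarrow> 'b::{banach, second_countable_topology}"
  assumes "f \<in> borel_measurable borel" "\<And>\<theta>. norm (f \<theta>) \<le> B"
  shows "integrable angle f"
  using assms by (intro angle.integrable_const_bound[of _ B]) (auto intro: measurable_angle)

lemma integral_angle:
  fixes f :: "real \<Rightarrow> 'b::{banach, second_countable_topology}"
  shows "(\<integral>\<theta>. f \<theta> \<partial>angle) = (\<integral>\<theta>. indicator {0..pi} \<theta> *\<^sub>R f \<theta> \<partial>lborel)"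
  unfolding angle_def by (rule integral_restrict_space) simp

lemma integral_angle_FTC:
  fixes f :: "real \<Rightarrow> 'b::euclidean_space"
  assumes "\<And>\<theta>. (g has_vector_derivative f \<theta>) (at \<theta>)" "continuous_on UNIV f"
  shows "(\<integral>\<theta>. f \<theta> \<partial>angle) = g pi - g 0"
  unfolding integral_angle
  by (rule integral_FTC_Icc)
     (auto intro: has_vector_derivative_at_within assms continuous_on_subset)

section \<open>Fubini for bounded kernels, and Fourier integrals\<close>

lemma integrable_pair_bounded:
  fixes H :: "'x \<Rightarrow> complex" and k :: "'x \<times> 'y \<Rightarrow> complex"
  assumes M: "sigma_finite_measure M" and N: "finite_measure N"
    and H: "integrable M H" and k[measurable]: "k \<in> borel_measurable (M \<Otimes>\<^sub>M N)"
    and B: "\<And>z. norm (k z) \<le> B"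
  shows "integrable (M \<Otimes>\<^sub>M N) (\<lambda>(x, y). H x * k (x, y))"
proof -
  interpret M: sigma_finite_measure M by fact
  interpret N: finite_measure N by fact
  interpret pair_sigma_finite M N ..
  note [measurable] = borel_measurable_integrable[OF H]
  have "integrable (M \<Otimes>\<^sub>M N) (\<lambda>(x, y). H x)"
  proof (rule Fubini_integrable)
    have "integrable M (\<lambda>x. measure N (space N) * norm (H x))" using H by auto
    then show "integrable M (\<lambda>x. \<integral>y. norm (case (x, y) of (x, y) \<Rightarrow> H x) \<partial>N)" by simp
  qed (auto simp: N.emeasure_eq_measure)
  then have "integrable (M \<Otimes>\<^sub>M N) (\<lambda>z. complex_of_real B * (case z of (x, y) \<Rightarrow> H x))" by (rule integrable_mult_right)
  then show ?thesis
  proof (rule Bochner_Integration.integrable_bound)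
    have "0 \<le> B" using B[of undefined] norm_ge_zero order_trans by blast
    then show "AE z in M \<Otimes>\<^sub>M N. norm (case z of (x, y) \<Rightarrow> H x * k (x, y)) \<le> norm (complex_of_real B * (case z of (x, y) \<Rightarrow> H x))"
      using B by (intro AE_I2) (auto simp: norm_mult mult.commute[of B] intro!: mult_left_mono)
  qed measurable
qed

lemma Fubini_bounded:
  fixes H :: "'x \<Rightarrow> complex" and k :: "'x \<times> 'y \<Rightarrow> complex"
  assumes M: "sigma_finite_measure M" and N: "finite_measure N"
    and H: "integrable M H" and k: "k \<in> borel_measurable (M \<Otimes>\<^sub>M N)"
    and B: "\<And>z. norm (k z) \<le> B"
  shows "(\<integral>x. H x * (\<integral>y. k (x, y) \<partial>N) \<partial>M) = (\<integral>y. (\<integral>x. H x * k (x, y) \<partial>M) \<partial>N)"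
proof -
  interpret M: sigma_finite_measure M by fact
  interpret N: finite_measure N by fact
  interpret pair_sigma_finite M N ..
  show ?thesis
    using Fubini_integral[of "\<lambda>x y. H x * k (x, y)"] integrable_pair_bounded[OF assms]
    by simp
qed

text \<open>There is no factor \<open>1 / (2 pi)\<close>, so inversion takes the form
  \<open>fourier_inv G y = 2 * pi * F y\<close>.\<close>

definition fourier_inv :: "(real \<Rightarrow> complex) \<Rightarrow> real \<Rightarrow> complex" where
  "fourier_inv H x = (\<integral>\<xi>. H \<xi> * cis (x * \<xi>) \<partial>lborel)"

lemma cis_measurable [measurable]: "cis \<in> borel_measurable borel"
  by (intro borel_measurable_continuous_onI continuous_intros)

lemma cnj_measurable [measurable]: "cnj \<in> borel_measurable borel"
  by (intro borel_measurable_continuous_onI continuous_intros)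

lemma integrable_mult_cis:
  assumes "integrable lborel H" "g \<in> borel_measurable borel"
  shows "integrable lborel (\<lambda>\<xi>. H \<xi> * cis (g \<xi>))"
  using assms(1) by (rule Bochner_Integration.integrable_bound) (use assms in \<open>auto simp: norm_mult\<close>)

lemma norm_fourier_inv_le:
  assumes "integrable lborel H"
  shows "norm (fourier_inv H x) \<le> (\<integral>\<xi>. norm (H \<xi>) \<partial>lborel)"
  unfolding fourier_inv_def
  by (rule order_trans[OF integral_norm_bound]) (simp add: norm_mult)

lemma continuous_fourier_inv:
  assumes "integrable lborel H"
  shows "continuous_on UNIV (fourier_inv H)"
  unfolding continuous_on_eq_continuous_at[OF open_UNIV] 
proof
  fix x
  show "isCont (fourier_inv H) x"
    unfolding continuous_at_sequentially comp_def fourier_inv_def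
  proof safe
    fix u :: "nat \<Rightarrow> real" assume u: "u \<longlonglongrightarrow> x"
    note [measurable] = borel_measurable_integrable[OF assms]
    show "(\<lambda>n. \<integral>\<xi>. H \<xi> * cis (u n * \<xi>) \<partial>lborel) \<longlonglongrightarrow> (\<integral>\<xi>. H \<xi> * cis (x * \<xi>) \<partial>lborel)"
    proof (rule integral_dominated_convergence[where w="\<lambda>\<xi>. norm (H \<xi>)"])
      show "AE \<xi> in lborel. (\<lambda>n. H \<xi> * cis (u n * \<xi>)) \<longlonglongrightarrow> H \<xi> * cis (x * \<xi>)"
        by (auto intro!: tendsto_intros u)
    qed (use assms in \<open>auto simp: norm_mult\<close>)
  qed
qed

lemma fourier_inv_measurable [measurable]:
  "integrable lborel H \<Longrightarrow> fourier_inv H \<in> borel_measurable borel"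
  by (intro borel_measurable_continuous_onI continuous_fourier_inv)

text \<open>Fubini moves the angular integral inside the frequency integral. There the integrand is
  an explicit smooth function of \<theta>, so it can be integrated by parts at the price of powers
  of \<xi> on \<open>H\<close>, without differentiating \<open>fourier_inv H\<close>.\<close>

lemma fourier_inv_angle:
  assumes H: "integrable lborel H" and g[measurable]: "g \<in> borel_measurable borel"
    and B: "\<And>\<theta>. norm (g \<theta>) \<le> B"
  shows "(\<integral>\<xi>. H \<xi> * (\<integral>\<theta>. cis ((1 - cos \<theta>) * \<xi>) * g \<theta> \<partial>angle) \<partial>lborel)
     = (\<integral>\<theta>. fourier_inv H (1 - cos \<theta>) * g \<theta> \<partial>angle)"
proof -
  have [measurable]: "cos \<in> borel_measurable angle" "g \<in> borel_measurable angle"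
    by (auto intro: measurable_angle)
  have m: "(\<lambda>z. cis ((1 - cos (snd z)) * fst z) * g (snd z)) \<in> borel_measurable (lborel \<Otimes>\<^sub>M angle)"
    by measurable
  have "(\<integral>\<xi>. H \<xi> * (\<integral>\<theta>. cis ((1 - cos \<theta>) * \<xi>) * g \<theta> \<partial>angle) \<partial>lborel)
      = (\<integral>\<theta>. (\<integral>\<xi>. H \<xi> * (cis ((1 - cos \<theta>) * \<xi>) * g \<theta>) \<partial>lborel) \<partial>angle)"
    using Fubini_bounded[OF sigma_finite_lborel finite_measure_angle H m, of B] B
    by (simp add: norm_mult)
  also have "\<dots> = (\<integral>\<theta>. fourier_inv H (1 - cos \<theta>) * g \<theta> \<partial>angle)"
    unfolding fourier_inv_def by (simp flip: mult.assoc)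
  finally show ?thesis .
qed

section \<open>Cauchy-Schwarz and Bessel inequalities\<close>

lemma Cauchy_Schwarz_integral:
  fixes f g :: "'x \<Rightarrow> real"
  assumes [measurable]: "f \<in> borel_measurable M" "g \<in> borel_measurable M"
    and f: "integrable M (\<lambda>x. (f x)\<^sup>2)" and g: "integrable M (\<lambda>x. (g x)\<^sup>2)"
  shows "integrable M (\<lambda>x. f x * g x)"
    "(\<integral>x. \<bar>f x * g x\<bar> \<partial>M)\<^sup>2 \<le> (\<integral>x. (f x)\<^sup>2 \<partial>M) * (\<integral>x. (g x)\<^sup>2 \<partial>M)"
proof -
  show i: "integrable M (\<lambda>x. f x * g x)"
  proof (rule Bochner_Integration.integrable_bound)
    show "integrable M (\<lambda>x. (f x)\<^sup>2 + (g x)\<^sup>2)" using f g by simp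
    have "\<bar>a * b\<bar> \<le> a\<^sup>2 + b\<^sup>2" for a b :: real
      unfolding abs_mult
      using sum_squares_bound[of "\<bar>a\<bar>" "\<bar>b\<bar>"] mult_nonneg_nonneg[OF abs_ge_zero[of a] abs_ge_zero[of b]]
      unfolding power2_abs by linarith
    then show "AE x in M. norm (f x * g x) \<le> norm ((f x)\<^sup>2 + (g x)\<^sup>2)" by simp
  qed measurable
  have "ennreal ((\<integral>x. \<bar>f x * g x\<bar> \<partial>M)\<^sup>2) = (\<integral>\<^sup>+x. ennreal \<bar>f x\<bar> * ennreal \<bar>g x\<bar> \<partial>M)\<^sup>2"
    using i by (subst ennreal_power[symmetric]) (auto simp: nn_integral_eq_integral abs_mult[symmetric] ennreal_mult[symmetric])
  also have "\<dots> \<le> (\<integral>\<^sup>+x. (ennreal \<bar>f x\<bar>)\<^sup>2 \<partial>M) * (\<integral>\<^sup>+x. (ennreal \<bar>g x\<bar>)\<^sup>2 \<partial>M)"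
    by (intro Cauchy_Schwarz_nn_integral) auto
  also have "\<dots> = ennreal ((\<integral>x. (f x)\<^sup>2 \<partial>M) * (\<integral>x. (g x)\<^sup>2 \<partial>M))"
    using f g by (subst ennreal_mult) (auto simp: ennreal_power nn_integral_eq_integral)
  finally show "(\<integral>x. \<bar>f x * g x\<bar> \<partial>M)\<^sup>2 \<le> (\<integral>x. (f x)\<^sup>2 \<partial>M) * (\<integral>x. (g x)\<^sup>2 \<partial>M)"
    by (subst (asm) ennreal_le_iff) auto
qed

text \<open>Integrates \<open>|\<kappa> g - s|^2 \<ge> 0\<close>, where \<open>s\<close> is \<kappa>
  times the orthogonal projection of \<open>g\<close>. Keeping \<kappa> instead of normalizing suits
  sines and cosines on \<open>[0, pi]\<close>, whose squared norm is \<open>pi / 2\<close>.\<close>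

lemma Bessel_inequality:
  fixes g :: "'x \<Rightarrow> complex" and e :: "nat \<Rightarrow> 'x \<Rightarrow> real"
  assumes "finite_measure M"
    and [measurable]: "g \<in> borel_measurable M" "\<And>n. e n \<in> borel_measurable M"
    and B: "\<And>x. norm (g x) \<le> B" and e: "\<And>n x. \<bar>e n x\<bar> \<le> 1"
    and orth: "\<And>n k. n \<in> I \<Longrightarrow> k \<in> I \<Longrightarrow> (\<integral>x. e n x * e k x \<partial>M) = (if n = k then \<kappa> else 0)"
    and "\<kappa> > 0" "finite I"
  shows "(\<Sum>n\<in>I. (norm (\<integral>x. g x * e n x \<partial>M))\<^sup>2) \<le> \<kappa> * (\<integral>x. (norm (g x))\<^sup>2 \<partial>M)"
proof -
  interpret finite_measure M by fact
  have B0: "0 \<le> B" using B order_trans[OF norm_ge_zero] by blast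
  define b where "b n = (\<integral>x. g x * e n x \<partial>M)" for n
  define s where "s x = (\<Sum>n\<in>I. b n * e n x)" for x
  have ie: "integrable M (\<lambda>x. e n x * e k x)" for n k
    by (rule integrable_const_bound[of _ 1]) (auto simp: abs_mult intro!: mult_le_one e)
  have ige: "integrable M (\<lambda>x. g x * e n x)" for n
    by (rule integrable_const_bound[of _ "B * 1"], unfold norm_mult, rule AE_I2, rule mult_mono) (auto simp: B0 e B)
  have igg: "integrable M (\<lambda>x. g x * cnj (g x))"
    by (rule integrable_const_bound[of _ "B * B"]) (auto simp: norm_mult B0 intro!: mult_mono e B)
  have gs_eq: "g x * cnj (s x) = (\<Sum>n\<in>I. cnj (b n) * (g x * e n x))" for x
    unfolding s_def cnj_sum sum_distrib_left by (intro sum.cong) simp_all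
  have igs: "integrable M (\<lambda>x. g x * cnj (s x))"
    unfolding gs_eq by (intro Bochner_Integration.integrable_sum integrable_mult_right ige)
  have "(\<integral>x. g x * cnj (s x) \<partial>M) = (\<Sum>n\<in>I. cnj (b n) * (\<integral>x. g x * e n x \<partial>M))"
    unfolding gs_eq
    by (subst Bochner_Integration.integral_sum) (intro integrable_mult_right ige, simp)
  also have "\<dots> = of_real (\<Sum>n\<in>I. (norm (b n))\<^sup>2)"
    unfolding b_def[symmetric] by (simp add: mult.commute complex_norm_square[symmetric])
  finally have gs: "(\<integral>x. g x * cnj (s x) \<partial>M) = of_real (\<Sum>n\<in>I. (norm (b n))\<^sup>2)" .
  have sg: "(\<integral>x. s x * cnj (g x) \<partial>M) = of_real (\<Sum>n\<in>I. (norm (b n))\<^sup>2)"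
    using arg_cong[OF gs, of cnj] by (simp flip: Bochner_Integration.integral_cnj add: mult.commute)
  have isg: "integrable M (\<lambda>x. s x * cnj (g x))"
    using integrable_cnj[OF igs] by (simp add: mult.commute)
  have ise: "integrable M (\<lambda>x. s x * e k x)" for k
    unfolding s_def sum_distrib_right mult.assoc
    by (intro Bochner_Integration.integrable_sum integrable_mult_right)
       (use ie[of _ k, THEN integrable_of_real[where 'a=complex]] in simp)
  have se: "(\<integral>x. s x * e k x \<partial>M) = \<kappa> * b k" if "k \<in> I" for k
  proof -
    have "(\<integral>x. s x * e k x \<partial>M) = (\<Sum>n\<in>I. b n * (\<integral>x. complex_of_real (e n x * e k x) \<partial>M))"
      unfolding s_def sum_distrib_right mult.assoc
      by (subst Bochner_Integration.integral_sum)
         (use ie[of _ k, THEN integrable_of_real[where 'a=complex]] in auto)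
    also have "\<dots> = (\<Sum>n\<in>I. if n = k then b n * \<kappa> else 0)"
    proof (rule sum.cong)
      fix n assume "n \<in> I"
      show "b n * (\<integral>x. complex_of_real (e n x * e k x) \<partial>M) = (if n = k then b n * \<kappa> else 0)"
        unfolding integral_complex_of_real orth[OF \<open>n \<in> I\<close> that] by simp
    qed simp
    finally show ?thesis using that \<open>finite I\<close> by (simp add: mult.commute)
  qed
  have ss_eq: "s x * cnj (s x) = (\<Sum>k\<in>I. cnj (b k) * (s x * e k x))" for x
    by (subst (2) s_def) (simp add: sum_distrib_left mult_ac)
  have "(\<integral>x. s x * cnj (s x) \<partial>M) = (\<Sum>k\<in>I. cnj (b k) * (\<integral>x. s x * e k x \<partial>M))"
    unfolding ss_eq
    by (subst Bochner_Integration.integral_sum) (intro integrable_mult_right ise, simp)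
  also have "\<dots> = of_real (\<kappa> * (\<Sum>n\<in>I. (norm (b n))\<^sup>2))"
    unfolding of_real_mult of_real_sum complex_norm_square by (simp add: se sum_distrib_left mult_ac)
  finally have ss: "(\<integral>x. s x * cnj (s x) \<partial>M) = of_real (\<kappa> * (\<Sum>n\<in>I. (norm (b n))\<^sup>2))" .
  have iss: "integrable M (\<lambda>x. s x * cnj (s x))"
    unfolding ss_eq by (intro Bochner_Integration.integrable_sum integrable_mult_right ise)
  define Q where "Q = (\<Sum>n\<in>I. (norm (b n))\<^sup>2)"
  have "complex_of_real ((norm (\<kappa> * g x - s x))\<^sup>2) =
      \<kappa>\<^sup>2 * (g x * cnj (g x)) - \<kappa> * (g x * cnj (s x)) - \<kappa> * (s x * cnj (g x)) + s x * cnj (s x)" for x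
    by (subst complex_norm_square) (simp add: algebra_simps power2_eq_square)
  then have "(\<integral>x. complex_of_real ((norm (\<kappa> * g x - s x))\<^sup>2) \<partial>M) =
     \<kappa>\<^sup>2 * (\<integral>x. g x * cnj (g x) \<partial>M) - \<kappa> * Q - \<kappa> * Q + \<kappa> * Q"
    using igg igs isg iss by (simp add: gs sg ss Q_def)
  also have "(\<integral>x. g x * cnj (g x) \<partial>M) = of_real (\<integral>x. (norm (g x))\<^sup>2 \<partial>M)"
    unfolding complex_norm_square[symmetric] by (rule integral_complex_of_real)
  finally have "complex_of_real (\<integral>x. (norm (\<kappa> * g x - s x))\<^sup>2 \<partial>M) = of_real (\<kappa>\<^sup>2 * (\<integral>x. (norm (g x))\<^sup>2 \<partial>M) - \<kappa> * Q)"
    by (simp only: integral_complex_of_real) simp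
  then have "(\<integral>x. (norm (\<kappa> * g x - s x))\<^sup>2 \<partial>M) = \<kappa>\<^sup>2 * (\<integral>x. (norm (g x))\<^sup>2 \<partial>M) - \<kappa> * Q"
    by (simp only: of_real_eq_iff)
  moreover have "0 \<le> (\<integral>x. (norm (\<kappa> * g x - s x))\<^sup>2 \<partial>M)" by simp
  ultimately have "\<kappa> * Q \<le> \<kappa> * (\<kappa> * (\<integral>x. (norm (g x))\<^sup>2 \<partial>M))"
    by (simp add: power2_eq_square mult.assoc)
  then show ?thesis using \<open>\<kappa> > 0\<close> unfolding Q_def b_def by simp
qed

section \<open>An upper Plancherel bound with Gaussian weight\<close>

lemma integral_cis_std_normal:
  "(\<integral>x. cis (t * x) \<partial>std_normal_distribution) = exp (- t\<^sup>2 / 2)"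
  using fun_cong[OF char_std_normal_distribution, of t]
  by (simp add: char_def cis_conv_exp)

lemma nn_integral_gaussian:
  "(\<integral>\<^sup>+\<eta>. ennreal (exp (- (\<eta> - \<xi>)\<^sup>2 / 2)) \<partial>lborel) = ennreal (sqrt (2 * pi))"
proof -
  have "(\<integral>\<^sup>+\<eta>. ennreal (exp (- (\<eta> - \<xi>)\<^sup>2 / 2)) \<partial>lborel)
     = (\<integral>\<^sup>+\<eta>. ennreal (sqrt (2 * pi)) * ennreal (normal_density \<xi> 1 \<eta>) \<partial>lborel)"
    by (intro nn_integral_cong) (simp add: normal_density_def ennreal_mult[symmetric])
  also have "\<dots> = ennreal (sqrt (2 * pi)) * (\<integral>\<^sup>+\<eta>. ennreal (normal_density \<xi> 1 \<eta>) \<partial>lborel)"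
    by (rule nn_integral_cmult) simp
  also have "(\<integral>\<^sup>+\<eta>. ennreal (normal_density \<xi> 1 \<eta>) \<partial>lborel) = 1"
    by (subst nn_integral_eq_integral) auto
  finally show ?thesis by simp
qed

text \<open>Applying Fubini twice turns the weighted energy into a quadratic form in
  \<open>H\<close>, whose kernel is the characteristic function of the normal distribution at
  \<open>\<eta> - \<xi>\<close>.\<close>

lemma gaussian_energy:
  assumes H: "integrable lborel H"
  shows "complex_of_real (\<integral>x. (norm (fourier_inv H x))\<^sup>2 \<partial>std_normal_distribution)
    = (\<integral>\<xi>. H \<xi> * cnj (\<integral>\<eta>. H \<eta> * exp (- (\<eta> - \<xi>)\<^sup>2 / 2) \<partial>lborel) \<partial>lborel)"
proof -
  let ?N = "std_normal_distribution" and ?B = "\<integral>\<xi>. norm (H \<xi>) \<partial>lborel"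
  interpret N: prob_space ?N by (rule prob_space_normal_density) simp
  have N: "finite_measure ?N" by (rule N.finite_measure_axioms)
  note [measurable] = borel_measurable_integrable[OF H] fourier_inv_measurable[OF H]
  have "complex_of_real (\<integral>x. (norm (fourier_inv H x))\<^sup>2 \<partial>?N) = (\<integral>x. fourier_inv H x * cnj (fourier_inv H x) \<partial>?N)"
    unfolding integral_complex_of_real[symmetric] complex_norm_square ..
  also have "\<dots> = (\<integral>x. (\<integral>\<xi>. H \<xi> * (cis (x * \<xi>) * cnj (fourier_inv H x)) \<partial>lborel) \<partial>?N)"
    by (subst (1) fourier_inv_def) (simp flip: mult.assoc)
  also have "\<dots> = (\<integral>\<xi>. H \<xi> * (\<integral>x. cis (x * \<xi>) * cnj (fourier_inv H x) \<partial>?N) \<partial>lborel)"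
    using Fubini_bounded[OF sigma_finite_lborel N H, of "\<lambda>(\<xi>, x). cis (x * \<xi>) * cnj (fourier_inv H x)" ?B]
      norm_fourier_inv_le[OF H]
    by (simp add: norm_mult split_beta')
  also have "\<dots> = (\<integral>\<xi>. H \<xi> * cnj (\<integral>\<eta>. H \<eta> * exp (- (\<eta> - \<xi>)\<^sup>2 / 2) \<partial>lborel) \<partial>lborel)"
  proof (intro Bochner_Integration.integral_cong refl arg_cong2[where f="(*)"])
    fix \<xi>
    show "(\<integral>x. cis (x * \<xi>) * cnj (fourier_inv H x) \<partial>?N)
     = cnj (\<integral>\<eta>. H \<eta> * exp (- (\<eta> - \<xi>)\<^sup>2 / 2) \<partial>lborel)"
  proof -
    have "(\<integral>x. cis (x * \<xi>) * cnj (fourier_inv H x) \<partial>?N) = (\<integral>x. cnj (cis (- (x * \<xi>)) * fourier_inv H x) \<partial>?N)"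
      by (simp add: cis_cnj)
    also have "\<dots> = cnj (\<integral>x. cis (- (x * \<xi>)) * fourier_inv H x \<partial>?N)"
      by (rule Bochner_Integration.integral_cnj)
    also have "(\<integral>x. cis (- (x * \<xi>)) * fourier_inv H x \<partial>?N)
       = (\<integral>x. (\<integral>\<eta>. H \<eta> * cis (x * (\<eta> - \<xi>)) \<partial>lborel) \<partial>?N)"
      unfolding fourier_inv_def
      by (subst integral_mult_right_zero[symmetric])
         (simp add: mult.left_commute cis_mult algebra_simps)
    also have "\<dots> = (\<integral>\<eta>. H \<eta> * (\<integral>x. cis (x * (\<eta> - \<xi>)) \<partial>?N) \<partial>lborel)"
      using Fubini_bounded[OF sigma_finite_lborel N H, of "\<lambda>(\<eta>, x). cis (x * (\<eta> - \<xi>))" 1]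
      by (simp add: split_beta')
    also have "\<dots> = (\<integral>\<eta>. H \<eta> * exp (- (\<eta> - \<xi>)\<^sup>2 / 2) \<partial>lborel)"
      using integral_cis_std_normal[of "\<eta> - \<xi>" for \<eta>] by (simp add: mult.commute[of _ "_ - \<xi>"])
    finally show ?thesis .
  qed
  qed
  finally show ?thesis .
qed

lemma integral_norm_bound_nn_integral:
  fixes f :: "'x \<Rightarrow> 'b::{banach, second_countable_topology}"
  shows "ennreal (norm (integral\<^sup>L M f)) \<le> (\<integral>\<^sup>+x. ennreal (norm (f x)) \<partial>M)"
  by (cases "integrable M f") (auto simp: not_integrable_integral_eq intro: integral_norm_bound_ennreal)

text \<open>Only an upper bound on a bounded range is wanted later, so a Gaussian weight may be
  inserted. The energy is then a quadratic form with kernel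
  \<open>exp (- (\<eta> - \<xi>)^2 / 2)\<close>; by \<open>2 |a b| \<le> a^2 + b^2\<close> and
  symmetry it is bounded by the row integral \<open>sqrt (2 * pi)\<close> times the energy of
  \<open>H\<close>.\<close>

lemma gaussian_Plancherel:
  assumes H: "integrable lborel H" and H2: "integrable lborel (\<lambda>\<xi>. (norm (H \<xi>))\<^sup>2)"
  shows "(\<integral>x. (norm (fourier_inv H x))\<^sup>2 \<partial>std_normal_distribution) \<le> sqrt (2 * pi) * (\<integral>\<xi>. (norm (H \<xi>))\<^sup>2 \<partial>lborel)"
proof -
  note [measurable] = borel_measurable_integrable[OF H]
  define e where "e \<xi> \<eta> = exp (- (\<eta> - \<xi>)\<^sup>2 / 2)" for \<xi> \<eta> :: real
  have [measurable]: "(\<lambda>(\<xi>, \<eta>). e \<xi> \<eta>) \<in> borel_measurable (lborel \<Otimes>\<^sub>M lborel)"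
    "(\<lambda>\<eta>. e \<xi> \<eta>) \<in> borel_measurable lborel" "(\<lambda>\<eta>. e \<eta> \<xi>) \<in> borel_measurable lborel" for \<xi>
    unfolding e_def by measurable
  define h where "h \<xi> = ennreal ((norm (H \<xi>))\<^sup>2)" for \<xi>
  have [measurable]: "h \<in> borel_measurable lborel" unfolding h_def by measurable
  have e_int: "(\<integral>\<^sup>+\<eta>. ennreal (e \<xi> \<eta>) \<partial>lborel) = ennreal (sqrt (2 * pi))" for \<xi>
    unfolding e_def by (rule nn_integral_gaussian)
  have e_sym: "e \<xi> \<eta> = e \<eta> \<xi>" for \<xi> \<eta> unfolding e_def by (simp add: power2_commute)
  have e_pos: "0 \<le> e \<xi> \<eta>" for \<xi> \<eta> unfolding e_def by simp
  have amgm: "norm (H \<xi>) * norm (H \<eta>) * 2 \<le> (norm (H \<xi>))\<^sup>2 + (norm (H \<eta>))\<^sup>2" for \<xi> \<eta>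
    using sum_squares_bound[of "norm (H \<xi>)" "norm (H \<eta>)"] by (simp add: mult_ac)
  let ?E = "\<integral>x. (norm (fourier_inv H x))\<^sup>2 \<partial>std_normal_distribution"
  have "ennreal ?E = ennreal (norm (complex_of_real ?E))" by simp
  also have "\<dots> \<le> (\<integral>\<^sup>+\<xi>. ennreal (norm (H \<xi> * cnj (\<integral>\<eta>. H \<eta> * e \<xi> \<eta> \<partial>lborel))) \<partial>lborel)"
    unfolding gaussian_energy[OF H] e_def by (rule integral_norm_bound_nn_integral)
  also have "\<dots> \<le> (\<integral>\<^sup>+\<xi>. \<integral>\<^sup>+\<eta>. ennreal (norm (H \<xi>)) * (ennreal (norm (H \<eta>)) * ennreal (e \<xi> \<eta>)) \<partial>lborel \<partial>lborel)"
  proof (intro nn_integral_mono)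
    fix \<xi>
    have "ennreal (norm (\<integral>\<eta>. H \<eta> * e \<xi> \<eta> \<partial>lborel)) \<le> (\<integral>\<^sup>+\<eta>. ennreal (norm (H \<eta> * e \<xi> \<eta>)) \<partial>lborel)"
      by (rule integral_norm_bound_nn_integral)
    also have "\<dots> = (\<integral>\<^sup>+\<eta>. ennreal (norm (H \<eta>)) * ennreal (e \<xi> \<eta>) \<partial>lborel)"
      by (simp add: norm_mult ennreal_mult e_pos)
    finally show "ennreal (norm (H \<xi> * cnj (\<integral>\<eta>. H \<eta> * e \<xi> \<eta> \<partial>lborel)))
      \<le> (\<integral>\<^sup>+\<eta>. ennreal (norm (H \<xi>)) * (ennreal (norm (H \<eta>)) * ennreal (e \<xi> \<eta>)) \<partial>lborel)"
      by (subst nn_integral_cmult) (auto simp: norm_mult ennreal_mult intro!: mult_left_mono)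
  qed
  also have "\<dots> \<le> (\<integral>\<^sup>+\<xi>. \<integral>\<^sup>+\<eta>. h \<xi> * ennreal (e \<xi> \<eta> / 2) + h \<eta> * ennreal (e \<xi> \<eta> / 2) \<partial>lborel \<partial>lborel)"
  proof (intro nn_integral_mono)
    fix \<xi> \<eta>
    have "norm (H \<xi>) * norm (H \<eta>) * 2 * (e \<xi> \<eta> / 2) \<le> ((norm (H \<xi>))\<^sup>2 + (norm (H \<eta>))\<^sup>2) * (e \<xi> \<eta> / 2)"
      by (rule mult_right_mono[OF amgm]) (use e_pos in auto)
    then show "ennreal (norm (H \<xi>)) * (ennreal (norm (H \<eta>)) * ennreal (e \<xi> \<eta>)) \<le> h \<xi> * ennreal (e \<xi> \<eta> / 2) + h \<eta> * ennreal (e \<xi> \<eta> / 2)"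
      unfolding h_def using e_pos[of \<xi> \<eta>]
      by (simp add: ennreal_mult[symmetric] ennreal_plus[symmetric] algebra_simps del: ennreal_plus)
  qed
  also have "\<dots> = (\<integral>\<^sup>+\<xi>. \<integral>\<^sup>+\<eta>. h \<xi> * ennreal (e \<xi> \<eta> / 2) \<partial>lborel \<partial>lborel) + (\<integral>\<^sup>+\<xi>. \<integral>\<^sup>+\<eta>. h \<eta> * ennreal (e \<xi> \<eta> / 2) \<partial>lborel \<partial>lborel)"
    by (subst nn_integral_add[symmetric]) (auto intro!: nn_integral_cong nn_integral_add)
  also have "(\<integral>\<^sup>+\<xi>. \<integral>\<^sup>+\<eta>. h \<eta> * ennreal (e \<xi> \<eta> / 2) \<partial>lborel \<partial>lborel) = (\<integral>\<^sup>+\<xi>. \<integral>\<^sup>+\<eta>. h \<xi> * ennreal (e \<xi> \<eta> / 2) \<partial>lborel \<partial>lborel)"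
    by (subst lborel_pair.Fubini') (auto simp: e_sym intro!: nn_integral_cong)
  also have "(\<integral>\<^sup>+\<xi>. \<integral>\<^sup>+\<eta>. h \<xi> * ennreal (e \<xi> \<eta> / 2) \<partial>lborel \<partial>lborel) = (\<integral>\<^sup>+\<xi>. h \<xi> * ennreal (sqrt (2 * pi) / 2) \<partial>lborel)"
  proof (intro nn_integral_cong)
    fix \<xi>
    have "(\<integral>\<^sup>+\<eta>. ennreal (e \<xi> \<eta> / 2) \<partial>lborel) = (\<integral>\<^sup>+\<eta>. ennreal (1/2) * ennreal (e \<xi> \<eta>) \<partial>lborel)"
      using e_pos by (intro nn_integral_cong) (simp add: ennreal_mult[symmetric] del: ennreal_half)
    also have "\<dots> = ennreal (1/2) * ennreal (sqrt (2 * pi))"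
      by (subst nn_integral_cmult) (auto simp: e_int)
    finally have "(\<integral>\<^sup>+\<eta>. ennreal (e \<xi> \<eta> / 2) \<partial>lborel) = ennreal (sqrt (2 * pi) / 2)"
      by (simp add: ennreal_mult[symmetric] del: ennreal_half)
    then show "(\<integral>\<^sup>+\<eta>. h \<xi> * ennreal (e \<xi> \<eta> / 2) \<partial>lborel) = h \<xi> * ennreal (sqrt (2 * pi) / 2)"
      by (subst nn_integral_cmult) auto
  qed
  also have "\<dots> = ennreal (\<integral>\<xi>. (norm (H \<xi>))\<^sup>2 \<partial>lborel) * ennreal (sqrt (2 * pi) / 2)"
    unfolding h_def by (subst nn_integral_multc) (auto simp: nn_integral_eq_integral H2)
  finally have "ennreal ?E \<le> ennreal ((\<integral>\<xi>. (norm (H \<xi>))\<^sup>2 \<partial>lborel) * sqrt (2 * pi))"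
    by (simp add: ennreal_mult[symmetric] ennreal_plus[symmetric] algebra_simps del: ennreal_plus)
  then show ?thesis by (subst (asm) ennreal_le_iff) (auto simp: mult.commute)
qed

text \<open>For \<open>x = 1 - cos \<theta>\<close> the measure
  \<open>sin \<theta> d\<theta>\<close> is \<open>dx\<close> on \<open>[0, 2]\<close>. The normal
  density is at least \<open>exp (-2) / sqrt (2 * pi)\<close> there, which gives the factor
  \<open>exp 2\<close>; the remaining \<open>sqrt (2 * pi)\<close> joins that of
  \<open>gaussian_Plancherel\<close>.\<close>

lemma angle_L2_bound:
  assumes H: "integrable lborel H" and H2: "integrable lborel (\<lambda>\<xi>. (norm (H \<xi>))\<^sup>2)"
  shows "(\<integral>\<theta>. (norm (fourier_inv H (1 - cos \<theta>)))\<^sup>2 * sin \<theta> \<partial>angle) \<le> 2 * pi * exp 2 * (\<integral>\<xi>. (norm (H \<xi>))\<^sup>2 \<partial>lborel)"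
proof -
  define f where "f x = (norm (fourier_inv H x))\<^sup>2" for x
  note [measurable] = fourier_inv_measurable[OF H]
  have f[measurable]: "f \<in> borel_measurable borel" unfolding f_def by measurable
  define B where "B = (\<integral>\<xi>. norm (H \<xi>) \<partial>lborel)"
  have fB: "f x \<le> B\<^sup>2" for x
    unfolding f_def B_def by (intro power_mono norm_fourier_inv_le H) simp
  have f0: "0 \<le> f x" for x by (simp add: f_def)
  have E: "(\<integral>\<^sup>+x. ennreal (f x) \<partial>std_normal_distribution) = ennreal (\<integral>x. f x \<partial>std_normal_distribution)"
  proof (intro nn_integral_eq_integral)
    interpret N: prob_space std_normal_distribution by (rule prob_space_normal_density) simp
    show "integrable std_normal_distribution f"
      by (rule N.integrable_const_bound[of _ "B\<^sup>2"]) (use fB f0 in auto)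
  qed (use f0 in auto)
  have i: "integrable angle (\<lambda>\<theta>. f (1 - cos \<theta>) * sin \<theta>)"
    by (rule integrable_angle[where B="B\<^sup>2 * 1"])
       (auto simp: abs_mult f0 simp del: mult_1_right intro!: mult_mono fB)
  have "ennreal (\<integral>\<theta>. f (1 - cos \<theta>) * sin \<theta> \<partial>angle) = (\<integral>\<^sup>+\<theta>. ennreal (f (1 - cos \<theta>) * sin \<theta>) \<partial>angle)"
    using i by (intro nn_integral_eq_integral[symmetric]) (auto intro!: AE_I2 mult_nonneg_nonneg f0 sin_ge_zero)
  also have "\<dots> = (\<integral>\<^sup>+\<theta>. ennreal (f (1 - cos \<theta>) * sin \<theta>) * indicator {0..pi} \<theta> \<partial>lborel)"
    unfolding angle_def by (rule nn_integral_restrict_space) simp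
  also have "\<dots> = (\<integral>\<^sup>+\<theta>. ennreal (f (1 - cos \<theta>) * sin \<theta> * indicator {0..pi} \<theta>) \<partial>lborel)"
    by (intro nn_integral_cong) (auto split: split_indicator)
  also have "\<dots> = (\<integral>\<^sup>+x. ennreal (f x * indicator {1 - cos 0..1 - cos pi} x) \<partial>lborel)"
    by (rule nn_integral_substitution[symmetric])
       (auto intro!: derivative_eq_intros continuous_intros sin_ge_zero simp: set_borel_measurable_def)
  also have "\<dots> \<le> (\<integral>\<^sup>+x. ennreal (sqrt (2 * pi) * exp 2) * (ennreal (std_normal_density x) * ennreal (f x)) \<partial>lborel)"
  proof (intro nn_integral_mono)
    fix x :: real
    have "f x * indicator {1 - cos 0..1 - cos pi} x \<le> f x * exp (2 - x\<^sup>2 / 2)"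
    proof (cases "x \<in> {0..2}")
      case True
      then have "x\<^sup>2 \<le> 2\<^sup>2" by (intro power_mono) auto
      then have "1 \<le> exp (2 - x\<^sup>2 / 2)" by simp
      then show ?thesis using True mult_left_mono[of 1 "exp (2 - x\<^sup>2 / 2)" "f x"] f0[of x] by simp
    next
      case False
      then show ?thesis using f0[of x] by simp
    qed
    also have "\<dots> = sqrt (2 * pi) * exp 2 * (std_normal_density x * f x)"
      by (simp add: std_normal_density_def diff_conv_add_uminus exp_add del: add_uminus_conv_diff)
    finally show "ennreal (f x * indicator {1 - cos 0..1 - cos pi} x) \<le> ennreal (sqrt (2 * pi) * exp 2) * (ennreal (std_normal_density x) * ennreal (f x))"
      by (simp add: ennreal_mult[symmetric] f0 ennreal_leI)
  qed
  also have "\<dots> = ennreal (sqrt (2 * pi) * exp 2) * (\<integral>\<^sup>+x. ennreal (f x) \<partial>std_normal_distribution)"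
    by (subst nn_integral_cmult) (auto simp: nn_integral_density)
  also have "\<dots> = ennreal (sqrt (2 * pi) * exp 2 * (\<integral>x. f x \<partial>std_normal_distribution))"
    unfolding E by (subst ennreal_mult[symmetric]) (auto simp: f0)
  finally have "(\<integral>\<theta>. f (1 - cos \<theta>) * sin \<theta> \<partial>angle) \<le> sqrt (2 * pi) * exp 2 * (\<integral>x. f x \<partial>std_normal_distribution)"
    by (subst (asm) ennreal_le_iff) (auto simp: f0)
  also have "\<dots> \<le> sqrt (2 * pi) * exp 2 * (sqrt (2 * pi) * (\<integral>\<xi>. (norm (H \<xi>))\<^sup>2 \<partial>lborel))"
    unfolding f_def by (intro mult_left_mono gaussian_Plancherel H H2) auto
  also have "\<dots> = 2 * pi * exp 2 * (\<integral>\<xi>. (norm (H \<xi>))\<^sup>2 \<partial>lborel)"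
    by (simp add: mult_ac flip: real_sqrt_mult)
  finally show ?thesis unfolding f_def .
qed

section \<open>Cosine coefficients of band-limited functions\<close>

definition cheb_coef :: "nat \<Rightarrow> (real \<Rightarrow> complex) \<Rightarrow> complex" where
  "cheb_coef n H = (\<integral>\<theta>. fourier_inv H (1 - cos \<theta>) * complex_of_real (cos (real n * \<theta>)) \<partial>angle)"

lemma cheb_coef_eq:
  assumes "integrable lborel H"
  shows "cheb_coef n H = (\<integral>\<xi>. H \<xi> * (\<integral>\<theta>. cis ((1 - cos \<theta>) * \<xi>) * complex_of_real (cos (real n * \<theta>)) \<partial>angle) \<partial>lborel)"
  unfolding cheb_coef_def
  by (rule fourier_inv_angle[OF assms, of _ 1, symmetric]) auto

lemma has_vector_derivative_cis:
  "((\<lambda>\<theta>. cis ((1 - cos \<theta>) * \<xi>)) has_vector_derivative (\<i> * \<xi> * complex_of_real (sin \<theta>) * cis ((1 - cos \<theta>) * \<xi>))) (at \<theta>)"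
proof -
  have "((\<lambda>z. exp (\<i> * ((1 - cos z) * of_real \<xi>))) has_field_derivative
      (\<i> * \<xi> * sin (of_real \<theta>) * exp (\<i> * ((1 - cos (of_real \<theta>)) * of_real \<xi>)))) (at (of_real \<theta>))"
    by (auto intro!: derivative_eq_intros)
  from has_vector_derivative_real_field[OF this] show ?thesis
    by (simp add: cis_conv_exp sin_of_real cos_of_real)
qed

text \<open>The boundary terms vanish because \<open>sin (n * pi) = 0\<close>. One factor
  \<open>n\<close> costs one factor \<xi> and leaves a factor \<open>sin \<theta>\<close>, exactly
  what the change of variable in \<open>angle_L2_bound\<close> asks for.\<close>

lemma integral_by_parts_sin:
  "n * (\<integral>\<theta>. cis ((1 - cos \<theta>) * \<xi>) * complex_of_real (cos (real n * \<theta>)) \<partial>angle)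
    = - (\<i> * \<xi>) * (\<integral>\<theta>. cis ((1 - cos \<theta>) * \<xi>) * complex_of_real (sin \<theta> * sin (real n * \<theta>)) \<partial>angle)"
proof -
  have i: "integrable angle (\<lambda>\<theta>. cis ((1 - cos \<theta>) * \<xi>) * complex_of_real (cos (real n * \<theta>)))"
      "integrable angle (\<lambda>\<theta>. cis ((1 - cos \<theta>) * \<xi>) * complex_of_real (sin \<theta> * sin (real n * \<theta>)))"
    by (rule integrable_angle[where B=1]; simp add: norm_mult abs_mult mult_le_one del: of_real_mult)+
  have "(\<integral>\<theta>. (\<i> * \<xi> * complex_of_real (sin \<theta>) * cis ((1 - cos \<theta>) * \<xi>)) * complex_of_real (sin (real n * \<theta>))
        + cis ((1 - cos \<theta>) * \<xi>) * complex_of_real (n * cos (real n * \<theta>)) \<partial>angle)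
     = cis ((1 - cos pi) * \<xi>) * complex_of_real (sin (real n * pi)) - cis ((1 - cos 0) * \<xi>) * complex_of_real (sin (real n * 0))"
  proof (rule integral_angle_FTC)
    fix \<theta> :: real
    have "((\<lambda>\<theta>. complex_of_real (sin (real n * \<theta>))) has_vector_derivative complex_of_real (n * cos (real n * \<theta>))) (at \<theta>)"
      by (intro has_vector_derivative_of_real) (auto intro!: derivative_eq_intros)
    from has_vector_derivative_mult[OF has_vector_derivative_cis[of \<xi> \<theta>] this]
    show "((\<lambda>\<theta>. cis ((1 - cos \<theta>) * \<xi>) * complex_of_real (sin (real n * \<theta>))) has_vector_derivative
       (\<i> * \<xi> * complex_of_real (sin \<theta>) * cis ((1 - cos \<theta>) * \<xi>)) * complex_of_real (sin (real n * \<theta>))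
        + cis ((1 - cos \<theta>) * \<xi>) * complex_of_real (n * cos (real n * \<theta>))) (at \<theta>)"
      by (simp add: add.commute)
  qed (intro continuous_intros)
  also have "(\<lambda>\<theta>. (\<i> * \<xi> * complex_of_real (sin \<theta>) * cis ((1 - cos \<theta>) * \<xi>)) * complex_of_real (sin (real n * \<theta>))
        + cis ((1 - cos \<theta>) * \<xi>) * complex_of_real (n * cos (real n * \<theta>)))
     = (\<lambda>\<theta>. (\<i> * \<xi>) * (cis ((1 - cos \<theta>) * \<xi>) * complex_of_real (sin \<theta> * sin (real n * \<theta>)))
        + n * (cis ((1 - cos \<theta>) * \<xi>) * complex_of_real (cos (real n * \<theta>))))"
    by (simp add: mult_ac)
  finally show ?thesis using i by (simp add: eq_neg_iff_add_eq_0 add.commute)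
qed

text \<open>The boundary terms vanish thanks to the factor \<open>sin \<theta>\<close> left by the
  first integration by parts; \<open>cos (n * \<theta>)\<close> alone would not vanish at the
  ends.\<close>

lemma integral_by_parts_cos:
  "n * (\<integral>\<theta>. cis ((1 - cos \<theta>) * \<xi>) * complex_of_real (sin \<theta> * sin (real n * \<theta>)) \<partial>angle)
    = (\<integral>\<theta>. cis ((1 - cos \<theta>) * \<xi>) * complex_of_real (cos \<theta> * cos (real n * \<theta>)) \<partial>angle)
      + \<i> * \<xi> * (\<integral>\<theta>. cis ((1 - cos \<theta>) * \<xi>) * complex_of_real ((sin \<theta>)\<^sup>2 * cos (real n * \<theta>)) \<partial>angle)"
proof -
  have i: "integrable angle (\<lambda>\<theta>. cis ((1 - cos \<theta>) * \<xi>) * complex_of_real (cos \<theta> * cos (real n * \<theta>)))"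
      "integrable angle (\<lambda>\<theta>. cis ((1 - cos \<theta>) * \<xi>) * complex_of_real ((sin \<theta>)\<^sup>2 * cos (real n * \<theta>)))"
      "integrable angle (\<lambda>\<theta>. cis ((1 - cos \<theta>) * \<xi>) * complex_of_real (sin \<theta> * sin (real n * \<theta>)))"
    by (rule integrable_angle[where B=1];
        simp add: norm_mult abs_mult mult_le_one abs_square_le_1 del: of_real_mult)+
  have "(\<integral>\<theta>. (\<i> * \<xi> * complex_of_real (sin \<theta>) * cis ((1 - cos \<theta>) * \<xi>)) * complex_of_real (sin \<theta> * cos (real n * \<theta>))
        + cis ((1 - cos \<theta>) * \<xi>) * complex_of_real (cos \<theta> * cos (real n * \<theta>) - n * (sin \<theta> * sin (real n * \<theta>))) \<partial>angle)
     = cis ((1 - cos pi) * \<xi>) * complex_of_real (sin pi * cos (real n * pi)) - cis ((1 - cos 0) * \<xi>) * complex_of_real (sin 0 * cos (real n * 0))"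
  proof (rule integral_angle_FTC)
    fix \<theta> :: real
    have "((\<lambda>\<theta>. complex_of_real (sin \<theta> * cos (real n * \<theta>))) has_vector_derivative
       complex_of_real (cos \<theta> * cos (real n * \<theta>) - n * (sin \<theta> * sin (real n * \<theta>)))) (at \<theta>)"
      by (intro has_vector_derivative_of_real) (auto intro!: derivative_eq_intros)
    from has_vector_derivative_mult[OF has_vector_derivative_cis[of \<xi> \<theta>] this]
    show "((\<lambda>\<theta>. cis ((1 - cos \<theta>) * \<xi>) * complex_of_real (sin \<theta> * cos (real n * \<theta>))) has_vector_derivative
       (\<i> * \<xi> * complex_of_real (sin \<theta>) * cis ((1 - cos \<theta>) * \<xi>)) * complex_of_real (sin \<theta> * cos (real n * \<theta>))
        + cis ((1 - cos \<theta>) * \<xi>) * complex_of_real (cos \<theta> * cos (real n * \<theta>) - n * (sin \<theta> * sin (real n * \<theta>)))) (at \<theta>)"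
      by (simp add: add.commute)
  qed (intro continuous_intros)
  also have "(\<lambda>\<theta>. (\<i> * \<xi> * complex_of_real (sin \<theta>) * cis ((1 - cos \<theta>) * \<xi>)) * complex_of_real (sin \<theta> * cos (real n * \<theta>))
        + cis ((1 - cos \<theta>) * \<xi>) * complex_of_real (cos \<theta> * cos (real n * \<theta>) - n * (sin \<theta> * sin (real n * \<theta>))))
     = (\<lambda>\<theta>. (\<i> * \<xi>) * (cis ((1 - cos \<theta>) * \<xi>) * complex_of_real ((sin \<theta>)\<^sup>2 * cos (real n * \<theta>)))
        + cis ((1 - cos \<theta>) * \<xi>) * complex_of_real (cos \<theta> * cos (real n * \<theta>))
        - n * (cis ((1 - cos \<theta>) * \<xi>) * complex_of_real (sin \<theta> * sin (real n * \<theta>))))"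
    by (simp add: algebra_simps power2_eq_square)
  finally show ?thesis using i by (simp add: add.commute)
qed

lemma integral_angle_cos:
  assumes "sin (j * pi) = 0" "j \<noteq> 0"
  shows "(\<integral>\<theta>. cos (j * \<theta>) \<partial>angle) = 0"
proof -
  have "(\<integral>\<theta>. cos (j * \<theta>) \<partial>angle) = sin (j * pi) / j - sin (j * 0) / j"
    by (rule integral_angle_FTC)
       (auto intro!: derivative_eq_intros continuous_intros simp: assms has_real_derivative_iff_has_vector_derivative[symmetric])
  then show ?thesis using assms by simp
qed

lemma integral_angle_cos_int: "i \<noteq> 0 \<Longrightarrow> (\<integral>\<theta>. cos (real_of_int i * \<theta>) \<partial>angle) = 0"
  by (rule integral_angle_cos) (auto simp: mult.commute sin_integer_2pi sin_zero_iff_int2)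

lemma measure_angle: "measure angle {0..pi} = pi"
  unfolding angle_def by (subst measure_restrict_space) auto

lemma orthogonal_cos_sin:
  assumes "0 < n" "0 < k"
  shows "(\<integral>\<theta>. cos (real n * \<theta>) * cos (real k * \<theta>) \<partial>angle) = (if n = k then pi / 2 else 0)"
    "(\<integral>\<theta>. sin (real n * \<theta>) * sin (real k * \<theta>) \<partial>angle) = (if n = k then pi / 2 else 0)"
proof -
  have i: "integrable angle (\<lambda>\<theta>. cos (c * \<theta>))" for c :: real
    by (rule integrable_angle[where B=1]) auto
  have p: "(\<integral>\<theta>. cos ((real n + real k) * \<theta>) \<partial>angle) = 0"
    using integral_angle_cos_int[of "int n + int k"] assms by simp
  have m: "(\<integral>\<theta>. cos ((real n - real k) * \<theta>) \<partial>angle) = (if n = k then pi else 0)"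
    using integral_angle_cos_int[of "int n - int k"] by (auto simp: measure_angle)
  have c: "cos (real n * \<theta>) * cos (real k * \<theta>) = (cos ((real n - real k) * \<theta>) + cos ((real n + real k) * \<theta>)) / 2" for \<theta>
    by (simp add: cos_times_cos left_diff_distrib distrib_right)
  have s: "sin (real n * \<theta>) * sin (real k * \<theta>) = (cos ((real n - real k) * \<theta>) - cos ((real n + real k) * \<theta>)) / 2" for \<theta>
    by (simp add: sin_times_sin left_diff_distrib distrib_right)
  show "(\<integral>\<theta>. cos (real n * \<theta>) * cos (real k * \<theta>) \<partial>angle) = (if n = k then pi / 2 else 0)"
    unfolding c using p m i by simp
  show "(\<integral>\<theta>. sin (real n * \<theta>) * sin (real k * \<theta>) \<partial>angle) = (if n = k then pi / 2 else 0)"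
    unfolding s using p m i by simp
qed

text \<open>Since \<open>(R + n) (R + n - 1) \<le> 2 (R^2 + n^2)\<close>, each term is at most
  \<open>2 R^2 (1 / (R + n - 1) - 1 / (R + n))\<close>, and these differences telescope.\<close>

lemma sum_telescope_square:
  fixes R :: real
  assumes "R > 0"
  shows "(\<Sum>n\<in>{1..K}. R\<^sup>2 / (R\<^sup>2 + (real n)\<^sup>2)) \<le> 2 * R"
proof -
  have "(\<Sum>n\<in>{1..K}. R\<^sup>2 / (R\<^sup>2 + (real n)\<^sup>2)) \<le> 2 * R\<^sup>2 * (1 / R - 1 / (R + K))"
  proof (induction K)
    case (Suc K)
    let ?n = "real (Suc K)"
    have "(R + ?n) * (R + K) \<le> 2 * (R\<^sup>2 + ?n\<^sup>2)"
    proof -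
      have "(R + ?n) * (R + K) \<le> (R + ?n) * (R + ?n)" using assms by (intro mult_left_mono) auto
      also have "\<dots> \<le> 2 * (R\<^sup>2 + ?n\<^sup>2)" using sum_squares_bound[of R ?n] by (simp add: power2_eq_square algebra_simps)
      finally show ?thesis .
    qed
    moreover have "0 < (R + ?n) * (R + K)" using assms by simp
    ultimately have "2 * R\<^sup>2 / (2 * (R\<^sup>2 + ?n\<^sup>2)) \<le> 2 * R\<^sup>2 / ((R + ?n) * (R + K))"
      by (intro divide_left_mono) (auto intro!: mult_pos_pos add_pos_nonneg assms)
    also have "\<dots> = 2 * R\<^sup>2 * (1 / (R + K) - 1 / (R + ?n))"
      using assms by (simp add: divide_simps)
    also have "2 * R\<^sup>2 / (2 * (R\<^sup>2 + ?n\<^sup>2)) = R\<^sup>2 / (R\<^sup>2 + ?n\<^sup>2)" by (rule mult_divide_mult_cancel_left) simp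
    finally show ?case using Suc by (simp add: algebra_simps)
  qed simp
  also have "\<dots> \<le> 2 * R\<^sup>2 * (1 / R)" using assms by (intro mult_left_mono) auto
  also have "\<dots> = 2 * R" using assms by (simp add: power2_eq_square)
  finally show ?thesis .
qed

text \<open>Cauchy-Schwarz against the indicator of the band, which has length
  \<open>2 * R\<close>.\<close>

lemma frequency_bounds:
  fixes H :: "real \<Rightarrow> complex"
  assumes [measurable]: "H \<in> borel_measurable borel"
    and supp: "\<And>\<xi>. R < \<bar>\<xi>\<bar> \<Longrightarrow> H \<xi> = 0" and "0 \<le> R"
    and H2: "integrable lborel (\<lambda>\<xi>. (norm (H \<xi>))\<^sup>2)"
  shows "integrable lborel H" "(\<integral>\<xi>. norm (H \<xi>) \<partial>lborel)\<^sup>2 \<le> 2 * R * (\<integral>\<xi>. (norm (H \<xi>))\<^sup>2 \<partial>lborel)"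
proof -
  have eq: "indicator {-R..R} \<xi> * norm (H \<xi>) = norm (H \<xi>)" for \<xi>
    using supp[of \<xi>] by (auto split: split_indicator)
  have i: "integrable lborel (\<lambda>\<xi>. (indicator {-R..R} \<xi> :: real)\<^sup>2)" "(\<integral>\<xi>. (indicator {-R..R} \<xi> :: real)\<^sup>2 \<partial>lborel) = 2 * R"
  proof -
    have "(indicator {-R..R} \<xi> :: real)\<^sup>2 = indicator {-R..R} \<xi>" for \<xi>
      by (simp split: split_indicator)
    then show "integrable lborel (\<lambda>\<xi>. (indicator {-R..R} \<xi> :: real)\<^sup>2)" "(\<integral>\<xi>. (indicator {-R..R} \<xi> :: real)\<^sup>2 \<partial>lborel) = 2 * R"
      using \<open>0 \<le> R\<close> by simp_all
  qed
  have "integrable lborel (\<lambda>\<xi>. norm (H \<xi>))"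
    using Cauchy_Schwarz_integral(1)[OF _ _ i(1) H2] unfolding eq by simp
  then show "integrable lborel H" by (simp add: integrable_norm_iff)
  show "(\<integral>\<xi>. norm (H \<xi>) \<partial>lborel)\<^sup>2 \<le> 2 * R * (\<integral>\<xi>. (norm (H \<xi>))\<^sup>2 \<partial>lborel)"
    using Cauchy_Schwarz_integral(2)[OF _ _ i(1) H2] unfolding eq i(2) by simp
qed

lemma frequency_weight:
  fixes H :: "real \<Rightarrow> complex" and c :: "real \<Rightarrow> complex"
  assumes [measurable]: "H \<in> borel_measurable borel" "c \<in> borel_measurable borel"
    and supp: "\<And>\<xi>. R < \<bar>\<xi>\<bar> \<Longrightarrow> H \<xi> = 0" and c: "\<And>\<xi>. \<bar>\<xi>\<bar> \<le> R \<Longrightarrow> norm (c \<xi>) \<le> B"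
    and H2: "integrable lborel (\<lambda>\<xi>. (norm (H \<xi>))\<^sup>2)"
  shows "integrable lborel (\<lambda>\<xi>. (norm (c \<xi> * H \<xi>))\<^sup>2)"
    "(\<integral>\<xi>. (norm (c \<xi> * H \<xi>))\<^sup>2 \<partial>lborel) \<le> B\<^sup>2 * (\<integral>\<xi>. (norm (H \<xi>))\<^sup>2 \<partial>lborel)"
proof -
  have le: "(norm (c \<xi> * H \<xi>))\<^sup>2 \<le> B\<^sup>2 * (norm (H \<xi>))\<^sup>2" for \<xi>
  proof (cases "R < \<bar>\<xi>\<bar>")
    case False
    then show ?thesis
      using c[of \<xi>] by (auto simp: norm_mult power_mult_distrib intro!: mult_right_mono power_mono)
  qed (simp add: supp)
  have i: "integrable lborel (\<lambda>\<xi>. B\<^sup>2 * (norm (H \<xi>))\<^sup>2)" using H2 by simp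
  show i': "integrable lborel (\<lambda>\<xi>. (norm (c \<xi> * H \<xi>))\<^sup>2)"
    by (rule Bochner_Integration.integrable_bound[OF i]) (use le in auto)
  show "(\<integral>\<xi>. (norm (c \<xi> * H \<xi>))\<^sup>2 \<partial>lborel) \<le> B\<^sup>2 * (\<integral>\<xi>. (norm (H \<xi>))\<^sup>2 \<partial>lborel)"
    using integral_mono[OF i' i le] by simp
qed

text \<open>By one and by two integrations by parts, \<open>n * cheb_coef n H\<close> and
  \<open>n^2 * cheb_coef n H\<close> are, up to sign, sine and cosine coefficients of functions with
  energy of order \<open>R^2 * E\<close> and \<open>R^4 * E\<close>. Bessel's inequality, then
  Cauchy-Schwarz with the weight \<open>1 + n^2 / R^2\<close>, whose reciprocals sum to at most
  \<open>2 * R\<close>, give the power \<open>R^3\<close>.\<close>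

lemma cheb_coef_band_limited:
  fixes H :: "real \<Rightarrow> complex"
  assumes [measurable]: "H \<in> borel_measurable borel"
    and supp: "\<And>\<xi>. R < \<bar>\<xi>\<bar> \<Longrightarrow> H \<xi> = 0" and R: "1 \<le> R"
    and H2: "integrable lborel (\<lambda>\<xi>. (norm (H \<xi>))\<^sup>2)"
  defines "E \<equiv> \<integral>\<xi>. (norm (H \<xi>))\<^sup>2 \<partial>lborel"
  shows "(\<Sum>n\<in>{1..K}. real n * norm (cheb_coef n H))\<^sup>2 \<le> (6 * pi\<^sup>2 * exp 2 + 4 * pi\<^sup>2) * R ^ 3 * E"
proof -
  \<comment> \<open>\<open>H1\<close> and \<open>H2'\<close> are the frequency sides of the first
    and second derivative of \<open>fourier_inv H\<close>.\<close>
  define H1 where "H1 \<xi> = \<i> * complex_of_real \<xi> * H \<xi>" for \<xi>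
  define H2' where "H2' \<xi> = - (complex_of_real \<xi>)\<^sup>2 * H \<xi>" for \<xi>
  have m[measurable]: "H1 \<in> borel_measurable borel" "H2' \<in> borel_measurable borel"
    unfolding H1_def H2'_def by measurable
  have R0: "0 \<le> R" using R by simp
  have supp1: "R < \<bar>\<xi>\<bar> \<Longrightarrow> H1 \<xi> = 0" and supp2: "R < \<bar>\<xi>\<bar> \<Longrightarrow> H2' \<xi> = 0" for \<xi>
    by (simp_all add: H1_def H2'_def supp)
  have sq1: "integrable lborel (\<lambda>\<xi>. (norm (H1 \<xi>))\<^sup>2)" "(\<integral>\<xi>. (norm (H1 \<xi>))\<^sup>2 \<partial>lborel) \<le> R\<^sup>2 * E"
    unfolding H1_def E_def
    using frequency_weight[of H "\<lambda>\<xi>. \<i> * complex_of_real \<xi>" R R, OF _ _ supp _ H2] by (auto simp: norm_mult)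
  have sq2: "integrable lborel (\<lambda>\<xi>. (norm (H2' \<xi>))\<^sup>2)" "(\<integral>\<xi>. (norm (H2' \<xi>))\<^sup>2 \<partial>lborel) \<le> (R\<^sup>2)\<^sup>2 * E"
    unfolding H2'_def E_def
    using frequency_weight[of H "\<lambda>\<xi>. - (complex_of_real \<xi>)\<^sup>2" R "R\<^sup>2", OF _ _ supp _ H2]
    by (auto simp: norm_mult norm_power abs_le_square_iff[symmetric] R0)
  have i0: "integrable lborel H"
    by (rule frequency_bounds(1)[OF _ supp R0 H2]) simp_all
  have i1: "integrable lborel H1" "(\<integral>\<xi>. norm (H1 \<xi>) \<partial>lborel)\<^sup>2 \<le> 2 * R * (\<integral>\<xi>. (norm (H1 \<xi>))\<^sup>2 \<partial>lborel)"
    by (rule frequency_bounds[OF _ supp1 R0 sq1(1)]; simp)+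
  have i2: "integrable lborel H2'"
    by (rule frequency_bounds(1)[OF _ supp2 R0 sq2(1)]) simp_all
  have E0: "0 \<le> E" unfolding E_def by simp
  note [measurable] = fourier_inv_measurable[OF i1(1)] fourier_inv_measurable[OF i2]
  define B1 where "B1 = (\<integral>\<xi>. norm (H1 \<xi>) \<partial>lborel)"
  define B2 where "B2 = (\<integral>\<xi>. norm (H2' \<xi>) \<partial>lborel)"
  have B1: "norm (fourier_inv H1 x) \<le> B1" for x unfolding B1_def by (rule norm_fourier_inv_le[OF i1(1)])
  have B2: "norm (fourier_inv H2' x) \<le> B2" for x unfolding B2_def by (rule norm_fourier_inv_le[OF i2])
  have B0: "0 \<le> B1" "0 \<le> B2" unfolding B1_def B2_def by simp_all
  define g1 where "g1 \<theta> = fourier_inv H1 (1 - cos \<theta>) * sin \<theta>" for \<theta> :: real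
  define g2 where "g2 \<theta> = fourier_inv H1 (1 - cos \<theta>) * cos \<theta> + fourier_inv H2' (1 - cos \<theta>) * (sin \<theta>)\<^sup>2" for \<theta> :: real
  have mg: "g1 \<in> borel_measurable borel" "g2 \<in> borel_measurable borel"
    unfolding g1_def g2_def by measurable
  have g1B: "norm (g1 \<theta>) \<le> B1 * 1" for \<theta>
    unfolding g1_def norm_mult by (intro mult_mono B1 B0) auto
  have g2B: "norm (g2 \<theta>) \<le> B1 * 1 + B2 * 1" for \<theta>
    unfolding g2_def
    by (intro norm_triangle_le add_mono, unfold norm_mult; intro mult_mono B1 B2 B0)
       (auto simp: abs_square_le_1 norm_power)
  have c1: "real n * cheb_coef n H = - (\<integral>\<theta>. g1 \<theta> * complex_of_real (sin (real n * \<theta>)) \<partial>angle)" for n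
  proof -
    have "real n * cheb_coef n H = (\<integral>\<xi>. real n * (H \<xi> * (\<integral>\<theta>. cis ((1 - cos \<theta>) * \<xi>) * complex_of_real (cos (real n * \<theta>)) \<partial>angle)) \<partial>lborel)"
      unfolding cheb_coef_eq[OF i0] by simp
    also have "\<dots> = (\<integral>\<xi>. - (H1 \<xi> * (\<integral>\<theta>. cis ((1 - cos \<theta>) * \<xi>) * complex_of_real (sin \<theta> * sin (real n * \<theta>)) \<partial>angle)) \<partial>lborel)"
    proof (rule Bochner_Integration.integral_cong[OF refl])
      fix \<xi> :: real
      show "real n * (H \<xi> * (\<integral>\<theta>. cis ((1 - cos \<theta>) * \<xi>) * complex_of_real (cos (real n * \<theta>)) \<partial>angle))
        = - (H1 \<xi> * (\<integral>\<theta>. cis ((1 - cos \<theta>) * \<xi>) * complex_of_real (sin \<theta> * sin (real n * \<theta>)) \<partial>angle))"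
        using integral_by_parts_sin[of n \<xi>] unfolding H1_def by (simp add: mult.left_commute[of _ "H \<xi>"] mult.assoc)
    qed
    also have "\<dots> = - (\<integral>\<theta>. fourier_inv H1 (1 - cos \<theta>) * complex_of_real (sin \<theta> * sin (real n * \<theta>)) \<partial>angle)"
      unfolding Bochner_Integration.integral_minus
      by (subst fourier_inv_angle[OF i1(1), of _ 1]) (auto simp: norm_mult abs_mult mult_le_one simp del: of_real_mult)
    finally show ?thesis unfolding g1_def by (simp add: mult.assoc)
  qed
  have c2: "(real n)\<^sup>2 * cheb_coef n H = - (\<integral>\<theta>. g2 \<theta> * complex_of_real (cos (real n * \<theta>)) \<partial>angle)" for n
  proof -
    let ?c = "\<lambda>\<theta>. complex_of_real (cos \<theta> * cos (real n * \<theta>))" and ?s = "\<lambda>\<theta>. complex_of_real ((sin \<theta>)\<^sup>2 * cos (real n * \<theta>))"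
    have b: "norm (?c \<theta>) \<le> 1" "norm (?s \<theta>) \<le> 1" for \<theta>
      by (simp_all add: abs_mult mult_le_one abs_square_le_1 del: of_real_mult)
    have I1: "(\<integral>\<xi>. H1 \<xi> * (\<integral>\<theta>. cis ((1 - cos \<theta>) * \<xi>) * ?c \<theta> \<partial>angle) \<partial>lborel) = (\<integral>\<theta>. fourier_inv H1 (1 - cos \<theta>) * ?c \<theta> \<partial>angle)"
      by (rule fourier_inv_angle[OF i1(1) _ b(1)]) simp
    have I2: "(\<integral>\<xi>. H2' \<xi> * (\<integral>\<theta>. cis ((1 - cos \<theta>) * \<xi>) * ?s \<theta> \<partial>angle) \<partial>lborel) = (\<integral>\<theta>. fourier_inv H2' (1 - cos \<theta>) * ?s \<theta> \<partial>angle)"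
      by (rule fourier_inv_angle[OF i2 _ b(2)]) simp
    have m: "(\<lambda>z. cis ((1 - cos (snd z)) * fst z) * h (snd z)) \<in> borel_measurable (lborel \<Otimes>\<^sub>M angle)"
      if "h \<in> borel_measurable borel" for h
    proof -
      have [measurable]: "cos \<in> borel_measurable angle" "h \<in> borel_measurable angle"
        using that by (auto intro: measurable_angle)
      show ?thesis by measurable
    qed
    have J: "integrable lborel (\<lambda>\<xi>. G \<xi> * (\<integral>\<theta>. cis ((1 - cos \<theta>) * \<xi>) * h \<theta> \<partial>angle))"
      if G: "integrable lborel G" and h: "h \<in> borel_measurable borel" and hb: "\<And>\<theta>. norm (h \<theta>) \<le> 1" for G h
    proof -
      interpret pair_sigma_finite lborel angle ..
      show ?thesis
        using integrable_fst'[OF integrable_pair_bounded[OF sigma_finite_lborel finite_measure_angle G m[OF h], of 1]] hb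
        by (simp add: norm_mult)
    qed
    have "(real n)\<^sup>2 * cheb_coef n H = (\<integral>\<xi>. real n * (real n * (H \<xi> * (\<integral>\<theta>. cis ((1 - cos \<theta>) * \<xi>) * complex_of_real (cos (real n * \<theta>)) \<partial>angle))) \<partial>lborel)"
      unfolding cheb_coef_eq[OF i0] by (simp add: power2_eq_square mult.assoc)
    also have "\<dots> = (\<integral>\<xi>. - (H1 \<xi> * (\<integral>\<theta>. cis ((1 - cos \<theta>) * \<xi>) * ?c \<theta> \<partial>angle) + H2' \<xi> * (\<integral>\<theta>. cis ((1 - cos \<theta>) * \<xi>) * ?s \<theta> \<partial>angle)) \<partial>lborel)"
    proof (rule Bochner_Integration.integral_cong[OF refl])
      fix \<xi> :: real
      let ?I = "\<integral>\<theta>. cis ((1 - cos \<theta>) * \<xi>) * complex_of_real (cos (real n * \<theta>)) \<partial>angle"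
      let ?S = "\<integral>\<theta>. cis ((1 - cos \<theta>) * \<xi>) * complex_of_real (sin \<theta> * sin (real n * \<theta>)) \<partial>angle"
      have "real n * (real n * (H \<xi> * ?I)) = H \<xi> * (real n * (real n * ?I))" by (simp add: mult_ac)
      also have "\<dots> = H \<xi> * (- (\<i> * \<xi>) * (real n * ?S))"
        using integral_by_parts_sin[of n \<xi>] by (simp add: mult_ac)
      also have "\<dots> = H \<xi> * (- (\<i> * \<xi>) * ((\<integral>\<theta>. cis ((1 - cos \<theta>) * \<xi>) * ?c \<theta> \<partial>angle) + \<i> * \<xi> * (\<integral>\<theta>. cis ((1 - cos \<theta>) * \<xi>) * ?s \<theta> \<partial>angle)))"
        using integral_by_parts_cos[of n \<xi>] by simp
      finally show "real n * (real n * (H \<xi> * ?I)) = - (H1 \<xi> * (\<integral>\<theta>. cis ((1 - cos \<theta>) * \<xi>) * ?c \<theta> \<partial>angle) + H2' \<xi> * (\<integral>\<theta>. cis ((1 - cos \<theta>) * \<xi>) * ?s \<theta> \<partial>angle))"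
        unfolding H1_def H2'_def by (simp add: algebra_simps power2_eq_square)
    qed
    also have "\<dots> = - ((\<integral>\<theta>. fourier_inv H1 (1 - cos \<theta>) * ?c \<theta> \<partial>angle) + (\<integral>\<theta>. fourier_inv H2' (1 - cos \<theta>) * ?s \<theta> \<partial>angle))"
      unfolding Bochner_Integration.integral_minus
      by (subst Bochner_Integration.integral_add)
         (use J[OF i1(1) _ b(1)] J[OF i2 _ b(2)] in \<open>simp_all only: I1 I2, simp_all\<close>)
    also have "\<dots> = - (\<integral>\<theta>. fourier_inv H1 (1 - cos \<theta>) * ?c \<theta> + fourier_inv H2' (1 - cos \<theta>) * ?s \<theta> \<partial>angle)"
    proof (subst Bochner_Integration.integral_add)
      show "integrable angle (\<lambda>\<theta>. fourier_inv H1 (1 - cos \<theta>) * ?c \<theta>)"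
        by (rule integrable_angle[where B="B1 * 1"], simp, unfold norm_mult[of "fourier_inv _ _"], intro mult_mono B1 B0 b) simp
      show "integrable angle (\<lambda>\<theta>. fourier_inv H2' (1 - cos \<theta>) * ?s \<theta>)"
        by (rule integrable_angle[where B="B2 * 1"], simp, unfold norm_mult[of "fourier_inv _ _"], intro mult_mono B2 B0 b) simp
    qed simp
    finally show ?thesis unfolding g2_def by (simp add: distrib_right mult.assoc)
  qed
  have X1: "(\<integral>\<theta>. (norm (g1 \<theta>))\<^sup>2 \<partial>angle) \<le> 2 * pi * exp 2 * (R\<^sup>2 * E)"
  proof -
    have "(\<integral>\<theta>. (norm (g1 \<theta>))\<^sup>2 \<partial>angle) \<le> (\<integral>\<theta>. (norm (fourier_inv H1 (1 - cos \<theta>)))\<^sup>2 * sin \<theta> \<partial>angle)"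
    proof (rule integral_mono)
      show "integrable angle (\<lambda>\<theta>. (norm (g1 \<theta>))\<^sup>2)"
        using mg by (intro integrable_angle[where B="(B1 * 1)\<^sup>2"]) (auto simp: norm_power simp del: mult_1_right intro!: power_mono g1B)
      show "integrable angle (\<lambda>\<theta>. (norm (fourier_inv H1 (1 - cos \<theta>)))\<^sup>2 * sin \<theta>)"
        by (intro integrable_angle[where B="B1\<^sup>2 * 1"]) (auto simp: abs_mult simp del: mult_1_right intro!: mult_mono power_mono B1)
      fix \<theta> assume "\<theta> \<in> space angle"
      then have "0 \<le> sin \<theta>" by (auto intro: sin_ge_zero)
      then have "(sin \<theta>)\<^sup>2 \<le> sin \<theta>" by (simp add: power2_eq_square mult_left_le)
      then show "(norm (g1 \<theta>))\<^sup>2 \<le> (norm (fourier_inv H1 (1 - cos \<theta>)))\<^sup>2 * sin \<theta>"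
        unfolding g1_def by (auto simp: norm_mult power_mult_distrib intro!: mult_left_mono)
    qed
    also have "\<dots> \<le> 2 * pi * exp 2 * (\<integral>\<xi>. (norm (H1 \<xi>))\<^sup>2 \<partial>lborel)"
      by (rule angle_L2_bound[OF i1(1) sq1(1)])
    also have "\<dots> \<le> 2 * pi * exp 2 * (R\<^sup>2 * E)"
      by (rule mult_left_mono[OF sq1(2)]) simp
    finally show ?thesis .
  qed
  have X2: "(\<integral>\<theta>. (norm (g2 \<theta>))\<^sup>2 \<partial>angle) \<le> 2 * pi * (2 * R * (R\<^sup>2 * E)) + 4 * pi * exp 2 * ((R\<^sup>2)\<^sup>2 * E)"
  proof -
    have ie: "integrable angle (\<lambda>\<theta>. (norm (fourier_inv H2' (1 - cos \<theta>)))\<^sup>2 * sin \<theta>)"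
      by (intro integrable_angle[where B="B2\<^sup>2 * 1"]) (auto simp: abs_mult simp del: mult_1_right intro!: mult_mono power_mono B2)
    have "(\<integral>\<theta>. (norm (g2 \<theta>))\<^sup>2 \<partial>angle) \<le> (\<integral>\<theta>. 2 * B1\<^sup>2 + 2 * ((norm (fourier_inv H2' (1 - cos \<theta>)))\<^sup>2 * sin \<theta>) \<partial>angle)"
    proof (rule integral_mono)
      show "integrable angle (\<lambda>\<theta>. (norm (g2 \<theta>))\<^sup>2)"
        using mg by (intro integrable_angle[where B="(B1 * 1 + B2 * 1)\<^sup>2"]) (auto simp: norm_power simp del: mult_1_right intro!: power_mono g2B)
      show "integrable angle (\<lambda>\<theta>. 2 * B1\<^sup>2 + 2 * ((norm (fourier_inv H2' (1 - cos \<theta>)))\<^sup>2 * sin \<theta>))"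
        using ie by simp
      fix \<theta> assume "\<theta> \<in> space angle"
      then have s: "0 \<le> sin \<theta>" by (auto intro: sin_ge_zero)
      have "norm (g2 \<theta>) \<le> B1 * 1 + norm (fourier_inv H2' (1 - cos \<theta>)) * (sin \<theta>)\<^sup>2"
        unfolding g2_def
        by (intro norm_triangle_le add_mono, unfold norm_mult; (intro mult_mono B1 B0)?) (auto simp: norm_power)
      then have "(norm (g2 \<theta>))\<^sup>2 \<le> (B1 + norm (fourier_inv H2' (1 - cos \<theta>)) * (sin \<theta>)\<^sup>2)\<^sup>2"
        by (intro power_mono) auto
      also have "\<dots> \<le> 2 * B1\<^sup>2 + 2 * (norm (fourier_inv H2' (1 - cos \<theta>)) * (sin \<theta>)\<^sup>2)\<^sup>2"
        using sum_squares_bound[of B1 "norm (fourier_inv H2' (1 - cos \<theta>)) * (sin \<theta>)\<^sup>2"] by (simp add: power2_sum)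
      also have "(norm (fourier_inv H2' (1 - cos \<theta>)) * (sin \<theta>)\<^sup>2)\<^sup>2 \<le> (norm (fourier_inv H2' (1 - cos \<theta>)))\<^sup>2 * sin \<theta>"
      proof -
        have "(sin \<theta>)^4 \<le> (sin \<theta>)^1" using s by (intro power_decreasing) auto
        then show ?thesis by (auto simp: power_mult_distrib power_mult[symmetric] intro!: mult_left_mono)
      qed
      finally show "(norm (g2 \<theta>))\<^sup>2 \<le> 2 * B1\<^sup>2 + 2 * ((norm (fourier_inv H2' (1 - cos \<theta>)))\<^sup>2 * sin \<theta>)" by simp
    qed
    also have "\<dots> = 2 * pi * B1\<^sup>2 + 2 * (\<integral>\<theta>. (norm (fourier_inv H2' (1 - cos \<theta>)))\<^sup>2 * sin \<theta> \<partial>angle)"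
      using ie by (simp add: measure_angle)
    also have "\<dots> \<le> 2 * pi * (2 * R * (R\<^sup>2 * E)) + 2 * (2 * pi * exp 2 * ((R\<^sup>2)\<^sup>2 * E))"
    proof (intro add_mono mult_left_mono)
      have "2 * R * (\<integral>\<xi>. (norm (H1 \<xi>))\<^sup>2 \<partial>lborel) \<le> 2 * R * (R\<^sup>2 * E)"
        using sq1(2) R0 by (intro mult_left_mono) auto
      then show "B1\<^sup>2 \<le> 2 * R * (R\<^sup>2 * E)" using i1(2) unfolding B1_def by linarith
      have "2 * pi * exp 2 * (\<integral>\<xi>. (norm (H2' \<xi>))\<^sup>2 \<partial>lborel) \<le> 2 * pi * exp 2 * ((R\<^sup>2)\<^sup>2 * E)"
        by (rule mult_left_mono[OF sq2(2)]) simp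
      then show "(\<integral>\<theta>. (norm (fourier_inv H2' (1 - cos \<theta>)))\<^sup>2 * sin \<theta> \<partial>angle) \<le> 2 * pi * exp 2 * ((R\<^sup>2)\<^sup>2 * E)"
        using angle_L2_bound[OF i2 sq2(1)] by linarith
    qed auto
    finally show ?thesis by simp
  qed
  have S1: "(\<Sum>n\<in>{1..K}. (real n * norm (cheb_coef n H))\<^sup>2) \<le> pi / 2 * (\<integral>\<theta>. (norm (g1 \<theta>))\<^sup>2 \<partial>angle)"
  proof -
    have "real n * norm (cheb_coef n H) = norm (\<integral>\<theta>. g1 \<theta> * complex_of_real (sin (real n * \<theta>)) \<partial>angle)" for n
      using arg_cong[OF c1[of n], of norm] by (simp add: norm_mult)
    then show ?thesis
      using Bessel_inequality[OF finite_measure_angle, of g1 "\<lambda>n \<theta>. sin (real n * \<theta>)" "B1 * 1" "{1..K}" "pi/2"] g1B mg orthogonal_cos_sin(2)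
      by (auto intro: measurable_angle)
  qed
  have S2: "(\<Sum>n\<in>{1..K}. ((real n)\<^sup>2 * norm (cheb_coef n H))\<^sup>2) \<le> pi / 2 * (\<integral>\<theta>. (norm (g2 \<theta>))\<^sup>2 \<partial>angle)"
  proof -
    have "(real n)\<^sup>2 * norm (cheb_coef n H) = norm (\<integral>\<theta>. g2 \<theta> * complex_of_real (cos (real n * \<theta>)) \<partial>angle)" for n
      using arg_cong[OF c2[of n], of norm] by (simp add: norm_mult norm_power)
    then show ?thesis
      using Bessel_inequality[OF finite_measure_angle, of g2 "\<lambda>n \<theta>. cos (real n * \<theta>)" "B1 * 1 + B2 * 1" "{1..K}" "pi/2"] g2B mg orthogonal_cos_sin(1)
      by (auto intro: measurable_angle)
  qed
  \<comment> \<open>The weight balances the two Bessel estimates: \<open>S1\<close> controls the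
    indices up to \<open>R\<close>, and \<open>S2\<close> divided by \<open>R^2\<close> the larger
    ones.\<close>
  let ?w = "\<lambda>n. 1 + (real n)\<^sup>2 / R\<^sup>2"
  have w: "0 < ?w n" for n by (simp add: add_pos_nonneg)
  have "(\<Sum>n\<in>{1..K}. real n * norm (cheb_coef n H))\<^sup>2
    = (\<Sum>n\<in>{1..K}. (real n * norm (cheb_coef n H) * sqrt (?w n)) * (1 / sqrt (?w n)))\<^sup>2"
    using w by (intro arg_cong[where f="\<lambda>x. x\<^sup>2"] sum.cong) (auto simp: less_le)
  also have "\<dots> \<le> (\<Sum>n\<in>{1..K}. (real n * norm (cheb_coef n H) * sqrt (?w n))\<^sup>2) * (\<Sum>n\<in>{1..K}. (1 / sqrt (?w n))\<^sup>2)"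
    by (rule Cauchy_Schwarz_ineq_sum)
  also have "(\<Sum>n\<in>{1..K}. (1 / sqrt (?w n))\<^sup>2) = (\<Sum>n\<in>{1..K}. R\<^sup>2 / (R\<^sup>2 + (real n)\<^sup>2))"
    using w R by (intro sum.cong) (auto simp: power_divide less_imp_le field_simps)
  also have "(\<Sum>n\<in>{1..K}. (real n * norm (cheb_coef n H) * sqrt (?w n))\<^sup>2)
    = (\<Sum>n\<in>{1..K}. (real n * norm (cheb_coef n H))\<^sup>2) + (\<Sum>n\<in>{1..K}. ((real n)\<^sup>2 * norm (cheb_coef n H))\<^sup>2) / R\<^sup>2"
    unfolding sum_divide_distrib sum.distrib[symmetric]
    using w by (intro sum.cong) (auto simp: power_mult_distrib less_imp_le field_simps)
  also have "\<dots> * (\<Sum>n\<in>{1..K}. R\<^sup>2 / (R\<^sup>2 + (real n)\<^sup>2)) \<le>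
      (pi / 2 * (2 * pi * exp 2 * (R\<^sup>2 * E)) + pi / 2 * (2 * pi * (2 * R * (R\<^sup>2 * E)) + 4 * pi * exp 2 * ((R\<^sup>2)\<^sup>2 * E)) / R\<^sup>2) * (2 * R)"
  proof (intro mult_mono add_mono divide_right_mono)
    show "(\<Sum>n\<in>{1..K}. (real n * norm (cheb_coef n H))\<^sup>2) \<le> pi / 2 * (2 * pi * exp 2 * (R\<^sup>2 * E))"
      by (rule order_trans[OF S1]) (intro mult_left_mono X1, simp)
    show "(\<Sum>n\<in>{1..K}. ((real n)\<^sup>2 * norm (cheb_coef n H))\<^sup>2) \<le> pi / 2 * (2 * pi * (2 * R * (R\<^sup>2 * E)) + 4 * pi * exp 2 * ((R\<^sup>2)\<^sup>2 * E))"
      by (rule order_trans[OF S2]) (intro mult_left_mono X2, simp)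
    show "(\<Sum>n\<in>{1..K}. R\<^sup>2 / (R\<^sup>2 + (real n)\<^sup>2)) \<le> 2 * R"
      using R by (intro sum_telescope_square) simp
  qed (use E0 R0 in \<open>auto intro!: sum_nonneg add_nonneg_nonneg\<close>)
  also have "\<dots> = 6 * pi\<^sup>2 * exp 2 * R ^ 3 * E + 4 * pi\<^sup>2 * R\<^sup>2 * E"
    using R by (simp add: field_simps power2_eq_square power3_eq_cube)
  also have "\<dots> \<le> (6 * pi\<^sup>2 * exp 2 + 4 * pi\<^sup>2) * R ^ 3 * E"
  proof -
    have "R ^ 2 \<le> R ^ 3" using R by (intro power_increasing) auto
    then have "4 * pi\<^sup>2 * R\<^sup>2 * E \<le> 4 * pi\<^sup>2 * R ^ 3 * E" using E0 by (intro mult_right_mono mult_left_mono) auto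
    then show ?thesis by (simp add: algebra_simps)
  qed
  finally show ?thesis .
qed

section \<open>Gaussian regularization and Fourier inversion\<close>

lemma integral_gaussian_cis:
  fixes s a :: real
  assumes "s > 0"
  shows "(\<integral>\<xi>. complex_of_real (exp (- (\<xi> / s)\<^sup>2 / 2)) * cis (a * \<xi>) \<partial>lborel) = complex_of_real (sqrt (2 * pi) * s * exp (- (s * a)\<^sup>2 / 2))"
proof -
  have "complex_of_real (exp (- (s * a)\<^sup>2 / 2)) = (\<integral>x. cis (s * a * x) \<partial>std_normal_distribution)"
    by (rule integral_cis_std_normal[symmetric])
  also have "\<dots> = (\<integral>x. std_normal_density x *\<^sub>R cis (s * a * x) \<partial>lborel)"
    by (rule integral_density) auto
  also have "\<dots> = (\<integral>x. complex_of_real (1 / sqrt (2 * pi)) * (complex_of_real (exp (- x\<^sup>2 / 2)) * cis (s * a * x)) \<partial>lborel)"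
    by (intro Bochner_Integration.integral_cong) (auto simp: std_normal_density_def scaleR_conv_of_real)
  also have "\<dots> = complex_of_real (1 / sqrt (2 * pi)) * (\<integral>x. complex_of_real (exp (- x\<^sup>2 / 2)) * cis (s * a * x) \<partial>lborel)"
    by (rule integral_mult_right_zero)
  finally have *: "(\<integral>x. complex_of_real (exp (- x\<^sup>2 / 2)) * cis (s * a * x) \<partial>lborel) = complex_of_real (sqrt (2 * pi) * exp (- (s * a)\<^sup>2 / 2))"
    by (simp add: field_simps)
  have "(\<integral>\<xi>. complex_of_real (exp (- (\<xi> / s)\<^sup>2 / 2)) * cis (a * \<xi>) \<partial>lborel)
      = \<bar>s\<bar> *\<^sub>R (\<integral>x. complex_of_real (exp (- ((0 + s * x) / s)\<^sup>2 / 2)) * cis (a * (0 + s * x)) \<partial>lborel)"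
    by (rule lborel_integral_real_affine) (use assms in simp)
  also have "\<dots> = s *\<^sub>R (\<integral>x. complex_of_real (exp (- x\<^sup>2 / 2)) * cis (s * a * x) \<partial>lborel)"
    using assms by (simp add: mult_ac)
  finally show ?thesis using * by (simp add: scaleR_conv_of_real mult_ac)
qed

lemma integrable_gaussian:
  fixes s y :: real
  assumes "s > 0"
  shows "integrable lborel (\<lambda>x. exp (- (s * (y - x))\<^sup>2 / 2))"
proof -
  have "integrable lborel (\<lambda>x. sqrt (2 * pi) * std_normal_density x)" by (intro integrable_mult_right) simp
  then have "integrable lborel (\<lambda>x::real. exp (- x\<^sup>2 / 2) :: real)" by (simp add: std_normal_density_def)
  from lborel_integrable_real_affine[OF this, of "- s" "s * y"] assms show ?thesis
    by (simp add: right_diff_distrib)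
qed

lemma square_integrable_gaussian:
  fixes s y :: real
  assumes "s > 0"
  shows "integrable lborel (\<lambda>x. (exp (- (s * (y - x))\<^sup>2 / 2))\<^sup>2)"
proof -
  have "(exp (- (s * (y - x))\<^sup>2 / 2))\<^sup>2 = exp (- ((sqrt 2 * s) * (y - x))\<^sup>2 / 2)" for x
    by (simp add: exp_double[symmetric] power_mult_distrib)
  then show ?thesis using integrable_gaussian[of "sqrt 2 * s" y] assms by simp
qed

lemma tendsto_0_le_ennreal:
  fixes f g :: "'x \<Rightarrow> ennreal"
  assumes "(g \<longlongrightarrow> 0) F" "\<And>x. f x \<le> g x"
  shows "(f \<longlongrightarrow> 0) F"
  by (rule tendsto_sandwich[OF _ _ tendsto_const assms(1)]) (auto intro!: always_eventually assms(2))

text \<open>\<open>G\<close> is known only as an L^2 limit of transforms of truncations, so it is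
  tested against a Gaussian times a character. By Cauchy-Schwarz such a test is continuous for L^2
  convergence, and for each integrable truncation Fubini evaluates it.\<close>

lemma fourier_transform_gaussian:
  assumes FT: "is_fourier_transform F G"
    and [measurable]: "F \<in> borel_measurable borel"
    and F2: "integrable lborel (\<lambda>x. (norm (F x))\<^sup>2)"
    and G: "integrable lborel G" and s: "s > 0"
  shows "(\<integral>\<xi>. G \<xi> * (complex_of_real (exp (- (\<xi> / s)\<^sup>2 / 2)) * cis (y * \<xi>)) \<partial>lborel)
     = complex_of_real (sqrt (2 * pi) * s) * (\<integral>x. F x * complex_of_real (exp (- (s * (y - x))\<^sup>2 / 2)) \<partial>lborel)"
proof -
  note [measurable] = borel_measurable_integrable[OF G]
  define g where "g \<xi> = exp (- (\<xi> / s)\<^sup>2 / 2)" for \<xi>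
  have [measurable]: "g \<in> borel_measurable borel" unfolding g_def by measurable
  have g_eq: "g \<xi> = exp (- (1 / s * (0 - \<xi>))\<^sup>2 / 2)" for \<xi> unfolding g_def by simp
  have g_fun: "g = (\<lambda>\<xi>. exp (- (1 / s * (0 - \<xi>))\<^sup>2 / 2))" by (rule ext) (rule g_eq)
  have s': "0 < 1 / s" using s by simp
  have ig: "integrable lborel g"
    unfolding g_fun by (rule integrable_gaussian[OF s'])
  have ig2: "integrable lborel (\<lambda>\<xi>. (g \<xi>)\<^sup>2)"
    unfolding g_fun by (rule square_integrable_gaussian[OF s'])
  have g0: "0 \<le> g \<xi>" for \<xi> unfolding g_def by simp
  define k where "k \<xi> = complex_of_real (g \<xi>) * cis (y * \<xi>)" for \<xi>
  have [measurable]: "k \<in> borel_measurable borel" unfolding k_def by measurable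
  have nk: "norm (k \<xi>) = g \<xi>" for \<xi> unfolding k_def by (simp add: norm_mult g0)
  have ik: "integrable lborel k"
    by (rule Bochner_Integration.integrable_bound[OF ig]) (auto simp: nk g0)
  define FN where "FN N x = indicator {-N..N} x * F x" for N x :: real
  have [measurable]: "FN N \<in> borel_measurable borel" for N unfolding FN_def by measurable
  have FN2: "integrable lborel (\<lambda>x. (norm (FN N x))\<^sup>2)" for N
    by (rule Bochner_Integration.integrable_bound[OF F2])
       (auto simp: FN_def norm_mult split: split_indicator)
  have FN: "integrable lborel (FN N)" if "0 \<le> N" for N
    by (rule frequency_bounds(1)[of _ N, OF _ _ that FN2]) (auto simp: FN_def split: split_indicator)
  define h where "h N \<xi> = (\<integral>x. FN N x * cis (- (x * \<xi>)) \<partial>lborel)" for N \<xi>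
  have h_eq: "(LINT x:{-N..N}|lborel. F x * cis (- (x * \<xi>))) = h N \<xi>" for N \<xi>
    unfolding h_def set_lebesgue_integral_def FN_def
    by (intro Bochner_Integration.integral_cong) (auto split: split_indicator)
  have h_inv: "h N \<xi> = fourier_inv (FN N) (- \<xi>)" for N \<xi>
    unfolding h_def fourier_inv_def by (simp add: mult.commute)
  have [measurable]: "h N \<in> borel_measurable borel" if "0 \<le> N" for N
    unfolding h_inv using fourier_inv_measurable[OF FN[OF that]] by measurable
  have hk: "integrable lborel (\<lambda>\<xi>. h N \<xi> * k \<xi>)" if "0 \<le> N" for N
  proof (rule Bochner_Integration.integrable_bound)
    show "integrable lborel (\<lambda>\<xi>. (\<integral>x. norm (FN N x) \<partial>lborel) * g \<xi>)" using ig by simp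
    show "AE \<xi> in lborel. norm (h N \<xi> * k \<xi>) \<le> norm ((\<integral>x. norm (FN N x) \<partial>lborel) * g \<xi>)"
      by (auto simp: norm_mult nk g0 h_inv intro!: mult_right_mono norm_fourier_inv_le FN that)
  qed (use that in measurable)
  have Gk: "integrable lborel (\<lambda>\<xi>. G \<xi> * k \<xi>)"
  proof (rule Bochner_Integration.integrable_bound)
    show "AE \<xi> in lborel. norm (G \<xi> * k \<xi>) \<le> norm (G \<xi>)"
      by (auto simp: norm_mult nk g_def intro!: mult_left_le)
  qed (use G in auto)
  let ?I = "\<lambda>n. \<integral>\<xi>. h (real n) \<xi> * k \<xi> \<partial>lborel"
  let ?c = "complex_of_real (sqrt (2 * pi) * s)"
  let ?e = "\<lambda>x. complex_of_real (exp (- (s * (y - x))\<^sup>2 / 2))"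
  have lim1: "?I \<longlonglongrightarrow> (\<integral>\<xi>. G \<xi> * k \<xi> \<partial>lborel)"
  proof -
    have "(\<lambda>n. \<integral>\<^sup>+\<xi>. ennreal ((norm (G \<xi> - h (real n) \<xi>))\<^sup>2) \<partial>lborel) \<longlonglongrightarrow> 0"
      by (rule filterlim_compose[OF conjunct2 filterlim_real_sequentially,
            OF FT[unfolded is_fourier_transform_def h_eq]])
    moreover have "(\<integral>\<^sup>+\<xi>. (ennreal (g \<xi>))\<^sup>2 \<partial>lborel) < top"
      using ig2 by (simp add: ennreal_power g0 nn_integral_eq_integral)
    ultimately have "(\<lambda>n. (\<integral>\<^sup>+\<xi>. (ennreal (g \<xi>))\<^sup>2 \<partial>lborel) * (\<integral>\<^sup>+\<xi>. ennreal ((norm (G \<xi> - h (real n) \<xi>))\<^sup>2) \<partial>lborel)) \<longlonglongrightarrow>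
        (\<integral>\<^sup>+\<xi>. (ennreal (g \<xi>))\<^sup>2 \<partial>lborel) * 0"
      by (intro ennreal_tendsto_cmult) auto
    moreover have "ennreal ((norm (?I n - (\<integral>\<xi>. G \<xi> * k \<xi> \<partial>lborel)))\<^sup>2)
      \<le> (\<integral>\<^sup>+\<xi>. (ennreal (g \<xi>))\<^sup>2 \<partial>lborel) * (\<integral>\<^sup>+\<xi>. ennreal ((norm (G \<xi> - h (real n) \<xi>))\<^sup>2) \<partial>lborel)" for n
    proof -
      have "norm (?I n - (\<integral>\<xi>. G \<xi> * k \<xi> \<partial>lborel)) = norm (\<integral>\<xi>. (G \<xi> - h (real n) \<xi>) * k \<xi> \<partial>lborel)"
        using hk[of "real n"] Gk by (simp add: left_diff_distrib norm_minus_commute)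
      then have "ennreal (norm (?I n - (\<integral>\<xi>. G \<xi> * k \<xi> \<partial>lborel))) \<le> (\<integral>\<^sup>+\<xi>. ennreal (norm ((G \<xi> - h (real n) \<xi>) * k \<xi>)) \<partial>lborel)"
        by (simp add: integral_norm_bound_nn_integral)
      also have "\<dots> = (\<integral>\<^sup>+\<xi>. ennreal (norm (G \<xi> - h (real n) \<xi>)) * ennreal (g \<xi>) \<partial>lborel)"
        by (simp add: norm_mult nk ennreal_mult g0)
      finally have "(ennreal (norm (?I n - (\<integral>\<xi>. G \<xi> * k \<xi> \<partial>lborel))))\<^sup>2 \<le> (\<integral>\<^sup>+\<xi>. ennreal (norm (G \<xi> - h (real n) \<xi>)) * ennreal (g \<xi>) \<partial>lborel)\<^sup>2"
        by (rule power_mono) simp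
      also have "\<dots> \<le> (\<integral>\<^sup>+\<xi>. (ennreal (norm (G \<xi> - h (real n) \<xi>)))\<^sup>2 \<partial>lborel) * (\<integral>\<^sup>+\<xi>. (ennreal (g \<xi>))\<^sup>2 \<partial>lborel)"
        by (rule Cauchy_Schwarz_nn_integral) measurable
      finally show ?thesis by (simp add: ennreal_power mult.commute)
    qed
    ultimately have "(\<lambda>n. ennreal ((norm (?I n - (\<integral>\<xi>. G \<xi> * k \<xi> \<partial>lborel)))\<^sup>2)) \<longlonglongrightarrow> 0"
      unfolding mult_zero_right by (rule tendsto_0_le_ennreal)
    then have "(\<lambda>n. (norm (?I n - (\<integral>\<xi>. G \<xi> * k \<xi> \<partial>lborel)))\<^sup>2) \<longlonglongrightarrow> 0"
      by (subst (asm) ennreal_tendsto_0_iff) auto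
    from tendsto_real_sqrt[OF this] have "(\<lambda>n. norm (?I n - (\<integral>\<xi>. G \<xi> * k \<xi> \<partial>lborel))) \<longlonglongrightarrow> 0"
      by simp
    then show ?thesis by (simp only: tendsto_norm_zero_iff LIM_zero_iff)
  qed
  have I_eq: "?I n = (\<integral>x. FN (real n) x * (?c * ?e x) \<partial>lborel)" for n
  proof -
    \<comment> \<open>Absorbing the Gaussian into a finite measure leaves a kernel of modulus one,
      as \<open>Fubini_bounded\<close> requires.\<close>
    let ?\<nu> = "density lborel (\<lambda>\<xi>. ennreal (g \<xi>))"
    have fin: "finite_measure ?\<nu>"
      using ig by (intro finite_measureI) (simp add: emeasure_density nn_integral_eq_integral g0)
    have dens: "(\<integral>\<xi>. f \<xi> \<partial>?\<nu>) = (\<integral>\<xi>. complex_of_real (g \<xi>) * f \<xi> \<partial>lborel)" if "f \<in> borel_measurable borel" for f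
      using integral_density[of f lborel g] that g0 by (simp add: scaleR_conv_of_real)
    have [measurable]: "h (real n) \<in> borel_measurable borel" by measurable
    have "?I n = (\<integral>\<xi>. complex_of_real (g \<xi>) * (h (real n) \<xi> * cis (y * \<xi>)) \<partial>lborel)"
      unfolding k_def by (simp add: mult_ac)
    also have "\<dots> = (\<integral>\<xi>. h (real n) \<xi> * cis (y * \<xi>) \<partial>?\<nu>)"
      by (rule dens[symmetric]) measurable
    also have "\<dots> = (\<integral>\<xi>. (\<integral>x. FN (real n) x * cis ((y - x) * \<xi>) \<partial>lborel) \<partial>?\<nu>)"
    proof (rule Bochner_Integration.integral_cong[OF refl])
      fix \<xi>
      have "h (real n) \<xi> * cis (y * \<xi>) = (\<integral>x. FN (real n) x * cis (- (x * \<xi>) + y * \<xi>) \<partial>lborel)"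
        unfolding h_def integral_mult_left_zero[symmetric] mult.assoc cis_mult ..
      then show "h (real n) \<xi> * cis (y * \<xi>) = (\<integral>x. FN (real n) x * cis ((y - x) * \<xi>) \<partial>lborel)"
        by (simp add: left_diff_distrib)
    qed
    also have "\<dots> = (\<integral>x. FN (real n) x * (\<integral>\<xi>. cis ((y - x) * \<xi>) \<partial>?\<nu>) \<partial>lborel)"
    proof -
      have "(\<lambda>z. cis ((y - fst z) * snd z)) \<in> borel_measurable (lborel \<Otimes>\<^sub>M ?\<nu>)"
        by measurable
      from Fubini_bounded[OF sigma_finite_lborel fin FN this, of "real n" 1]
      show ?thesis by simp
    qed
    also have "\<dots> = (\<integral>x. FN (real n) x * (?c * ?e x) \<partial>lborel)"
    proof (rule Bochner_Integration.integral_cong[OF refl])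
      fix x
      have "(\<integral>\<xi>. cis ((y - x) * \<xi>) \<partial>?\<nu>) = ?c * ?e x"
        using integral_gaussian_cis[OF s, of "y - x"] by (subst dens) (simp_all add: g_def)
      then show "FN (real n) x * (\<integral>\<xi>. cis ((y - x) * \<xi>) \<partial>?\<nu>) = FN (real n) x * (?c * ?e x)" by simp
    qed
    finally show ?thesis .
  qed
  have "(\<lambda>n. \<integral>x. FN (real n) x * (?c * ?e x) \<partial>lborel) \<longlonglongrightarrow> (\<integral>x. F x * (?c * ?e x) \<partial>lborel)"
  proof (rule integral_dominated_convergence)
    have "integrable lborel (\<lambda>x. norm (F x) * exp (- (s * (y - x))\<^sup>2 / 2))"
      by (rule Cauchy_Schwarz_integral(1)[OF _ _ F2 square_integrable_gaussian[OF s]]) measurable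
    then show "integrable lborel (\<lambda>x. norm (F x) * (norm ?c * exp (- (s * (y - x))\<^sup>2 / 2)))"
      by (simp only: mult.left_commute[of _ "norm ?c"]) (rule integrable_mult_right)
    show "AE x in lborel. (\<lambda>n. FN (real n) x * (?c * ?e x)) \<longlonglongrightarrow> F x * (?c * ?e x)"
    proof (rule AE_I2)
      fix x
      have "eventually (\<lambda>n. FN (real n) x = F x) sequentially"
        using eventually_ge_at_top[of "nat \<lceil>\<bar>x\<bar>\<rceil>"]
        by eventually_elim (auto simp: FN_def indicator_def)
      then show "(\<lambda>n. FN (real n) x * (?c * ?e x)) \<longlonglongrightarrow> F x * (?c * ?e x)"
        by (intro tendsto_eventually) (auto elim: eventually_mono)
    qed
    show "AE x in lborel. norm (FN (real n) x * (?c * ?e x)) \<le> norm (F x) * (norm ?c * exp (- (s * (y - x))\<^sup>2 / 2))" for n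
      by (rule AE_I2) (auto simp: FN_def norm_mult split: split_indicator)
  qed measurable
  then have "?I \<longlonglongrightarrow> (\<integral>x. ?c * (F x * ?e x) \<partial>lborel)" unfolding I_eq by (simp add: mult.left_commute)
  from LIMSEQ_unique[OF lim1 this] show ?thesis
    unfolding k_def g_def by simp
qed

text \<open>\<open>F\<close> comes with no global bound, so the integral is split at distance one
  from \<open>y\<close>. Near \<open>y\<close> compactness bounds \<open>F\<close> and dominated
  convergence applies after rescaling; far away the Gaussian is exponentially small in
  \<open>n\<close> and square integrability of \<open>F\<close> suffices.\<close>

lemma gaussian_approximation:
  fixes F :: "real \<Rightarrow> complex"
  assumes F: "continuous_on UNIV F" and F2: "integrable lborel (\<lambda>x. (norm (F x))\<^sup>2)"
  shows "(\<lambda>n. complex_of_real (real (Suc n)) * (\<integral>x. F x * complex_of_real (exp (- (real (Suc n) * (y - x))\<^sup>2 / 2)) \<partial>lborel))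
     \<longlonglongrightarrow> complex_of_real (sqrt (2 * pi)) * F y"
proof -
  have Fm[measurable]: "F \<in> borel_measurable borel" by (rule borel_measurable_continuous_onI[OF F])
  define a where "a x = F x * indicator {y - 1..y + 1} x" for x
  define b where "b x = F x * indicator (- {y - 1..y + 1}) x" for x
  have [measurable]: "a \<in> borel_measurable borel" "b \<in> borel_measurable borel" unfolding a_def b_def by measurable
  have ab: "F x = a x + b x" for x unfolding a_def b_def by (auto split: split_indicator)
  have sq: "integrable lborel (\<lambda>x. (norm (a x))\<^sup>2)" "integrable lborel (\<lambda>x. (norm (b x))\<^sup>2)"
    by (rule Bochner_Integration.integrable_bound[OF F2]; auto simp: a_def b_def norm_mult split: split_indicator)+
  let ?g = "\<lambda>s x. exp (- (s * (y - x))\<^sup>2 / 2)"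
  have ig: "integrable lborel (\<lambda>x. norm (f x) * ?g s x)"
    if "integrable lborel (\<lambda>x. (norm (f x))\<^sup>2)" "f \<in> borel_measurable borel" "s > 0" for f :: "real \<Rightarrow> complex" and s
    using that by (intro Cauchy_Schwarz_integral(1)[OF _ _ that(1) square_integrable_gaussian[OF that(3)]]) auto
  have ic: "integrable lborel (\<lambda>x. f x * complex_of_real (?g s x))"
    if "integrable lborel (\<lambda>x. (norm (f x))\<^sup>2)" "f \<in> borel_measurable borel" "s > 0" for f and s
    by (rule Bochner_Integration.integrable_bound[OF ig[OF that]]) (use that in \<open>auto simp: norm_mult\<close>)
  have "compact (F ` {y - 1..y + 1})"
    by (intro compact_continuous_image continuous_on_subset[OF F]) auto
  then obtain B where B: "\<And>x. x \<in> {y - 1..y + 1} \<Longrightarrow> norm (F x) \<le> B"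
    by (metis compact_imp_bounded bounded_iff imageI)
  have B0: "0 \<le> B" using order_trans[OF norm_ge_zero B[of y]] by simp
  have aB: "norm (a x) \<le> B" for x using B[of x] B0 by (auto simp: a_def norm_mult split: split_indicator)
  have la: "(\<lambda>n. complex_of_real (real (Suc n)) * (\<integral>x. a x * complex_of_real (?g (real (Suc n)) x) \<partial>lborel)) \<longlonglongrightarrow> complex_of_real (sqrt (2 * pi)) * F y"
  proof -
    have eq: "complex_of_real (real (Suc n)) * (\<integral>x. a x * complex_of_real (?g (real (Suc n)) x) \<partial>lborel)
        = (\<integral>u. a (y + 1 / real (Suc n) * u) * complex_of_real (exp (- u\<^sup>2 / 2)) \<partial>lborel)" for n
    proof -
      define s where "s = real (Suc n)"
      have s: "s > 0" by (simp add: s_def)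
      have "(\<integral>x. a x * complex_of_real (?g s x) \<partial>lborel) = \<bar>1 / s\<bar> *\<^sub>R (\<integral>u. a (y + 1 / s * u) * complex_of_real (?g s (y + 1 / s * u)) \<partial>lborel)"
        by (rule lborel_integral_real_affine) (use s in simp)
      then have "complex_of_real s * (\<integral>x. a x * complex_of_real (?g s x) \<partial>lborel) = (\<integral>u. a (y + 1 / s * u) * complex_of_real (exp (- u\<^sup>2 / 2)) \<partial>lborel)"
        using s by (simp add: scaleR_conv_of_real)
      then show ?thesis by (simp add: s_def)
    qed
    have int1: "integrable lborel (\<lambda>u. exp (- u\<^sup>2 / 2) :: real)" using integrable_gaussian[of 1 0] by simp
    have "(\<lambda>n. \<integral>u. a (y + 1 / real (Suc n) * u) * complex_of_real (exp (- u\<^sup>2 / 2)) \<partial>lborel) \<longlonglongrightarrow> (\<integral>u. F y * complex_of_real (exp (- u\<^sup>2 / 2)) \<partial>lborel)"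
    proof (rule integral_dominated_convergence)
      show "integrable lborel (\<lambda>u. B * exp (- u\<^sup>2 / 2))" using int1 by simp
      show "AE u in lborel. (\<lambda>n. a (y + 1 / real (Suc n) * u) * complex_of_real (exp (- u\<^sup>2 / 2))) \<longlonglongrightarrow> F y * complex_of_real (exp (- u\<^sup>2 / 2))"
      proof (rule AE_I2, rule tendsto_mult[OF _ tendsto_const])
        fix u :: real
        have l: "(\<lambda>n. y + 1 / real (Suc n) * u) \<longlonglongrightarrow> y + 0 * u"
          by (intro tendsto_intros LIMSEQ_Suc[OF lim_inverse_n'])
        then have "eventually (\<lambda>n. y + 1 / real (Suc n) * u \<in> {y - 1<..<y + 1}) sequentially"
          by (intro topological_tendstoD[OF l]) auto
        then have ev: "eventually (\<lambda>n. F (y + 1 / real (Suc n) * u) = a (y + 1 / real (Suc n) * u)) sequentially"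
          by eventually_elim (auto simp: a_def)
        have "isCont F y" using F continuous_on_eq_continuous_at by blast
        from isCont_tendsto_compose[OF this] l have "(\<lambda>n. F (y + 1 / real (Suc n) * u)) \<longlonglongrightarrow> F y" by simp
        then show "(\<lambda>n. a (y + 1 / real (Suc n) * u)) \<longlonglongrightarrow> F y"
          by (rule Lim_transform_eventually[OF _ ev])
      qed
      show "AE u in lborel. norm (a (y + 1 / real (Suc n) * u) * complex_of_real (exp (- u\<^sup>2 / 2))) \<le> B * exp (- u\<^sup>2 / 2)" for n
        by (rule AE_I2) (auto simp: norm_mult intro!: mult_right_mono aB)
    qed measurable
    moreover have "(\<integral>u. complex_of_real (exp (- u\<^sup>2 / 2)) \<partial>lborel) = complex_of_real (sqrt (2 * pi))"
      using integral_gaussian_cis[of 1 0] by simp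
    ultimately show ?thesis unfolding eq by (simp add: mult.commute)
  qed
  have lb: "(\<lambda>n. complex_of_real (real (Suc n)) * (\<integral>x. b x * complex_of_real (?g (real (Suc n)) x) \<partial>lborel)) \<longlonglongrightarrow> 0"
  proof (rule Lim_null_comparison)
    define C where "C = (\<integral>x. norm (b x) * ?g (sqrt (1/2)) x \<partial>lborel)"
    have "norm (complex_of_real (real (Suc n)) * (\<integral>x. b x * complex_of_real (?g (real (Suc n)) x) \<partial>lborel)) \<le> real (Suc n) * (exp (- (real (Suc n))\<^sup>2 / 4) * C)" for n
    proof -
      define s where "s = real (Suc n)"
      have s: "s \<ge> 1" by (simp add: s_def)
      have "norm (\<integral>x. b x * complex_of_real (?g s x) \<partial>lborel) \<le> (\<integral>x. exp (- s\<^sup>2 / 4) * (norm (b x) * ?g (sqrt (1/2)) x) \<partial>lborel)"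
      proof (rule order_trans[OF integral_norm_bound], rule integral_mono)
        show "integrable lborel (\<lambda>x. norm (b x * complex_of_real (?g s x)))"
          using ic[OF sq(2), of s] s by (intro integrable_norm) auto
        show "integrable lborel (\<lambda>x. exp (- s\<^sup>2 / 4) * (norm (b x) * ?g (sqrt (1/2)) x))"
          using ig[OF sq(2), of "sqrt (1/2)"] by simp
        fix x
        show "norm (b x * complex_of_real (?g s x)) \<le> exp (- s\<^sup>2 / 4) * (norm (b x) * ?g (sqrt (1/2)) x)"
        proof (cases "x \<in> {y - 1..y + 1}")
          case False
          then have d: "1 \<le> \<bar>y - x\<bar>" by auto
          \<comment> \<open>Both \<open>s\<close> and the distance are at least one, so
            \<open>s^2 (y - x)^2\<close> dominates each of its two factors. Half of the exponent
            therefore pays for \<open>exp (- s^2 / 4)\<close> together with a Gaussian that does not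
            depend on \<open>s\<close>.\<close>
          have d2: "1 \<le> (y - x)\<^sup>2" using power_mono[OF d, of 2] by simp
          have s2: "1 \<le> s\<^sup>2" using power_mono[OF s, of 2] by simp
          have "s\<^sup>2 * 1 \<le> s\<^sup>2 * (y - x)\<^sup>2" "1 * (y - x)\<^sup>2 \<le> s\<^sup>2 * (y - x)\<^sup>2"
            using d2 s2 by (intro mult_left_mono mult_right_mono; simp)+
          then have "- (s * (y - x))\<^sup>2 / 2 \<le> - s\<^sup>2 / 4 + - (sqrt (1/2) * (y - x))\<^sup>2 / 2"
            by (simp add: power_mult_distrib real_sqrt_divide power_divide)
          then have "?g s x \<le> exp (- s\<^sup>2 / 4) * ?g (sqrt (1/2)) x"
            unfolding exp_add[symmetric] by simp
          then have "norm (b x) * ?g s x \<le> norm (b x) * (exp (- s\<^sup>2 / 4) * ?g (sqrt (1/2)) x)"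
            by (intro mult_left_mono) auto
          then show ?thesis by (simp add: norm_mult mult_ac)
        qed (simp add: b_def)
      qed
      then have "norm (\<integral>x. b x * complex_of_real (?g s x) \<partial>lborel) \<le> exp (- s\<^sup>2 / 4) * C" unfolding C_def by simp
      then have "s * norm (\<integral>x. b x * complex_of_real (?g s x) \<partial>lborel) \<le> s * (exp (- s\<^sup>2 / 4) * C)"
        using s by (intro mult_left_mono) auto
      then show ?thesis using s by (simp add: norm_mult s_def del: of_nat_Suc)
    qed
    then show "eventually (\<lambda>n. norm (complex_of_real (real (Suc n)) * (\<integral>x. b x * complex_of_real (?g (real (Suc n)) x) \<partial>lborel)) \<le> real (Suc n) * (exp (- (real (Suc n))\<^sup>2 / 4) * C)) sequentially"
      by simp
    have "((\<lambda>x::real. x * exp (- x\<^sup>2 / 4)) \<longlongrightarrow> 0) at_top" by real_asymp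
    then have "(\<lambda>n. real n * exp (- (real n)\<^sup>2 / 4)) \<longlonglongrightarrow> 0"
      by (rule filterlim_compose[OF _ filterlim_real_sequentially])
    then have "(\<lambda>n. real (Suc n) * exp (- (real (Suc n))\<^sup>2 / 4)) \<longlonglongrightarrow> 0" by (rule LIMSEQ_Suc)
    from tendsto_mult_left_zero[OF this, of C]
    show "(\<lambda>n. real (Suc n) * (exp (- (real (Suc n))\<^sup>2 / 4) * C)) \<longlonglongrightarrow> 0" by (simp add: mult.assoc)
  qed
  have "complex_of_real (real (Suc n)) * (\<integral>x. F x * complex_of_real (?g (real (Suc n)) x) \<partial>lborel)
    = complex_of_real (real (Suc n)) * (\<integral>x. a x * complex_of_real (?g (real (Suc n)) x) \<partial>lborel)
     + complex_of_real (real (Suc n)) * (\<integral>x. b x * complex_of_real (?g (real (Suc n)) x) \<partial>lborel)" for n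
    unfolding ab distrib_right distrib_left[symmetric]
    using ic[OF sq(1), of "real (Suc n)"] ic[OF sq(2), of "real (Suc n)"]
    by (subst Bochner_Integration.integral_add) simp_all
  then show ?thesis using tendsto_add[OF la lb] by simp
qed

text \<open>Both sides of \<open>fourier_transform_gaussian\<close> converge as the frequency
  Gaussian widens: one by dominated convergence to \<open>fourier_inv G y\<close>, the other by
  continuity to a multiple of \<open>F y\<close>. Hence equality at every point, not just almost
  everywhere.\<close>

lemma fourier_inversion:
  fixes F :: "real \<Rightarrow> complex"
  assumes FT: "is_fourier_transform F G"
    and F: "continuous_on UNIV F" and F2: "integrable lborel (\<lambda>x. (norm (F x))\<^sup>2)"
    and G: "integrable lborel G"
  shows "fourier_inv G y = 2 * pi * F y"
proof -
  have [measurable]: "F \<in> borel_measurable borel" by (rule borel_measurable_continuous_onI[OF F])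
  note [measurable] = borel_measurable_integrable[OF G]
  let ?L = "\<lambda>n. \<integral>\<xi>. G \<xi> * (complex_of_real (exp (- (\<xi> / real (Suc n))\<^sup>2 / 2)) * cis (y * \<xi>)) \<partial>lborel"
  have "?L n = complex_of_real (sqrt (2 * pi)) * (complex_of_real (real (Suc n)) * (\<integral>x. F x * complex_of_real (exp (- (real (Suc n) * (y - x))\<^sup>2 / 2)) \<partial>lborel))" for n
    by (subst fourier_transform_gaussian[OF FT _ F2 G]) simp_all
  then have "?L \<longlonglongrightarrow> complex_of_real (sqrt (2 * pi)) * (complex_of_real (sqrt (2 * pi)) * F y)"
    by (simp only:) (intro tendsto_mult_left gaussian_approximation F F2)
  moreover have "?L \<longlonglongrightarrow> fourier_inv G y"
    unfolding fourier_inv_def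
  proof (rule integral_dominated_convergence[where w="\<lambda>\<xi>. norm (G \<xi>)"])
    show "AE \<xi> in lborel. (\<lambda>n. G \<xi> * (complex_of_real (exp (- (\<xi> / real (Suc n))\<^sup>2 / 2)) * cis (y * \<xi>))) \<longlonglongrightarrow> G \<xi> * cis (y * \<xi>)"
    proof (rule AE_I2)
      fix \<xi> :: real
      have "(\<lambda>n. - (\<xi> * (1 / real (Suc n)))\<^sup>2 / 2) \<longlonglongrightarrow> - (\<xi> * 0)\<^sup>2 / 2"
        by (intro tendsto_intros LIMSEQ_Suc[OF lim_inverse_n']) simp
      then have "(\<lambda>n. complex_of_real (exp (- (\<xi> / real (Suc n))\<^sup>2 / 2))) \<longlonglongrightarrow> complex_of_real (exp 0)"
        by (intro tendsto_of_real tendsto_exp) simp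
      then show "(\<lambda>n. G \<xi> * (complex_of_real (exp (- (\<xi> / real (Suc n))\<^sup>2 / 2)) * cis (y * \<xi>))) \<longlonglongrightarrow> G \<xi> * cis (y * \<xi>)"
        using tendsto_mult[OF tendsto_const[of "G \<xi>"] tendsto_mult[OF _ tendsto_const[of "cis (y * \<xi>)"]]] by fastforce
    qed
    show "AE \<xi> in lborel. norm (G \<xi> * (complex_of_real (exp (- (\<xi> / real (Suc n))\<^sup>2 / 2)) * cis (y * \<xi>))) \<le> norm (G \<xi>)" for n
      by (auto simp: norm_mult intro!: mult_left_le)
  qed (use G in auto)
  ultimately have "fourier_inv G y = complex_of_real (sqrt (2 * pi)) * (complex_of_real (sqrt (2 * pi)) * F y)"
    by (rule LIMSEQ_unique[rotated])
  moreover have "complex_of_real (sqrt (2 * pi)) * complex_of_real (sqrt (2 * pi)) = 2 * complex_of_real pi"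
    unfolding of_real_mult[symmetric] real_sqrt_mult_self by simp
  ultimately show ?thesis by (simp flip: mult.assoc)
qed

section \<open>Chebyshev polynomials of the second kind and cosine series\<close>

fun chebU :: "nat \<Rightarrow> real \<Rightarrow> real" where
  "chebU 0 x = 1"
| "chebU (Suc 0) x = 2 * x"
| "chebU (Suc (Suc n)) x = 2 * x * chebU (Suc n) x - chebU n x"

lemma cos_recurrence: "cos (real (Suc (Suc n)) * t) = 2 * cos t * cos (real (Suc n) * t) - cos (real n * t)"
proof -
  have "real (Suc (Suc n)) * t = real (Suc n) * t + t" "real n * t = real (Suc n) * t - t"
    by (simp_all add: algebra_simps)
  then show ?thesis by (simp only: cos_add cos_diff) simp
qed

text \<open>The classical relation \<open>U_n - U_(n-2) = 2 T_n\<close>, with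
  \<open>T_n (cos t)\<close> written as \<open>cos (n t)\<close>. It converts cosine series into
  series in \<open>chebU\<close>.\<close>

lemma chebU_diff: "chebU (Suc (Suc n)) (cos t) - chebU n (cos t) = 2 * cos (real (Suc (Suc n)) * t)"
proof (induction n rule: induct_nat_012)
  case 0
  then show ?case using cos_recurrence[of 0 t] by simp
next
  case 1
  have "chebU (Suc (Suc 1)) (cos t) - chebU 1 (cos t) = 2 * (2 * cos t * (2 * cos t * cos t - 1) - cos t)"
    by (simp add: algebra_simps)
  also have "\<dots> = 2 * cos (real (Suc (Suc 1)) * t)"
    using cos_recurrence[of 1 t] cos_recurrence[of 0 t] by simp
  finally show ?case by simp
next
  case (ge2 n)
  have "chebU (Suc (Suc (Suc (Suc n)))) (cos t) - chebU (Suc (Suc n)) (cos t)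
     = 2 * cos t * (chebU (Suc (Suc (Suc n))) (cos t) - chebU (Suc n) (cos t)) - (chebU (Suc (Suc n)) (cos t) - chebU n (cos t))"
    by (simp only: chebU.simps(3)[of _ "cos t"]) (simp add: algebra_simps)
  also have "\<dots> = 2 * cos (real (Suc (Suc (Suc (Suc n)))) * t)"
    unfolding ge2 using cos_recurrence[of "Suc (Suc n)" t] by (simp only: mult.assoc right_diff_distrib)
  finally show ?case .
qed

lemma chebU_bound:
  assumes "\<bar>x\<bar> \<le> 1"
  shows "\<bar>chebU n x\<bar> \<le> real (Suc n)"
proof -
  obtain t where t: "x = cos t" using assms by (metis abs_le_iff cos_arccos minus_le_iff)
  show ?thesis
  proof (induction n rule: induct_nat_012)
    case 1 then show ?case using assms by (simp add: abs_mult)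
  next
    case (ge2 n)
    have "chebU (Suc (Suc n)) x = chebU n x + 2 * cos (real (Suc (Suc n)) * t)"
      using chebU_diff[of n t] unfolding t by simp
    then have "\<bar>chebU (Suc (Suc n)) x\<bar> \<le> \<bar>chebU n x\<bar> + 2 * \<bar>cos (real (Suc (Suc n)) * t)\<bar>"
      using abs_triangle_ineq[of "chebU n x" "2 * cos (real (Suc (Suc n)) * t)"] by (simp add: abs_mult del: chebU.simps)
    also have "\<dots> \<le> real (Suc n) + 2 * 1" by (intro add_mono ge2 mult_left_mono) auto
    finally show ?case by simp
  qed simp
qed

text \<open>Products of cosines are sums of cosines, so \<open>D\<close> is orthogonal to every
  polynomial in \<open>cos \<theta>\<close>. Weierstrass approximation of
  \<open>D (arccos x)\<close> makes such polynomials uniformly close to \<open>D\<close>, so the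
  integral of \<open>D^2\<close> vanishes.\<close>

lemma cos_coefficients_unique:
  fixes D :: "real \<Rightarrow> real"
  assumes D: "continuous_on UNIV D" and orth: "\<And>n. (\<integral>\<theta>. D \<theta> * cos (real n * \<theta>) \<partial>angle) = 0"
    and "\<theta> \<in> {0..pi}"
  shows "D \<theta> = 0"
proof -
  have [measurable]: "D \<in> borel_measurable borel" by (rule borel_measurable_continuous_onI[OF D])
  have cont_int: "integrable angle f" if "continuous_on UNIV f" for f :: "real \<Rightarrow> real"
  proof -
    have "integrable lborel (\<lambda>x. indicator {0..pi} x *\<^sub>R f x)"
      by (rule borel_integrable_compact) (auto intro: continuous_on_subset[OF that])
    then show ?thesis unfolding angle_def by (subst integrable_restrict_space) auto
  qed
  have pow: "(\<integral>\<theta>. D \<theta> * (cos \<theta> ^ k * cos (real n * \<theta>)) \<partial>angle) = 0" for k n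
  proof (induction k arbitrary: n)
    case (Suc k)
    have ci: "integrable angle (\<lambda>\<theta>. D \<theta> * (cos \<theta> ^ k * cos (real n * \<theta>)))" for n
      by (intro cont_int continuous_intros D)
    show ?case
    proof (cases n)
      case 0
      then show ?thesis using Suc[of 1] by (simp add: mult_ac)
    next
      case (Suc n')
      have c: "cos \<theta> * cos (real n * \<theta>) = (cos (real (Suc n) * \<theta>) + cos (real n' * \<theta>)) / 2" for \<theta>
        using cos_recurrence[of n' \<theta>] Suc by simp
      have "D \<theta> * (cos \<theta> ^ Suc k * cos (real n * \<theta>)) = D \<theta> * cos \<theta> ^ k * (cos \<theta> * cos (real n * \<theta>))" for \<theta>
        by (simp only: power_Suc mult_ac)
      then have e: "D \<theta> * (cos \<theta> ^ Suc k * cos (real n * \<theta>))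
          = (D \<theta> * (cos \<theta> ^ k * cos (real (Suc n) * \<theta>)) + D \<theta> * (cos \<theta> ^ k * cos (real n' * \<theta>))) / 2" for \<theta>
        unfolding c by (simp only: distrib_left times_divide_eq_right mult.assoc)
      show ?thesis unfolding e using Suc.IH ci by (simp del: of_nat_Suc)
    qed
  qed (use orth in simp)
  have poly: "(\<integral>\<theta>. D \<theta> * p (cos \<theta>) \<partial>angle) = 0" if "real_polynomial_function p" for p
  proof -
    obtain a and N :: nat where p: "p = (\<lambda>x. \<Sum>i\<le>N. a i * x ^ i)"
      using \<open>real_polynomial_function p\<close> unfolding real_polynomial_function_iff_sum by auto
    have "integrable angle (\<lambda>\<theta>. D \<theta> * (a i * cos \<theta> ^ i))" for i
      by (intro cont_int continuous_intros D)
    then have "(\<integral>\<theta>. D \<theta> * p (cos \<theta>) \<partial>angle) = (\<Sum>i\<le>N. \<integral>\<theta>. D \<theta> * (a i * cos \<theta> ^ i) \<partial>angle)"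
      unfolding p sum_distrib_left by (subst Bochner_Integration.integral_sum) auto
    also have "\<dots> = 0" using pow[of _ 0] by (intro sum.neutral) (simp add: mult.left_commute[of "D _"])
    finally show ?thesis .
  qed
  have "(\<integral>\<theta>. D \<theta> * D \<theta> \<partial>angle) \<le> e * (\<integral>\<theta>. \<bar>D \<theta>\<bar> \<partial>angle)" if e: "e > 0" for e
  proof -
    have "continuous_on {-1..1} (\<lambda>x. D (arccos x))"
      by (rule continuous_on_compose2[OF D]) (auto intro: continuous_on_arccos')
    from Stone_Weierstrass_real_polynomial_function[OF _ this e]
    obtain p where p: "real_polynomial_function p" "\<And>x. x \<in> {-1..1} \<Longrightarrow> \<bar>D (arccos x) - p x\<bar> < e"
      by auto
    have pc: "continuous_on UNIV (\<lambda>\<theta>. p (cos \<theta>))"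
      by (rule continuous_on_compose2[OF continuous_on_polymonial_function, of _ UNIV])
         (use p(1) in \<open>auto intro!: continuous_intros simp: real_polynomial_function_eq[symmetric]\<close>)
    have i: "integrable angle (\<lambda>\<theta>. D \<theta> * D \<theta>)" "integrable angle (\<lambda>\<theta>. D \<theta> * p (cos \<theta>))" "integrable angle (\<lambda>\<theta>. e * \<bar>D \<theta>\<bar>)"
      by (intro cont_int continuous_intros D pc)+
    have "(\<integral>\<theta>. D \<theta> * D \<theta> \<partial>angle) = (\<integral>\<theta>. D \<theta> * D \<theta> - D \<theta> * p (cos \<theta>) \<partial>angle)"
      using i poly[OF p(1)] by simp
    also have "\<dots> \<le> (\<integral>\<theta>. e * \<bar>D \<theta>\<bar> \<partial>angle)"
    proof (rule integral_mono)
      fix \<theta> assume "\<theta> \<in> space angle"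
      then have "\<bar>D \<theta> - p (cos \<theta>)\<bar> \<le> e" using p(2)[of "cos \<theta>"] by (auto simp: arccos_cos)
      then have "\<bar>D \<theta>\<bar> * \<bar>D \<theta> - p (cos \<theta>)\<bar> \<le> \<bar>D \<theta>\<bar> * e" by (rule mult_left_mono) simp
      then show "D \<theta> * D \<theta> - D \<theta> * p (cos \<theta>) \<le> e * \<bar>D \<theta>\<bar>"
        unfolding right_diff_distrib[symmetric] abs_mult[symmetric] by (simp add: mult.commute)
    qed (use i in auto)
    finally show ?thesis by simp
  qed note le = this
  have "(\<integral>\<theta>. D \<theta> * D \<theta> \<partial>angle) \<le> 0"
  proof (rule field_le_epsilon)
    fix e :: real assume e: "e > 0"
    define J where "J = (\<integral>\<theta>. \<bar>D \<theta>\<bar> \<partial>angle)"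
    have J: "0 \<le> J" unfolding J_def by simp
    have "(\<integral>\<theta>. D \<theta> * D \<theta> \<partial>angle) \<le> e / (J + 1) * J"
      unfolding J_def by (rule le) (intro divide_pos_pos add_nonneg_pos e J[unfolded J_def], simp)
    also have "\<dots> \<le> e" using e J by (simp add: field_simps)
    finally show "(\<integral>\<theta>. D \<theta> * D \<theta> \<partial>angle) \<le> 0 + e" by simp
  qed
  moreover have "0 \<le> (\<integral>\<theta>. D \<theta> * D \<theta> \<partial>angle)" by simp
  ultimately have "(\<integral>\<theta>. D \<theta> * D \<theta> \<partial>angle) = 0" by simp
  moreover have "(\<integral>\<theta>. D \<theta> * D \<theta> \<partial>angle) = integral {0..pi} (\<lambda>\<theta>. D \<theta> * D \<theta>)"
  proof -
    have "set_integrable lborel {0..pi} (\<lambda>\<theta>. D \<theta> * D \<theta>)"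
      unfolding set_integrable_def by (rule borel_integrable_compact) (auto intro!: continuous_intros continuous_on_subset[OF D])
    from set_borel_integral_eq_integral(2)[OF this] show ?thesis
      unfolding integral_angle set_lebesgue_integral_def .
  qed
  ultimately have "\<forall>\<theta>\<in>{0..pi}. D \<theta> * D \<theta> = 0"
    by (subst integral_eq_0_iff[symmetric]) (auto intro!: continuous_intros continuous_on_subset[OF D])
  then show ?thesis using assms(3) by auto
qed

text \<open>The cosine series with coefficients \<open>a n\<close> converges uniformly, and has the
  same cosine coefficients as \<open>F (1 - cos \<theta>)\<close>; so the two agree. Replacing each
  cosine by a difference of two \<open>chebU\<close> and regrouping shifts indices by two only, so
  the weight \<open>n + 1\<close> on the coefficients remains summable.\<close>

lemma chebyshev_expansion:
  fixes F :: "real \<Rightarrow> complex"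
  assumes F: "continuous_on UNIV F"
    and \<alpha>: "\<And>n. \<alpha> n = (\<integral>\<theta>. F (1 - cos \<theta>) * complex_of_real (cos (real n * \<theta>)) \<partial>angle)"
    and sm: "summable (\<lambda>n. real n * norm (\<alpha> n))"
  shows "\<exists>c. summable (\<lambda>n. real (Suc n) * norm (c n)) \<and> (\<forall>x\<in>{-1..1}. (\<lambda>n. c n * complex_of_real (chebU n x)) sums F (1 - x))"
proof -
  \<comment> \<open>The squared norm of \<open>cos (n * \<theta>)\<close> on
    \<open>[0, pi]\<close>.\<close>
  define k where "k n = (if n = 0 then pi else pi / 2)" for n :: nat
  have k: "k n > 0" "pi / 2 \<le> k n" for n unfolding k_def by auto
  have orth: "(\<integral>\<theta>. cos (real n * \<theta>) * cos (real j * \<theta>) \<partial>angle) = (if n = j then k n else 0)" for n j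
  proof (cases "n = 0 \<or> j = 0")
    case True
    then show ?thesis using integral_angle_cos_int[of "int j"] integral_angle_cos_int[of "int n"]
      by (auto simp: k_def measure_angle)
  next
    case False
    then show ?thesis using orthogonal_cos_sin(1)[of n j] by (simp add: k_def)
  qed
  define a where "a n = \<alpha> n / k n" for n
  have na: "norm (a n) \<le> norm (\<alpha> n)" for n
  proof -
    have "1 \<le> k n" using k(2)[of n] pi_ge_two by linarith
    then show ?thesis unfolding a_def by (simp add: norm_divide divide_le_eq mult_left_le)
       (use mult_left_mono[of 1 "k n" "norm (\<alpha> n)"] in auto)
  qed
  have sma: "summable (\<lambda>n. real (Suc n) * norm (a n))"
  proof (rule summable_comparison_test_ev)
    show "summable (\<lambda>n. 2 * (real n * norm (\<alpha> n)))" using sm by simp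
    show "eventually (\<lambda>n. norm (real (Suc n) * norm (a n)) \<le> 2 * (real n * norm (\<alpha> n))) sequentially"
      using eventually_ge_at_top[of 1]
    proof eventually_elim
      case (elim n)
      have "real (Suc n) * norm (a n) \<le> (2 * real n) * norm (\<alpha> n)" using elim na by (intro mult_mono) auto
      then show ?case by simp
    qed
  qed
  have sma0: "summable (\<lambda>n. norm (a n))"
    by (rule summable_comparison_test[OF _ sma]) (auto simp: algebra_simps)
  define S where "S \<theta> = (\<Sum>n. a n * complex_of_real (cos (real n * \<theta>)))" for \<theta>
  have bnd: "norm (a n * complex_of_real (cos (real n * \<theta>))) \<le> norm (a n)" for n \<theta>
    by (simp add: norm_mult mult_left_le)
  have Scont: "continuous_on UNIV S"
  proof (rule uniform_limit_theorem)
    show "uniform_limit UNIV (\<lambda>N \<theta>. \<Sum>n<N. a n * complex_of_real (cos (real n * \<theta>))) S sequentially"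
      unfolding S_def using sma0 bnd by (intro Weierstrass_m_test) auto
    show "eventually (\<lambda>N. continuous_on UNIV (\<lambda>\<theta>. \<Sum>n<N. a n * complex_of_real (cos (real n * \<theta>)))) sequentially"
      by (intro always_eventually allI continuous_intros)
  qed simp
  define D where "D \<theta> = F (1 - cos \<theta>) - S \<theta>" for \<theta>
  have Dcont: "continuous_on UNIV D"
    unfolding D_def by (intro continuous_intros Scont continuous_on_compose2[OF F]) auto
  have cont_int: "integrable angle f" if "continuous_on UNIV f" for f :: "real \<Rightarrow> complex"
  proof -
    have "integrable lborel (\<lambda>x. indicator {0..pi} x *\<^sub>R f x)"
      by (rule borel_integrable_compact) (auto intro: continuous_on_subset[OF that])
    then show ?thesis unfolding angle_def by (subst integrable_restrict_space) auto
  qed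
  have Sint: "(\<integral>\<theta>. S \<theta> * complex_of_real (cos (real j * \<theta>)) \<partial>angle) = \<alpha> j" for j
  proof -
    let ?f = "\<lambda>n \<theta>. a n * complex_of_real (cos (real n * \<theta>)) * complex_of_real (cos (real j * \<theta>))"
    have nf: "norm (?f n \<theta>) \<le> norm (a n)" for n \<theta>
      unfolding norm_mult[of "_ * _"] by (rule order_trans[OF mult_left_le bnd]) auto
    have fi: "integrable angle (?f n)" for n by (intro cont_int continuous_intros)
    have "S \<theta> * complex_of_real (cos (real j * \<theta>)) = (\<Sum>n. ?f n \<theta>)" for \<theta>
      unfolding S_def by (rule suminf_mult2) (rule summable_comparison_test[OF _ sma0], use bnd in auto)
    then have "(\<integral>\<theta>. S \<theta> * complex_of_real (cos (real j * \<theta>)) \<partial>angle) = (\<integral>\<theta>. (\<Sum>n. ?f n \<theta>) \<partial>angle)" by simp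
    also have "\<dots> = (\<Sum>n. integral\<^sup>L angle (?f n))"
    proof (rule integral_suminf[OF fi])
      show "AE \<theta> in angle. summable (\<lambda>n. norm (?f n \<theta>))"
        by (intro AE_I2 summable_comparison_test[OF _ sma0]) (use nf in auto)
      show "summable (\<lambda>n. \<integral>\<theta>. norm (?f n \<theta>) \<partial>angle)"
      proof (rule summable_comparison_test)
        show "summable (\<lambda>n. norm (a n) * pi)" using sma0 by (rule summable_mult2)
        have "(\<integral>\<theta>. norm (?f n \<theta>) \<partial>angle) \<le> (\<integral>\<theta>. norm (a n) \<partial>angle)" for n
          by (rule integral_mono) (use fi nf in auto)
        then show "\<exists>N. \<forall>n\<ge>N. norm (\<integral>\<theta>. norm (?f n \<theta>) \<partial>angle) \<le> norm (a n) * pi"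
          by (simp add: measure_angle mult.commute)
      qed
    qed
    also have "integral\<^sup>L angle (?f n) = (if n = j then \<alpha> j else 0)" for n
    proof -
      have "integral\<^sup>L angle (?f n) = (\<integral>\<theta>. a n * complex_of_real (cos (real n * \<theta>) * cos (real j * \<theta>)) \<partial>angle)"
        by (simp add: mult.assoc)
      also have "\<dots> = a n * complex_of_real (if n = j then k n else 0)"
        unfolding integral_mult_right_zero integral_complex_of_real orth ..
      finally show ?thesis using k[of n] by (auto simp: a_def)
    qed
    then have "(\<Sum>n. integral\<^sup>L angle (?f n)) = \<alpha> j" using suminf_finite[of "{j}" "\<lambda>n. if n = j then \<alpha> j else 0"] by simp
    finally show ?thesis .
  qed
  have Dorth: "(\<integral>\<theta>. D \<theta> * complex_of_real (cos (real j * \<theta>)) \<partial>angle) = 0" for j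
  proof -
    have "integrable angle (\<lambda>\<theta>. F (1 - cos \<theta>) * complex_of_real (cos (real j * \<theta>)))"
      "integrable angle (\<lambda>\<theta>. S \<theta> * complex_of_real (cos (real j * \<theta>)))"
      by (intro cont_int continuous_intros Scont continuous_on_compose2[OF F]; simp)+
    then show ?thesis unfolding D_def left_diff_distrib using Sint \<alpha> by simp
  qed
  have D0: "D \<theta> = 0" if "\<theta> \<in> {0..pi}" for \<theta>
  proof (rule complex_eqI)
    have ci: "integrable angle (\<lambda>\<theta>. D \<theta> * complex_of_real (cos (real j * \<theta>)))" for j
      by (intro cont_int continuous_intros Dcont)
    have "(\<integral>\<theta>. Re (D \<theta>) * cos (real j * \<theta>) \<partial>angle) = 0" for j
      using integral_Re[OF ci[of j]] Dorth[of j] by simp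
    then show "Re (D \<theta>) = Re 0"
      using cos_coefficients_unique[of "\<lambda>\<theta>. Re (D \<theta>)"] that by (auto intro: continuous_intros Dcont)
    have "(\<integral>\<theta>. Im (D \<theta>) * cos (real j * \<theta>) \<partial>angle) = 0" for j
      using integral_Im[OF ci[of j]] Dorth[of j] by simp
    then show "Im (D \<theta>) = Im 0"
      using cos_coefficients_unique[of "\<lambda>\<theta>. Im (D \<theta>)"] that by (auto intro: continuous_intros Dcont)
  qed
  \<comment> \<open>A cosine of index \<open>n \<ge> 2\<close> contributes \<open>a n / 2\<close> at
    index \<open>n\<close> and \<open>- a n / 2\<close> at index \<open>n - 2\<close>. The
    additional \<open>a 0 / 2\<close> is due to \<open>T_0 = U_0\<close>, where the halved
    difference formula would give only \<open>U_0 / 2\<close>.\<close>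
  define c where "c n = (if n = 0 then a 0 / 2 else 0) + a n / 2 - a (Suc (Suc n)) / 2" for n
  have sum_c: "summable (\<lambda>n. real (Suc n) * norm (c n))"
  proof (rule summable_comparison_test)
    have "summable (\<lambda>n. real (Suc (n + 2)) * norm (a (n + 2)))" using sma by (rule summable_ignore_initial_segment)
    then have "summable (\<lambda>n. real (Suc n) * norm (a (Suc (Suc n))))"
      by (rule summable_comparison_test[rotated]) (auto intro!: exI[of _ 0] mult_right_mono)
    then show "summable (\<lambda>n. (if n = 0 then norm (a 0) else 0) + real (Suc n) * norm (a n) + real (Suc n) * norm (a (Suc (Suc n))))"
      using sma by (intro summable_add summable_single)
    have "norm (c n) \<le> (if n = 0 then norm (a 0) else 0) + norm (a n) + norm (a (Suc (Suc n)))" for n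
    proof -
      have "norm (c n) \<le> norm (if n = 0 then a 0 / 2 else 0) + norm (a n / 2) + norm (a (Suc (Suc n)) / 2)"
        unfolding c_def by (intro norm_triangle_le norm_triangle_le_diff add_mono order_refl)
      also have "\<dots> \<le> (if n = 0 then norm (a 0) else 0) + norm (a n) + norm (a (Suc (Suc n)))"
        by (auto simp: norm_divide intro!: add_mono)
      finally show ?thesis .
    qed
    note nc = this
    have "real (Suc n) * norm (c n) \<le> (if n = 0 then norm (a 0) else 0) + real (Suc n) * norm (a n) + real (Suc n) * norm (a (Suc (Suc n)))" for n
    proof -
      have "real (Suc n) * norm (c n) \<le> real (Suc n) * ((if n = 0 then norm (a 0) else 0) + norm (a n) + norm (a (Suc (Suc n))))"
        by (rule mult_left_mono[OF nc]) simp
      also have "\<dots> = (if n = 0 then norm (a 0) else 0) + real (Suc n) * norm (a n) + real (Suc n) * norm (a (Suc (Suc n)))"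
        unfolding distrib_left by simp
      finally show ?thesis .
    qed
    then show "\<exists>N. \<forall>n\<ge>N. norm (real (Suc n) * norm (c n)) \<le> (if n = 0 then norm (a 0) else 0) + real (Suc n) * norm (a n) + real (Suc n) * norm (a (Suc (Suc n)))"
      by (intro exI[of _ 0] allI impI) simp
  qed
  have "(\<lambda>n. c n * complex_of_real (chebU n x)) sums F (1 - x)" if x: "x \<in> {-1..1}" for x
  proof -
    define t where "t = arccos x"
    have t: "t \<in> {0..pi}" "cos t = x" using x unfolding t_def by (auto intro: arccos_lbound arccos_ubound)
    have U: "norm (complex_of_real (chebU n x)) \<le> real (Suc n)" for n using chebU_bound[of x n] x by auto
    define A where "A n = a n / 2 * complex_of_real (chebU n x)" for n
    define B where "B n = a (Suc (Suc n)) / 2 * complex_of_real (chebU n x)" for n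
    have sA: "summable A"
    proof (rule summable_comparison_test[OF _ sma])
      have "norm (A n) \<le> real (Suc n) * norm (a n)" for n
      proof -
        have "norm (A n) = norm (complex_of_real (chebU n x)) * (norm (a n) / 2)"
          unfolding A_def by (simp add: norm_mult norm_divide)
        also have "\<dots> \<le> real (Suc n) * norm (a n)"
          by (intro mult_mono U) auto
        finally show ?thesis .
      qed
      then show "\<exists>N. \<forall>n\<ge>N. norm (A n) \<le> real (Suc n) * norm (a n)" by blast
    qed
    have sB: "summable B"
    proof (rule summable_comparison_test)
      have "summable (\<lambda>n. real (Suc (n + 2)) * norm (a (n + 2)))" using sma by (rule summable_ignore_initial_segment)
      then show "summable (\<lambda>n. real (Suc (Suc (Suc n))) * norm (a (Suc (Suc n))))" by simp
      have "norm (B n) \<le> real (Suc (Suc (Suc n))) * norm (a (Suc (Suc n)))" for n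
      proof -
        have "norm (B n) = norm (complex_of_real (chebU n x)) * (norm (a (Suc (Suc n))) / 2)"
          unfolding B_def by (simp add: norm_mult norm_divide)
        also have "\<dots> \<le> real (Suc (Suc (Suc n))) * norm (a (Suc (Suc n)))"
          by (intro mult_mono order_trans[OF U[of n]]) auto
        finally show ?thesis .
      qed
      then show "\<exists>N. \<forall>n\<ge>N. norm (B n) \<le> real (Suc (Suc (Suc n))) * norm (a (Suc (Suc n)))" by blast
    qed
    \<comment> \<open>\<open>V\<close> is \<open>B\<close> delayed by two indices. It has the same
      sum, but its terms combine with those of \<open>A\<close> to the cosine of the same index,
      whereas \<open>A n - B n\<close> yields the coefficients \<open>c n\<close>.\<close>
    define V where "V n = (if n < 2 then 0 else B (n - 2))" for n
    have "V sums suminf B"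
    proof -
      have "(\<lambda>n. V (n + 2)) sums (suminf B)" unfolding V_def using summable_sums[OF sB] by simp
      then show ?thesis by (subst (asm) sums_iff_shift) (simp add: V_def numeral_2_eq_2)
    qed
    moreover have "A sums suminf A" using sA by (rule summable_sums)
    moreover have "(\<lambda>n. if n = 0 then a 0 / 2 else 0) sums (a 0 / 2)" by (rule sums_single)
    ultimately have 1: "(\<lambda>n. (if n = 0 then a 0 / 2 else 0) + A n - V n) sums (a 0 / 2 + suminf A - suminf B)"
      by (intro sums_add sums_diff)
    have 2: "(if n = 0 then a 0 / 2 else 0) + A n - V n = a n * complex_of_real (cos (real n * t))" for n
    proof (cases "n < 2")
      case True
      then have "n = 0 \<or> n = 1" by auto
      then show ?thesis using t by (auto simp: A_def V_def)
    next
      case False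
      then obtain j where j: "n = Suc (Suc j)" by (metis add_2_eq_Suc le_Suc_ex not_less)
      have "A n - V n = a n / 2 * complex_of_real (chebU (Suc (Suc j)) x - chebU j x)"
        unfolding A_def V_def B_def using j by (simp add: algebra_simps del: chebU.simps)
      moreover have "chebU (Suc (Suc j)) x - chebU j x = 2 * cos (real n * t)"
        using chebU_diff[of j t] unfolding t(2) j .
      ultimately have "A n - V n = a n / 2 * complex_of_real (2 * cos (real n * t))" by (simp only:)
      then show ?thesis using False by simp
    qed
    have "(\<lambda>n. (if n = 0 then a 0 / 2 else 0) + A n - B n) sums (a 0 / 2 + suminf A - suminf B)"
      by (intro sums_add sums_diff summable_sums sA sB sums_single)
    moreover have "(if n = 0 then a 0 / 2 else 0) + A n - B n = c n * complex_of_real (chebU n x)" for n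
      by (cases "n = 0") (auto simp: c_def A_def B_def algebra_simps)
    moreover have "a 0 / 2 + suminf A - suminf B = F (1 - x)"
    proof -
      have "a 0 / 2 + suminf A - suminf B = S t"
        using 1 unfolding 2 S_def by (simp add: sums_iff)
      then show ?thesis using D0[OF t(1)] t(2) unfolding D_def by simp
    qed
    ultimately show ?thesis by simp
  qed
  then show ?thesis using sum_c by blast
qed

section \<open>Dyadic decomposition of Sobolev functions\<close>

lemma cheb_coef_add:
  assumes "integrable lborel H" "integrable lborel H'"
  shows "cheb_coef n (\<lambda>\<xi>. H \<xi> + H' \<xi>) = cheb_coef n H + cheb_coef n H'"
proof -
  have i: "integrable lborel (\<lambda>\<xi>. G \<xi> * cis (x * \<xi>))" if "integrable lborel G" for G x
    using that by (rule integrable_mult_cis) simp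
  have "fourier_inv (\<lambda>\<xi>. H \<xi> + H' \<xi>) x = fourier_inv H x + fourier_inv H' x" for x
    unfolding fourier_inv_def distrib_right using assms i by (intro Bochner_Integration.integral_add) auto
  moreover have "integrable angle (\<lambda>\<theta>. fourier_inv G (1 - cos \<theta>) * complex_of_real (cos (real n * \<theta>)))"
    if G: "integrable lborel G" for G
  proof (rule integrable_angle)
    show "norm (fourier_inv G (1 - cos \<theta>) * complex_of_real (cos (real n * \<theta>))) \<le> (\<integral>\<xi>. norm (G \<xi>) \<partial>lborel) * 1" for \<theta>
      unfolding norm_mult by (intro mult_mono norm_fourier_inv_le G) auto
  qed (use fourier_inv_measurable[OF G] in measurable)
  ultimately show ?thesis
    unfolding cheb_coef_def using assms by (simp add: distrib_right)
qed

lemma norm_cheb_coef_le: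
  assumes G: "integrable lborel G"
  shows "norm (cheb_coef n G) \<le> pi * (\<integral>\<xi>. norm (G \<xi>) \<partial>lborel)"
proof -
  have b: "norm (fourier_inv G (1 - cos \<theta>) * complex_of_real (cos (real n * \<theta>))) \<le> (\<integral>\<xi>. norm (G \<xi>) \<partial>lborel) * 1" for \<theta>
    unfolding norm_mult by (intro mult_mono norm_fourier_inv_le G) auto
  have "norm (cheb_coef n G) \<le> (\<integral>\<theta>. norm (fourier_inv G (1 - cos \<theta>) * complex_of_real (cos (real n * \<theta>))) \<partial>angle)"
    unfolding cheb_coef_def by (rule integral_norm_bound)
  also have "\<dots> \<le> (\<integral>\<theta>. (\<integral>\<xi>. norm (G \<xi>) \<partial>lborel) * 1 \<partial>angle)"
  proof (rule integral_mono)
    show "integrable angle (\<lambda>\<theta>. norm (fourier_inv G (1 - cos \<theta>) * complex_of_real (cos (real n * \<theta>))))"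
      by (intro integrable_norm integrable_angle[OF _ b]) (use fourier_inv_measurable[OF G] in measurable)
  qed (use b in auto)
  finally show ?thesis by (simp add: measure_angle)
qed

text \<open>On the block \<open>2^(j-1) < |\<xi>| \<le> 2^j\<close> the Sobolev weight is at least
  \<open>2^(2 s (j-1))\<close>, while the band-limited estimate costs \<open>2^(3 j / 2)\<close>.
  With \<open>s = 3/2 + \<epsilon>\<close> the contribution of the block decays like
  \<open>2^(- \<epsilon> j)\<close>, and the geometric series bounds the weighted coefficient
  sum.\<close>

lemma sobolev_chebyshev_expansion:
  fixes F :: "real \<Rightarrow> complex"
  assumes \<epsilon>: "\<epsilon> > 0" and F: "F \<in> L2_sobolev (3/2 + \<epsilon>)" and Fc: "continuous_on UNIV F"
  shows "\<exists>c. summable (\<lambda>n. real (Suc n) * norm (c n)) \<and> (\<forall>x\<in>{-1..1}. (\<lambda>n. c n * complex_of_real (chebU n x)) sums F (1 - x))"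
proof -
  define s where "s = 3/2 + \<epsilon>"
  have s: "s > 3/2" using \<epsilon> by (simp add: s_def)
  obtain G where FT: "is_fourier_transform F G"
    and Gs: "(\<integral>\<^sup>+\<xi>. ennreal ((1 + \<xi>\<^sup>2) powr s * (norm (G \<xi>))\<^sup>2) \<partial>lborel) < \<infinity>"
    using F unfolding L2_sobolev_def s_def by auto
  have Gm[measurable]: "G \<in> borel_measurable borel" using FT by (simp add: is_fourier_transform_def)
  have Fm[measurable]: "F \<in> borel_measurable borel" using F by (simp add: L2_sobolev_def)
  have F2: "integrable lborel (\<lambda>x. (norm (F x))\<^sup>2)"
    using F by (intro integrableI_bounded) (auto simp: L2_sobolev_def)
  define w where "w \<xi> = (1 + \<xi>\<^sup>2) powr s * (norm (G \<xi>))\<^sup>2" for \<xi>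
  have iw: "integrable lborel w"
    unfolding w_def using Gs by (intro integrableI_bounded) auto
  define W where "W = (\<integral>\<xi>. w \<xi> \<partial>lborel)"
  have w0: "0 \<le> w \<xi>" for \<xi> by (simp add: w_def)
  have W0: "0 \<le> W" unfolding W_def by (intro integral_nonneg_AE) (simp add: w0)
  have q: "1 \<le> 1 + \<xi>\<^sup>2" for \<xi> :: real by simp
  \<comment> \<open>Cauchy-Schwarz against \<open>(1 + \<xi>^2) powr (- s / 2)\<close>, whose square
    is at most \<open>1 / (1 + \<xi>^2)\<close>.\<close>
  have iG: "integrable lborel G"
  proof -
    have pw: "(x powr a)\<^sup>2 = x powr (2 * a)" for x a :: real
      by (simp add: power2_eq_square powr_add[symmetric])
    have i1: "integrable lborel (\<lambda>\<xi>. ((1 + \<xi>\<^sup>2) powr (s/2) * norm (G \<xi>))\<^sup>2)"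
    proof -
      have "((1 + \<xi>\<^sup>2) powr (s/2) * norm (G \<xi>))\<^sup>2 = w \<xi>" for \<xi>
        by (simp add: w_def power_mult_distrib pw)
      then show ?thesis using iw by simp
    qed
    have i2: "integrable lborel (\<lambda>\<xi>. ((1 + \<xi>\<^sup>2) powr (- s/2))\<^sup>2 :: real)"
    proof (rule Bochner_Integration.integrable_bound)
      show "integrable lborel (\<lambda>\<xi>. inverse (1 + \<xi>\<^sup>2) :: real)"
        using integrable_inverse_1_plus_square by (simp add: set_integrable_def einterval_def)
      show "AE \<xi> in lborel. norm (((1 + \<xi>\<^sup>2) powr (- s/2))\<^sup>2) \<le> norm (inverse (1 + \<xi>\<^sup>2) :: real)"
      proof (rule AE_I2)
        fix \<xi> :: real
        have "((1 + \<xi>\<^sup>2) powr (- s/2))\<^sup>2 = (1 + \<xi>\<^sup>2) powr (- s)" by (simp add: pw)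
        also have "\<dots> \<le> (1 + \<xi>\<^sup>2) powr (- 1)" using s q[of \<xi>] by (intro powr_mono) auto
        also have "\<dots> = inverse (1 + \<xi>\<^sup>2)" using q[of \<xi>] by (simp add: powr_minus)
        finally show "norm (((1 + \<xi>\<^sup>2) powr (- s/2))\<^sup>2) \<le> norm (inverse (1 + \<xi>\<^sup>2) :: real)" by simp
      qed
    qed measurable
    have eq: "((1 + \<xi>\<^sup>2) powr (s/2) * norm (G \<xi>)) * (1 + \<xi>\<^sup>2) powr (- s/2) = norm (G \<xi>)" for \<xi>
    proof -
      have "(1 + \<xi>\<^sup>2) powr (s/2) * (1 + \<xi>\<^sup>2) powr (- s/2) = 1"
        unfolding powr_add[symmetric] using less_le_trans[OF zero_less_one q[of \<xi>]] by simp
      then show ?thesis by (simp add: mult.commute[of _ "norm (G \<xi>)"] mult.assoc)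
    qed
    have "integrable lborel (\<lambda>\<xi>. norm (G \<xi>))"
      using Cauchy_Schwarz_integral(1)[OF _ _ i1 i2] unfolding eq by simp
    then show ?thesis by (simp add: integrable_norm_iff)
  qed
  define block where "block j \<xi> = (if \<bar>\<xi>\<bar> \<le> 2 ^ j \<and> (j = 0 \<or> 2 ^ (j - 1) < \<bar>\<xi>\<bar>) then G \<xi> else 0)" for j :: nat and \<xi> :: real
  define trunc where "trunc j \<xi> = (if \<bar>\<xi>\<bar> \<le> 2 ^ j then G \<xi> else 0)" for j :: nat and \<xi> :: real
  define tail where "tail j \<xi> = (if \<bar>\<xi>\<bar> \<le> 2 ^ j then 0 else G \<xi>)" for j :: nat and \<xi> :: real
  have [measurable]: "block j \<in> borel_measurable borel" "trunc j \<in> borel_measurable borel" "tail j \<in> borel_measurable borel" for j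
    unfolding block_def trunc_def tail_def by measurable
  have int: "integrable lborel (block j)" "integrable lborel (trunc j)" "integrable lborel (tail j)" for j
    by (rule Bochner_Integration.integrable_bound[OF iG]; simp add: block_def trunc_def tail_def)+
  have trunc_Suc: "trunc (Suc j) = (\<lambda>\<xi>. trunc j \<xi> + block (Suc j) \<xi>)" for j
  proof
    fix \<xi> :: real
    have "\<bar>\<xi>\<bar> \<le> 2 ^ Suc j" if "\<bar>\<xi>\<bar> \<le> 2 ^ j" using that by (rule order_trans) simp
    then show "trunc (Suc j) \<xi> = trunc j \<xi> + block (Suc j) \<xi>"
      unfolding trunc_def block_def by (auto simp del: power_Suc)
  qed
  have G_split: "G = (\<lambda>\<xi>. trunc j \<xi> + tail j \<xi>)" for j
    unfolding trunc_def tail_def by auto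
  define C where "C = 6 * pi\<^sup>2 * exp 2 + 4 * pi\<^sup>2"
  have C0: "0 \<le> C" unfolding C_def by simp
  define r where "r = 2 powr (- \<epsilon>)"
  have r: "0 < r" "r < 1" using \<epsilon> unfolding r_def by (auto simp: powr_less_one)
  \<comment> \<open>The factor \<open>2 powr (2 * s)\<close> is lost by using the inner radius
    \<open>2 ^ (j - 1)\<close> of the block in the Sobolev weight.\<close>
  define K0 where "K0 = sqrt (C * W * 2 powr (2 * s))"
  have K0: "0 \<le> K0" unfolding K0_def using C0 W0 by simp
  have block_bound: "(\<Sum>n\<in>{1..K}. real n * norm (cheb_coef n (block j))) \<le> K0 * r ^ j" for j K
  proof -
    have le: "(norm (block j \<xi>))\<^sup>2 \<le> 2 powr (2 * s * (1 - real j)) * w \<xi>" for \<xi>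
    proof (cases "\<bar>\<xi>\<bar> \<le> 2 ^ j \<and> (j = 0 \<or> 2 ^ (j - 1) < \<bar>\<xi>\<bar>)")
      case True
      have "1 \<le> 2 powr (2 * s * (1 - real j)) * (1 + \<xi>\<^sup>2) powr s"
      proof (cases j)
        case 0
        have "1 * 1 \<le> 2 powr (2 * s) * (1 + \<xi>\<^sup>2) powr s"
          using s by (intro mult_mono ge_one_powr_ge_zero) auto
        then show ?thesis using 0 by simp
      next
        case (Suc i)
        then have "2 ^ i < \<bar>\<xi>\<bar>" using True by simp
        then have "(2 ^ i)\<^sup>2 \<le> \<bar>\<xi>\<bar>\<^sup>2" by (intro power_mono) auto
        then have "(2 ^ i)\<^sup>2 \<le> 1 + \<xi>\<^sup>2" by simp
        then have "((2 ^ i)\<^sup>2) powr s \<le> (1 + \<xi>\<^sup>2) powr s" using s by (intro powr_mono2) auto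
        moreover have "((2 ^ i)\<^sup>2) powr s = 2 powr (2 * s * real i)"
        proof -
          have "((2::real) ^ i)\<^sup>2 = 2 powr real (i * 2)" by (simp only: power_mult powr_realpow zero_less_numeral)
          then show ?thesis by (simp only: powr_powr) (simp add: mult_ac)
        qed
        ultimately have "2 powr (2 * s * (1 - real j)) * 2 powr (2 * s * real i) \<le> 2 powr (2 * s * (1 - real j)) * (1 + \<xi>\<^sup>2) powr s"
          by (intro mult_left_mono) auto
        then show ?thesis using Suc unfolding powr_add[symmetric] by (simp add: algebra_simps)
      qed
      from mult_right_mono[OF this, of "(norm (G \<xi>))\<^sup>2"] show ?thesis
        using True by (simp add: block_def w_def mult.assoc)
    qed (auto simp: block_def w0)
    have ib2: "integrable lborel (\<lambda>\<xi>. (norm (block j \<xi>))\<^sup>2)"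
      by (rule Bochner_Integration.integrable_bound[OF integrable_mult_right[OF iw, of "2 powr (2 * s * (1 - real j))"]])
         (use le in \<open>auto simp: abs_mult w0\<close>)
    have E: "(\<integral>\<xi>. (norm (block j \<xi>))\<^sup>2 \<partial>lborel) \<le> 2 powr (2 * s * (1 - real j)) * W"
      using integral_mono[OF ib2 integrable_mult_right[OF iw, of "2 powr (2 * s * (1 - real j))"] le] by (simp add: W_def)
    have "(\<Sum>n\<in>{1..K}. real n * norm (cheb_coef n (block j)))\<^sup>2 \<le> C * (2 ^ j) ^ 3 * (\<integral>\<xi>. (norm (block j \<xi>))\<^sup>2 \<partial>lborel)"
      unfolding C_def by (rule cheb_coef_band_limited[OF _ _ _ ib2]) (auto simp: block_def)
    also have "\<dots> \<le> C * (2 ^ j) ^ 3 * (2 powr (2 * s * (1 - real j)) * W)"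
      using E C0 by (intro mult_left_mono) auto
    also have "\<dots> = C * W * ((2 ^ j) ^ 3 * 2 powr (2 * s * (1 - real j)))" by (simp add: mult_ac)
    also have "(2 ^ j) ^ 3 * 2 powr (2 * s * (1 - real j)) = 2 powr (2 * s) * (r ^ j)\<^sup>2"
    proof -
      have "((2::real) ^ j) ^ 3 = 2 powr (3 * real j)"
      proof -
        have "((2::real) ^ j) ^ 3 = 2 powr real (j * 3)" by (simp only: power_mult powr_realpow zero_less_numeral)
        then show ?thesis by (simp add: mult.commute)
      qed
      moreover have "(r ^ j)\<^sup>2 = 2 powr (- \<epsilon> * (2 * real j))"
      proof -
        have "(r ^ j)\<^sup>2 = r ^ (j * 2)" by (simp add: power_mult)
        also have "\<dots> = r powr (real (j * 2))" using r by (simp only: powr_realpow)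
        also have "\<dots> = 2 powr (- \<epsilon> * (2 * real j))" unfolding r_def powr_powr by (simp only: of_nat_mult of_nat_numeral mult_ac)
        finally show ?thesis .
      qed
      ultimately show ?thesis
        unfolding s_def by (simp add: powr_add[symmetric] algebra_simps)
    qed
    finally have "(\<Sum>n\<in>{1..K}. real n * norm (cheb_coef n (block j)))\<^sup>2 \<le> (K0 * r ^ j)\<^sup>2"
      unfolding K0_def power_mult_distrib using C0 W0 by (simp add: mult.assoc)
    then show ?thesis by (rule power2_le_imp_le) (use K0 r in simp)
  qed
  have trunc_bound: "(\<Sum>n\<in>{1..K}. real n * norm (cheb_coef n (trunc J))) \<le> (\<Sum>j\<le>J. K0 * r ^ j)" for J K
  proof (induction J)
    case 0
    have "trunc 0 = block 0" unfolding trunc_def block_def by auto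
    then show ?case using block_bound[of 0 K] by simp
  next
    case (Suc J)
    have "(\<Sum>n\<in>{1..K}. real n * norm (cheb_coef n (trunc (Suc J))))
       \<le> (\<Sum>n\<in>{1..K}. real n * norm (cheb_coef n (trunc J)) + real n * norm (cheb_coef n (block (Suc J))))"
      unfolding trunc_Suc cheb_coef_add[OF int(2) int(1)] distrib_left[symmetric]
      by (intro sum_mono mult_left_mono norm_triangle_ineq) auto
    then show ?case using Suc block_bound[of "Suc J" K] by (simp add: sum.distrib)
  qed
  have geo: "(\<Sum>j\<le>J. K0 * r ^ j) \<le> K0 / (1 - r)" for J
  proof -
    have "(\<Sum>j\<le>J. r ^ j) \<le> (\<Sum>j. r ^ j)" using r by (intro sum_le_suminf) auto
    also have "\<dots> = 1 / (1 - r)" using r by (intro suminf_geometric) auto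
    finally show ?thesis using mult_left_mono[OF _ K0, of _ "1 / (1 - r)"] by (simp add: sum_distrib_left[symmetric])
  qed
  \<comment> \<open>Each coefficient is continuous in the L^1 norm of the frequency function, so
    bounds on finitely many coefficients pass from the truncations to \<open>G\<close>.\<close>
  have lim: "(\<lambda>J. cheb_coef n (trunc J)) \<longlonglongrightarrow> cheb_coef n G" for n
  proof -
    have "(\<lambda>J. \<integral>\<xi>. norm (tail J \<xi>) \<partial>lborel) \<longlonglongrightarrow> (\<integral>\<xi>. 0 \<partial>(lborel :: real measure))"
    proof (rule integral_dominated_convergence[where w="\<lambda>\<xi>. norm (G \<xi>)"])
      show "AE \<xi> in lborel. (\<lambda>J. norm (tail J \<xi>)) \<longlonglongrightarrow> 0"
      proof (rule AE_I2)
        fix \<xi> :: real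
        obtain J0 where J0: "\<bar>\<xi>\<bar> < 2 ^ J0" using real_arch_pow[of 2 "\<bar>\<xi>\<bar>"] by auto
        have "norm (tail J \<xi>) = 0" if "J \<ge> J0" for J
        proof -
          have "(2::real) ^ J0 \<le> 2 ^ J" using that by (intro power_increasing) auto
          with J0 have "\<bar>\<xi>\<bar> \<le> 2 ^ J" by linarith
          then show ?thesis by (simp add: tail_def)
        qed
        then show "(\<lambda>J. norm (tail J \<xi>)) \<longlonglongrightarrow> 0"
          by (intro tendsto_eventually) (auto simp: eventually_sequentially)
      qed
    qed (use iG in \<open>auto simp: tail_def\<close>)
    then have "(\<lambda>J. pi * (\<integral>\<xi>. norm (tail J \<xi>) \<partial>lborel)) \<longlonglongrightarrow> 0" using tendsto_mult_right_zero by simp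
    then have "(\<lambda>J. cheb_coef n (tail J)) \<longlonglongrightarrow> 0"
      by (rule Lim_null_comparison[rotated]) (simp add: norm_cheb_coef_le int)
    then have "(\<lambda>J. cheb_coef n G - cheb_coef n (tail J)) \<longlonglongrightarrow> cheb_coef n G - 0" by (intro tendsto_intros)
    moreover have "cheb_coef n G - cheb_coef n (tail J) = cheb_coef n (trunc J)" for J
      by (subst G_split[of J]) (simp add: cheb_coef_add int)
    ultimately show ?thesis by simp
  qed
  have G_bound: "(\<Sum>n\<in>{1..K}. real n * norm (cheb_coef n G)) \<le> K0 / (1 - r)" for K
  proof (rule LIMSEQ_le_const2)
    show "(\<lambda>J. \<Sum>n\<in>{1..K}. real n * norm (cheb_coef n (trunc J))) \<longlonglongrightarrow> (\<Sum>n\<in>{1..K}. real n * norm (cheb_coef n G))"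
      by (intro tendsto_intros lim)
    show "\<exists>N. \<forall>J\<ge>N. (\<Sum>n\<in>{1..K}. real n * norm (cheb_coef n (trunc J))) \<le> K0 / (1 - r)"
      using order_trans[OF trunc_bound geo] by blast
  qed
  have smG: "summable (\<lambda>n. real n * norm (cheb_coef n G))"
  proof (rule summableI_nonneg_bounded)
    show "(\<Sum>n<K. real n * norm (cheb_coef n G)) \<le> K0 / (1 - r)" for K
    proof -
      have "(\<Sum>n<K. real n * norm (cheb_coef n G)) \<le> (\<Sum>n\<in>insert 0 {1..K}. real n * norm (cheb_coef n G))"
        by (rule sum_mono2) auto
      then show ?thesis using G_bound[of K] by simp
    qed
  qed simp
  define \<alpha> where "\<alpha> n = cheb_coef n G / (2 * pi)" for n
  have inv: "fourier_inv G y = 2 * pi * F y" for y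
    by (rule fourier_inversion[OF FT Fc F2 iG])
  show ?thesis
  proof (rule chebyshev_expansion[OF Fc])
    show "\<alpha> n = (\<integral>\<theta>. F (1 - cos \<theta>) * complex_of_real (cos (real n * \<theta>)) \<partial>angle)" for n
      unfolding \<alpha>_def cheb_coef_def inv by (simp add: mult.assoc)
    show "summable (\<lambda>n. real n * norm (\<alpha> n))"
      using summable_mult[OF smG, of "1 / (2 * pi)"] by (simp add: \<alpha>_def norm_divide norm_mult)
  qed
qed

section \<open>The Hausdorff moment problem\<close>

text \<open>Both measures live on one compact interval, where polynomials approximate
  \<open>f\<close> uniformly; the finite total masses turn this into closeness of the
  integrals.\<close>

lemma moments_determine_integral:
  fixes \<mu> \<nu> :: "real measure" and f :: "real \<Rightarrow> real"
  assumes \<mu>: "sets \<mu> = sets borel" "finite_measure \<mu>" "emeasure \<mu> (- {-R..R}) = 0"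
    and \<nu>: "sets \<nu> = sets borel" "finite_measure \<nu>" "emeasure \<nu> (- {-R..R}) = 0"
    and mom: "\<And>n. (\<integral>t. t ^ n \<partial>\<mu>) = (\<integral>t. t ^ n \<partial>\<nu>)"
    and f: "continuous_on UNIV f" "\<And>x. \<bar>f x\<bar> \<le> B"
  shows "(\<integral>t. f t \<partial>\<mu>) = (\<integral>t. f t \<partial>\<nu>)"
proof -
  have fm: "f \<in> borel_measurable borel" by (rule borel_measurable_continuous_onI[OF f(1)])
  have main: "\<bar>(\<integral>t. f t \<partial>M) - (\<integral>t. p t \<partial>M)\<bar> \<le> e * measure M (space M) \<and> (\<forall>n. integrable M (\<lambda>t. t ^ n))"
    if M: "sets M = sets borel" "finite_measure M" "emeasure M (- {-R..R}) = 0"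
      and p: "p = (\<lambda>x. \<Sum>i\<le>N. a i * x ^ i)" "\<And>x. x \<in> {-R..R} \<Longrightarrow> \<bar>f x - p x\<bar> < e"
    for M e N a and p :: "real \<Rightarrow> real"
  proof -
    interpret finite_measure M by fact
    have ae: "AE t in M. t \<in> {-R..R}"
      by (rule AE_I'[of "- {-R..R}"]) (use M in \<open>auto simp: null_sets_def\<close>)
    have m: "g \<in> borel_measurable M" if "g \<in> borel_measurable borel" for g :: "real \<Rightarrow> real"
      using that unfolding measurable_cong_sets[OF M(1) refl] .
    have ip: "integrable M (\<lambda>t. t ^ n)" for n
    proof (rule integrable_const_bound[where B="\<bar>R\<bar> ^ n"])
      show "AE t in M. norm (t ^ n) \<le> \<bar>R\<bar> ^ n"
        using ae by eventually_elim (auto simp: power_abs intro!: power_mono)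
    qed (intro m, simp)
    have ifn: "integrable M f"
      by (rule integrable_const_bound[where B=B]) (use f(2) m[OF fm] in auto)
    have ipp: "integrable M p" unfolding p(1) using ip by simp
    have "\<bar>(\<integral>t. f t \<partial>M) - (\<integral>t. p t \<partial>M)\<bar> = \<bar>\<integral>t. f t - p t \<partial>M\<bar>"
      using ifn ipp by simp
    also have "\<dots> \<le> (\<integral>t. \<bar>f t - p t\<bar> \<partial>M)" by (rule integral_abs_bound)
    also have "\<dots> \<le> (\<integral>t. e \<partial>M)"
    proof (rule integral_mono_AE)
      show "AE t in M. \<bar>f t - p t\<bar> \<le> e"
        using ae by eventually_elim (use p(2) in \<open>auto simp: less_imp_le\<close>)
    qed (use ifn ipp in auto)
    finally show ?thesis using ip by (simp add: mult.commute)
  qed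
  let ?C = "measure \<mu> (space \<mu>) + measure \<nu> (space \<nu>)"
  have C: "0 \<le> ?C" by simp
  have "\<bar>(\<integral>t. f t \<partial>\<mu>) - (\<integral>t. f t \<partial>\<nu>)\<bar> \<le> 0"
  proof (rule field_le_epsilon)
    fix e :: real assume e: "e > 0"
    define d where "d = e / (?C + 1)"
    have d: "d > 0" unfolding d_def using e C by (intro divide_pos_pos) linarith+
    from Stone_Weierstrass_real_polynomial_function[OF _ continuous_on_subset[OF f(1)] d, of "{-R..R}"]
    obtain p where p: "real_polynomial_function p" "\<And>x. x \<in> {-R..R} \<Longrightarrow> \<bar>f x - p x\<bar> < d" by auto
    from p(1) obtain a and N :: nat where pa: "p = (\<lambda>x. \<Sum>i\<le>N. a i * x ^ i)"
      unfolding real_polynomial_function_iff_sum by auto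
    note 1 = main[OF \<mu> pa p(2)] and 2 = main[OF \<nu> pa p(2)]
    have "(\<integral>t. p t \<partial>\<mu>) = (\<integral>t. p t \<partial>\<nu>)"
      unfolding pa using 1 2 by (subst (1 2) Bochner_Integration.integral_sum) (auto simp: mom)
    then have "\<bar>(\<integral>t. f t \<partial>\<mu>) - (\<integral>t. f t \<partial>\<nu>)\<bar> \<le> d * measure \<mu> (space \<mu>) + d * measure \<nu> (space \<nu>)"
      using 1 2 by linarith
    also have "\<dots> = d * ?C" by (simp add: distrib_left)
    also have "\<dots> \<le> d * (?C + 1)" using d by (intro mult_left_mono) auto
    also have "\<dots> = e"
    proof -
      have "?C + 1 \<noteq> 0" using C by linarith
      then show ?thesis unfolding d_def by simp
    qed
    finally show "\<bar>(\<integral>t. f t \<partial>\<mu>) - (\<integral>t. f t \<partial>\<nu>)\<bar> \<le> 0 + e" by simp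
  qed
  then show ?thesis by simp
qed

text \<open>Continuous step functions tending to the indicator of a half-line recover the
  distribution functions from integrals of bounded continuous functions, to which
  \<open>moments_determine_integral\<close> applies on a common interval.\<close>

lemma moments_determine_measure:
  fixes \<mu> \<nu> :: "real measure"
  assumes \<mu>: "sets \<mu> = sets borel" "finite_measure \<mu>" "emeasure \<mu> (- {-R..R}) = 0"
    and \<nu>: "sets \<nu> = sets borel" "finite_measure \<nu>" "emeasure \<nu> (- {-R'..R'}) = 0"
    and mom: "\<And>n. (\<integral>t. t ^ n \<partial>\<mu>) = (\<integral>t. t ^ n \<partial>\<nu>)"
  shows "\<mu> = \<nu>"
proof -
  define S where "S = max R R'"
  have S: "emeasure M (- {-S..S}) = 0" if "sets M = sets borel" "emeasure M (- {-r..r}) = 0" "r \<le> S" for M :: "real measure" and r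
    using emeasure_mono[of "- {-S..S}" "- {-r..r}" M] that by auto
  have sup: "emeasure \<mu> (- {-S..S}) = 0" "emeasure \<nu> (- {-S..S}) = 0"
    by (rule S[OF \<mu>(1,3)], simp add: S_def, rule S[OF \<nu>(1,3)], simp add: S_def)
  have f: "finite_borel_measure \<mu>" "finite_borel_measure \<nu>"
    using \<mu> \<nu> by (auto simp: finite_borel_measure_def finite_borel_measure_axioms_def)
  have lim: "(\<lambda>n. \<integral>t. cts_step x (x + 1 / real (Suc n)) t \<partial>M) \<longlonglongrightarrow> cdf M x"
    if M: "sets M = sets borel" "finite_measure M" for M x
  proof -
    interpret finite_measure M by fact
    have "(\<lambda>n. \<integral>t. cts_step x (x + 1 / real (Suc n)) t \<partial>M) \<longlonglongrightarrow> (\<integral>t. indicator {..x} t \<partial>M)"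
    proof (rule integral_dominated_convergence[where w="\<lambda>_. 1"])
      show "AE t in M. (\<lambda>n. cts_step x (x + 1 / real (Suc n)) t) \<longlonglongrightarrow> indicator {..x} t"
      proof (rule AE_I2)
        fix t
        show "(\<lambda>n. cts_step x (x + 1 / real (Suc n)) t) \<longlonglongrightarrow> indicator {..x} t"
        proof (cases "t \<le> x")
          case False
          then obtain N where N: "inverse (real (Suc N)) < t - x" using reals_Archimedean[of "t - x"] by auto
          have "cts_step x (x + 1 / real (Suc n)) t = 0" if "n \<ge> N" for n
          proof -
            have "1 / real (Suc n) \<le> 1 / real (Suc N)" using that by (intro divide_left_mono) auto
            then show ?thesis using N False by (simp add: cts_step_def inverse_eq_divide)
          qed
          then show ?thesis using False by (intro tendsto_eventually) (auto simp: eventually_sequentially)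
        qed (simp add: cts_step_def)
      qed
      have "cts_step x (x + 1 / real (Suc n)) \<in> borel_measurable borel" for n
        by (intro borel_measurable_continuous_onI uniformly_continuous_imp_continuous cts_step_uniformly_continuous) simp
      then show "cts_step x (x + 1 / real (Suc n)) \<in> borel_measurable M" for n
        unfolding measurable_cong_sets[OF M(1) refl] .
      show "(\<lambda>t. indicator {..x} t :: real) \<in> borel_measurable M"
        unfolding measurable_cong_sets[OF M(1) refl] by measurable
      show "AE t in M. norm (cts_step x (x + 1 / real (Suc n)) t) \<le> 1" for n
        by (rule AE_I2) (auto simp: cts_step_def divide_simps)
    qed simp
    also have "(\<integral>t. indicator {..x} t \<partial>M) = measure M {..x}" using M(1) sets_eq_imp_space_eq[OF M(1)] by simp
    finally show ?thesis by (simp add: cdf_def)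
  qed
  have "cdf \<mu> x = cdf \<nu> x" for x
  proof (rule LIMSEQ_unique[OF lim[OF \<mu>(1,2)]])
    have "(\<integral>t. cts_step x (x + 1 / real (Suc n)) t \<partial>\<mu>) = (\<integral>t. cts_step x (x + 1 / real (Suc n)) t \<partial>\<nu>)" for n
      by (rule moments_determine_integral[OF \<mu>(1,2) sup(1) \<nu>(1,2) sup(2) mom, where B=1])
         (intro uniformly_continuous_imp_continuous cts_step_uniformly_continuous, simp, simp add: cts_step_def divide_simps)
    then show "(\<lambda>n. \<integral>t. cts_step x (x + 1 / real (Suc n)) t \<partial>\<mu>) \<longlonglongrightarrow> cdf \<nu> x"
      using lim[OF \<nu>(1,2)] by simp
  qed
  then show ?thesis using cdf_unique'[OF f] by auto
qed

text \<open>
  Think of \<open>D m k\<close> as the integral of \<open>t\<^sup>k (1 - t)\<^sup>m\<close>.  The measure is a weak limit of the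
  discrete measures attaching the mass of the Bernstein polynomial of index \<open>k\<close> to the point \<open>k / n\<close>.
\<close>

locale hausdorff_moments =
  fixes D :: "nat \<Rightarrow> nat \<Rightarrow> real"
  assumes D_nonneg: "0 \<le> D m k" and D_split: "D (Suc m) k + D m (Suc k) = D m k"
begin

lemma D_decreasing: "D 0 k \<le> D 0 0"
proof (induction k)
  case (Suc k)
  then show ?case using D_split[of 0 k] D_nonneg[of "Suc 0" k] by linarith
qed simp

text \<open>For genuine integrals of \<open>t^a (1 - t)^r\<close> this is the expansion of
  \<open>(t + (1 - t))^n = 1\<close>. Here \<open>D_split\<close> stands in for that identity and
  Pascal's rule carries the induction.\<close>

lemma binomial_sum: "(\<Sum>k\<le>n. real (n choose k) * D (n - k + r) (k + a)) = D r a"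
proof (induction n arbitrary: r a)
  case (Suc n)
  have "(\<Sum>k\<le>Suc n. real (Suc n choose k) * D (Suc n - k + r) (k + a))
    = D (Suc n + r) a + (\<Sum>k\<le>n. real (Suc n choose Suc k) * D (n - k + r) (Suc k + a))"
    by (subst sum.atMost_Suc_shift) simp
  also have "\<dots> = (D (Suc n + r) a + (\<Sum>k\<le>n. real (n choose Suc k) * D (n - k + r) (Suc k + a)))
      + (\<Sum>k\<le>n. real (n choose k) * D (n - k + r) (Suc k + a))"
    by (simp add: distrib_right sum.distrib)
  also have "D (Suc n + r) a + (\<Sum>k\<le>n. real (n choose Suc k) * D (n - k + r) (Suc k + a))
     = (\<Sum>k\<le>Suc n. real (n choose k) * D (Suc n - k + r) (k + a))"
    by (subst sum.atMost_Suc_shift) simp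
  also have "\<dots> = (\<Sum>k\<le>n. real (n choose k) * D (Suc n - k + r) (k + a))" by simp
  also have "\<dots> = (\<Sum>k\<le>n. real (n choose k) * D (n - k + Suc r) (k + a))"
    by (intro sum.cong) (auto simp: Suc_diff_le)
  also have "\<dots> = D (Suc r) a" by (rule Suc)
  also have "(\<Sum>k\<le>n. real (n choose k) * D (n - k + r) (Suc k + a)) = D r (Suc a)"
    using Suc[of r "Suc a"] by simp
  finally show ?case by (simp add: D_split)
qed simp

text \<open>The \<open>j\<close>-th moment of the \<open>n\<close>-th discrete measure, with an
  additional \<open>t^a\<close> in the density. The parameter \<open>a\<close> is there because
  absorbing a factor \<open>k / n\<close> into the binomial coefficient raises it.\<close>

definition moment :: "nat \<Rightarrow> nat \<Rightarrow> nat \<Rightarrow> real" where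
  "moment n j a = (\<Sum>k\<le>n. real (n choose k) * D (n - k) (k + a) * (real k / real n) ^ j)"

lemma power_diff_bound:
  fixes x y :: real
  assumes "x \<in> {0..1}" "y \<in> {0..1}"
  shows "\<bar>x ^ j - y ^ j\<bar> \<le> real j * \<bar>x - y\<bar>"
proof (induction j)
  case (Suc j)
  have "\<bar>x ^ Suc j - y ^ Suc j\<bar> = \<bar>x * (x ^ j - y ^ j) + (x - y) * y ^ j\<bar>" by (simp add: algebra_simps)
  also have "\<dots> \<le> \<bar>x\<bar> * \<bar>x ^ j - y ^ j\<bar> + \<bar>x - y\<bar> * \<bar>y ^ j\<bar>"
    by (rule order_trans[OF abs_triangle_ineq]) (simp add: abs_mult)
  also have "\<dots> \<le> 1 * (real j * \<bar>x - y\<bar>) + \<bar>x - y\<bar> * 1"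
    using assms Suc by (intro add_mono mult_mono mult_left_mono) (auto simp: power_le_one)
  finally show ?case by (simp add: algebra_simps)
qed simp

text \<open>By \<open>(n+1 choose k+1) (k+1) / (n+1) = (n choose k)\<close> one power of the node is
  traded for a larger \<open>a\<close>. What remains is the error from replacing the node
  \<open>(k+1) / (n+1)\<close> by \<open>k / n\<close>, and these differ by at most
  \<open>1 / (n+1)\<close>.\<close>

lemma moment_step:
  assumes "n \<ge> 1"
  shows "\<bar>moment (Suc n) (Suc j) a - moment n j (Suc a)\<bar> \<le> real j / real (Suc n) * D 0 (Suc a)"
proof -
  have "moment (Suc n) (Suc j) a = (\<Sum>k\<le>n. real (Suc n choose Suc k) * D (n - k) (Suc k + a) * (real (Suc k) / real (Suc n)) ^ Suc j)"
    unfolding moment_def by (subst sum.atMost_Suc_shift) simp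
  also have "\<dots> = (\<Sum>k\<le>n. real (n choose k) * D (n - k) (k + Suc a) * (real (Suc k) / real (Suc n)) ^ j)"
  proof (intro sum.cong refl)
    fix k
    have "real (Suc n choose Suc k) * real (Suc k) = real (Suc n) * real (n choose k)"
      using arg_cong[OF Suc_times_binomial_eq[of n k], of real] by (simp only: of_nat_mult)
    then have *: "real (Suc n choose Suc k) * (real (Suc k) / real (Suc n)) = real (n choose k)"
      by (simp only: times_divide_eq_right) simp
    have "real (Suc n choose Suc k) * D (n - k) (Suc k + a) * (real (Suc k) / real (Suc n)) ^ Suc j
      = (real (Suc n choose Suc k) * (real (Suc k) / real (Suc n))) * D (n - k) (Suc k + a) * (real (Suc k) / real (Suc n)) ^ j"
      by (simp only: power_Suc mult_ac)
    then show "real (Suc n choose Suc k) * D (n - k) (Suc k + a) * (real (Suc k) / real (Suc n)) ^ Suc j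
      = real (n choose k) * D (n - k) (k + Suc a) * (real (Suc k) / real (Suc n)) ^ j"
      unfolding * by simp
  qed
  finally have eq: "moment (Suc n) (Suc j) a - moment n j (Suc a)
    = (\<Sum>k\<le>n. real (n choose k) * D (n - k) (k + Suc a) * ((real (Suc k) / real (Suc n)) ^ j - (real k / real n) ^ j))"
    unfolding moment_def by (simp only: right_diff_distrib sum_subtractf)
  have "\<bar>moment (Suc n) (Suc j) a - moment n j (Suc a)\<bar> \<le> (\<Sum>k\<le>n. real (n choose k) * D (n - k) (k + Suc a) * (real j / real (Suc n)))"
    unfolding eq
  proof (rule order_trans[OF sum_abs], rule sum_mono)
    fix k assume "k \<in> {..n}"
    then have k: "k \<le> n" by simp
    have "real (Suc k) / real (Suc n) - real k / real n = (real n - real k) / (real n * real (Suc n))"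
      using assms by (simp add: field_simps)
    moreover have "(real n - real k) / (real n * real (Suc n)) \<le> real n / (real n * real (Suc n))"
      by (rule divide_right_mono) simp_all
    moreover have "0 \<le> (real n - real k) / (real n * real (Suc n))" using k by simp
    moreover have "real n / (real n * real (Suc n)) = 1 / real (Suc n)" using assms by simp
    ultimately have "\<bar>real (Suc k) / real (Suc n) - real k / real n\<bar> \<le> 1 / real (Suc n)" by linarith
    then have "real j * \<bar>real (Suc k) / real (Suc n) - real k / real n\<bar> \<le> real j * (1 / real (Suc n))"
      by (rule mult_left_mono) simp
    moreover have "\<bar>(real (Suc k) / real (Suc n)) ^ j - (real k / real n) ^ j\<bar> \<le> real j * \<bar>real (Suc k) / real (Suc n) - real k / real n\<bar>"
      by (rule power_diff_bound) (use k assms in auto)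
    ultimately have "\<bar>(real (Suc k) / real (Suc n)) ^ j - (real k / real n) ^ j\<bar> \<le> real j / real (Suc n)"
      by simp
    then show "\<bar>real (n choose k) * D (n - k) (k + Suc a) * ((real (Suc k) / real (Suc n)) ^ j - (real k / real n) ^ j)\<bar>
       \<le> real (n choose k) * D (n - k) (k + Suc a) * (real j / real (Suc n))"
      unfolding abs_mult by (intro mult_mono) (auto simp: D_nonneg)
  qed
  also have "\<dots> = (\<Sum>k\<le>n. real (n choose k) * D (n - k + 0) (k + Suc a)) * (real j / real (Suc n))"
    unfolding sum_distrib_right add_0_right ..
  also have "\<dots> = real j / real (Suc n) * D 0 (Suc a)"
    unfolding binomial_sum by (rule mult.commute)
  finally show ?thesis .
qed

lemma moment_limit: "(\<lambda>n. moment n j a) \<longlonglongrightarrow> D 0 (a + j)"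
proof (induction j arbitrary: a)
  case 0
  then show ?case using binomial_sum[of _ 0 a] by (simp add: moment_def)
next
  case (Suc j)
  have "(\<lambda>n. moment (Suc n) (Suc j) a - moment n j (Suc a)) \<longlonglongrightarrow> 0"
  proof (rule Lim_null_comparison)
    show "eventually (\<lambda>n. norm (moment (Suc n) (Suc j) a - moment n j (Suc a)) \<le> real j / real (Suc n) * D 0 (Suc a)) sequentially"
      using eventually_ge_at_top[of 1] by eventually_elim (use moment_step in auto)
    have "(\<lambda>n. real j / real n * D 0 (Suc a)) \<longlonglongrightarrow> 0"
      by (intro tendsto_mult_left_zero lim_const_over_n)
    then show "(\<lambda>n. real j / real (Suc n) * D 0 (Suc a)) \<longlonglongrightarrow> 0" by (rule LIMSEQ_Suc)
  qed
  from tendsto_add[OF this Suc[of "Suc a"]] have "(\<lambda>n. moment (Suc n) (Suc j) a) \<longlonglongrightarrow> D 0 (a + Suc j)" by simp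
  then show ?case by (rule LIMSEQ_imp_Suc)
qed

text \<open>The discrete measures are probability measures on \<open>[0, 1]\<close>, hence tight,
  and a subsequence converges weakly. Powers are unbounded on the line, so the moments of the limit
  are computed with powers of the clamped variable \<open>cl\<close>.\<close>

lemma exists_measure_normalized:
  assumes one: "D 0 0 = 1"
  shows "\<exists>\<mu>. sets \<mu> = sets borel \<and> finite_measure \<mu> \<and> emeasure \<mu> (- {0..1}) = 0 \<and> (\<forall>n. (\<integral>t. t ^ n \<partial>\<mu>) = D 0 n)"
proof -
  define w where "w n k = real (n choose k) * D (n - k) k" for n k
  have w0: "0 \<le> w n k" for n k by (simp add: w_def D_nonneg)
  have w1: "(\<Sum>k\<le>n. w n k) = 1" for n using binomial_sum[of n 0 0] one by (simp add: w_def)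
  define P where "P n = point_measure {..n} (\<lambda>k. ennreal (w n k))" for n
  define \<mu> where "\<mu> n = distr (P n) borel (\<lambda>k. real k / real n)" for n
  have sP: "space (P n) = {..n}" for n by (simp add: P_def space_point_measure)
  have mP: "g \<in> borel_measurable (P n)" for g :: "nat \<Rightarrow> real" and n
    by (simp add: P_def measurable_point_measure_eq1)
  have pP: "prob_space (P n)" for n
  proof (rule prob_spaceI)
    show "emeasure (P n) (space (P n)) = 1"
      unfolding sP unfolding P_def by (subst emeasure_point_measure_finite) (auto simp: w0 w1)
  qed
  have rd: "real_distribution (\<mu> n)" for n
    unfolding \<mu>_def using pP mP by (rule prob_space.real_distribution_distr)
  have int: "(\<integral>t. f t \<partial>\<mu> n) = (\<Sum>k\<le>n. w n k * f (real k / real n))" if "f \<in> borel_measurable borel" for f :: "real \<Rightarrow> real" and n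
    unfolding \<mu>_def by (subst integral_distr[OF mP that]) (simp add: P_def lebesgue_integral_point_measure_finite w0)
  have "tight \<mu>"
    unfolding tight_def
  proof (intro conjI allI impI rd)
    fix e :: real assume "e > 0"
    \<comment> \<open>Tightness is stated with intervals open on the left, so the left end is placed
      below the node 0.\<close>
    have "measure (\<mu> n) {-1<..1} = 1" for n
    proof -
      interpret real_distribution "\<mu> n" by (rule rd)
      have "measure (\<mu> n) {-1<..1} = (\<integral>t. indicator {-1<..1} t \<partial>\<mu> n)" by simp
      also have "\<dots> = (\<Sum>k\<le>n. w n k * 1)"
        by (subst int) (auto simp: indicator_def divide_simps intro!: sum.cong)
      finally show ?thesis using w1 by simp
    qed
    then show "\<exists>a b. a < b \<and> (\<forall>n. 1 - e < measure (\<mu> n) {a<..b})"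
      using \<open>e > 0\<close> by (intro exI[of _ "-1"] exI[of _ 1]) auto
  qed
  from tight_imp_convergent_subsubsequence[OF this strict_mono_id]
  obtain s M where s: "strict_mono s" and M: "real_distribution M" and wc: "weak_conv_m (\<mu> \<circ> id \<circ> s) M" by auto
  interpret M: real_distribution M by (rule M)
  have conv: "(\<lambda>n. \<integral>t. f t \<partial>\<mu> (s n)) \<longlonglongrightarrow> (\<integral>t. f t \<partial>M)" if "\<And>x. isCont f x" "\<And>x. norm (f x) \<le> B" for f :: "real \<Rightarrow> real" and B
    using weak_conv_imp_integral_bdd_continuous_conv[OF _ M wc that] rd by simp
  have cm: "f \<in> borel_measurable borel" if "\<And>x. isCont f x" for f :: "real \<Rightarrow> real"
    using that by (intro borel_measurable_continuous_onI continuous_at_imp_continuous_on) auto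
  define cl :: "real \<Rightarrow> real" where "cl t = max 0 (min 1 t)" for t
  \<comment> \<open>The distance to \<open>[0, 1]\<close>, capped to be a bounded test function. Its
    integral is zero along the sequence and hence for the limit, which confines the limit to
    \<open>[0, 1]\<close>.\<close>
  define out :: "real \<Rightarrow> real" where "out t = min 1 \<bar>t - cl t\<bar>" for t
  have ccl: "isCont cl t" for t unfolding cl_def by (intro continuous_intros)
  have cout: "isCont out t" for t unfolding out_def by (intro continuous_intros ccl)
  have clk: "cl (real k / real n) = real k / real n" if "k \<le> n" for k n
    using that by (auto simp: cl_def max_def min_def divide_simps)
  have "(\<integral>t. out t \<partial>\<mu> n) = 0" for n
    by (subst int[OF cm[OF cout]]) (auto simp: out_def clk)
  with conv[OF cout, of 1] have "(\<lambda>n. 0) \<longlonglongrightarrow> (\<integral>t. out t \<partial>M)" by (auto simp: out_def)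
  then have out0: "(\<integral>t. out t \<partial>M) = 0" by (simp add: LIMSEQ_const_iff)
  have "integrable M out"
    by (rule M.integrable_const_bound[of _ 1]) (use cm[OF cout] in \<open>auto simp: out_def\<close>)
  then have "AE t in M. out t = 0"
    using out0 by (subst (asm) integral_nonneg_eq_0_iff_AE) (auto simp: out_def)
  then have ae: "AE t in M. t \<in> {0..1}"
    by eventually_elim (auto simp: out_def cl_def min_def max_def split: if_splits)
  then have "emeasure M (- {0..1}) = 0"
    by (subst (asm) AE_iff_measurable[OF _ refl]) (auto simp: Compl_eq)
  moreover have "(\<integral>t. t ^ j \<partial>M) = D 0 j" for j
  proof -
    have "(\<lambda>n. \<integral>t. cl t ^ j \<partial>\<mu> (s n)) \<longlonglongrightarrow> (\<integral>t. cl t ^ j \<partial>M)"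
      by (rule conv[of _ 1]) (auto intro!: continuous_intros ccl simp: power_abs cl_def power_le_one)
    moreover have "(\<integral>t. cl t ^ j \<partial>\<mu> n) = moment n j 0" for n
    proof -
      have "(\<lambda>t. cl t ^ j) \<in> borel_measurable borel" by (intro borel_measurable_power cm ccl)
      from int[OF this] show ?thesis unfolding moment_def by (simp add: clk w_def)
    qed
    moreover have "(\<lambda>n. moment (s n) j 0) \<longlonglongrightarrow> D 0 j"
      using LIMSEQ_subseq_LIMSEQ[OF moment_limit[of j 0] s] by (simp add: comp_def)
    ultimately have "(\<integral>t. cl t ^ j \<partial>M) = D 0 j" by (auto intro: LIMSEQ_unique)
    moreover have "(\<integral>t. cl t ^ j \<partial>M) = (\<integral>t. t ^ j \<partial>M)"
    proof (rule integral_cong_AE)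
      have "(\<lambda>t. cl t ^ j) \<in> borel_measurable borel" by (intro borel_measurable_power cm ccl)
      then show "(\<lambda>t. cl t ^ j) \<in> borel_measurable M" by simp
      show "AE t in M. cl t ^ j = t ^ j"
        using ae by (rule eventually_mono) (simp add: cl_def)
    qed simp
    ultimately show ?thesis by simp
  qed
  ultimately show ?thesis using M.events_eq_borel M.finite_measure_axioms by blast
qed

end

text \<open>Division by the total mass \<open>D 0 0\<close> reduces to probability measures. If that
  mass is zero, \<open>D_decreasing\<close> makes every moment zero.\<close>

lemma hausdorff_moment_problem:
  assumes "\<And>m k. 0 \<le> D m k" "\<And>m k. D (Suc m) k + D m (Suc k) = D m k"
  shows "\<exists>\<mu> :: real measure. sets \<mu> = sets borel \<and> finite_measure \<mu> \<and> emeasure \<mu> (- {0..1}) = 0 \<and> (\<forall>n. (\<integral>t. t ^ n \<partial>\<mu>) = D 0 n)"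
proof (cases "D 0 0 = 0")
  case True
  interpret hausdorff_moments D using assms by unfold_locales
  have "D 0 n = 0" for n using D_decreasing[of n] D_nonneg[of 0 n] True by simp
  then show ?thesis
    by (intro exI[of _ "null_measure borel"]) (auto intro!: finite_measureI)
next
  case False
  define c where "c = D 0 0"
  have c: "c > 0" using False assms(1)[of 0 0] by (simp add: c_def)
  interpret hausdorff_moments "\<lambda>m k. D m k / c"
    using assms c by unfold_locales (auto simp: add_divide_distrib[symmetric])
  obtain \<mu> :: "real measure" where \<mu>: "sets \<mu> = sets borel" "finite_measure \<mu>" "emeasure \<mu> (- {0..1}) = 0" "\<And>n. (\<integral>t. t ^ n \<partial>\<mu>) = D 0 n / c"
    using exists_measure_normalized False c_def by auto
  let ?\<nu> = "density \<mu> (\<lambda>_. ennreal c)"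
  have e: "emeasure ?\<nu> A = ennreal c * emeasure \<mu> A" if "A \<in> sets borel" for A
    using that \<mu>(1) by (intro emeasure_density_const) simp
  have "finite_measure ?\<nu>"
    using finite_measure.emeasure_finite[OF \<mu>(2)] sets.top[of \<mu>] \<mu>(1)
    by (intro finite_measureI) (simp add: e ennreal_mult_eq_top_iff)
  moreover have "(\<integral>t. t ^ n \<partial>?\<nu>) = D 0 n" for n
  proof -
    have "(\<lambda>t. t ^ n) \<in> borel_measurable \<mu>" unfolding measurable_cong_sets[OF \<mu>(1) refl] by simp
    then have "(\<integral>t. t ^ n \<partial>?\<nu>) = c * (\<integral>t. t ^ n \<partial>\<mu>)"
      using c by (subst integral_density) auto
    then show ?thesis using \<mu>(4)[of n] c by simp
  qed
  ultimately show ?thesis using \<mu> e[of "- {0..1}"] by (intro exI[of _ ?\<nu>]) auto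
qed

section \<open>Trees with root at infinity\<close>

text \<open>Non-backtracking walks are functions of which only an initial segment matters, so that a
  single function can serve as a geodesic ray by satisfying this for all lengths.\<close>

definition nb_walk :: "('a \<times> 'a) set \<Rightarrow> (nat \<Rightarrow> 'a) \<Rightarrow> nat \<Rightarrow> bool" where
  "nb_walk E w n \<longleftrightarrow> (\<forall>i<n. (w i, w (Suc i)) \<in> E) \<and> (\<forall>i. Suc (Suc i) \<le> n \<longrightarrow> w i \<noteq> w (Suc (Suc i)))"

text \<open>A return of minimal length \<open>d\<close> passes through distinct vertices.
  Irreflexivity excludes \<open>d = 1\<close> and the absence of backtracking \<open>d = 2\<close>,
  so a forbidden cycle would arise.\<close>

lemma nb_walk_not_closed:
  assumes "is_tree E" "nb_walk E w n" "i < j" "j \<le> n"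
  shows "w i \<noteq> w j"
proof
  assume eq: "w i = w j"
  define P where "P d \<longleftrightarrow> 0 < d \<and> (\<exists>i. i + d \<le> n \<and> w i = w (i + d))" for d
  have "P (j - i)" unfolding P_def using assms(3,4) eq by (intro conjI exI[of _ i]) auto
  then obtain d where d: "P d" "\<And>d'. P d' \<Longrightarrow> d \<le> d'"
    using LeastI[of P, OF \<open>P (j - i)\<close>] Least_le[of P] by blast
  then obtain k where k: "0 < d" "k + d \<le> n" "w k = w (k + d)" unfolding P_def by auto
  have E: "(w i, w (Suc i)) \<in> E" if "i < n" for i using assms(2) that by (auto simp: nb_walk_def)
  have "d \<noteq> 1" using k E[of k] assms(1) by (auto simp: is_tree_def irrefl_def)
  moreover have "d \<noteq> 2" using k assms(2) by (auto simp: nb_walk_def)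
  ultimately have "3 \<le> d" using k(1) by arith
  let ?xs = "map w [k..<k + d]"
  have "distinct ?xs"
    unfolding distinct_map
  proof (intro conjI)
    show "inj_on w (set [k..<k + d])"
    proof (rule linorder_inj_onI)
      fix a b assume ab: "a < b" "a \<in> set [k..<k + d]" "b \<in> set [k..<k + d]"
      show "w a \<noteq> w b"
      proof
        assume "w a = w b"
        then have "P (b - a)" unfolding P_def using ab k by (intro conjI exI[of _ a]) auto
        from d(2)[OF this] show False using ab by auto
      qed
    qed auto
  qed simp
  moreover have "successively (\<lambda>x y. (x, y) \<in> E) ?xs"
    unfolding successively_conv_nth using E k by auto
  moreover have "(last ?xs, hd ?xs) \<in> E"
  proof -
    have "last ?xs = w (k + d - 1)" using k by (simp add: last_map last_conv_nth)
    moreover have "hd ?xs = w (k + d)" using k by (simp add: hd_map hd_conv_nth)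
    ultimately show ?thesis using E[of "k + d - 1"] k by simp
  qed
  moreover have "3 \<le> length ?xs" using \<open>3 \<le> d\<close> by simp
  moreover have "\<not> (\<exists>xs. 3 \<le> length xs \<and> distinct xs \<and>
            successively (\<lambda>x y. (x, y) \<in> E) xs \<and> (last xs, hd xs) \<in> E)"
    using assms(1) unfolding is_tree_def by (elim conjE)
  ultimately show False by blast
qed

text \<open>If both walks arrive from the same vertex, the last edge is removed. Otherwise running
  along one and back along the other does not backtrack at the junction and is closed.\<close>

lemma nb_walk_unique:
  assumes tree: "is_tree E"
  shows "nb_walk E w n \<Longrightarrow> nb_walk E v m \<Longrightarrow> w 0 = v 0 \<Longrightarrow> w n = v m \<Longrightarrow> n = m \<and> (\<forall>i\<le>n. w i = v i)"
proof (induction n arbitrary: m)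
  case 0
  then have "m = 0" using nb_walk_not_closed[OF tree 0(2), of 0 m] by auto
  then show ?case using 0 by auto
next
  case (Suc n)
  have "m \<noteq> 0" using nb_walk_not_closed[OF tree Suc(2), of 0 "Suc n"] Suc(4,5) by (cases m) auto
  then obtain m' where m: "m = Suc m'" by (cases m) auto
  have sub: "nb_walk E w n" "nb_walk E v m'"
    using Suc(2,3) m by (auto simp: nb_walk_def)
  show ?case
  proof (cases "w n = v m'")
    case True
    from Suc.IH[OF sub Suc(4) True] show ?thesis using m Suc(5) by (auto simp: le_Suc_eq)
  next
    case False
    \<comment> \<open>\<open>w\<close> followed by \<open>v\<close> in reverse. At index
      \<open>Suc n\<close> the two descriptions agree because the walks have the same end.\<close>
    define u where "u i = (if i \<le> Suc n then w i else v (Suc n + m - i))" for i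
    have sE: "(x, y) \<in> E \<Longrightarrow> (y, x) \<in> E" for x y using tree by (auto simp: is_tree_def sym_def)
    have wE: "(w i, w (Suc i)) \<in> E" if "i < Suc n" for i using Suc(2) that by (auto simp: nb_walk_def)
    have vE: "(v i, v (Suc i)) \<in> E" if "i < m" for i using Suc(3) that by (auto simp: nb_walk_def)
    have u2: "u i = v (Suc n + m - i)" if "Suc n \<le> i" for i using that Suc(5) by (cases "i = Suc n") (auto simp: u_def)
    have u1: "u i = w i" if "i \<le> Suc n" for i using that by (simp add: u_def)
    have "nb_walk E u (Suc n + m)"
      unfolding nb_walk_def
    proof (intro conjI allI impI)
      fix i assume i: "i < Suc n + m"
      show "(u i, u (Suc i)) \<in> E"
      proof (cases "i < Suc n")
        case True then show ?thesis using wE u1 by simp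
      next
        case False
        have "Suc n + m - i = Suc (Suc n + m - Suc i)" using i by arith
        then show ?thesis using vE[of "Suc n + m - Suc i"] False i u2[of i] u2[of "Suc i"] by (auto intro: sE)
      qed
    next
      fix i assume i: "Suc (Suc i) \<le> Suc n + m"
      consider "Suc (Suc i) \<le> Suc n" | "i = n" | "Suc n \<le> i" by arith
      then show "u i \<noteq> u (Suc (Suc i))"
      proof cases
        case 1 then show ?thesis using Suc(2) u1 by (simp add: nb_walk_def)
      next
        case 2
        have "Suc n + m - Suc (Suc n) = m'" using m by simp
        then show ?thesis using 2 False u1[of n] u2[of "Suc (Suc n)"] by simp
      next
        case 3
        have "Suc n + m - i = Suc (Suc (Suc n + m - Suc (Suc i)))" "Suc (Suc (Suc n + m - Suc (Suc i))) \<le> m" using i 3 by arith+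
        moreover have "v k \<noteq> v (Suc (Suc k))" if "Suc (Suc k) \<le> m" for k using Suc(3) that by (auto simp: nb_walk_def)
        ultimately show ?thesis using 3 u2[of i] u2[of "Suc (Suc i)"] by (metis le_Suc_eq)
      qed
    qed
    from nb_walk_not_closed[OF tree this, of 0 "Suc n + m"] have False
      using u1[of 0] u2[of "Suc n + m"] Suc(4) by simp
    then show ?thesis ..
  qed
qed

text \<open>A shortest walk cannot backtrack, since cutting out the detour would save two
  steps.\<close>

lemma walk_of_graph_dist:
  assumes tree: "is_tree E"
  obtains w where "nb_walk E w (graph_dist E x y)" "w 0 = x" "w (graph_dist E x y) = y"
proof -
  let ?d = "graph_dist E x y"
  have "\<exists>n. (x, y) \<in> E ^^ n" using tree by (simp add: is_tree_def rtrancl_is_UN_relpow)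
  then have "(x, y) \<in> E ^^ ?d" unfolding graph_dist_def by (rule LeastI_ex)
  then obtain w where w: "w 0 = x" "w ?d = y" "\<And>i. i < ?d \<Longrightarrow> (w i, w (Suc i)) \<in> E"
    unfolding relpow_fun_conv by auto
  have "nb_walk E w ?d"
    unfolding nb_walk_def
  proof (intro conjI allI impI w(3))
    fix i assume i: "Suc (Suc i) \<le> ?d"
    show "w i \<noteq> w (Suc (Suc i))"
    proof
      assume eq: "w i = w (Suc (Suc i))"
      have 1: "(w 0, w i) \<in> E ^^ i" unfolding relpow_fun_conv using w i by (intro exI[of _ w]) auto
      have 2: "(w (Suc (Suc i)), w ?d) \<in> E ^^ (?d - Suc (Suc i))"
        unfolding relpow_fun_conv
      proof (intro exI[of _ "\<lambda>k. w (Suc (Suc i) + k)"] conjI allI impI)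
        show "w (Suc (Suc i) + (?d - Suc (Suc i))) = w ?d" using i by (intro arg_cong[of _ _ w]) arith
      qed (use w(3) in auto)
      have "(x, y) \<in> E ^^ (i + (?d - Suc (Suc i)))"
        using 1 2 eq w by (auto simp: relpow_add)
      then have "?d \<le> i + (?d - Suc (Suc i))" unfolding graph_dist_def by (rule Least_le)
      then show False using i by arith
    qed
  qed simp
  then show thesis using that w by blast
qed

lemma graph_dist_nb_walk:
  assumes "is_tree E" "nb_walk E w n"
  shows "graph_dist E (w 0) (w n) = n"
  using nb_walk_unique[OF assms(1)] assms(2) walk_of_graph_dist[OF assms(1), of "w 0" "w n"] by metis

lemma geodesic_ray_iff:
  assumes tree: "is_tree E"
  shows "\<rho> \<in> geodesic_rays E \<longleftrightarrow> (\<forall>n. nb_walk E \<rho> n)"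
proof
  assume \<rho>: "\<rho> \<in> geodesic_rays E"
  have d: "graph_dist E (\<rho> i) (\<rho> (i + n)) = n" for i n using \<rho> by (simp add: geodesic_rays_def)
  have "(\<rho> i, \<rho> (Suc i)) \<in> E" for i
    using walk_of_graph_dist[OF tree, of "\<rho> i" "\<rho> (Suc i)"] d[of i 1] by (auto simp: nb_walk_def)
  moreover have "\<rho> i \<noteq> \<rho> (Suc (Suc i))" for i
  proof
    assume "\<rho> i = \<rho> (Suc (Suc i))"
    then have "graph_dist E (\<rho> i) (\<rho> i) = 2" using d[of i 2] by simp
    moreover have "graph_dist E (\<rho> i) (\<rho> i) \<le> 0" unfolding graph_dist_def by (rule Least_le) simp
    ultimately show False by simp
  qed
  ultimately show "\<forall>n. nb_walk E \<rho> n" by (simp add: nb_walk_def)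
next
  assume w: "\<forall>n. nb_walk E \<rho> n"
  show "\<rho> \<in> geodesic_rays E"
    unfolding geodesic_rays_def
  proof safe
    fix i j :: nat assume ij: "i \<le> j"
    have "nb_walk E (\<lambda>k. \<rho> (i + k)) (j - i)"
      using w[rule_format, of j] ij by (auto simp: nb_walk_def)
    from graph_dist_nb_walk[OF tree this] show "graph_dist E (\<rho> i) (\<rho> j) = j - i" using ij by simp
  qed
qed

section \<open>Predecessors and confluence\<close>

locale rooted_tree =
  fixes T :: "'a rooted_tree"
  assumes rooted: "is_rooted_tree T"
begin

lemma tree: "is_tree (edges T)"
  using rooted by (simp add: is_rooted_tree_def)

lemma sym_edges: "(x, y) \<in> edges T \<Longrightarrow> (y, x) \<in> edges T"
  using tree by (auto simp: is_tree_def sym_def)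

lemma level_pred: "level T (Defs.pred T x) = level T x + 1"
  using rooted by (simp add: is_rooted_tree_def)

lemma root_end_cofinal:
  obtains \<rho> where "\<And>\<sigma>. \<sigma> \<in> root_end T \<longleftrightarrow> \<sigma> \<in> geodesic_rays (edges T) \<and> (\<exists>i j. \<forall>n. \<rho> (i + n) = \<sigma> (j + n))"
    "\<rho> \<in> geodesic_rays (edges T)"
proof -
  have "root_end T \<in> tree_boundary (edges T)" using rooted by (simp add: is_rooted_tree_def)
  then obtain \<rho> where "\<rho> \<in> geodesic_rays (edges T)" "root_end T = cofinal_rays (edges T) `` {\<rho>}"
    by (auto simp: tree_boundary_def quotient_def)
  then show thesis by (intro that[of \<rho>]) (auto simp: cofinal_rays_def)
qed

lemma root_end_geodesic: "\<sigma> \<in> root_end T \<Longrightarrow> nb_walk (edges T) \<sigma> n"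
  using root_end_cofinal geodesic_ray_iff[OF tree] by metis

lemma root_end_shift: 
  assumes "\<sigma> \<in> root_end T"
  shows "(\<lambda>n. \<sigma> (Suc n)) \<in> root_end T"
proof -
  obtain \<rho> where \<rho>: "\<And>\<sigma>. \<sigma> \<in> root_end T \<longleftrightarrow> \<sigma> \<in> geodesic_rays (edges T) \<and> (\<exists>i j. \<forall>n. \<rho> (i + n) = \<sigma> (j + n))"
    using root_end_cofinal by blast
  obtain i j where ij: "\<And>n. \<rho> (i + n) = \<sigma> (j + n)" using assms \<rho> by blast
  have "\<rho> (Suc i + n) = \<sigma> (Suc (j + n))" for n using ij[of "Suc n"] by simp
  moreover have "(\<lambda>n. \<sigma> (Suc n)) \<in> geodesic_rays (edges T)"
    unfolding geodesic_ray_iff[OF tree]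
  proof
    fix n show "nb_walk (edges T) (\<lambda>n. \<sigma> (Suc n)) n"
      using root_end_geodesic[OF assms, of "Suc n"] by (auto simp: nb_walk_def)
  qed
  ultimately show ?thesis unfolding \<rho> by blast
qed

lemma root_end_extend: 
  assumes \<sigma>: "\<sigma> \<in> root_end T" and y: "(\<sigma> 0, y) \<in> edges T" "y \<noteq> \<sigma> 1"
  shows "case_nat y \<sigma> \<in> root_end T"
proof -
  obtain \<rho> where \<rho>: "\<And>\<sigma>. \<sigma> \<in> root_end T \<longleftrightarrow> \<sigma> \<in> geodesic_rays (edges T) \<and> (\<exists>i j. \<forall>n. \<rho> (i + n) = \<sigma> (j + n))"
    using root_end_cofinal by blast
  obtain i j where ij: "\<And>n. \<rho> (i + n) = \<sigma> (j + n)" using \<sigma> \<rho> by blast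
  have "\<rho> (i + n) = case_nat y \<sigma> (Suc j + n)" for n using ij[of n] by simp
  moreover have "case_nat y \<sigma> \<in> geodesic_rays (edges T)"
    unfolding geodesic_ray_iff[OF tree]
  proof
    fix n show "nb_walk (edges T) (case_nat y \<sigma>) n"
      using root_end_geodesic[OF \<sigma>, of n] y sym_edges[OF y(1)]
      by (auto simp: nb_walk_def split: nat.split)
  qed
  ultimately show ?thesis unfolding \<rho> by blast
qed

text \<open>By connectedness it suffices to move along one edge: either the edge is the first one of
  the ray, which is then shortened, or it prolongs the ray. Both operations stay in the same
  end.\<close>

lemma root_end_from: "\<exists>\<sigma>\<in>root_end T. \<sigma> 0 = x"
proof -
  obtain \<rho> where \<rho>: "\<And>\<sigma>. \<sigma> \<in> root_end T \<longleftrightarrow> \<sigma> \<in> geodesic_rays (edges T) \<and> (\<exists>i j. \<forall>n. \<rho> (i + n) = \<sigma> (j + n))"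
      "\<rho> \<in> geodesic_rays (edges T)"
    using root_end_cofinal by blast
  have "(\<rho> 0, x) \<in> (edges T)\<^sup>*" using tree by (simp add: is_tree_def)
  then show ?thesis
  proof induction
    case base
    then show ?case using \<rho> by blast
  next
    case (step y z)
    then obtain \<sigma> where \<sigma>: "\<sigma> \<in> root_end T" "\<sigma> 0 = y" by blast
    show ?case
    proof (cases "z = \<sigma> 1")
      case True
      then show ?thesis using root_end_shift[OF \<sigma>(1)] by (intro bexI[of _ "\<lambda>n. \<sigma> (Suc n)"]) auto
    next
      case False
      then show ?thesis using root_end_extend[OF \<sigma>(1), of z] step(2) \<sigma>(2) by (intro bexI[of _ "case_nat z \<sigma>"]) auto
    qed
  qed
qed

text \<open>Two rays of the end coincide from some point on, and non-backtracking walks between the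
  same vertices are equal. This is what makes the description in \<open>pred\<close> well
  defined.\<close>

lemma root_end_unique:
  assumes \<sigma>: "\<sigma> \<in> root_end T" and \<tau>: "\<tau> \<in> root_end T" and eq: "\<sigma> 0 = \<tau> 0"
  shows "\<sigma> 1 = \<tau> 1"
proof -
  obtain \<rho> where \<rho>: "\<And>\<sigma>. \<sigma> \<in> root_end T \<longleftrightarrow> \<sigma> \<in> geodesic_rays (edges T) \<and> (\<exists>i j. \<forall>n. \<rho> (i + n) = \<sigma> (j + n))"
    using root_end_cofinal by blast
  obtain i j where ij: "\<And>n. \<rho> (i + n) = \<sigma> (j + n)" using \<sigma> \<rho> by blast
  obtain i' j' where ij': "\<And>n. \<rho> (i' + n) = \<tau> (j' + n)" using \<tau> \<rho> by blast
  \<comment> \<open>Both sides are \<rho> at index \<open>i + i' + 1\<close>; the added one ensures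
    that the common initial stretch contains index 1.\<close>
  have "\<sigma> (j + (i' + 1)) = \<tau> (j' + (i + 1))"
    using ij[of "i' + 1"] ij'[of "i + 1"] by (simp only: add.assoc[symmetric] add.commute[of i' i])
  from nb_walk_unique[OF tree root_end_geodesic[OF \<sigma>] root_end_geodesic[OF \<tau>] eq this]
  show ?thesis by auto
qed

lemma pred_eq: "\<sigma> \<in> root_end T \<Longrightarrow> Defs.pred T (\<sigma> 0) = \<sigma> 1"
  unfolding Defs.pred_def by (rule the_equality) (use root_end_unique in blast)+

lemma edges_iff: "(x, y) \<in> edges T \<longleftrightarrow> y = Defs.pred T x \<or> x = Defs.pred T y"
proof -
  have up: "(x, Defs.pred T x) \<in> edges T" for x
  proof -
    obtain \<sigma> where \<sigma>: "\<sigma> \<in> root_end T" "\<sigma> 0 = x" using root_end_from by blast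
    then show ?thesis using pred_eq[OF \<sigma>(1)] root_end_geodesic[OF \<sigma>(1), of 1] by (auto simp: nb_walk_def)
  qed
  have "y = Defs.pred T x \<or> x = Defs.pred T y" if e: "(x, y) \<in> edges T"
  proof -
    obtain \<sigma> where \<sigma>: "\<sigma> \<in> root_end T" "\<sigma> 0 = x" using root_end_from by blast
    show ?thesis
    proof (cases "y = \<sigma> 1")
      case True then show ?thesis using pred_eq[OF \<sigma>(1)] \<sigma>(2) by simp
    next
      case False
      then show ?thesis using pred_eq[OF root_end_extend[OF \<sigma>(1), of y]] e \<sigma>(2) by simp
    qed
  qed
  then show ?thesis using up[of x] sym_edges[OF up[of y]] by auto
qed

text \<open>A neighbour below \<open>x\<close> is never also the predecessor of \<open>x\<close>:
  two steps up raise the level by two, so \<open>pred\<close> has no 2-cycle.\<close>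

lemma succs_eq: "succs T x = {y. Defs.pred T y = x}"
proof -
  have "Defs.pred T (Defs.pred T y) \<noteq> y" for y
    using level_pred[of y] level_pred[of "Defs.pred T y"] by (metis add_cancel_right_right add.assoc one_add_one zero_neq_numeral)
  note pp = this
  show ?thesis unfolding succs_def using edges_iff pp pp[symmetric] by auto
qed

lemma finite_succs: "finite {y. Defs.pred T y = x}"
proof -
  have "finite (edges T `` {x})" using tree by (simp add: is_tree_def)
  then show ?thesis unfolding succs_eq[symmetric] succs_def by simp
qed

lemma level_pred_pow: "level T ((Defs.pred T ^^ n) x) = level T x + int n"
  by (induction n) (auto simp: level_pred)

text \<open>Every walk reduces to a climb followed by a descent. A new first step upwards lengthens
  the climb; a new first step downwards cancels a step of the climb or, if there is none, lengthens
  the descent.\<close>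

lemma confluent_of_walk:
  assumes "(x, y) \<in> edges T ^^ n"
  shows "\<exists>a b. (Defs.pred T ^^ a) x = (Defs.pred T ^^ b) y \<and> a + b \<le> n"
  using assms
proof (induction n arbitrary: x)
  case 0
  then show ?case by (intro exI[of _ 0]) simp
next
  case (Suc n)
  from relpow_Suc_D2[OF Suc.prems] obtain z where z: "(x, z) \<in> edges T" "(z, y) \<in> edges T ^^ n" by blast
  from Suc.IH[OF z(2)] obtain a b where ab: "(Defs.pred T ^^ a) z = (Defs.pred T ^^ b) y" "a + b \<le> n" by blast
  from z(1) consider "z = Defs.pred T x" | "x = Defs.pred T z" unfolding edges_iff by blast
  then show ?case
  proof cases
    case 1
    then have "(Defs.pred T ^^ Suc a) x = (Defs.pred T ^^ b) y" using ab by (simp add: funpow_swap1)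
    then show ?thesis using ab by (intro exI[of _ "Suc a"] exI[of _ b]) simp
  next
    case 2
    show ?thesis
    proof (cases a)
      case 0
      then have "(Defs.pred T ^^ 0) x = (Defs.pred T ^^ Suc b) y" using ab 2 by simp
      then show ?thesis using ab 0 by (intro exI[of _ 0] exI[of _ "Suc b"]) simp
    next
      case (Suc a')
      then have "(Defs.pred T ^^ a') x = (Defs.pred T ^^ b) y" using ab 2 by (simp add: funpow_swap1)
      then show ?thesis using ab Suc by (intro exI[of _ a'] exI[of _ b]) simp
    qed
  qed
qed

lemma graph_dist_confluent:
  "\<exists>a b. (Defs.pred T ^^ a) x = (Defs.pred T ^^ b) y \<and> a + b \<le> graph_dist (edges T) x y"
proof (rule confluent_of_walk)
  have "\<exists>n. (x, y) \<in> edges T ^^ n" using tree by (simp add: is_tree_def rtrancl_is_UN_relpow)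
  then show "(x, y) \<in> edges T ^^ graph_dist (edges T) x y" unfolding graph_dist_def by (rule LeastI_ex)
qed

lemma graph_dist_le:
  assumes "(Defs.pred T ^^ a) x = (Defs.pred T ^^ b) y"
  shows "graph_dist (edges T) x y \<le> a + b"
proof -
  have up: "(x, (Defs.pred T ^^ a) x) \<in> edges T ^^ a" for x a
    by (induction a) (auto simp: edges_iff)
  have down: "((Defs.pred T ^^ a) x, x) \<in> edges T ^^ a" for x a
  proof (induction a)
    case (Suc a)
    have "((Defs.pred T ^^ Suc a) x, (Defs.pred T ^^ a) x) \<in> edges T" by (simp add: edges_iff)
    with Suc show ?case by (blast intro: relpow_Suc_I2)
  qed simp
  have "(x, y) \<in> edges T ^^ (a + b)"
    using up[of x a] down[of b y] assms by (auto simp: relpow_add)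
  then show ?thesis unfolding graph_dist_def by (rule Least_le)
qed

end

section \<open>Averages on flow trees\<close>

lemma powr_diff_one_mult: "0 < u \<Longrightarrow> u powr (r - 1) * u = u powr r" for u r :: real
  using powr_add[of u "r - 1" 1] by simp

lemma powr_tangent:
  fixes t u r :: real
  assumes "t \<ge> 0" "u > 0" "r \<ge> 1"
  shows "u powr r + r * u powr (r - 1) * (t - u) \<le> t powr r"
proof (cases "t = 0")
  case True
  have "u powr r + r * u powr (r - 1) * (t - u) = u powr r - r * (u powr (r - 1) * u)"
    unfolding True by (simp only: right_diff_distrib mult.assoc mult_zero_right)
  also have "\<dots> = (1 - r) * u powr r"
    unfolding powr_diff_one_mult[OF assms(2)] by (simp only: left_diff_distrib mult_1)
  also have "\<dots> \<le> 0" using assms by (intro mult_nonpos_nonneg) auto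
  finally show ?thesis using True by simp
next
  case False
  have "r * u powr (r - 1) * (t - u) \<le> t powr r - u powr r"
  proof (rule convex_on_imp_above_tangent[OF powr_convex[OF assms(3)]])
    show "((\<lambda>x. x powr r) has_real_derivative r * u powr (r - 1)) (at u within {0<..})"
      by (rule has_field_derivative_at_within[OF has_real_derivative_powr[OF assms(2)]])
    show "connected {(0::real)<..}" by simp
    show "u \<in> interior {0<..}" using assms by (simp add: interior_open)
    show "t \<in> {0<..}" using assms False by simp
  qed
  then show ?thesis by simp
qed

text \<open>Sums the tangent inequality at \<open>u = s / W\<close>. Total weight below
  \<open>W\<close> is allowed so that partial sums of a series can be treated with one
  constant.\<close>

lemma powr_sum_Jensen:
  fixes w t :: "'i \<Rightarrow> real"
  assumes I: "finite I" and w: "\<And>i. i \<in> I \<Longrightarrow> 0 \<le> w i" and t: "\<And>i. i \<in> I \<Longrightarrow> 0 \<le> t i"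
    and W: "(\<Sum>i\<in>I. w i) \<le> W" "0 < W" and r: "1 \<le> r"
  shows "(\<Sum>i\<in>I. w i * t i) powr r \<le> W powr (r - 1) * (\<Sum>i\<in>I. w i * t i powr r)"
proof -
  define s where "s = (\<Sum>i\<in>I. w i * t i)"
  have s0: "0 \<le> s" unfolding s_def by (intro sum_nonneg mult_nonneg_nonneg w t)
  show ?thesis
  proof (cases "s = 0")
    case True
    then show ?thesis unfolding s_def[symmetric] by (auto intro!: mult_nonneg_nonneg sum_nonneg w)
  next
    case False
    define u where "u = s / W"
    have u: "0 < u" using False s0 W(2) by (simp add: u_def)
    have su: "s = u * W" using W(2) by (simp add: u_def)
    have up: "u powr (r - 1) * u = u powr r" using u by (rule powr_diff_one_mult)
    \<comment> \<open>The missing weight enters with the factor \<open>1 - r \<le> 0\<close>, so it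
      works in the right direction.\<close>
    have "u powr r * W \<le> u powr r * ((\<Sum>i\<in>I. w i) * (1 - r) + r * W)"
    proof (rule mult_left_mono)
      have "W * (1 - r) \<le> (\<Sum>i\<in>I. w i) * (1 - r)" using W(1) r by (intro mult_right_mono_neg) auto
      then show "W \<le> (\<Sum>i\<in>I. w i) * (1 - r) + r * W" by (simp add: algebra_simps)
    qed simp
    also have "\<dots> = (\<Sum>i\<in>I. w i) * u powr r + r * u powr (r - 1) * (s - u * (\<Sum>i\<in>I. w i))"
      unfolding su up[symmetric] by (simp add: algebra_simps)
    also have "\<dots> = (\<Sum>i\<in>I. w i * (u powr r + r * u powr (r - 1) * (t i - u)))"
      unfolding s_def by (simp add: algebra_simps sum.distrib sum_subtractf sum_distrib_left sum_distrib_right)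
    also have "\<dots> \<le> (\<Sum>i\<in>I. w i * t i powr r)"
      by (intro sum_mono mult_left_mono powr_tangent w t u r)
    finally have le: "u powr r * W \<le> (\<Sum>i\<in>I. w i * t i powr r)" .
    have "s powr r = W powr (r - 1) * (u powr r * W)"
    proof -
      have "W powr (r - 1) * W = W powr r" using W(2) by (rule powr_diff_one_mult)
      then show ?thesis unfolding su using u W(2) by (simp add: powr_mult)
    qed
    also have "\<dots> \<le> W powr (r - 1) * (\<Sum>i\<in>I. w i * t i powr r)"
      by (intro mult_left_mono le) simp
    finally show ?thesis by (simp add: s_def)
  qed
qed

section \<open>Descendants and averages\<close>

locale flow_tree = rooted_tree T for T :: "'a rooted_tree" +
  fixes m :: "'a \<Rightarrow> real"
  assumes flow: "is_flow T m"
begin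

abbreviation p :: "'a \<Rightarrow> 'a" where "p \<equiv> Defs.pred T"

definition desc :: "nat \<Rightarrow> 'a \<Rightarrow> 'a set" where
  "desc b z = {y. (p ^^ b) y = z}"

lemma m_pos: "0 < m x"
  using flow unfolding is_flow_def by blast

lemma m_nz [simp]: "m x \<noteq> 0"
  using m_pos[of x] by simp

lemma desc_0 [simp]: "desc 0 z = {z}"
  by (auto simp: desc_def)

lemma mem_desc: "y \<in> desc b z \<longleftrightarrow> (p ^^ b) y = z"
  by (simp add: desc_def)

lemma desc_1: "desc (Suc 0) z = {y. p y = z}"
  by (auto simp: desc_def)

lemma desc_Suc: "desc (Suc b) z = (\<Union>x\<in>desc (Suc 0) z. desc b x)"
  by (auto simp: desc_def)

lemma finite_desc [simp]: "finite (desc b z)"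
proof (induction b arbitrary: z)
  case (Suc b)
  have "finite (desc (Suc 0) z)" using finite_succs[of z] by (simp add: desc_1)
  then show ?case unfolding desc_Suc[of b] using Suc by blast
qed simp

lemma sum_desc_Suc:
  fixes g :: "'a \<Rightarrow> 'b::comm_monoid_add"
  shows "(\<Sum>y\<in>desc (Suc b) z. g y) = (\<Sum>x\<in>desc (Suc 0) z. \<Sum>y\<in>desc b x. g y)"
  unfolding desc_Suc[of b] by (rule sum.UNION_disjoint) (simp, simp, auto simp: mem_desc)

lemma mass_desc_1: "(\<Sum>y\<in>desc (Suc 0) z. m y) = m z"
proof -
  have "m z = (\<Sum>y\<in>succs T z. m y)" using flow unfolding is_flow_def by blast
  then show ?thesis unfolding desc_1 succs_eq by (rule sym)
qed

lemma mass_desc: "(\<Sum>y\<in>desc b z. m y) = m z"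
proof (induction b arbitrary: z)
  case (Suc b)
  then show ?case by (subst sum_desc_Suc) (simp add: mass_desc_1)
qed simp

text \<open>The power \<open>R^b\<close> of the averaging operator. The flow condition makes the
  weights \<open>m y / m z\<close> sum to one over each generation.\<close>

definition avg :: "nat \<Rightarrow> ('a \<Rightarrow> complex) \<Rightarrow> 'a \<Rightarrow> complex" where
  "avg b f z = (\<Sum>y\<in>desc b z. f y * of_real (m y)) / of_real (m z)"

definition avg_real :: "nat \<Rightarrow> ('a \<Rightarrow> real) \<Rightarrow> 'a \<Rightarrow> real" where
  "avg_real b f z = (\<Sum>y\<in>desc b z. f y * m y) / m z"

lemma avg_0 [simp]: "avg 0 f = f"
  by (rule ext) (simp add: avg_def)

lemma avg_Suc: "avg (Suc b) f z = avg (Suc 0) (avg b f) z"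
  unfolding avg_def by (subst sum_desc_Suc) simp

lemma avg_real_nonneg: "(\<And>y. 0 \<le> f y) \<Longrightarrow> 0 \<le> avg_real b f z"
  unfolding avg_real_def using less_imp_le[OF m_pos] by (intro divide_nonneg_nonneg sum_nonneg mult_nonneg_nonneg) simp_all

lemma norm_avg_le: "norm (avg b f z) \<le> avg_real b (\<lambda>y. norm (f y)) z"
proof -
  have "norm (avg b f z) = norm (\<Sum>y\<in>desc b z. f y * of_real (m y)) / m z"
    unfolding avg_def using m_pos[of z] by (simp add: norm_divide)
  also have "\<dots> \<le> (\<Sum>y\<in>desc b z. norm (f y * of_real (m y))) / m z"
    using m_pos[of z] by (intro divide_right_mono norm_sum) auto
  also have "\<dots> = avg_real b (\<lambda>y. norm (f y)) z"
    unfolding avg_real_def using m_pos by (simp add: norm_mult less_imp_le)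
  finally show ?thesis .
qed

lemma avg_real_le:
  assumes "\<And>y. y \<in> desc b z \<Longrightarrow> f y \<le> B"
  shows "avg_real b f z \<le> B"
proof -
  have "(\<Sum>y\<in>desc b z. f y * m y) \<le> (\<Sum>y\<in>desc b z. B * m y)"
    using m_pos by (intro sum_mono mult_right_mono assms) (auto intro: less_imp_le)
  also have "\<dots> = B * m z" by (simp add: sum_distrib_left[symmetric] mass_desc)
  finally show ?thesis unfolding avg_real_def using m_pos[of z] by (simp add: divide_le_eq)
qed

lemma avg_real_Jensen:
  assumes "\<And>y. 0 \<le> f y" "1 \<le> r"
  shows "avg_real b f z powr r \<le> avg_real b (\<lambda>y. f y powr r) z"
proof -
  have "(\<Sum>y\<in>desc b z. m y / m z * f y) powr r \<le> 1 powr (r - 1) * (\<Sum>y\<in>desc b z. m y / m z * f y powr r)"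
  proof (rule powr_sum_Jensen)
    show "(\<Sum>y\<in>desc b z. m y / m z) \<le> 1"
      unfolding sum_divide_distrib[symmetric] mass_desc by simp
  qed (use assms m_pos in \<open>auto simp: less_imp_le\<close>)
  then show ?thesis unfolding avg_real_def by (simp add: sum_divide_distrib mult.commute)
qed

lemma avg_add: "avg b (\<lambda>y. f y + g y) z = avg b f z + avg b g z"
  by (simp add: avg_def distrib_right sum.distrib add_divide_distrib)

lemma avg_mult: "avg b (\<lambda>y. c * f y) z = c * avg b f z"
  by (simp add: avg_def sum_distrib_left mult.assoc)

text \<open>The summand with index \<open>a\<close> is \<open>S^a R^(n - a) f\<close>, so
  \<open>avg (n - a) f\<close> is evaluated at the \<open>a\<close>-th ancestor.\<close>

definition UU :: "nat \<Rightarrow> ('a \<Rightarrow> complex) \<Rightarrow> 'a \<Rightarrow> complex" where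
  "UU n f x = (\<Sum>a\<le>n. avg (n - a) f ((p ^^ a) x))"

definition Av :: "('a \<Rightarrow> complex) \<Rightarrow> 'a \<Rightarrow> complex" where
  "Av f x = (f (p x) + avg (Suc 0) f x) / 2"

lemma UU_0 [simp]: "UU 0 f = f"
  by (rule ext) (simp add: UU_def)

lemma UU_1: "UU (Suc 0) f x = 2 * Av f x"
  by (simp add: UU_def Av_def)

lemma UU_add: "UU n (\<lambda>y. f y + g y) x = UU n f x + UU n g x"
  by (simp add: UU_def avg_add sum.distrib)

lemma UU_mult: "UU n (\<lambda>y. c * f y) x = c * UU n f x"
  by (simp add: UU_def avg_mult sum_distrib_left)

text \<open>The recurrence of the Chebyshev polynomials of the second kind, because averaging over
  successors inverts composition with the predecessor map on one side.\<close>

lemma UU_Suc_Suc: "UU (Suc (Suc n)) f x = 2 * Av (UU (Suc n) f) x - UU n f x"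
proof -
  have 1: "UU (Suc n) f (p x) = UU (Suc (Suc n)) f x - avg (Suc (Suc n)) f x"
    unfolding UU_def by (subst (2) sum.atMost_Suc_shift) (simp add: funpow_swap1)
  have "avg (Suc 0) (UU (Suc n) f) x
      = (\<Sum>y\<in>desc (Suc 0) x. (avg (Suc n) f y + UU n f x) * of_real (m y)) / of_real (m x)"
    unfolding avg_def[of "Suc 0"]
  proof (intro arg_cong2[where f="(/)"] sum.cong refl arg_cong2[where f="(*)"])
    fix y assume "y \<in> desc (Suc 0) x"
    then have "p y = x" by (simp add: desc_1)
    then show "UU (Suc n) f y = avg (Suc n) f y + UU n f x"
      unfolding UU_def by (subst sum.atMost_Suc_shift) (simp add: funpow_swap1)
  qed
  also have "\<dots> = avg (Suc 0) (avg (Suc n) f) x + UU n f x * (\<Sum>y\<in>desc (Suc 0) x. of_real (m y)) / of_real (m x)"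
    unfolding avg_def[of "Suc 0"] by (simp add: distrib_right sum.distrib add_divide_distrib sum_distrib_left)
  also have "(\<Sum>y\<in>desc (Suc 0) x. of_real (m y)) = complex_of_real (m x)"
    using mass_desc_1[of x] by (simp flip: of_real_sum)
  finally have 2: "avg (Suc 0) (UU (Suc n) f) x = avg (Suc (Suc n)) f x + UU n f x"
    by (simp add: avg_Suc[of "Suc n"])
  show ?thesis unfolding Av_def 1 2 by (simp add: add_divide_distrib)
qed

lemma nn_integral_flow:
  "(\<integral>\<^sup>+x. g x \<partial>flow_measure m) = (\<integral>\<^sup>+x. ennreal (m x) * g x \<partial>count_space UNIV)"
  unfolding flow_measure_def by (rule nn_integral_density) auto

text \<open>Each vertex has exactly one \<open>b\<close>-th ancestor, so the sets
  \<open>desc b z\<close> partition the tree; the rest is Tonelli for counting measure.\<close>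

lemma nn_integral_fibers:
  fixes h :: "'a \<Rightarrow> ennreal"
  shows "(\<integral>\<^sup>+z. (\<Sum>x\<in>desc b z. h x) \<partial>count_space UNIV) = (\<integral>\<^sup>+x. h x \<partial>count_space UNIV)"
proof -
  let ?f = "\<lambda>(z, x). h x * indicator (desc b z) x"
  have "(\<integral>\<^sup>+z. (\<Sum>x\<in>desc b z. h x) \<partial>count_space UNIV) = (\<integral>\<^sup>+z. \<integral>\<^sup>+x. ?f (z, x) \<partial>count_space UNIV \<partial>count_space UNIV)"
  proof (rule nn_integral_cong)
    fix z
    have "(\<Sum>x\<in>desc b z. h x) = (\<integral>\<^sup>+x. h x \<partial>count_space (desc b z))"
      by (rule nn_integral_count_space_finite[symmetric]) simp
    also have "\<dots> = (\<integral>\<^sup>+x. ?f (z, x) \<partial>count_space UNIV)"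
      by (subst nn_integral_count_space_indicator) auto
    finally show "(\<Sum>x\<in>desc b z. h x) = (\<integral>\<^sup>+x. ?f (z, x) \<partial>count_space UNIV)" .
  qed
  also have "\<dots> = (\<integral>\<^sup>+x. \<integral>\<^sup>+z. ?f (z, x) \<partial>count_space UNIV \<partial>count_space UNIV)"
    unfolding nn_integral_fst_count_space nn_integral_snd_count_space ..
  also have "\<dots> = (\<integral>\<^sup>+x. h x \<partial>count_space UNIV)"
  proof (rule nn_integral_cong)
    fix x
    have "(\<integral>\<^sup>+z. ?f (z, x) \<partial>count_space UNIV) = (\<integral>\<^sup>+z. h x * indicator {(p ^^ b) x} z \<partial>count_space UNIV)"
      by (rule nn_integral_cong) (auto simp: mem_desc split: split_indicator)
    also have "\<dots> = h x" by (subst nn_integral_cmult_indicator) auto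
    finally show "(\<integral>\<^sup>+z. ?f (z, x) \<partial>count_space UNIV) = h x" .
  qed
  finally show ?thesis .
qed

text \<open>The descendants of \<open>z\<close> in one generation have total mass
  \<open>m z\<close>, so composing with \<open>p\<close> changes no integral. Hence \<open>S\<close>
  is an isometry of every Lebesgue space.\<close>

lemma nn_integral_pred_pow: "(\<integral>\<^sup>+x. g ((p ^^ a) x) \<partial>flow_measure m) = (\<integral>\<^sup>+x. g x \<partial>flow_measure m)"
proof -
  have "(\<integral>\<^sup>+x. g ((p ^^ a) x) \<partial>flow_measure m) = (\<integral>\<^sup>+z. (\<Sum>x\<in>desc a z. ennreal (m x) * g ((p ^^ a) x)) \<partial>count_space UNIV)"
    unfolding nn_integral_flow by (rule nn_integral_fibers[symmetric])
  also have "\<dots> = (\<integral>\<^sup>+z. ennreal (m z) * g z \<partial>count_space UNIV)"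
  proof (rule nn_integral_cong)
    fix z
    have "(\<Sum>x\<in>desc a z. ennreal (m x) * g ((p ^^ a) x)) = (\<Sum>x\<in>desc a z. ennreal (m x)) * g z"
      unfolding sum_distrib_right by (rule sum.cong) (auto simp: mem_desc)
    also have "(\<Sum>x\<in>desc a z. ennreal (m x)) = ennreal (m z)"
      using m_pos by (subst sum_ennreal) (auto simp: mass_desc less_imp_le)
    finally show "(\<Sum>x\<in>desc a z. ennreal (m x) * g ((p ^^ a) x)) = ennreal (m z) * g z" .
  qed
  finally show ?thesis by (simp add: nn_integral_flow)
qed

lemma nn_integral_avg_real:
  assumes "\<And>x. 0 \<le> g x"
  shows "(\<integral>\<^sup>+x. ennreal (avg_real b g x) \<partial>flow_measure m) = (\<integral>\<^sup>+x. ennreal (g x) \<partial>flow_measure m)"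
proof -
  have "(\<integral>\<^sup>+x. ennreal (avg_real b g x) \<partial>flow_measure m) = (\<integral>\<^sup>+z. (\<Sum>x\<in>desc b z. ennreal (m x) * ennreal (g x)) \<partial>count_space UNIV)"
    unfolding nn_integral_flow
  proof (rule nn_integral_cong)
    fix z
    have "ennreal (m z) * ennreal (avg_real b g z) = ennreal (\<Sum>x\<in>desc b z. g x * m x)"
      using m_pos[of z] avg_real_nonneg[OF assms, where z=z and b=b]
      by (simp add: ennreal_mult[symmetric] avg_real_def)
    also have "\<dots> = (\<Sum>x\<in>desc b z. ennreal (m x) * ennreal (g x))"
      using m_pos assms by (subst sum_ennreal[symmetric]) (auto simp: ennreal_mult[symmetric] less_imp_le mult.commute)
    finally show "ennreal (m z) * ennreal (avg_real b g z) = (\<Sum>x\<in>desc b z. ennreal (m x) * ennreal (g x))" .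
  qed
  also have "\<dots> = (\<integral>\<^sup>+x. ennreal (g x) \<partial>flow_measure m)"
    unfolding nn_integral_flow by (rule nn_integral_fibers)
  finally show ?thesis .
qed

lemma nn_integral_avg_real_pred:
  assumes "\<And>x. 0 \<le> g x"
  shows "(\<integral>\<^sup>+x. ennreal (avg_real b g ((p ^^ a) x)) \<partial>flow_measure m) = (\<integral>\<^sup>+x. ennreal (g x) \<partial>flow_measure m)"
  using nn_integral_pred_pow[of "\<lambda>x. ennreal (avg_real b g x)" a] nn_integral_avg_real[of g b] assms by simp

text \<open>A common domain, containing every Lebesgue space, on which the series \<open>Sop\<close> below converges
  pointwise.\<close>

definition tame :: "('a \<Rightarrow> complex) \<Rightarrow> bool" where
  "tame f \<longleftrightarrow> (\<forall>x. \<exists>C. \<forall>a b. norm (avg b f ((p ^^ a) x)) \<le> C)"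

lemma tame_mult: "tame f \<Longrightarrow> tame (\<lambda>x. c * f x)"
  unfolding tame_def avg_mult norm_mult by (metis mult_left_mono norm_ge_zero)

lemma tame_bound:
  assumes "tame f"
  obtains C where "\<And>n. norm (UU n f x) \<le> real (Suc n) * C"
proof -
  obtain C where C: "\<And>a b. norm (avg b f ((p ^^ a) x)) \<le> C" using assms unfolding tame_def by blast
  have "norm (UU n f x) \<le> real (Suc n) * C" for n
  proof -
    have "norm (UU n f x) \<le> (\<Sum>a\<le>n. C)" unfolding UU_def by (intro order_trans[OF norm_sum] sum_mono C)
    then show ?thesis by simp
  qed
  then show thesis by (rule that)
qed

text \<open>A pointwise series rather than a limit in some operator norm, so that one and the same
  map can be restricted to every \<open>Lp m q\<close>.\<close>

definition Sop :: "(nat \<Rightarrow> complex) \<Rightarrow> ('a \<Rightarrow> complex) \<Rightarrow> 'a \<Rightarrow> complex" where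
  "Sop c f x = (\<Sum>n. c n * UU n f x)"

lemma summable_Sop:
  assumes c: "summable (\<lambda>n. real (Suc n) * norm (c n))" and f: "tame f"
  shows "summable (\<lambda>n. norm (c n * UU n f x))"
proof -
  obtain C where C: "\<And>n. norm (UU n f x) \<le> real (Suc n) * C" using tame_bound[OF f] by blast
  show ?thesis
  proof (rule summable_comparison_test)
    show "summable (\<lambda>n. real (Suc n) * norm (c n) * C)" using c by (rule summable_mult2)
    have "norm (c n * UU n f x) \<le> real (Suc n) * norm (c n) * C" for n
      using mult_left_mono[OF C[of n], of "norm (c n)"] by (simp add: norm_mult mult_ac)
    then show "\<exists>N. \<forall>n\<ge>N. norm (norm (c n * UU n f x)) \<le> real (Suc n) * norm (c n) * C" by simp
  qed
qed

lemma Sop_add: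
  assumes c: "summable (\<lambda>n. real (Suc n) * norm (c n))" and f: "tame f" "tame g"
  shows "Sop c (\<lambda>y. f y + g y) x = Sop c f x + Sop c g x"
  unfolding Sop_def UU_add distrib_left
  using summable_Sop[OF c f(1), THEN summable_norm_cancel] summable_Sop[OF c f(2), THEN summable_norm_cancel]
  by (rule suminf_add[symmetric])

lemma Sop_mult:
  assumes c: "summable (\<lambda>n. real (Suc n) * norm (c n))" and f: "tame f"
  shows "Sop c (\<lambda>y. k * f y) x = k * Sop c f x"
  unfolding Sop_def UU_mult mult.left_commute[of _ k]
  using summable_Sop[OF c f, THEN summable_norm_cancel] by (rule suminf_mult)

end

section \<open>Elementary properties of the Lebesgue norms\<close>

lemma Lp_norm_infinity: "Lp_norm m \<infinity> f = (SUP x. ennreal (norm (f x)))"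
  by (simp add: Lp_norm_def)

text \<open>The norm to the power \<open>r\<close>, with infinity kept as a value; this avoids the
  root and the case distinction of \<open>Lp_norm\<close>.\<close>

definition pint :: "('a \<Rightarrow> real) \<Rightarrow> real \<Rightarrow> ('a \<Rightarrow> complex) \<Rightarrow> ennreal" where
  "pint m r f = (\<integral>\<^sup>+x. ennreal (norm (f x) powr r) \<partial>flow_measure m)"

lemma Lp_norm_finite:
  assumes "q \<noteq> \<infinity>"
  shows "Lp_norm m q f = (if pint m (enn2real q) f = \<infinity> then \<infinity> else ennreal (enn2real (pint m (enn2real q) f) powr (1 / enn2real q)))"
  using assms unfolding Lp_norm_def pint_def by (simp add: Let_def)

lemma mem_Lp_iff: "q \<noteq> \<infinity> \<Longrightarrow> f \<in> Lp m q \<longleftrightarrow> pint m (enn2real q) f < \<infinity>"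
  unfolding Lp_def by (auto simp: Lp_norm_finite less_top)

lemma Lp_norm_le_iff:
  assumes "q \<noteq> \<infinity>" "0 < enn2real q" "0 \<le> C"
  shows "Lp_norm m q f \<le> ennreal C \<longleftrightarrow> pint m (enn2real q) f \<le> ennreal (C powr enn2real q)"
proof (cases "pint m (enn2real q) f")
  case (real I)
  have "I powr (1 / enn2real q) \<le> C \<longleftrightarrow> I \<le> C powr enn2real q"
  proof
    assume "I powr (1 / enn2real q) \<le> C"
    then have "(I powr (1 / enn2real q)) powr enn2real q \<le> C powr enn2real q"
      using assms by (intro powr_mono2) auto
    then show "I \<le> C powr enn2real q" using assms real(1) by (simp add: powr_powr)
  next
    assume "I \<le> C powr enn2real q"
    then have "I powr (1 / enn2real q) \<le> (C powr enn2real q) powr (1 / enn2real q)"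
      using assms real(1) by (intro powr_mono2) auto
    then show "I powr (1 / enn2real q) \<le> C" using assms by (simp add: powr_powr)
  qed
  then show ?thesis using assms real by (simp add: Lp_norm_finite)
next
  case top
  then show ?thesis using assms by (simp add: Lp_norm_finite top_unique)
qed

lemma ennreal_real_ge_1:
  assumes "(1::ennreal) \<le> q" "q \<noteq> \<infinity>"
  shows "1 \<le> enn2real q"
  using assms by (cases q) auto

lemma Lp_norm_bound:
  assumes q: "q \<noteq> \<infinity>" "0 < enn2real q" and C: "0 \<le> C"
    and le: "pint m (enn2real q) g \<le> ennreal (C powr enn2real q) * pint m (enn2real q) f"
    and f: "f \<in> Lp m q"
  shows "Lp_norm m q g \<le> ennreal C * Lp_norm m q f"
proof -
  let ?r = "enn2real q"
  obtain I where I: "pint m ?r f = ennreal I" "0 \<le> I"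
    using f unfolding mem_Lp_iff[OF q(1)] by (cases "pint m ?r f") auto
  have "pint m ?r g \<le> ennreal ((C * I powr (1 / ?r)) powr ?r)"
    using le I q C by (simp add: powr_mult powr_powr ennreal_mult)
  then have "Lp_norm m q g \<le> ennreal (C * I powr (1 / ?r))"
    using C by (subst Lp_norm_le_iff[OF q]) auto
  also have "\<dots> = ennreal C * Lp_norm m q f"
    using I q C by (simp add: Lp_norm_finite ennreal_mult)
  finally show ?thesis .
qed

text \<open>A crude substitute for Minkowski's inequality, enough for \<open>Lp\<close> to be closed
  under addition: \<open>|f + g|\<close> is at most twice the larger summand.\<close>

lemma pint_add_le:
  assumes "0 \<le> r"
  shows "pint m r (\<lambda>x. f x + g x) \<le> ennreal (2 powr r) * (pint m r f + pint m r g)"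
proof -
  have "ennreal (norm (f x + g x) powr r) \<le> ennreal (2 powr r) * (ennreal (norm (f x) powr r) + ennreal (norm (g x) powr r))" for x
  proof -
    have "norm (f x + g x) \<le> 2 * max (norm (f x)) (norm (g x))"
      using norm_triangle_ineq[of "f x" "g x"] by linarith
    then have "norm (f x + g x) powr r \<le> (2 * max (norm (f x)) (norm (g x))) powr r"
      using assms by (intro powr_mono2) auto
    also have "\<dots> = 2 powr r * max (norm (f x)) (norm (g x)) powr r"
      by (rule powr_mult)
    also have "\<dots> \<le> 2 powr r * (norm (f x) powr r + norm (g x) powr r)"
      by (intro mult_left_mono) (auto simp: max_def)
    finally show ?thesis
      by (subst ennreal_plus[symmetric]) (auto simp: ennreal_mult[symmetric] intro!: ennreal_leI simp del: ennreal_plus)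
  qed
  then have "pint m r (\<lambda>x. f x + g x) \<le> (\<integral>\<^sup>+x. ennreal (2 powr r) * (ennreal (norm (f x) powr r) + ennreal (norm (g x) powr r)) \<partial>flow_measure m)"
    unfolding pint_def by (rule nn_integral_mono)
  also have "\<dots> = ennreal (2 powr r) * (pint m r f + pint m r g)"
    unfolding pint_def by (subst nn_integral_cmult, simp add: flow_measure_def, subst nn_integral_add) (simp_all add: flow_measure_def)
  finally show ?thesis .
qed

lemma pint_mult: "0 \<le> r \<Longrightarrow> pint m r (\<lambda>x. c * f x) = ennreal (norm c powr r) * pint m r f"
  unfolding pint_def norm_mult
  by (subst nn_integral_cmult[symmetric]) (auto simp: flow_measure_def powr_mult ennreal_mult intro!: nn_integral_cong)

lemma Lp_infinity_iff: "f \<in> Lp m \<infinity> \<longleftrightarrow> (\<exists>B. \<forall>x. norm (f x) \<le> B)"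
proof
  assume "f \<in> Lp m \<infinity>"
  then have "(SUP x. ennreal (norm (f x))) < \<infinity>" unfolding Lp_def Lp_norm_infinity by simp
  then obtain B where B: "(SUP x. ennreal (norm (f x))) = ennreal B" "0 \<le> B"
    by (cases "SUP x. ennreal (norm (f x))") auto
  have "norm (f x) \<le> B" for x
    using SUP_upper[of x UNIV "\<lambda>x. ennreal (norm (f x))"] B by (simp add: ennreal_le_iff)
  then show "\<exists>B. \<forall>x. norm (f x) \<le> B" by blast
next
  assume "\<exists>B. \<forall>x. norm (f x) \<le> B"
  then obtain B where "\<And>x. norm (f x) \<le> B" by blast
  then have "(SUP x. ennreal (norm (f x))) \<le> ennreal B" by (intro SUP_least ennreal_leI)
  then show "f \<in> Lp m \<infinity>" unfolding Lp_def Lp_norm_infinity by (simp add: le_less_trans)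
qed

lemma Lp_norm_infinity_le_iff: "0 \<le> C \<Longrightarrow> Lp_norm m \<infinity> f \<le> ennreal C \<longleftrightarrow> (\<forall>x. norm (f x) \<le> C)"
  unfolding Lp_norm_infinity SUP_le_iff by (auto simp: ennreal_le_iff)

lemma Lp_add: "f \<in> Lp m q \<Longrightarrow> g \<in> Lp m q \<Longrightarrow> (\<lambda>x. f x + g x) \<in> Lp m q"
proof (cases "q = \<infinity>")
  case True
  assume "f \<in> Lp m q" "g \<in> Lp m q"
  then obtain B B' where "\<And>x. norm (f x) \<le> B" "\<And>x. norm (g x) \<le> B'"
    unfolding True Lp_infinity_iff by blast
  then have "norm (f x + g x) \<le> B + B'" for x by (intro norm_triangle_le add_mono)
  then show ?thesis unfolding True Lp_infinity_iff by blast
next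
  case False
  assume "f \<in> Lp m q" "g \<in> Lp m q"
  then have "ennreal (2 powr enn2real q) * (pint m (enn2real q) f + pint m (enn2real q) g) < \<infinity>"
    unfolding mem_Lp_iff[OF False] by (simp add: ennreal_mult_less_top)
  then show ?thesis unfolding mem_Lp_iff[OF False] using pint_add_le[of "enn2real q" m f g] by (simp add: le_less_trans)
qed

lemma Lp_mult: "f \<in> Lp m q \<Longrightarrow> (\<lambda>x. c * f x) \<in> Lp m q"
proof (cases "q = \<infinity>")
  case True
  assume "f \<in> Lp m q"
  then obtain B where "\<And>x. norm (f x) \<le> B" unfolding True Lp_infinity_iff by blast
  then have "norm (c * f x) \<le> norm c * B" for x by (simp add: norm_mult mult_left_mono)
  then show ?thesis unfolding True Lp_infinity_iff by blast
next
  case False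
  assume "f \<in> Lp m q"
  then show ?thesis unfolding mem_Lp_iff[OF False] by (simp add: pint_mult ennreal_mult_less_top)
qed

lemma Lp_norm_mult:
  assumes "1 \<le> q"
  shows "Lp_norm m q (\<lambda>x. c * f x) = ennreal (norm c) * Lp_norm m q f"
proof (cases "q = \<infinity>")
  case True
  then show ?thesis unfolding True Lp_norm_infinity
    by (subst SUP_mult_left_ennreal) (auto simp: norm_mult ennreal_mult)
next
  case False
  let ?r = "enn2real q"
  have r: "1 \<le> ?r" using ennreal_real_ge_1[OF assms False] .
  show ?thesis
  proof (cases "pint m ?r f")
    case (real I)
    then have "pint m ?r (\<lambda>x. c * f x) = ennreal (norm c powr ?r * I)"
      using r by (simp add: pint_mult ennreal_mult)
    then have "Lp_norm m q (\<lambda>x. c * f x) = ennreal ((norm c powr ?r * I) powr (1 / ?r))"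
      using real(1) by (simp only: Lp_norm_finite[OF False]) simp
    also have "(norm c powr ?r * I) powr (1 / ?r) = norm c * I powr (1 / ?r)"
      using real(1) r by (simp add: powr_mult powr_powr)
    finally show ?thesis using real by (simp add: Lp_norm_finite[OF False] ennreal_mult)
  next
    case top
    moreover have "pint m ?r (\<lambda>x. 0) = 0" by (simp add: pint_def)
    ultimately show ?thesis using r
      by (cases "c = 0") (simp_all add: Lp_norm_finite[OF False] pint_mult ennreal_mult_eq_top_iff ennreal_mult_top powr_eq_0_iff)
  qed
qed

section \<open>Boundedness of the Chebyshev series on Lebesgue spaces\<close>

context flow_tree
begin

lemma point_le_pint: "ennreal (m x) * ennreal (norm (f x) powr r) \<le> pint m r f"
proof -
  have "ennreal (m x) * ennreal (norm (f x) powr r) = (\<integral>\<^sup>+y. ennreal (m x) * ennreal (norm (f x) powr r) * indicator {x} y \<partial>count_space UNIV)"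
    by (subst nn_integral_cmult_indicator) auto
  also have "\<dots> \<le> (\<integral>\<^sup>+y. ennreal (m y) * ennreal (norm (f y) powr r) \<partial>count_space UNIV)"
    by (rule nn_integral_mono) (auto split: split_indicator)
  finally show ?thesis unfolding pint_def nn_integral_flow .
qed

lemma pint_less_top_bound:
  assumes "pint m r f < \<infinity>"
  shows "norm (f x) powr r \<le> enn2real (pint m r f) / m x"
proof -
  obtain I where I: "pint m r f = ennreal I" "0 \<le> I" using assms by (cases "pint m r f") auto
  have "ennreal (m x * norm (f x) powr r) \<le> ennreal I"
    using point_le_pint[of x f r] m_pos[of x] by (simp add: I ennreal_mult less_imp_le)
  then show ?thesis using I m_pos[of x] by (simp add: ennreal_le_iff field_simps)
qed

text \<open>Jensen's inequality inside the average, followed by conservation of the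
  integral.\<close>

lemma pint_avg_le:
  assumes "1 \<le> r"
  shows "pint m r (\<lambda>x. avg b f ((p ^^ a) x)) \<le> pint m r f"
proof -
  have "pint m r (\<lambda>x. avg b f ((p ^^ a) x)) \<le> (\<integral>\<^sup>+x. ennreal (avg_real b (\<lambda>y. norm (f y) powr r) ((p ^^ a) x)) \<partial>flow_measure m)"
    unfolding pint_def
  proof (intro nn_integral_mono ennreal_leI)
    fix x
    have "norm (avg b f ((p ^^ a) x)) powr r \<le> avg_real b (\<lambda>y. norm (f y)) ((p ^^ a) x) powr r"
      using assms by (intro powr_mono2 norm_avg_le) auto
    also have "\<dots> \<le> avg_real b (\<lambda>y. norm (f y) powr r) ((p ^^ a) x)"
      by (rule avg_real_Jensen[OF _ assms]) simp
    finally show "norm (avg b f ((p ^^ a) x)) powr r \<le> avg_real b (\<lambda>y. norm (f y) powr r) ((p ^^ a) x)" .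
  qed
  also have "\<dots> = pint m r f"
    unfolding pint_def by (rule nn_integral_avg_real_pred) simp
  finally show ?thesis .
qed

lemma bounded_avg:
  assumes "\<And>y. norm (f y) \<le> B"
  shows "norm (avg b f z) \<le> B"
  by (rule order_trans[OF norm_avg_le avg_real_le]) (rule assms)

lemma Lp_avg:
  assumes "f \<in> Lp m q" "1 \<le> q"
  shows "(\<lambda>x. avg b f ((p ^^ a) x)) \<in> Lp m q"
proof (cases "q = \<infinity>")
  case True
  then show ?thesis using assms bounded_avg unfolding True Lp_infinity_iff by blast
next
  case False
  then show ?thesis using assms pint_avg_le[OF ennreal_real_ge_1[OF assms(2) False], of b f a]
    unfolding mem_Lp_iff[OF False] by (simp add: le_less_trans)
qed

text \<open>As functions of \<open>x\<close>, all \<open>avg b f ((p ^^ a) x)\<close> have norm at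
  most that of \<open>f\<close>, and a norm bound controls the value at a vertex because the vertex
  has positive mass.\<close>

lemma Lp_tame:
  assumes "f \<in> Lp m q" "1 \<le> q"
  shows "tame f"
proof (cases "q = \<infinity>")
  case True
  then show ?thesis using assms bounded_avg unfolding True Lp_infinity_iff tame_def by blast
next
  case False
  let ?r = "enn2real q"
  have r: "1 \<le> ?r" using ennreal_real_ge_1[OF assms(2) False] .
  show ?thesis
    unfolding tame_def
  proof
    fix x
    have "norm (avg b f ((p ^^ a) x)) \<le> (enn2real (pint m ?r f) / m x) powr (1 / ?r)" for a b
    proof -
      have le: "pint m ?r (\<lambda>x. avg b f ((p ^^ a) x)) \<le> pint m ?r f" by (rule pint_avg_le[OF r])
      have fin: "pint m ?r f < \<infinity>" using assms(1) unfolding mem_Lp_iff[OF False] .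
      have "norm (avg b f ((p ^^ a) x)) powr ?r \<le> enn2real (pint m ?r (\<lambda>x. avg b f ((p ^^ a) x))) / m x"
        by (rule pint_less_top_bound) (use le fin in auto)
      also have "\<dots> \<le> enn2real (pint m ?r f) / m x"
        using m_pos[of x] le fin by (intro divide_right_mono enn2real_mono) auto
      finally have "(norm (avg b f ((p ^^ a) x)) powr ?r) powr (1 / ?r) \<le> (enn2real (pint m ?r f) / m x) powr (1 / ?r)"
        using r by (intro powr_mono2) auto
      then show ?thesis using r by (simp add: powr_powr)
    qed
    then show "\<exists>C. \<forall>a b. norm (avg b f ((p ^^ a) x)) \<le> C" by blast
  qed
qed

text \<open>After division by \<open>n + 1\<close> the operator is a mean of \<open>n + 1\<close>
  contractions, so Jensen's inequality applies twice: to this mean and inside each average.\<close>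

lemma norm_UU_powr_le:
  assumes "1 \<le> r"
  shows "(norm (UU n f x) / real (Suc n)) powr r \<le> (\<Sum>a\<le>n. avg_real (n - a) (\<lambda>y. norm (f y) powr r) ((p ^^ a) x)) / real (Suc n)"
proof -
  let ?g = "\<lambda>a. avg_real (n - a) (\<lambda>y. norm (f y)) ((p ^^ a) x)"
  have g0: "0 \<le> ?g a" for a by (rule avg_real_nonneg) simp
  have "norm (UU n f x) / real (Suc n) \<le> (\<Sum>a\<le>n. (1 / real (Suc n)) * ?g a)"
    unfolding UU_def sum_distrib_left[symmetric]
    by (auto simp: divide_simps simp del: of_nat_Suc intro!: order_trans[OF norm_sum] sum_mono norm_avg_le)
  then have "(norm (UU n f x) / real (Suc n)) powr r \<le> (\<Sum>a\<le>n. (1 / real (Suc n)) * ?g a) powr r"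
    using assms by (intro powr_mono2) auto
  also have "\<dots> \<le> 1 powr (r - 1) * (\<Sum>a\<le>n. (1 / real (Suc n)) * ?g a powr r)"
    using assms g0 by (intro powr_sum_Jensen) auto
  also have "\<dots> \<le> (\<Sum>a\<le>n. (1 / real (Suc n)) * avg_real (n - a) (\<lambda>y. norm (f y) powr r) ((p ^^ a) x))"
    unfolding powr_one_eq_one mult_1 using assms by (intro sum_mono mult_left_mono avg_real_Jensen) auto
  finally show ?thesis by (simp add: sum_divide_distrib)
qed

lemma nn_integral_UU_powr_le:
  assumes "1 \<le> r"
  shows "(\<integral>\<^sup>+x. ennreal ((norm (UU n f x) / real (Suc n)) powr r) \<partial>flow_measure m) \<le> pint m r f"
proof -
  let ?h = "\<lambda>y. norm (f y) powr r"
  have "(\<integral>\<^sup>+x. ennreal ((norm (UU n f x) / real (Suc n)) powr r) \<partial>flow_measure m)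
     \<le> (\<integral>\<^sup>+x. (\<Sum>a\<le>n. ennreal (1 / real (Suc n)) * ennreal (avg_real (n - a) ?h ((p ^^ a) x))) \<partial>flow_measure m)"
  proof (rule nn_integral_mono)
    fix x
    have "ennreal ((norm (UU n f x) / real (Suc n)) powr r) \<le> ennreal (\<Sum>a\<le>n. 1 / real (Suc n) * avg_real (n - a) ?h ((p ^^ a) x))"
      using norm_UU_powr_le[OF assms, of n f x] unfolding sum_divide_distrib by (intro ennreal_leI) simp
    also have "\<dots> = (\<Sum>a\<le>n. ennreal (1 / real (Suc n)) * ennreal (avg_real (n - a) ?h ((p ^^ a) x)))"
      by (subst sum_ennreal[symmetric]) (auto simp: ennreal_mult[symmetric] avg_real_nonneg)
    finally show "ennreal ((norm (UU n f x) / real (Suc n)) powr r) \<le> (\<Sum>a\<le>n. ennreal (1 / real (Suc n)) * ennreal (avg_real (n - a) ?h ((p ^^ a) x)))" .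
  qed
  also have "\<dots> = (\<Sum>a\<le>n. ennreal (1 / real (Suc n)) * (\<integral>\<^sup>+x. ennreal (avg_real (n - a) ?h ((p ^^ a) x)) \<partial>flow_measure m))"
    by (subst nn_integral_sum) (auto simp: flow_measure_def intro!: sum.cong nn_integral_cmult)
  also have "\<dots> = (\<Sum>a\<le>n. ennreal (1 / real (Suc n)) * pint m r f)"
    unfolding pint_def by (subst nn_integral_avg_real_pred) auto
  also have "\<dots> = of_nat (Suc n) * (ennreal (1 / real (Suc n)) * pint m r f)" by simp
  also have "\<dots> = ennreal (real (Suc n) * (1 / real (Suc n))) * pint m r f"
    by (subst ennreal_mult) (auto simp: ennreal_of_nat_eq_real_of_nat mult.assoc simp del: of_nat_Suc)
  also have "\<dots> = pint m r f" by (simp del: of_nat_Suc)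
  finally show ?thesis .
qed

lemma pint_UU_le: "1 \<le> r \<Longrightarrow> pint m r (UU n f) \<le> ennreal (real (Suc n) powr r) * pint m r f"
proof -
  assume r: "1 \<le> r"
  have "pint m r (UU n f) = (\<integral>\<^sup>+x. ennreal (real (Suc n) powr r) * ennreal ((norm (UU n f x) / real (Suc n)) powr r) \<partial>flow_measure m)"
    unfolding pint_def
  proof (rule nn_integral_cong)
    fix x
    have "norm (UU n f x) powr r = (real (Suc n) * (norm (UU n f x) / real (Suc n))) powr r" by (simp del: of_nat_Suc)
    also have "\<dots> = real (Suc n) powr r * (norm (UU n f x) / real (Suc n)) powr r" by (rule powr_mult)
    finally show "ennreal (norm (UU n f x) powr r) = ennreal (real (Suc n) powr r) * ennreal ((norm (UU n f x) / real (Suc n)) powr r)"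
      by (simp only: ennreal_mult powr_ge_zero)
  qed
  also have "\<dots> = ennreal (real (Suc n) powr r) * (\<integral>\<^sup>+x. ennreal ((norm (UU n f x) / real (Suc n)) powr r) \<partial>flow_measure m)"
    by (rule nn_integral_cmult) (simp add: flow_measure_def)
  also have "\<dots> \<le> ennreal (real (Suc n) powr r) * pint m r f"
    by (intro mult_left_mono nn_integral_UU_powr_le r) simp
  finally show ?thesis .
qed

lemma bounded_UU:
  assumes "\<And>y. norm (f y) \<le> B"
  shows "norm (UU n f x) \<le> real (Suc n) * B"
proof -
  have "norm (UU n f x) \<le> (\<Sum>a\<le>n. B)"
    unfolding UU_def by (intro order_trans[OF norm_sum] sum_mono bounded_avg assms)
  then show ?thesis by simp
qed

lemma Lp_UU:
  assumes "f \<in> Lp m q" "1 \<le> q"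
  shows "UU n f \<in> Lp m q"
proof (cases "q = \<infinity>")
  case True
  then show ?thesis using assms bounded_UU unfolding True Lp_infinity_iff by blast
next
  case False
  have "ennreal (real (Suc n) powr enn2real q) * pint m (enn2real q) f < \<infinity>"
    using assms(1) unfolding mem_Lp_iff[OF False] by (simp add: ennreal_mult_less_top)
  then show ?thesis using pint_UU_le[OF ennreal_real_ge_1[OF assms(2) False], of n f]
    unfolding mem_Lp_iff[OF False] by (rule le_less_trans[rotated])
qed

text \<open>Jensen's inequality with weights \<open>(n + 1) |c n|\<close> and entries
  \<open>|UU n f| / (n + 1)\<close>, for partial sums and then in the pointwise limit. Integrating
  the resulting series replaces Minkowski's inequality for infinite sums.\<close>

lemma pint_Sop_le:
  assumes c: "summable (\<lambda>n. real (Suc n) * norm (c n))" and \<Lambda>: "(\<Sum>n. real (Suc n) * norm (c n)) \<le> \<Lambda>" "0 < \<Lambda>"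
    and r: "1 \<le> r" and f: "tame f"
  shows "pint m r (Sop c f) \<le> ennreal (\<Lambda> powr r) * pint m r f"
proof -
  define w where "w n = real (Suc n) * norm (c n)" for n
  define t where "t n x = norm (UU n f x) / real (Suc n)" for n x
  have w0: "0 \<le> w n" and t0: "0 \<le> t n x" for n x by (simp_all add: w_def t_def)
  have sw: "summable w" "suminf w \<le> \<Lambda>" using c \<Lambda>(1) by (simp_all add: w_def[abs_def])
  have wt: "norm (c n * UU n f x) = w n * t n x" for n x by (simp add: w_def t_def norm_mult del: of_nat_Suc)
  have point: "ennreal (norm (Sop c f x) powr r) \<le> ennreal (\<Lambda> powr (r - 1)) * (\<Sum>n. ennreal (w n) * ennreal (t n x powr r))" for x
  proof -
    have s: "summable (\<lambda>n. norm (c n * UU n f x))" by (rule summable_Sop[OF c f])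
    have le: "ennreal (norm (\<Sum>n<N. c n * UU n f x) powr r) \<le> ennreal (\<Lambda> powr (r - 1)) * (\<Sum>n. ennreal (w n) * ennreal (t n x powr r))" for N
    proof -
      have "norm (\<Sum>n<N. c n * UU n f x) \<le> (\<Sum>n<N. w n * t n x)"
        unfolding wt[symmetric] by (rule norm_sum)
      then have "norm (\<Sum>n<N. c n * UU n f x) powr r \<le> (\<Sum>n<N. w n * t n x) powr r"
        using r by (intro powr_mono2) auto
      also have "\<dots> \<le> \<Lambda> powr (r - 1) * (\<Sum>n<N. w n * t n x powr r)"
      proof (rule powr_sum_Jensen)
        show "(\<Sum>n<N. w n) \<le> \<Lambda>" using sum_le_suminf[OF sw(1), of "{..<N}"] w0 sw(2) by auto
      qed (use w0 t0 \<Lambda> r in auto)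
      finally have "ennreal (norm (\<Sum>n<N. c n * UU n f x) powr r) \<le> ennreal (\<Lambda> powr (r - 1) * (\<Sum>n<N. w n * t n x powr r))"
        by (rule ennreal_leI)
      also have "\<dots> = ennreal (\<Lambda> powr (r - 1)) * (\<Sum>n<N. ennreal (w n) * ennreal (t n x powr r))"
        by (subst ennreal_mult) (auto simp: w0 ennreal_mult[symmetric] intro!: sum_nonneg)
      also have "\<dots> \<le> ennreal (\<Lambda> powr (r - 1)) * (\<Sum>n. ennreal (w n) * ennreal (t n x powr r))"
        by (intro mult_left_mono sum_le_suminf) auto
      finally show ?thesis .
    qed
    have lim: "(\<lambda>N. ennreal (norm (\<Sum>n<N. c n * UU n f x) powr r)) \<longlonglongrightarrow> ennreal (norm (Sop c f x) powr r)"
    proof -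
      have "(\<lambda>N. \<Sum>n<N. c n * UU n f x) \<longlonglongrightarrow> Sop c f x"
        unfolding Sop_def using summable_norm_cancel[OF s] by (rule summable_LIMSEQ)
      then have "(\<lambda>N. norm (\<Sum>n<N. c n * UU n f x) powr r) \<longlonglongrightarrow> norm (Sop c f x) powr r"
        by (intro tendsto_powr2 tendsto_norm tendsto_const) (use r in auto)
      then show ?thesis by (rule tendsto_ennrealI)
    qed
    show ?thesis by (rule LIMSEQ_le_const2[OF lim]) (use le in blast)
  qed
  have "pint m r (Sop c f) \<le> (\<integral>\<^sup>+x. ennreal (\<Lambda> powr (r - 1)) * (\<Sum>n. ennreal (w n) * ennreal (t n x powr r)) \<partial>flow_measure m)"
    unfolding pint_def by (rule nn_integral_mono) (rule point)
  also have "\<dots> = ennreal (\<Lambda> powr (r - 1)) * (\<integral>\<^sup>+x. (\<Sum>n. ennreal (w n) * ennreal (t n x powr r)) \<partial>flow_measure m)"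
    by (rule nn_integral_cmult) (simp add: flow_measure_def)
  also have "(\<integral>\<^sup>+x. (\<Sum>n. ennreal (w n) * ennreal (t n x powr r)) \<partial>flow_measure m)
     = (\<Sum>n. \<integral>\<^sup>+x. ennreal (w n) * ennreal (t n x powr r) \<partial>flow_measure m)"
    by (rule nn_integral_suminf) (simp add: flow_measure_def)
  also have "\<dots> = (\<Sum>n. ennreal (w n) * (\<integral>\<^sup>+x. ennreal (t n x powr r) \<partial>flow_measure m))"
    by (subst nn_integral_cmult) (simp_all add: flow_measure_def)
  also have "\<dots> \<le> (\<Sum>n. ennreal (w n) * pint m r f)"
    unfolding t_def by (intro suminf_le mult_left_mono nn_integral_UU_powr_le r) auto
  also have "\<dots> = (\<Sum>n. ennreal (w n)) * pint m r f" by (rule ennreal_suminf_multc)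
  also have "(\<Sum>n. ennreal (w n)) = ennreal (suminf w)" by (rule suminf_ennreal2[OF w0 sw(1)])
  also have "ennreal (\<Lambda> powr (r - 1)) * (ennreal (suminf w) * pint m r f) \<le> ennreal (\<Lambda> powr (r - 1)) * (ennreal \<Lambda> * pint m r f)"
    by (intro mult_left_mono mult_right_mono ennreal_leI sw(2)) auto
  also have "\<dots> = ennreal (\<Lambda> powr r) * pint m r f"
    using \<Lambda>(2) by (simp only: mult.assoc[symmetric] ennreal_mult[symmetric] powr_ge_zero less_imp_le powr_diff_one_mult)
  finally show ?thesis by (simp add: mult_left_mono)
qed

lemma bounded_Sop:
  assumes c: "summable (\<lambda>n. real (Suc n) * norm (c n))" and f: "\<And>x. norm (f x) \<le> B"
  shows "norm (Sop c f x) \<le> (\<Sum>n. real (Suc n) * norm (c n)) * B"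
proof -
  have t: "tame f" using f bounded_avg unfolding tame_def by blast
  have "norm (Sop c f x) \<le> (\<Sum>n. norm (c n * UU n f x))"
    unfolding Sop_def by (rule summable_norm[OF summable_Sop[OF c t]])
  also have "\<dots> \<le> (\<Sum>n. real (Suc n) * norm (c n) * B)"
  proof (rule suminf_le[OF _ summable_Sop[OF c t]])
    show "norm (c n * UU n f x) \<le> real (Suc n) * norm (c n) * B" for n
      using mult_left_mono[OF bounded_UU[OF f], of "norm (c n)"] by (simp add: norm_mult mult_ac)
    show "summable (\<lambda>n. real (Suc n) * norm (c n) * B)" using c by (rule summable_mult2)
  qed
  also have "\<dots> = (\<Sum>n. real (Suc n) * norm (c n)) * B" by (rule suminf_mult2[symmetric, OF c])
  finally show ?thesis .
qed

lemma Lp_norm_Sop_le: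
  assumes c: "summable (\<lambda>n. real (Suc n) * norm (c n))" and \<Lambda>: "(\<Sum>n. real (Suc n) * norm (c n)) \<le> \<Lambda>" "0 < \<Lambda>"
    and q: "1 \<le> q" and f: "f \<in> Lp m q"
  shows "Lp_norm m q (Sop c f) \<le> ennreal \<Lambda> * Lp_norm m q f"
proof (cases "q = \<infinity>")
  case True
  show ?thesis
  proof (cases "Lp_norm m q f")
    case (real B)
    then have "norm (f x) \<le> B" for x using Lp_norm_infinity_le_iff[of B m f] True by simp
    then have "norm (Sop c f x) \<le> \<Lambda> * B" for x
      using bounded_Sop[OF c, of f B x] mult_right_mono[OF \<Lambda>(1) real(1)] by (meson order_trans)
    then have "Lp_norm m q (Sop c f) \<le> ennreal (\<Lambda> * B)"
      unfolding True using \<Lambda>(2) real(1) by (subst Lp_norm_infinity_le_iff) auto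
    then show ?thesis using real \<Lambda>(2) by (simp add: ennreal_mult)
  next
    case top
    then show ?thesis using f by (simp add: Lp_def)
  qed
next
  case False
  have r: "1 \<le> enn2real q" using ennreal_real_ge_1[OF q False] .
  show ?thesis
    by (rule Lp_norm_bound[OF False]) (use r \<Lambda> pint_Sop_le[OF c \<Lambda> r Lp_tame[OF f q]] f in auto)
qed

lemma Lp_Sop:
  assumes c: "summable (\<lambda>n. real (Suc n) * norm (c n))" and q: "1 \<le> q" and f: "f \<in> Lp m q"
  shows "Sop c f \<in> Lp m q"
proof -
  have "(\<Sum>n. real (Suc n) * norm (c n)) \<ge> 0" by (intro suminf_nonneg c) simp
  \<comment> \<open>One is added because \<open>Lp_norm_Sop_le\<close> asks for a positive
    bound.\<close>
  then have "Lp_norm m q (Sop c f) \<le> ennreal ((\<Sum>n. real (Suc n) * norm (c n)) + 1) * Lp_norm m q f"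
    by (intro Lp_norm_Sop_le c q f) auto
  also have "\<dots> < \<infinity>" using f by (simp add: Lp_def ennreal_mult_less_top)
  finally show ?thesis by (simp add: Lp_def)
qed

lemma bounded_op_Sop:
  assumes c: "summable (\<lambda>n. real (Suc n) * norm (c n))" and q: "1 \<le> q"
  shows "bounded_op m q (restrict (Sop c) (Lp m q))"
  unfolding bounded_op_def
proof (intro conjI ballI allI)
  let ?A = "restrict (Sop c) (Lp m q)"
  show "?A \<in> Lp m q \<rightarrow> Lp m q" using Lp_Sop[OF c q] by auto
  show "?A (\<lambda>x. f x + g x) = (\<lambda>x. ?A f x + ?A g x)" if "f \<in> Lp m q" "g \<in> Lp m q" for f g
    using that Lp_add[OF that] Sop_add[OF c Lp_tame[OF that(1) q] Lp_tame[OF that(2) q]] by (simp add: restrict_def fun_eq_iff)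
  show "?A (\<lambda>x. k * f x) = (\<lambda>x. k * ?A f x)" if "f \<in> Lp m q" for f k
    using that Lp_mult[OF that] Sop_mult[OF c Lp_tame[OF that q]] by (simp add: restrict_def fun_eq_iff)
  have "(\<Sum>n. real (Suc n) * norm (c n)) \<ge> 0" by (intro suminf_nonneg c) simp
  then show "\<exists>C. \<forall>f\<in>Lp m q. Lp_norm m q (?A f) \<le> ennreal C * Lp_norm m q f"
    by (intro exI[of _ "(\<Sum>n. real (Suc n) * norm (c n)) + 1"] ballI) (auto simp del: ennreal_plus intro!: Lp_norm_Sop_le c q)
qed

end

section \<open>The functional calculus of the flow Laplacian\<close>

definition delta :: "'a \<Rightarrow> 'a \<Rightarrow> complex" where
  "delta x y = (if y = x then 1 else 0)"

section \<open>Duality between ancestors and averages\<close>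

context flow_tree
begin

lemma measurable_flow [simp]: "f \<in> measurable (flow_measure m) N \<longleftrightarrow> f \<in> UNIV \<rightarrow> space N"
  by (simp add: flow_measure_def)

lemma integrable_flow_iff:
  fixes f :: "'a \<Rightarrow> complex"
  shows "integrable (flow_measure m) f \<longleftrightarrow> integrable (count_space UNIV) (\<lambda>x. of_real (m x) * f x)"
  unfolding flow_measure_def using m_pos
  by (subst integrable_density) (auto simp: scaleR_conv_of_real less_imp_le)

lemma integral_flow:
  fixes f :: "'a \<Rightarrow> complex"
  shows "(\<integral>x. f x \<partial>flow_measure m) = (\<integral>x. of_real (m x) * f x \<partial>count_space UNIV)"
  unfolding flow_measure_def using m_pos
  by (subst integral_density) (auto simp: scaleR_conv_of_real less_imp_le)

text \<open>The complex counterpart of \<open>nn_integral_fibers\<close>. Absolute summability lets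
  the sum be rearranged over the disjoint union of the sets \<open>desc b z\<close>.\<close>

lemma integral_fibers:
  fixes h :: "'a \<Rightarrow> complex"
  assumes h: "integrable (count_space UNIV) h"
  shows "(\<integral>z. (\<Sum>x\<in>desc b z. h x) \<partial>count_space UNIV) = (\<integral>x. h x \<partial>count_space UNIV)"
proof -
  have "integrable (count_space UNIV) (\<lambda>z. \<Sum>x\<in>desc b z. h x)"
  proof (rule integrableI_bounded)
    have "(\<integral>\<^sup>+z. ennreal (norm (\<Sum>x\<in>desc b z. h x)) \<partial>count_space UNIV) \<le> (\<integral>\<^sup>+z. (\<Sum>x\<in>desc b z. ennreal (norm (h x))) \<partial>count_space UNIV)"
      by (intro nn_integral_mono) (simp add: ennreal_leI norm_sum)
    also have "\<dots> = (\<integral>\<^sup>+x. ennreal (norm (h x)) \<partial>count_space UNIV)" by (rule nn_integral_fibers)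
    also have "\<dots> < \<infinity>" using h by (simp add: integrable_iff_bounded)
    finally show "(\<integral>\<^sup>+z. ennreal (norm (\<Sum>x\<in>desc b z. h x)) \<partial>count_space UNIV) < \<infinity>" .
  qed simp
  then have 1: "(\<integral>z. (\<Sum>x\<in>desc b z. h x) \<partial>count_space UNIV) = infsum (\<lambda>z. \<Sum>x\<in>desc b z. h x) UNIV"
    using infsetsum_infsum[of "\<lambda>z. \<Sum>x\<in>desc b z. h x" UNIV] by (simp add: infsetsum_def Infinite_Set_Sum.abs_summable_on_def)
  have abs: "Infinite_Set_Sum.abs_summable_on h UNIV" using h by (simp add: Infinite_Set_Sum.abs_summable_on_def)
  have 2: "(\<integral>x. h x \<partial>count_space UNIV) = infsum h UNIV"
    using infsetsum_infsum[OF abs] by (simp add: infsetsum_def)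
  have bij: "bij_betw snd (Sigma UNIV (desc b)) UNIV"
    by (rule bij_betw_byWitness[where f'="\<lambda>x. ((p ^^ b) x, x)"]) (auto simp: mem_desc)
  have "h summable_on UNIV"
    using abs unfolding abs_summable_equivalent[symmetric] by (rule abs_summable_summable)
  then have s: "(\<lambda>(z, x). h x) summable_on (Sigma UNIV (desc b))"
    using summable_on_reindex_bij_betw[OF bij, of h] by (simp add: split_beta')
  have "infsum h UNIV = infsum (\<lambda>(z, x). h x) (Sigma UNIV (desc b))"
    using infsum_reindex_bij_betw[OF bij, of h] by (simp add: split_beta')
  also have "\<dots> = infsum (\<lambda>z. infsum h (desc b z)) UNIV"
    by (rule infsum_Sigma'_banach[OF s, symmetric])
  also have "\<dots> = infsum (\<lambda>z. \<Sum>x\<in>desc b z. h x) UNIV" by simp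
  finally show ?thesis using 1 2 by simp
qed

text \<open>Grouping the vertices by their \<open>b\<close>-th ancestor shows that averaging is
  adjoint to composition with the predecessor map.\<close>

lemma pairing_pred_pow:
  assumes "integrable (flow_measure m) (\<lambda>x. f ((p ^^ b) x) * cnj (g x))"
  shows "pairing m (\<lambda>x. f ((p ^^ b) x)) g = pairing m f (avg b g)"
proof -
  have "pairing m (\<lambda>x. f ((p ^^ b) x)) g = (\<integral>x. of_real (m x) * (f ((p ^^ b) x) * cnj (g x)) \<partial>count_space UNIV)"
    unfolding pairing_def by (rule integral_flow)
  also have "\<dots> = (\<integral>z. (\<Sum>x\<in>desc b z. of_real (m x) * (f ((p ^^ b) x) * cnj (g x))) \<partial>count_space UNIV)"
    using assms unfolding integrable_flow_iff by (rule integral_fibers[symmetric])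
  also have "\<dots> = (\<integral>z. of_real (m z) * (f z * cnj (avg b g z)) \<partial>count_space UNIV)"
  proof (rule Bochner_Integration.integral_cong[OF refl])
    fix z
    have "(\<Sum>x\<in>desc b z. of_real (m x) * (f ((p ^^ b) x) * cnj (g x))) = f z * (\<Sum>x\<in>desc b z. cnj (g x) * of_real (m x))"
      unfolding sum_distrib_left by (rule sum.cong) (auto simp: mem_desc)
    then show "(\<Sum>x\<in>desc b z. of_real (m x) * (f ((p ^^ b) x) * cnj (g x))) = of_real (m z) * (f z * cnj (avg b g z))"
      by (simp add: avg_def)
  qed
  also have "\<dots> = pairing m f (avg b g)"
    unfolding pairing_def by (rule integral_flow[symmetric])
  finally show ?thesis .
qed

lemma pairing_cnj: "pairing m f g = cnj (pairing m g f)"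
  unfolding pairing_def by (simp flip: Bochner_Integration.integral_cnj add: mult.commute)

text \<open>The pairs of exponents that the functional calculus meets: spectral theory takes place
  on L^2, and the case \<open>p = \<infinity>\<close> is defined by duality with L^1.\<close>

definition dual :: "ennreal \<Rightarrow> ennreal \<Rightarrow> bool" where
  "dual q q' \<longleftrightarrow> (q = 2 \<and> q' = 2) \<or> (q = \<infinity> \<and> q' = 1) \<or> (q = 1 \<and> q' = \<infinity>)"

lemma dual_sym: "dual q q' \<Longrightarrow> dual q' q"
  by (auto simp: dual_def)

lemma dual_ge_1: "dual q q' \<Longrightarrow> 1 \<le> q" "dual q q' \<Longrightarrow> 1 \<le> q'"
  by (auto simp: dual_def)

lemma pint_1: "pint m 1 f = (\<integral>\<^sup>+x. ennreal (norm (f x)) \<partial>flow_measure m)"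
  by (simp add: pint_def)

lemma L1_iff: "f \<in> Lp m 1 \<longleftrightarrow> pint m 1 f < \<infinity>"
  using mem_Lp_iff[of 1 f m] by simp

lemma L2_iff: "f \<in> Lp m 2 \<longleftrightarrow> pint m 2 f < \<infinity>"
  using mem_Lp_iff[of 2 f m] by simp

text \<open>What matters is the linear growth in \<open>n\<close>: the weight \<open>n + 1\<close>
  in the summability of \<open>c\<close> absorbs it when the series is paired term by term.\<close>

lemma nn_pairing_bound:
  assumes d: "dual q q'" and f: "f \<in> Lp m q" and g: "g \<in> Lp m q'"
  obtains K where "0 \<le> K"
    "\<And>n. (\<integral>\<^sup>+x. ennreal (norm (UU n f x * cnj (g x))) \<partial>flow_measure m) \<le> ennreal (real (Suc n) * K)"
proof -
  have real: "\<exists>K\<ge>0. I = ennreal K" if "I < \<infinity>" for I :: ennreal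
    using that by (cases I) auto
  consider "q = 2" "q' = 2" | "q = \<infinity>" "q' = 1" | "q = 1" "q' = \<infinity>" using d unfolding dual_def by blast
  then show thesis
  proof cases
    case 1
    obtain K1 K2 where K: "pint m 2 f = ennreal K1" "pint m 2 g = ennreal K2" "0 \<le> K1" "0 \<le> K2"
      using f g real unfolding 1 L2_iff by metis
    have "(\<integral>\<^sup>+x. ennreal (norm (UU n f x * cnj (g x))) \<partial>flow_measure m) \<le> ennreal (real (Suc n) * (K1 + K2))" for n
    proof -
      let ?N = "real (Suc n)"
      have "(\<integral>\<^sup>+x. ennreal (norm (UU n f x * cnj (g x))) \<partial>flow_measure m)
         \<le> (\<integral>\<^sup>+x. ennreal ?N * (ennreal ((norm (UU n f x) / ?N) powr 2) + ennreal (norm (g x) powr 2)) \<partial>flow_measure m)"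
      proof (rule nn_integral_mono)
        fix x
        let ?u = "norm (UU n f x) / ?N" and ?v = "norm (g x)"
        have "?u * ?v \<le> ?u\<^sup>2 + ?v\<^sup>2"
        proof -
          have "0 \<le> ?u * ?v" by simp
          then show ?thesis using sum_squares_bound[of ?u ?v] by linarith
        qed
        then have "?N * (?u * ?v) \<le> ?N * (?u powr 2 + ?v powr 2)"
          by (intro mult_left_mono) (simp_all add: powr_numeral)
        then have "norm (UU n f x * cnj (g x)) \<le> ?N * (?u powr 2 + ?v powr 2)"
          by (simp add: norm_mult del: of_nat_Suc)
        then have "ennreal (norm (UU n f x * cnj (g x))) \<le> ennreal (?N * (?u powr 2 + ?v powr 2))" by (rule ennreal_leI)
        then show "ennreal (norm (UU n f x * cnj (g x))) \<le> ennreal ?N * (ennreal (?u powr 2) + ennreal (?v powr 2))"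
          by (simp add: ennreal_mult del: of_nat_Suc)
      qed
      also have "\<dots> = ennreal ?N * ((\<integral>\<^sup>+x. ennreal ((norm (UU n f x) / ?N) powr 2) \<partial>flow_measure m) + pint m 2 g)"
        unfolding pint_def by (subst nn_integral_cmult, simp, subst nn_integral_add) simp_all
      also have "\<dots> \<le> ennreal ?N * (pint m 2 f + pint m 2 g)"
        by (intro mult_left_mono add_right_mono nn_integral_UU_powr_le) auto
      also have "\<dots> = ennreal (?N * (K1 + K2))" using K by (simp add: ennreal_mult del: of_nat_Suc)
      finally show ?thesis .
    qed
    then show thesis using K by (intro that[of "K1 + K2"]) auto
  next
    case 2
    obtain B where B: "\<And>x. norm (f x) \<le> B" using f unfolding 2 Lp_infinity_iff by blast
    have B0: "0 \<le> B" using order_trans[OF norm_ge_zero B] .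
    obtain K where K: "pint m 1 g = ennreal K" "0 \<le> K" using g real unfolding 2 L1_iff by metis
    have "(\<integral>\<^sup>+x. ennreal (norm (UU n f x * cnj (g x))) \<partial>flow_measure m) \<le> ennreal (real (Suc n) * (B * K))" for n
    proof -
      have "(\<integral>\<^sup>+x. ennreal (norm (UU n f x * cnj (g x))) \<partial>flow_measure m) \<le> (\<integral>\<^sup>+x. ennreal (real (Suc n) * B) * ennreal (norm (g x)) \<partial>flow_measure m)"
        using B0 by (intro nn_integral_mono) (auto simp: norm_mult ennreal_mult[symmetric] simp del: of_nat_Suc intro!: ennreal_leI mult_right_mono bounded_UU B)
      also have "\<dots> = ennreal (real (Suc n) * B) * pint m 1 g"
        unfolding pint_1 by (rule nn_integral_cmult) simp
      also have "\<dots> = ennreal (real (Suc n) * (B * K))" using K B0 by (simp add: ennreal_mult mult.assoc del: of_nat_Suc)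
      finally show ?thesis .
    qed
    then show thesis using K B0 by (intro that[of "B * K"]) auto
  next
    case 3
    obtain B where B: "\<And>x. norm (g x) \<le> B" using g unfolding 3 Lp_infinity_iff by blast
    have B0: "0 \<le> B" using order_trans[OF norm_ge_zero B] .
    obtain K where K: "pint m 1 f = ennreal K" "0 \<le> K" using f real unfolding 3 L1_iff by metis
    have "(\<integral>\<^sup>+x. ennreal (norm (UU n f x * cnj (g x))) \<partial>flow_measure m) \<le> ennreal (real (Suc n) * (B * K))" for n
    proof -
      have "(\<integral>\<^sup>+x. ennreal (norm (UU n f x * cnj (g x))) \<partial>flow_measure m) \<le> (\<integral>\<^sup>+x. ennreal B * ennreal (norm (UU n f x)) \<partial>flow_measure m)"
        using B0 by (intro nn_integral_mono) (auto simp: norm_mult mult.commute ennreal_mult[symmetric] intro!: ennreal_leI mult_right_mono B)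
      also have "\<dots> = ennreal B * pint m 1 (UU n f)"
        unfolding pint_1 by (rule nn_integral_cmult) simp
      also have "\<dots> \<le> ennreal B * (ennreal (real (Suc n) powr 1) * pint m 1 f)"
        by (intro mult_left_mono pint_UU_le) auto
      also have "\<dots> = ennreal (real (Suc n) * (B * K))" using K B0 by (simp add: ennreal_mult mult_ac del: of_nat_Suc)
      finally show ?thesis .
    qed
    then show thesis using K B0 by (intro that[of "B * K"]) auto
  qed
qed

lemma integrable_pairing:
  assumes "dual q q'" "f \<in> Lp m q" "g \<in> Lp m q'"
  shows "integrable (flow_measure m) (\<lambda>x. f x * cnj (g x))"
proof -
  obtain K where "\<And>n. (\<integral>\<^sup>+x. ennreal (norm (UU n f x * cnj (g x))) \<partial>flow_measure m) \<le> ennreal (real (Suc n) * K)"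
    using nn_pairing_bound[OF assms] by blast
  from this[of 0] show ?thesis by (intro integrableI_bounded) (auto simp: le_less_trans)
qed

lemma pairing_add_left:
  "dual q q' \<Longrightarrow> f \<in> Lp m q \<Longrightarrow> f' \<in> Lp m q \<Longrightarrow> g \<in> Lp m q' \<Longrightarrow>
    pairing m (\<lambda>x. f x + f' x) g = pairing m f g + pairing m f' g"
  unfolding pairing_def distrib_right by (rule Bochner_Integration.integral_add) (rule integrable_pairing; assumption)+

lemma pairing_mult_left: "pairing m (\<lambda>x. c * f x) g = c * pairing m f g"
  unfolding pairing_def by (simp add: mult.assoc)

lemma pairing_sum_left:
  "dual q q' \<Longrightarrow> finite I \<Longrightarrow> (\<And>i. i \<in> I \<Longrightarrow> f i \<in> Lp m q) \<Longrightarrow> g \<in> Lp m q' \<Longrightarrow>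
    pairing m (\<lambda>x. \<Sum>i\<in>I. f i x) g = (\<Sum>i\<in>I. pairing m (f i) g)"
  unfolding pairing_def sum_distrib_right by (rule Bochner_Integration.integral_sum) (blast intro: integrable_pairing)

lemma pairing_avg:
  assumes d: "dual q q'" and f: "f \<in> Lp m q" and g: "g \<in> Lp m q'"
  shows "pairing m (\<lambda>x. avg b f ((p ^^ a) x)) g = pairing m f (\<lambda>x. avg a g ((p ^^ b) x))"
proof -
  have "pairing m (\<lambda>x. avg b f ((p ^^ a) x)) g = pairing m (avg b f) (avg a g)"
    by (rule pairing_pred_pow[OF integrable_pairing[OF d Lp_avg[OF f dual_ge_1(1)[OF d]] g]])
  also have "\<dots> = cnj (pairing m (avg a g) (avg b f))" by (rule pairing_cnj)
  also have "pairing m (avg a g) (avg b f) = pairing m (\<lambda>x. avg a g ((p ^^ b) x)) f"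
    by (rule pairing_pred_pow[OF integrable_pairing[OF dual_sym[OF d] Lp_avg[OF g dual_ge_1(2)[OF d]] f], symmetric])
  also have "cnj \<dots> = pairing m f (\<lambda>x. avg a g ((p ^^ b) x))" by (rule pairing_cnj[symmetric])
  finally show ?thesis .
qed

text \<open>Passing to the adjoint exchanges climbing and averaging, that is, \<open>a\<close> and
  \<open>n - a\<close>, and the sum is symmetric under this exchange.\<close>

lemma pairing_UU:
  assumes d: "dual q q'" and f: "f \<in> Lp m q" and g: "g \<in> Lp m q'"
  shows "pairing m (UU n f) g = pairing m f (UU n g)"
proof -
  have "pairing m (UU n f) g = (\<Sum>a\<le>n. pairing m (\<lambda>x. avg (n - a) f ((p ^^ a) x)) g)"
    unfolding UU_def[abs_def] by (rule pairing_sum_left[OF d]) (use Lp_avg[OF f dual_ge_1(1)[OF d]] g in auto)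
  also have "\<dots> = (\<Sum>a\<le>n. pairing m f (\<lambda>x. avg a g ((p ^^ (n - a)) x)))"
    using pairing_avg[OF d f g] by simp
  also have "\<dots> = (\<Sum>a\<le>n. pairing m f (\<lambda>x. avg (n - a) g ((p ^^ a) x)))"
    by (rule sum.reindex_bij_witness[of _ "\<lambda>a. n - a" "\<lambda>a. n - a"]) auto
  also have "\<dots> = cnj (\<Sum>a\<le>n. pairing m (\<lambda>x. avg (n - a) g ((p ^^ a) x)) f)"
    by (simp flip: pairing_cnj)
  also have "(\<Sum>a\<le>n. pairing m (\<lambda>x. avg (n - a) g ((p ^^ a) x)) f) = pairing m (UU n g) f"
    unfolding UU_def[abs_def] by (rule pairing_sum_left[OF dual_sym[OF d], symmetric]) (use Lp_avg[OF g dual_ge_1(2)[OF d]] f in auto)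
  finally show ?thesis by (simp flip: pairing_cnj)
qed

lemma pairing_Sop_sums:
  assumes c: "summable (\<lambda>n. real (Suc n) * norm (c n))" and d: "dual q q'" and f: "f \<in> Lp m q" and g: "g \<in> Lp m q'"
  shows "(\<lambda>n. c n * pairing m (UU n f) g) sums pairing m (Sop c f) g"
proof -
  note q = dual_ge_1[OF d]
  obtain K where K: "0 \<le> K" "\<And>n. (\<integral>\<^sup>+x. ennreal (norm (UU n f x * cnj (g x))) \<partial>flow_measure m) \<le> ennreal (real (Suc n) * K)"
    using nn_pairing_bound[OF d f g] by blast
  have i: "integrable (flow_measure m) (\<lambda>x. c n * (UU n f x * cnj (g x)))" for n
    using integrable_pairing[OF d Lp_UU[OF f q(1)] g] by (rule integrable_mult_right)
  have s: "summable (\<lambda>n. norm (c n * UU n f x))" for x by (rule summable_Sop[OF c Lp_tame[OF f q(1)]])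
  have "(\<lambda>n. \<integral>x. c n * (UU n f x * cnj (g x)) \<partial>flow_measure m) sums (\<integral>x. (\<Sum>n. c n * (UU n f x * cnj (g x))) \<partial>flow_measure m)"
  proof (rule sums_integral[OF i])
    show "AE x in flow_measure m. summable (\<lambda>n. norm (c n * (UU n f x * cnj (g x))))"
    proof (rule AE_I2)
      fix x
      show "summable (\<lambda>n. norm (c n * (UU n f x * cnj (g x))))"
        using summable_mult2[OF s[of x], of "norm (cnj (g x))"] by (simp add: norm_mult mult.assoc)
    qed
    show "summable (\<lambda>n. \<integral>x. norm (c n * (UU n f x * cnj (g x))) \<partial>flow_measure m)"
    proof (rule summable_comparison_test)
      show "summable (\<lambda>n. real (Suc n) * norm (c n) * K)" using c by (rule summable_mult2)
      have "(\<integral>x. norm (c n * (UU n f x * cnj (g x))) \<partial>flow_measure m) \<le> real (Suc n) * norm (c n) * K" for n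
      proof -
        have "ennreal (\<integral>x. norm (UU n f x * cnj (g x)) \<partial>flow_measure m) = (\<integral>\<^sup>+x. ennreal (norm (UU n f x * cnj (g x))) \<partial>flow_measure m)"
          by (rule nn_integral_eq_integral[symmetric]) (use integrable_pairing[OF d Lp_UU[OF f q(1)] g] in auto)
        also have "\<dots> \<le> ennreal (real (Suc n) * K)" by (rule K(2))
        finally have "(\<integral>x. norm (UU n f x * cnj (g x)) \<partial>flow_measure m) \<le> real (Suc n) * K"
          using K(1) by (subst (asm) ennreal_le_iff) auto
        from mult_left_mono[OF this, of "norm (c n)"] show ?thesis
          by (simp only: norm_mult[of "c n"] integral_mult_right_zero norm_ge_zero mult_ac)
      qed
      then show "\<exists>N. \<forall>n\<ge>N. norm (\<integral>x. norm (c n * (UU n f x * cnj (g x))) \<partial>flow_measure m) \<le> real (Suc n) * norm (c n) * K"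
        by (intro exI[of _ 0]) simp
    qed
  qed
  moreover have "(\<Sum>n. c n * (UU n f x * cnj (g x))) = Sop c f x * cnj (g x)" for x
    unfolding Sop_def using suminf_mult2[OF summable_norm_cancel[OF s[of x]], of "cnj (g x)"] by (simp add: mult.assoc)
  ultimately show ?thesis unfolding pairing_def by simp
qed

lemma pairing_Sop:
  assumes c: "summable (\<lambda>n. real (Suc n) * norm (c n))" and d: "dual q q'" and f: "f \<in> Lp m q" and g: "g \<in> Lp m q'"
  shows "pairing m (Sop c f) g = pairing m f (Sop (\<lambda>n. cnj (c n)) g)"
proof -
  have "(\<lambda>n. cnj (c n) * pairing m (UU n g) f) sums pairing m (Sop (\<lambda>n. cnj (c n)) g) f"
    by (rule pairing_Sop_sums[OF _ dual_sym[OF d] g f]) (use c in simp)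
  then have "(\<lambda>n. cnj (cnj (c n) * pairing m (UU n g) f)) sums cnj (pairing m (Sop (\<lambda>n. cnj (c n)) g) f)"
    by (simp only: sums_cnj)
  moreover have "cnj (pairing m (UU n g) f) = pairing m (UU n f) g" for n
    using pairing_UU[OF d f g, of n] pairing_cnj[of f "UU n g"] by simp
  ultimately have "(\<lambda>n. c n * pairing m (UU n f) g) sums pairing m f (Sop (\<lambda>n. cnj (c n)) g)"
    by (simp only: complex_cnj_mult complex_cnj_cnj pairing_cnj[of f "Sop (\<lambda>n. cnj (c n)) g"])
  then show ?thesis using pairing_Sop_sums[OF c d f g] sums_unique2 by blast
qed

lemma pint_finite_support:
  assumes "finite {x. f x \<noteq> 0}" "0 < r"
  shows "pint m r f < \<infinity>"
proof -
  let ?S = "{x. f x \<noteq> 0}"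
  have "pint m r f = (\<integral>\<^sup>+x. ennreal (m x) * ennreal (norm (f x) powr r) * indicator ?S x \<partial>count_space UNIV)"
    unfolding pint_def nn_integral_flow by (rule nn_integral_cong) (auto split: split_indicator)
  also have "\<dots> = (\<integral>\<^sup>+x. ennreal (m x) * ennreal (norm (f x) powr r) \<partial>count_space ?S)"
    by (subst nn_integral_count_space_indicator) auto
  also have "\<dots> = (\<Sum>x\<in>?S. ennreal (m x) * ennreal (norm (f x) powr r))"
    by (rule nn_integral_count_space_finite[OF assms(1)])
  also have "\<dots> < \<infinity>" using assms(1) by (simp add: ennreal_mult_less_top)
  finally show ?thesis .
qed

lemma Lp_finite_support:
  assumes "finite {x. f x \<noteq> 0}" "1 \<le> q"
  shows "f \<in> Lp m q"
proof (cases "q = \<infinity>")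
  case True
  have "finite (insert 0 ((\<lambda>x. norm (f x)) ` {x. f x \<noteq> 0}))" using assms(1) by simp
  then have "norm (f x) \<le> Max (insert 0 ((\<lambda>x. norm (f x)) ` {x. f x \<noteq> 0}))" for x
    by (intro Max_ge) auto
  then show ?thesis unfolding True Lp_infinity_iff by blast
next
  case False
  then show ?thesis
    using pint_finite_support[OF assms(1), of "enn2real q"] ennreal_real_ge_1[OF assms(2) False]
    unfolding mem_Lp_iff[OF False] by simp
qed

lemma Lp_delta: "1 \<le> q \<Longrightarrow> delta x \<in> Lp m q"
  by (rule Lp_finite_support) (auto simp: delta_def)

lemma pairing_delta: "pairing m f (delta x) = of_real (m x) * f x"
proof -
  have "pairing m f (delta x) = (\<integral>y. of_real (m y) * (f y * cnj (delta x y)) \<partial>count_space UNIV)"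
    unfolding pairing_def by (rule integral_flow)
  also have "\<dots> = (\<Sum>y\<in>{y \<in> UNIV. of_real (m y) * (f y * cnj (delta x y)) \<noteq> 0}. of_real (m y) * (f y * cnj (delta x y)))"
    by (rule lebesgue_integral_count_space_finite_support) (rule finite_subset[of _ "{x}"], auto simp: delta_def)
  also have "\<dots> = (\<Sum>y\<in>{x}. of_real (m y) * (f y * cnj (delta x y)))"
    by (rule sum.mono_neutral_left) (auto simp: delta_def)
  finally show ?thesis by (simp add: delta_def)
qed

lemma pairing_eqI:
  assumes "\<And>g. g \<in> Lp m q \<Longrightarrow> pairing m f g = pairing m f' g" "1 \<le> q"
  shows "f = f'"
proof
  fix x
  from assms(1)[OF Lp_delta[OF assms(2), of x]] show "f x = f' x" by (simp add: pairing_delta)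
qed

section \<open>The flow Laplacian on L^2 and its positivity\<close>

abbreviation L2 :: "('a \<Rightarrow> complex) set" where "L2 \<equiv> Lp m 2"

lemma dual_2: "dual 2 2" by (simp add: dual_def)

lemma ge_2: "(1::ennreal) \<le> 2" by simp

lemma L2_pred: "f \<in> L2 \<Longrightarrow> (\<lambda>x. f (p x)) \<in> L2"
  using Lp_avg[of f 2 0 1] by simp

lemma L2_avg: "f \<in> L2 \<Longrightarrow> avg (Suc 0) f \<in> L2"
  using Lp_avg[of f 2 1 0] by simp

lemma L2_lin: "f \<in> L2 \<Longrightarrow> g \<in> L2 \<Longrightarrow> (\<lambda>x. a * f x + b * g x) \<in> L2"
  by (intro Lp_add Lp_mult)

lemma pairing_lin: "f \<in> L2 \<Longrightarrow> g \<in> L2 \<Longrightarrow> h \<in> L2 \<Longrightarrow> pairing m (\<lambda>x. a * f x + b * g x) h = a * pairing m f h + b * pairing m g h"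
  using pairing_add_left[OF dual_2 Lp_mult Lp_mult, of f g h a b] by (simp add: pairing_mult_left)

lemma L2_adjoint_gradient:
  assumes g: "g \<in> L2"
  shows "L2_adjoint m (flow_gradient T) g = (\<lambda>x. 1 * g x + (-1) * avg (Suc 0) g x)" (is "_ = ?h")
  unfolding L2_adjoint_def
proof (rule the_equality)
  have grad: "flow_gradient T f = (\<lambda>x. 1 * f x + (-1) * f (p x))" for f
    by (simp add: flow_gradient_def fun_eq_iff)
  have "pairing m (flow_gradient T f) g = pairing m f ?h" if f: "f \<in> L2" for f
  proof -
    have "pairing m (flow_gradient T f) g = pairing m f g - pairing m (\<lambda>x. f (p x)) g"
      unfolding grad pairing_lin[OF f L2_pred[OF f] g] by simp
    also have "pairing m (\<lambda>x. f (p x)) g = pairing m f (avg (Suc 0) g)"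
      using pairing_avg[OF dual_2 f g, of 0 1] by simp
    also have "pairing m f g - pairing m f (avg (Suc 0) g) = cnj (pairing m g f - pairing m (avg (Suc 0) g) f)"
      unfolding complex_cnj_diff by (simp flip: pairing_cnj)
    also have "pairing m g f - pairing m (avg (Suc 0) g) f = pairing m ?h f"
      unfolding pairing_lin[OF g L2_avg[OF g] f] by simp
    finally show ?thesis by (simp flip: pairing_cnj)
  qed
  note main = this
  then show "?h \<in> L2 \<and> (\<forall>f\<in>L2. pairing m (flow_gradient T f) g = pairing m f ?h)"
    using L2_lin[OF g L2_avg[OF g]] by blast
  fix h assume h: "h \<in> L2 \<and> (\<forall>f\<in>L2. pairing m (flow_gradient T f) g = pairing m f h)"
  show "h = ?h"
  proof (rule pairing_eqI[OF _ ge_2])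
    fix f assume f: "f \<in> L2"
    have "pairing m f h = pairing m f ?h" using main[OF f] h f by simp
    then show "pairing m h f = pairing m ?h f"
      by (simp only: pairing_cnj[of h f] pairing_cnj[of ?h f])
  qed
qed

definition lap :: "('a \<Rightarrow> complex) \<Rightarrow> 'a \<Rightarrow> complex" where
  "lap f x = f x - Av f x"

lemma avg_pred: "avg (Suc 0) (\<lambda>x. f (p x)) = f"
proof
  fix x
  have "(\<Sum>y\<in>desc (Suc 0) x. f (p y) * of_real (m y)) = f x * of_real (\<Sum>y\<in>desc (Suc 0) x. m y)"
    unfolding of_real_sum sum_distrib_left by (rule sum.cong) (auto simp: mem_desc)
  then show "avg (Suc 0) (\<lambda>x. f (p x)) x = f x" by (simp add: avg_def mass_desc)
qed

text \<open>\<open>(1 - R) (1 - S) / 2 = 1 - (S + R) / 2\<close> because \<open>R S = 1\<close>. The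
  claim is confined to \<open>L2\<close>, where the description of the adjoint is known to have a
  solution.\<close>

lemma flow_laplacian_eq:
  assumes f: "f \<in> L2"
  shows "flow_laplacian T m f = lap f"
proof
  fix x
  have grad: "flow_gradient T f = (\<lambda>x. 1 * f x + (-1) * f (p x))"
    by (simp add: flow_gradient_def fun_eq_iff)
  have "avg (Suc 0) (flow_gradient T f) x = avg (Suc 0) f x - f x"
    unfolding grad avg_add avg_mult avg_pred by simp
  then show "flow_laplacian T m f x = lap f x"
    using L2_adjoint_gradient[OF L2_lin[OF f L2_pred[OF f], of 1 "-1"]]
    by (simp add: flow_laplacian_def lap_def Av_def grad add_divide_distrib diff_divide_distrib)
qed

lemma L2_Av: "f \<in> L2 \<Longrightarrow> Av f \<in> L2"
  using L2_lin[OF L2_pred L2_avg, of f f "1/2" "1/2"] by (simp add: Av_def[abs_def] add_divide_distrib)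

lemma lap_lin: "lap (\<lambda>x. a * f x + b * g x) = (\<lambda>x. a * lap f x + b * lap g x)"
  by (rule ext) (simp add: lap_def Av_def avg_add avg_mult algebra_simps add_divide_distrib)

lemma lap_eq: "lap f = (\<lambda>x. 1 * f x + (-1) * Av f x)"
  by (rule ext) (simp add: lap_def)

lemma L2_lap: "f \<in> L2 \<Longrightarrow> lap f \<in> L2"
  unfolding lap_eq by (intro L2_lin L2_Av)

text \<open>\<open>BB\<close> is \<open>L / 2\<close> and \<open>CC\<close> is
  \<open>1 - L / 2\<close>. They commute, are positive and add up to the identity, like
  \<open>t\<close> and \<open>1 - t\<close> on \<open>[0, 1]\<close>.\<close>

definition BB :: "('a \<Rightarrow> complex) \<Rightarrow> 'a \<Rightarrow> complex" where
  "BB f = (\<lambda>x. (1/2) * f x + (-1/2) * Av f x)"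

definition CC :: "('a \<Rightarrow> complex) \<Rightarrow> 'a \<Rightarrow> complex" where
  "CC f = (\<lambda>x. (1/2) * f x + (1/2) * Av f x)"

lemma L2_BB: "f \<in> L2 \<Longrightarrow> BB f \<in> L2" and L2_CC: "f \<in> L2 \<Longrightarrow> CC f \<in> L2"
  unfolding BB_def CC_def by (intro L2_lin L2_Av; assumption)+

lemma L2_BB_pow: "f \<in> L2 \<Longrightarrow> (BB ^^ k) f \<in> L2" by (induction k) (auto intro: L2_BB)

lemma L2_CC_pow: "f \<in> L2 \<Longrightarrow> (CC ^^ k) f \<in> L2" by (induction k) (auto intro: L2_CC)

lemma Av_lin: "Av (\<lambda>x. a * f x + b * g x) = (\<lambda>x. a * Av f x + b * Av g x)"
  by (rule ext) (simp add: Av_def avg_add avg_mult algebra_simps add_divide_distrib)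

lemma BB_lin: "BB (\<lambda>x. a * f x + b * g x) = (\<lambda>x. a * BB f x + b * BB g x)"
  and CC_lin: "CC (\<lambda>x. a * f x + b * g x) = (\<lambda>x. a * CC f x + b * CC g x)"
  unfolding BB_def CC_def Av_lin by (rule ext, simp add: algebra_simps)+

lemma BB_CC: "BB (CC f) = CC (BB f)"
  unfolding BB_def CC_def Av_lin by (rule ext) (simp add: algebra_simps)

lemma BB_plus_CC: "BB f x + CC f x = f x"
  by (simp add: BB_def CC_def)

lemma CC_BB_pow: "CC ((BB ^^ k) f) = (BB ^^ k) (CC f)"
  by (induction k) (auto simp: BB_CC[symmetric])

lemma BB_CC_pow: "BB ((CC ^^ k) f) = (CC ^^ k) (BB f)"
  by (induction k) (auto simp: BB_CC)

lemma pairing_Av: "f \<in> L2 \<Longrightarrow> g \<in> L2 \<Longrightarrow> pairing m (Av f) g = pairing m f (Av g)"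
proof -
  assume fg: "f \<in> L2" "g \<in> L2"
  have U: "UU (Suc 0) h = (\<lambda>x. 2 * Av h x)" for h by (rule ext) (rule UU_1)
  have "2 * pairing m (Av f) g = pairing m f (\<lambda>x. 2 * Av g x)"
    using pairing_UU[OF dual_2 fg, of "Suc 0"] unfolding U pairing_mult_left .
  also have "\<dots> = 2 * pairing m f (Av g)"
    by (subst (1 2) pairing_cnj) (simp add: pairing_mult_left)
  finally show ?thesis by simp
qed

lemma pairing_lin_right: "f \<in> L2 \<Longrightarrow> g \<in> L2 \<Longrightarrow> h \<in> L2 \<Longrightarrow> pairing m h (\<lambda>x. a * f x + b * g x) = cnj a * pairing m h f + cnj b * pairing m h g"
  by (subst (1 2 3) pairing_cnj) (simp add: pairing_lin)

lemma pairing_BB: "f \<in> L2 \<Longrightarrow> g \<in> L2 \<Longrightarrow> pairing m (BB f) g = pairing m f (BB g)"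
  and pairing_CC: "f \<in> L2 \<Longrightarrow> g \<in> L2 \<Longrightarrow> pairing m (CC f) g = pairing m f (CC g)"
proof -
  have gen: "pairing m (\<lambda>x. (1/2) * f x + s * Av f x) g = pairing m f (\<lambda>x. (1/2) * g x + s * Av g x)"
    if f: "f \<in> L2" and g: "g \<in> L2" and "cnj s = s" for f g s
    unfolding pairing_lin[OF f L2_Av[OF f] g] pairing_lin_right[OF g L2_Av[OF g] f] pairing_Av[OF f g]
    using that by simp
  show "f \<in> L2 \<Longrightarrow> g \<in> L2 \<Longrightarrow> pairing m (BB f) g = pairing m f (BB g)"
    unfolding BB_def by (rule gen) simp_all
  show "f \<in> L2 \<Longrightarrow> g \<in> L2 \<Longrightarrow> pairing m (CC f) g = pairing m f (CC g)"
    unfolding CC_def by (rule gen) simp_all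
qed

lemma pairing_self_nonneg: "0 \<le> Re (pairing m f f)"
proof -
  have "pairing m f f = of_real (\<integral>x. (norm (f x))\<^sup>2 \<partial>flow_measure m)"
    unfolding pairing_def complex_norm_square[symmetric] by (rule integral_complex_of_real)
  then show ?thesis by simp
qed

text \<open>Four times the form is \<open>|f - S f|^2\<close> for \<open>BB\<close> and
  \<open>|f + S f|^2\<close> for \<open>CC\<close>, because \<open>S\<close> is an isometry with
  adjoint \<open>R\<close>.\<close>

lemma BB_CC_nonneg_1:
  assumes f: "f \<in> L2"
  shows "0 \<le> Re (pairing m (BB f) f)" "0 \<le> Re (pairing m (CC f) f)"
proof -
  have gen: "0 \<le> Re (pairing m (\<lambda>x. (1/2) * f x + (s/2) * Av f x) f)" if s: "s = 1 \<or> s = -1" for s :: complex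
  proof -
    define g where "g = (\<lambda>x. 1 * f x + s * f (p x))"
    have g: "g \<in> L2" unfolding g_def by (intro L2_lin f L2_pred)
    have cs: "cnj s = s" "s * s = 1" using s by auto
    have "pairing m g g = pairing m g f + cnj s * pairing m g (\<lambda>x. f (p x))"
      using pairing_lin_right[OF f L2_pred[OF f] g, of 1 s] unfolding g_def[symmetric] by simp
    also have "pairing m g (\<lambda>x. f (p x)) = pairing m (avg (Suc 0) g) f"
      using pairing_avg[OF dual_2 g f, of 1 0] by simp
    also have "avg (Suc 0) g = (\<lambda>x. 1 * avg (Suc 0) f x + s * f x)"
      by (rule ext) (simp add: g_def avg_add avg_mult avg_pred)
    also have "pairing m g f + cnj s * pairing m (\<lambda>x. 1 * avg (Suc 0) f x + s * f x) f
        = 2 * pairing m f f + s * (pairing m (\<lambda>x. f (p x)) f + pairing m (avg (Suc 0) f) f)"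
      unfolding g_def pairing_lin[OF f L2_pred[OF f] f] pairing_lin[OF L2_avg[OF f] f f] cs
      using cs by (simp add: algebra_simps)
    also have "pairing m (\<lambda>x. f (p x)) f + pairing m (avg (Suc 0) f) f = 2 * pairing m (Av f) f"
    proof -
      have "Av f = (\<lambda>x. (1/2) * f (p x) + (1/2) * avg (Suc 0) f x)" by (rule ext) (simp add: Av_def add_divide_distrib)
      then show ?thesis using pairing_lin[OF L2_pred[OF f] L2_avg[OF f] f, of "1/2" "1/2"] by simp
    qed
    finally have "pairing m g g = 4 * pairing m (\<lambda>x. (1/2) * f x + (s/2) * Av f x) f"
      unfolding pairing_lin[OF f L2_Av[OF f] f] by (simp add: algebra_simps)
    then show ?thesis using pairing_self_nonneg[of g] by simp
  qed
  show "0 \<le> Re (pairing m (BB f) f)" "0 \<le> Re (pairing m (CC f) f)"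
    unfolding BB_def CC_def using gen[of "-1"] gen[of 1] by simp_all
qed

text \<open>Even powers are moved across the pairing; for the product of the two operators, use that
  they add up to the identity.\<close>

lemma BB_CC_nonneg: "f \<in> L2 \<Longrightarrow> 0 \<le> Re (pairing m ((BB ^^ k) ((CC ^^ j) f)) f)"
proof (induction k arbitrary: f rule: induct_nat_012)
  case 0
  then show ?case
  proof (induction j arbitrary: f rule: induct_nat_012)
    case (ge2 j)
    have "pairing m ((CC ^^ Suc (Suc j)) f) f = pairing m ((CC ^^ j) (CC f)) (CC f)"
      using pairing_CC[OF L2_CC_pow[OF ge2(3), of "Suc j"] ge2(3)] by (simp add: funpow_swap1)
    then show ?case using ge2(1)[OF L2_CC[OF ge2(3)]] by simp
  qed (auto simp: pairing_self_nonneg BB_CC_nonneg_1)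
next
  case 1
  then show ?case
  proof (induction j arbitrary: f rule: induct_nat_012)
    case (ge2 j)
    have "(CC ^^ Suc (Suc j)) f = CC ((CC ^^ j) (CC f))" by (simp add: funpow_swap1)
    then have "(BB ^^ 1) ((CC ^^ Suc (Suc j)) f) = CC (BB ((CC ^^ j) (CC f)))" by (simp add: BB_CC)
    then have "pairing m ((BB ^^ 1) ((CC ^^ Suc (Suc j)) f)) f = pairing m ((BB ^^ 1) ((CC ^^ j) (CC f))) (CC f)"
      using pairing_CC[OF L2_BB[OF L2_CC_pow[OF L2_CC[OF ge2(3)]]] ge2(3), of j] by simp
    then show ?case using ge2(1)[OF L2_CC[OF ge2(3)]] by simp
  next
    case 1
    define h where "h = BB (CC f)"
    have h: "h \<in> L2" unfolding h_def by (intro L2_BB L2_CC 1)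
    have "h = (\<lambda>x. 1 * BB h x + 1 * CC h x)" by (rule ext) (simp add: BB_plus_CC)
    then have "pairing m h f = pairing m (BB h) f + pairing m (CC h) f"
      using pairing_lin[OF L2_BB[OF h] L2_CC[OF h] 1, of 1 1] by simp
    also have "pairing m (BB h) f = pairing m (CC (BB f)) (BB f)"
      using pairing_BB[OF h 1] by (simp add: h_def BB_CC)
    also have "pairing m (CC h) f = pairing m (BB (CC f)) (CC f)"
      using pairing_CC[OF h 1] by (simp add: h_def)
    finally show ?case
      using BB_CC_nonneg_1(2)[OF L2_BB[OF 1]] BB_CC_nonneg_1(1)[OF L2_CC[OF 1]] by (simp add: h_def)
  qed (auto simp: BB_CC_nonneg_1)
next
  case (ge2 k)
  have "(BB ^^ Suc (Suc k)) ((CC ^^ j) f) = BB ((BB ^^ k) ((CC ^^ j) (BB f)))"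
    by (simp add: BB_CC_pow funpow_swap1)
  then have "pairing m ((BB ^^ Suc (Suc k)) ((CC ^^ j) f)) f = pairing m ((BB ^^ k) ((CC ^^ j) (BB f))) (BB f)"
    using pairing_BB[OF L2_BB_pow[OF L2_CC_pow[OF L2_BB[OF ge2(3)]]] ge2(3)] by simp
  then show ?case using ge2(1)[OF L2_BB[OF ge2(3)]] by simp
qed

end

section \<open>Spectral measures and the Borel calculus\<close>

lemma integrable_bounded_support:
  fixes g :: "real \<Rightarrow> 'b::{banach, second_countable_topology}"
  assumes "sets \<mu> = sets borel" "finite_measure \<mu>" "AE t in \<mu>. t \<in> {a..b}" "continuous_on UNIV g"
  shows "integrable \<mu> g"
proof -
  interpret finite_measure \<mu> by fact
  have "compact (g ` {a..b})" by (intro compact_continuous_image continuous_on_subset[OF assms(4)]) auto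
  then obtain B where B: "\<And>t. t \<in> {a..b} \<Longrightarrow> norm (g t) \<le> B" by (metis compact_imp_bounded bounded_iff imageI)
  show ?thesis
  proof (rule integrable_const_bound[of _ B])
    show "AE t in \<mu>. norm (g t) \<le> B" using assms(3) by (rule eventually_mono) (rule B)
    show "g \<in> borel_measurable \<mu>"
      unfolding measurable_cong_sets[OF assms(1) refl] by (rule borel_measurable_continuous_onI[OF assms(4)])
  qed
qed

lemma continuous_chebU [continuous_intros]:
  "continuous_on S f \<Longrightarrow> continuous_on S (\<lambda>x. chebU n (f x))"
  by (induction n rule: induct_nat_012) (auto intro!: continuous_intros)

text \<open>The argument is \<open>1 - x\<close> because \<open>UU n\<close> is the \<open>n\<close>-th Chebyshev polynomial of the operator
  \<open>1 - lap\<close>.\<close>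

definition expansion :: "(real \<Rightarrow> complex) \<Rightarrow> (nat \<Rightarrow> complex) \<Rightarrow> bool" where
  "expansion F c \<longleftrightarrow> F \<in> borel_measurable borel \<and> summable (\<lambda>n. real (Suc n) * norm (c n)) \<and>
     (\<forall>x\<in>{-1..1}. (\<lambda>n. c n * complex_of_real (chebU n x)) sums F (1 - x))"

context flow_tree
begin

text \<open>The forms of \<open>BB ^^ k\<close> composed with \<open>CC ^^ j\<close> solve the
  Hausdorff problem: positivity is \<open>BB_CC_nonneg\<close>, and the splitting rule is
  \<open>BB + CC = 1\<close>. The measure obtained on \<open>[0, 1]\<close> is dilated by two, since
  \<open>lap\<close> is twice \<open>BB\<close>.\<close>

lemma spectral_measure_exists:
  assumes f: "f \<in> L2"
  obtains \<mu> :: "real measure" where "sets \<mu> = sets borel" "finite_measure \<mu>" "emeasure \<mu> (- {-2..2}) = 0"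
    "AE t in \<mu>. t \<in> {0..2}" "\<And>n. pairing m ((lap ^^ n) f) f = (\<integral>t. of_real (t ^ n) \<partial>\<mu>)"
proof -
  define D where "D j k = Re (pairing m ((BB ^^ k) ((CC ^^ j) f)) f)" for j k
  have "\<exists>\<nu> :: real measure. sets \<nu> = sets borel \<and> finite_measure \<nu> \<and> emeasure \<nu> (- {0..1}) = 0 \<and> (\<forall>n. (\<integral>t. t ^ n \<partial>\<nu>) = D 0 n)"
  proof (rule hausdorff_moment_problem)
    show "0 \<le> D j k" for j k unfolding D_def by (rule BB_CC_nonneg[OF f])
    show "D (Suc j) k + D j (Suc k) = D j k" for j k
    proof -
      let ?h = "(BB ^^ k) ((CC ^^ j) f)"
      have h: "?h \<in> L2" by (intro L2_BB_pow L2_CC_pow f)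
      have "(\<lambda>x. 1 * CC ?h x + 1 * BB ?h x) = ?h" by (rule ext) (simp add: BB_plus_CC add.commute)
      then have "pairing m ?h f = pairing m (CC ?h) f + pairing m (BB ?h) f"
        using pairing_lin[OF L2_CC[OF h] L2_BB[OF h] f, of 1 1] by simp
      then show ?thesis unfolding D_def by (simp add: CC_BB_pow)
    qed
  qed
  then obtain \<nu> :: "real measure" where \<nu>: "sets \<nu> = sets borel" "finite_measure \<nu>" "emeasure \<nu> (- {0..1}) = 0" "\<And>n. (\<integral>t. t ^ n \<partial>\<nu>) = D 0 n" by blast
  interpret \<nu>: finite_measure \<nu> by fact
  define \<mu> where "\<mu> = distr \<nu> borel (\<lambda>t. 2 * t)"
  have meas: "(\<lambda>t. 2 * t) \<in> measurable \<nu> borel" unfolding measurable_cong_sets[OF \<nu>(1) refl] by simp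
  have s: "sets \<mu> = sets borel" by (simp add: \<mu>_def)
  have fin: "finite_measure \<mu>" unfolding \<mu>_def by (rule \<nu>.finite_measure_distr[OF meas])
  have space: "space \<nu> = UNIV" using sets_eq_imp_space_eq[OF \<nu>(1)] by simp
  have ae: "AE t in \<nu>. t \<in> {0..1}" by (rule AE_I'[of "- {0..1}"]) (use \<nu> in \<open>auto simp: null_sets_def\<close>)
  have ae2: "AE t in \<mu>. t \<in> {0..2}"
    unfolding \<mu>_def by (subst AE_distr_iff[OF meas]) (use ae in \<open>auto elim: eventually_mono\<close>)
  have sup: "emeasure \<mu> (- {-2..2}) = 0"
  proof -
    have "emeasure \<mu> (- {0..2}) = 0"
      using ae2 by (subst (asm) AE_iff_measurable[of "- {0..2}"]) (auto simp: s sets_eq_imp_space_eq[OF s])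
    moreover have "emeasure \<mu> (- {-2..2}) \<le> emeasure \<mu> (- {0..2})" by (rule emeasure_mono) (auto simp: s)
    ultimately show ?thesis by simp
  qed
  have lapB: "lap g = (\<lambda>x. 2 * BB g x + 0 * g x)" for g by (rule ext) (simp add: lap_def BB_def)
  have lap_pow: "(lap ^^ n) f = (\<lambda>x. 2 ^ n * (BB ^^ n) f x)" for n
  proof (induction n)
    case (Suc n)
    have "BB (\<lambda>x. 2 ^ n * (BB ^^ n) f x + 0 * f x) = (\<lambda>x. 2 ^ n * BB ((BB ^^ n) f) x + 0 * BB f x)"
      by (rule BB_lin)
    moreover have "(lap ^^ Suc n) f = lap (\<lambda>x. 2 ^ n * (BB ^^ n) f x)" using Suc by simp
    ultimately show ?case using lapB[of "\<lambda>x. 2 ^ n * (BB ^^ n) f x"] by (simp add: mult.assoc)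
  qed simp
  have mom: "pairing m ((lap ^^ n) f) f = (\<integral>t. of_real (t ^ n) \<partial>\<mu>)" for n
  proof -
    \<comment> \<open>Self-adjointness makes the moments real, so taking real parts in
      \<open>D\<close> loses nothing.\<close>
    have sym: "pairing m ((BB ^^ n) f) f = pairing m f ((BB ^^ n) f)"
    proof -
      have "g \<in> L2 \<Longrightarrow> pairing m ((BB ^^ n) f) g = pairing m f ((BB ^^ n) g)" for g
      proof (induction n arbitrary: g)
        case (Suc n)
        have "pairing m ((BB ^^ Suc n) f) g = pairing m ((BB ^^ n) f) (BB g)"
          using pairing_BB[OF L2_BB_pow[OF f] Suc(2)] by simp
        also have "\<dots> = pairing m f ((BB ^^ n) (BB g))" by (rule Suc(1)[OF L2_BB[OF Suc(2)]])
        finally show ?case by (simp add: funpow_swap1)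
      qed simp
      from this[OF f] show ?thesis .
    qed
    have "Im (pairing m ((BB ^^ n) f) f) = 0"
      using arg_cong[OF pairing_cnj[of "(BB ^^ n) f" f], of Im] unfolding sym[symmetric] by simp
    then have "pairing m ((BB ^^ n) f) f = of_real (D 0 n)" by (simp add: D_def complex_eq_iff)
    then have "pairing m ((lap ^^ n) f) f = 2 ^ n * of_real (\<integral>t. t ^ n \<partial>\<nu>)"
      unfolding lap_pow pairing_mult_left \<nu>(4) by simp
    also have "\<dots> = of_real (\<integral>t. (2 * t) ^ n \<partial>\<nu>)" by (simp add: power_mult_distrib)
    also have "(\<integral>t. (2 * t) ^ n \<partial>\<nu>) = (\<integral>t. t ^ n \<partial>\<mu>)"
      unfolding \<mu>_def by (rule integral_distr[OF meas, symmetric]) simp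
    finally show ?thesis by (simp only: integral_complex_of_real)
  qed
  show thesis by (rule that[OF s fin sup ae2 mom])
qed

lemma flow_laplacian_pow:
  assumes f: "f \<in> L2"
  shows "(flow_laplacian T m ^^ n) f = (lap ^^ n) f" "(lap ^^ n) f \<in> L2"
proof (induction n)
  case (Suc n)
  show "(lap ^^ Suc n) f \<in> L2" using Suc(2) by (simp add: L2_lap)
  show "(flow_laplacian T m ^^ Suc n) f = (lap ^^ Suc n) f" using Suc by (simp add: flow_laplacian_eq)
qed (use f in simp_all)

text \<open>Uniqueness in the description comes from \<open>moments_determine_measure\<close>; a
  competitor may be supported in any compact interval, hence the two radii there.\<close>

lemma spectral_measure_props:
  assumes f: "f \<in> L2"
  defines "\<mu> \<equiv> spectral_measure m (flow_laplacian T m) f"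
  shows "sets \<mu> = sets borel" "finite_measure \<mu>" "AE t in \<mu>. t \<in> {0..2}"
    "pairing m ((lap ^^ n) f) f = (\<integral>t. of_real (t ^ n) \<partial>\<mu>)"
proof -
  obtain \<nu> :: "real measure" where \<nu>: "sets \<nu> = sets borel" "finite_measure \<nu>" "emeasure \<nu> (- {-2..2}) = 0"
    "AE t in \<nu>. t \<in> {0..2}" "\<And>n. pairing m ((lap ^^ n) f) f = (\<integral>t. of_real (t ^ n) \<partial>\<nu>)"
    using spectral_measure_exists[OF f] by blast
  have e: "spectral_measure m (flow_laplacian T m) f = \<nu>"
    unfolding spectral_measure_def flow_laplacian_pow(1)[OF f]
  proof (rule the_equality)
    show "sets \<nu> = sets borel \<and> finite_measure \<nu> \<and> (\<exists>R. emeasure \<nu> (- {-R..R}) = 0) \<and>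
        (\<forall>n. pairing m ((lap ^^ n) f) f = (\<integral>t. of_real (t ^ n) \<partial>\<nu>))"
      using \<nu> by blast
    fix \<kappa> :: "real measure"
    assume \<kappa>: "sets \<kappa> = sets borel \<and> finite_measure \<kappa> \<and> (\<exists>R. emeasure \<kappa> (- {-R..R}) = 0) \<and>
        (\<forall>n. pairing m ((lap ^^ n) f) f = (\<integral>t. of_real (t ^ n) \<partial>\<kappa>))"
    then obtain R where R: "emeasure \<kappa> (- {-R..R}) = 0" by blast
    have "complex_of_real (\<integral>t. t ^ n \<partial>\<kappa>) = complex_of_real (\<integral>t. t ^ n \<partial>\<nu>)" for n
      unfolding integral_complex_of_real[symmetric] using \<kappa> \<nu>(5)[of n] by simp
    then have "(\<integral>t. t ^ n \<partial>\<kappa>) = (\<integral>t. t ^ n \<partial>\<nu>)" for n by (simp only: of_real_eq_iff)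
    then show "\<kappa> = \<nu>" using \<kappa> \<nu> R by (intro moments_determine_measure[of _ R _ 2]) auto
  qed
  show "sets \<mu> = sets borel" "finite_measure \<mu>" "AE t in \<mu>. t \<in> {0..2}"
    "pairing m ((lap ^^ n) f) f = (\<integral>t. of_real (t ^ n) \<partial>\<mu>)"
    unfolding \<mu>_def e by (rule \<nu>)+
qed

text \<open>\<open>chebU n (1 - t)\<close> and \<open>UU n\<close> obey the same recurrence, with
  multiplication by \<open>1 - t\<close> corresponding to \<open>Av\<close>.\<close>

lemma spectral_integral_chebU:
  assumes f: "f \<in> L2"
  shows "(\<integral>t. of_real (chebU n (1 - t)) \<partial>spectral_measure m (flow_laplacian T m) f) = pairing m (UU n f) f"
proof -
  let ?\<mu> = "spectral_measure m (flow_laplacian T m) f"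
  note \<mu> = spectral_measure_props[OF f]
  have int: "integrable ?\<mu> g" if "continuous_on UNIV g" for g :: "real \<Rightarrow> complex"
    by (rule integrable_bounded_support[OF \<mu>(1-3) that])
  have lp: "(lap ^^ k) (\<lambda>x. a * g x + b * h x) = (\<lambda>x. a * (lap ^^ k) g x + b * (lap ^^ k) h x)" for k a b g h
    by (induction k) (simp_all add: lap_lin)
  have U: "UU n f \<in> L2" for n by (rule Lp_UU[OF f ge_2])
  have L: "(lap ^^ k) g \<in> L2" if "g \<in> L2" for g k by (rule flow_laplacian_pow(2)[OF that])
  \<comment> \<open>The additional power of \<open>t\<close> makes the induction close: the
    recurrence multiplies by \<open>t\<close>, which on the operator side is one more application of
    \<open>lap\<close>.\<close>
  have "(\<integral>t. of_real (t ^ k) * of_real (chebU n (1 - t)) \<partial>?\<mu>) = pairing m ((lap ^^ k) (UU n f)) f" for k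
  proof (induction n arbitrary: k rule: induct_nat_012)
    case 0
    then show ?case using \<mu>(4)[of k] by simp
  next
    case 1
    have "UU (Suc 0) f = (\<lambda>x. 2 * f x + (-2) * lap f x)" by (rule ext) (simp add: UU_1 lap_def)
    then have "pairing m ((lap ^^ k) (UU (Suc 0) f)) f = 2 * pairing m ((lap ^^ k) f) f + (-2) * pairing m ((lap ^^ k) (lap f)) f"
      by (simp only: lp pairing_lin[OF L[OF f] L[OF L2_lap[OF f]] f])
    also have "(lap ^^ k) (lap f) = (lap ^^ Suc k) f" by (simp add: funpow_swap1)
    finally have "pairing m ((lap ^^ k) (UU (Suc 0) f)) f = 2 * pairing m ((lap ^^ k) f) f - 2 * pairing m ((lap ^^ Suc k) f) f"
      by simp
    also have "\<dots> = (\<integral>t. 2 * of_real (t ^ k) - 2 * of_real (t ^ Suc k) \<partial>?\<mu>)"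
    proof (subst Bochner_Integration.integral_diff)
      show "integrable ?\<mu> (\<lambda>t. 2 * complex_of_real (t ^ k))" "integrable ?\<mu> (\<lambda>t. 2 * complex_of_real (t ^ Suc k))"
        by (rule int; intro continuous_intros)+
      show "2 * pairing m ((lap ^^ k) f) f - 2 * pairing m ((lap ^^ Suc k) f) f
        = (\<integral>t. 2 * complex_of_real (t ^ k) \<partial>?\<mu>) - (\<integral>t. 2 * complex_of_real (t ^ Suc k) \<partial>?\<mu>)"
        unfolding integral_mult_right_zero \<mu>(4) ..
    qed
    also have "\<dots> = (\<integral>t. of_real (t ^ k) * of_real (chebU (Suc 0) (1 - t)) \<partial>?\<mu>)"
      by (rule Bochner_Integration.integral_cong) (simp_all add: algebra_simps)
    finally show ?case by simp
  next
    case (ge2 n)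
    have "UU (Suc (Suc n)) f = (\<lambda>x. 1 * (2 * UU (Suc n) f x + (-2) * lap (UU (Suc n) f) x) + (-1) * UU n f x)"
      by (rule ext) (simp add: UU_Suc_Suc lap_def)
    then have "(lap ^^ k) (UU (Suc (Suc n)) f)
       = (\<lambda>x. 1 * (2 * (lap ^^ k) (UU (Suc n) f) x + (-2) * (lap ^^ Suc k) (UU (Suc n) f) x) + (-1) * (lap ^^ k) (UU n f) x)"
      by (simp only: lp) (simp add: funpow_swap1)
    then have "pairing m ((lap ^^ k) (UU (Suc (Suc n)) f)) f
       = 1 * (2 * pairing m ((lap ^^ k) (UU (Suc n) f)) f + (-2) * pairing m ((lap ^^ Suc k) (UU (Suc n) f)) f) + (-1) * pairing m ((lap ^^ k) (UU n f)) f"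
      by (simp only: pairing_lin[OF L2_lin[OF L[OF U] L[OF U]] L[OF U] f] pairing_lin[OF L[OF U] L[OF U] f])
    also have "\<dots> = (\<integral>t. (2 * (of_real (t ^ k) * of_real (chebU (Suc n) (1 - t))) - 2 * (of_real (t ^ Suc k) * of_real (chebU (Suc n) (1 - t))))
        - of_real (t ^ k) * of_real (chebU n (1 - t)) \<partial>?\<mu>)"
    proof -
      have i: "integrable ?\<mu> (\<lambda>t. 2 * (complex_of_real (t ^ k) * complex_of_real (chebU (Suc n) (1 - t))))"
        "integrable ?\<mu> (\<lambda>t. 2 * (complex_of_real (t ^ Suc k) * complex_of_real (chebU (Suc n) (1 - t))))"
        "integrable ?\<mu> (\<lambda>t. complex_of_real (t ^ k) * complex_of_real (chebU n (1 - t)))"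
        by (rule int; intro continuous_intros)+
      show ?thesis
        unfolding Bochner_Integration.integral_diff[OF Bochner_Integration.integrable_diff[OF i(1,2)] i(3)]
          Bochner_Integration.integral_diff[OF i(1,2)] integral_mult_right_zero ge2 by simp
    qed
    also have "\<dots> = (\<integral>t. of_real (t ^ k) * of_real (chebU (Suc (Suc n)) (1 - t)) \<partial>?\<mu>)"
      by (rule Bochner_Integration.integral_cong) (simp_all add: algebra_simps)
    finally show ?case by simp
  qed
  from this[of 0] show ?thesis by simp
qed

text \<open>The spectral measure sits on \<open>[0, 2]\<close>, where
  \<open>|chebU n (1 - t)| \<le> n + 1\<close>, so the expansion of \<open>F\<close> may be
  integrated term by term and compared with \<open>pairing_Sop_sums\<close>.\<close>

lemma spectral_integral_eq:
  assumes F: "expansion F c" and f: "f \<in> L2"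
  shows "(\<integral>t. F t \<partial>spectral_measure m (flow_laplacian T m) f) = pairing m (Sop c f) f"
proof -
  let ?\<mu> = "spectral_measure m (flow_laplacian T m) f"
  note \<mu> = spectral_measure_props[OF f]
  interpret \<mu>: finite_measure ?\<mu> by (rule \<mu>(2))
  have c: "summable (\<lambda>n. real (Suc n) * norm (c n))" using F by (simp add: expansion_def)
  have ex: "(\<lambda>n. c n * complex_of_real (chebU n (1 - t))) sums F t" if "t \<in> {0..2}" for t
    using F that unfolding expansion_def by (auto dest!: bspec[of _ _ "1 - t"])
  have bnd: "norm (c n * complex_of_real (chebU n (1 - t))) \<le> real (Suc n) * norm (c n)" if "t \<in> {0..2}" for t n
  proof -
    have "\<bar>chebU n (1 - t)\<bar> \<le> real (Suc n)" by (rule chebU_bound) (use that in auto)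
    from mult_left_mono[OF this, of "norm (c n)"] show ?thesis by (simp add: norm_mult mult.commute)
  qed
  have meas: "g \<in> borel_measurable ?\<mu>" if "g \<in> borel_measurable borel" for g :: "real \<Rightarrow> complex"
    unfolding measurable_cong_sets[OF \<mu>(1) refl] by (rule that)
  have i: "integrable ?\<mu> (\<lambda>t. c n * complex_of_real (chebU n (1 - t)))" for n
    by (rule integrable_bounded_support[OF \<mu>(1-3)]) (intro continuous_intros)
  have s: "summable (\<lambda>n. norm (c n * complex_of_real (chebU n (1 - t))))" if "t \<in> {0..2}" for t
    by (rule summable_comparison_test[OF _ c]) (use bnd[OF that] in auto)
  have "(\<lambda>n. \<integral>t. c n * complex_of_real (chebU n (1 - t)) \<partial>?\<mu>) sums (\<integral>t. (\<Sum>n. c n * complex_of_real (chebU n (1 - t))) \<partial>?\<mu>)"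
  proof (rule sums_integral[OF i])
    show "AE t in ?\<mu>. summable (\<lambda>n. norm (c n * complex_of_real (chebU n (1 - t))))"
      using \<mu>(3) by (rule eventually_mono) (rule s)
    show "summable (\<lambda>n. \<integral>t. norm (c n * complex_of_real (chebU n (1 - t))) \<partial>?\<mu>)"
    proof (rule summable_comparison_test)
      show "summable (\<lambda>n. real (Suc n) * norm (c n) * measure ?\<mu> (space ?\<mu>))" using c by (rule summable_mult2)
      have "(\<integral>t. norm (c n * complex_of_real (chebU n (1 - t))) \<partial>?\<mu>) \<le> (\<integral>t. real (Suc n) * norm (c n) \<partial>?\<mu>)" for n
        by (rule integral_mono_AE) (use i bnd \<mu>(3) in \<open>auto elim: eventually_mono simp del: of_nat_Suc\<close>)
      then show "\<exists>N. \<forall>n\<ge>N. norm (\<integral>t. norm (c n * complex_of_real (chebU n (1 - t))) \<partial>?\<mu>) \<le> real (Suc n) * norm (c n) * measure ?\<mu> (space ?\<mu>)"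
        by (intro exI[of _ 0]) (simp add: mult_ac del: of_nat_Suc)
    qed
  qed
  moreover have "(\<integral>t. (\<Sum>n. c n * complex_of_real (chebU n (1 - t))) \<partial>?\<mu>) = (\<integral>t. F t \<partial>?\<mu>)"
  proof (rule integral_cong_AE)
    show "(\<lambda>t. \<Sum>n. c n * complex_of_real (chebU n (1 - t))) \<in> borel_measurable ?\<mu>"
      by (intro borel_measurable_suminf borel_measurable_integrable[OF i])
    show "F \<in> borel_measurable ?\<mu>" using F by (intro meas) (simp add: expansion_def)
    show "AE t in ?\<mu>. (\<Sum>n. c n * complex_of_real (chebU n (1 - t))) = F t"
      using \<mu>(3) by (rule eventually_mono) (rule sums_unique[OF ex, symmetric])
  qed
  ultimately have "(\<lambda>n. c n * pairing m (UU n f) f) sums (\<integral>t. F t \<partial>?\<mu>)"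
    unfolding integral_mult_right_zero spectral_integral_chebU[OF f] by (simp only:)
  then show ?thesis using pairing_Sop_sums[OF c dual_2 f f] sums_unique2 by blast
qed

text \<open>Polarization: testing the difference of the forms with \<open>f + g\<close> and
  \<open>f + \<i> g\<close> separates \<open>Q f g\<close> from \<open>Q g f\<close>.\<close>

lemma quadratic_form_unique:
  assumes A: "bounded_op m 2 A" and B: "bounded_op m 2 B"
    and eq: "\<And>f. f \<in> L2 \<Longrightarrow> pairing m (A f) f = pairing m (B f) f" and f: "f \<in> L2"
  shows "A f = B f"
proof -
  define Q where "Q h g = pairing m (A h) g - pairing m (B h) g" for h g
  have AL: "A h \<in> L2" "B h \<in> L2" if "h \<in> L2" for h using A B that by (auto simp: bounded_op_def)
  have add: "A (\<lambda>x. h x + g x) = (\<lambda>x. A h x + A g x)" "B (\<lambda>x. h x + g x) = (\<lambda>x. B h x + B g x)" if "h \<in> L2" "g \<in> L2" for h g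
    using A B that by (auto simp: bounded_op_def)
  have mult: "A (\<lambda>x. k * h x) = (\<lambda>x. k * A h x)" "B (\<lambda>x. k * h x) = (\<lambda>x. k * B h x)" if "h \<in> L2" for h k
    using A B that by (auto simp: bounded_op_def)
  have Q0: "Q h h = 0" if "h \<in> L2" for h using eq[OF that] by (simp add: Q_def)
  have Qlin: "Q (\<lambda>x. a * h x + b * h' x) g = a * Q h g + b * Q h' g" if "h \<in> L2" "h' \<in> L2" "g \<in> L2" for a b h h' g
    unfolding Q_def add[OF Lp_mult[OF that(1)] Lp_mult[OF that(2)]] mult[OF that(1)] mult[OF that(2)]
      pairing_lin[OF AL(1)[OF that(1)] AL(1)[OF that(2)] that(3)] pairing_lin[OF AL(2)[OF that(1)] AL(2)[OF that(2)] that(3)]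
    by (simp add: algebra_simps)
  have Qlin2: "Q h (\<lambda>x. a * g x + b * g' x) = cnj a * Q h g + cnj b * Q h g'" if "h \<in> L2" "g \<in> L2" "g' \<in> L2" for a b h g g'
    unfolding Q_def pairing_lin_right[OF that(2,3) AL(1)[OF that(1)]] pairing_lin_right[OF that(2,3) AL(2)[OF that(1)]]
    by (simp add: algebra_simps)
  have pol: "cnj b * Q f g + b * Q g f = 0" if g: "g \<in> L2" for b g
  proof -
    have L: "(\<lambda>x. 1 * f x + b * g x) \<in> L2" by (rule L2_lin[OF f g])
    have "Q (\<lambda>x. 1 * f x + b * g x) (\<lambda>x. 1 * f x + b * g x) = 0" by (rule Q0[OF L])
    then show ?thesis
      unfolding Qlin[OF f g L] Qlin2[OF f f g] Qlin2[OF g f g] Q0[OF f] Q0[OF g] by simp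
  qed
  have "Q f g = 0" if g: "g \<in> L2" for g
  proof -
    have 1: "Q f g + Q g f = 0" using pol[OF g, of 1] by simp
    have "\<i> * (Q g f - Q f g) = 0" using pol[OF g, of \<i>] by (simp add: algebra_simps)
    then have "Q g f = Q f g" by simp
    then show ?thesis using 1 by simp
  qed
  then show ?thesis by (intro pairing_eqI[OF _ ge_2]) (simp add: Q_def)
qed

lemma borel_calculus_eq:
  assumes F: "expansion F c"
  shows "borel_calculus m (flow_laplacian T m) F = restrict (Sop c) L2"
  unfolding borel_calculus_def
proof (rule the_equality)
  have c: "summable (\<lambda>n. real (Suc n) * norm (c n))" using F by (simp add: expansion_def)
  have b: "bounded_op m 2 (restrict (Sop c) L2)" by (rule bounded_op_Sop[OF c ge_2])
  show "restrict (Sop c) L2 \<in> extensional L2 \<and> bounded_op m 2 (restrict (Sop c) L2) \<and>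
      (\<forall>f\<in>L2. pairing m (restrict (Sop c) L2 f) f = (\<integral>t. F t \<partial>spectral_measure m (flow_laplacian T m) f))"
    using b spectral_integral_eq[OF F] by simp
  fix B assume B: "B \<in> extensional L2 \<and> bounded_op m 2 B \<and>
      (\<forall>f\<in>L2. pairing m (B f) f = (\<integral>t. F t \<partial>spectral_measure m (flow_laplacian T m) f))"
  show "B = restrict (Sop c) L2"
  proof (rule extensionalityI[of _ L2])
    fix f assume f: "f \<in> L2"
    have B': "bounded_op m 2 B" using B by blast
    have "pairing m (B g) g = pairing m (restrict (Sop c) L2 g) g" if g: "g \<in> L2" for g
      using B g spectral_integral_eq[OF F g] by simp
    then show "B f = restrict (Sop c) L2 f"
      by (rule quadratic_form_unique[OF B' b _ f])
  qed (use B in auto)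
qed

end

section \<open>Extension to Lebesgue spaces, and the integral kernel\<close>

lemma nn_integral_count_space_le_finite:
  fixes h :: "'b \<Rightarrow> real"
  assumes h: "\<And>x. 0 \<le> h x" and K: "\<And>X. finite X \<Longrightarrow> sum h X \<le> K"
  shows "(\<integral>\<^sup>+x. ennreal (h x) \<partial>count_space UNIV) \<le> ennreal K"
proof -
  have s: "h summable_on UNIV"
    by (rule nonneg_bdd_above_summable_on) (use h K in \<open>auto intro!: bdd_aboveI[of _ K]\<close>)
  then have "(\<lambda>x. norm (h x)) summable_on UNIV" using h by simp
  then have abs: "Infinite_Set_Sum.abs_summable_on h UNIV" by (simp add: abs_summable_equivalent[symmetric])
  then have "integrable (count_space UNIV) h" by (simp add: Infinite_Set_Sum.abs_summable_on_def)
  then have "(\<integral>\<^sup>+x. ennreal (h x) \<partial>count_space UNIV) = ennreal (\<integral>x. h x \<partial>count_space UNIV)"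
    by (rule nn_integral_eq_integral) (simp add: h)
  also have "(\<integral>x. h x \<partial>count_space UNIV) = infsum h UNIV"
    using infsetsum_infsum[OF abs] by (simp add: infsetsum_def)
  also have "infsum h UNIV \<le> K" by (rule infsum_le_finite_sums[OF s]) (rule K)
  finally show ?thesis by (simp add: ennreal_leI)
qed

lemma nn_integral_count_space_tail:
  fixes h :: "'b \<Rightarrow> real"
  assumes h: "\<And>x. 0 \<le> h x" and fin: "(\<integral>\<^sup>+x. ennreal (h x) \<partial>count_space UNIV) < \<infinity>" and e: "0 < e"
  shows "\<exists>X. finite X \<and> (\<integral>\<^sup>+x. ennreal (if x \<in> X then 0 else h x) \<partial>count_space UNIV) \<le> ennreal e"
proof -
  have "integrable (count_space UNIV) h"
    by (rule integrableI_bounded) (use fin h in auto)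
  then have "Infinite_Set_Sum.abs_summable_on h UNIV" by (simp add: Infinite_Set_Sum.abs_summable_on_def)
  then have "(\<lambda>x. norm (h x)) summable_on UNIV" by (simp add: abs_summable_equivalent[symmetric])
  then have s: "h summable_on UNIV" using h by simp
  then have "(sum h \<longlongrightarrow> infsum h UNIV) (finite_subsets_at_top UNIV)"
    using has_sum_infsum has_sum_def by blast
  then have "eventually (\<lambda>X. infsum h UNIV - e < sum h X) (finite_subsets_at_top UNIV)"
    by (rule order_tendstoD) (use e in simp)
  then obtain X where X: "finite X" "infsum h UNIV - e < sum h X"
    by (auto simp: eventually_finite_subsets_at_top)
  have "(\<integral>\<^sup>+x. ennreal (if x \<in> X then 0 else h x) \<partial>count_space UNIV) \<le> ennreal e"
  proof (rule nn_integral_count_space_le_finite)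
    fix Y :: "'b set" assume Y: "finite Y"
    have "(\<Sum>x\<in>Y. if x \<in> X then 0 else h x) + sum h X = sum h (Y \<union> X)"
    proof -
      have "(\<Sum>x\<in>Y. if x \<in> X then 0 else h x) = sum h (Y - X)"
        by (rule sum.mono_neutral_cong_right) (use Y in auto)
      moreover have "sum h (Y - X) + sum h X = sum h ((Y - X) \<union> X)"
        by (rule sum.union_disjoint[symmetric]) (use X Y in auto)
      ultimately show ?thesis by simp
    qed
    also have "\<dots> \<le> infsum h UNIV"
      by (rule finite_sum_le_infsum[OF s]) (use X Y h in auto)
    finally show "(\<Sum>x\<in>Y. if x \<in> X then 0 else h x) \<le> e" using X(2) by linarith
  qed (simp add: h)
  then show ?thesis using X(1) by blast
qed

context flow_tree
begin

lemma pint_tail: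
  assumes f: "pint m r f < \<infinity>" and e: "0 < e" and r: "0 < r"
  shows "\<exists>X. finite X \<and> pint m r (\<lambda>x. if x \<in> X then 0 else f x) \<le> ennreal e"
proof -
  have eq: "pint m r g = (\<integral>\<^sup>+x. ennreal (m x * norm (g x) powr r) \<partial>count_space UNIV)" for g :: "'a \<Rightarrow> complex"
    unfolding pint_def nn_integral_flow using m_pos by (simp add: ennreal_mult less_imp_le)
  have "\<exists>X. finite X \<and> (\<integral>\<^sup>+x. ennreal (if x \<in> X then 0 else m x * norm (f x) powr r) \<partial>count_space UNIV) \<le> ennreal e"
    using f m_pos e unfolding eq by (intro nn_integral_count_space_tail) (auto simp: less_imp_le)
  then obtain X where X: "finite X" "(\<integral>\<^sup>+x. ennreal (if x \<in> X then 0 else m x * norm (f x) powr r) \<partial>count_space UNIV) \<le> ennreal e"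
    by blast
  have "pint m r (\<lambda>x. if x \<in> X then 0 else f x) = (\<integral>\<^sup>+x. ennreal (if x \<in> X then 0 else m x * norm (f x) powr r) \<partial>count_space UNIV)"
    unfolding eq by (rule nn_integral_cong) simp
  then show ?thesis using X by auto
qed

text \<open>For finite exponents the tail of \<open>f\<close> off a finite set has small norm, and
  evaluation at a vertex is continuous because the vertex has positive mass.\<close>

lemma Lp_bounded_op_unique:
  assumes q: "1 \<le> q" "q \<noteq> \<infinity>"
    and A: "bounded_op m q A" and B: "bounded_op m q B"
    and eq: "\<And>f. finite {x. f x \<noteq> 0} \<Longrightarrow> A f = B f" and f: "f \<in> Lp m q"
  shows "A f = B f"
proof
  fix x
  let ?r = "enn2real q"
  have r: "1 \<le> ?r" by (rule ennreal_real_ge_1[OF q])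
  have est: "\<exists>K\<ge>0. \<forall>g\<in>Lp m q. \<forall>e\<ge>0. pint m ?r g \<le> ennreal (e powr ?r) \<longrightarrow> norm (C g x) \<le> K * e"
    if C: "bounded_op m q C" for C
  proof -
    obtain K' where K': "\<And>g. g \<in> Lp m q \<Longrightarrow> Lp_norm m q (C g) \<le> ennreal K' * Lp_norm m q g"
      using C unfolding bounded_op_def by blast
    define K where "K = max 0 K'"
    have K0: "0 \<le> K" "ennreal K' \<le> ennreal K" by (auto simp: K_def intro!: ennreal_leI)
    have "norm (C g x) \<le> (1 / m x) powr (1 / ?r) * K * e"
      if g: "g \<in> Lp m q" and e: "0 \<le> e" and le: "pint m ?r g \<le> ennreal (e powr ?r)" for g e
    proof -
      have "Lp_norm m q g \<le> ennreal e" using le r e by (subst Lp_norm_le_iff[OF q(2)]) auto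
      then have "Lp_norm m q (C g) \<le> ennreal K * ennreal e"
        using K'[OF g] K0(2) by (meson mult_mono order_trans zero_le)
      then have "Lp_norm m q (C g) \<le> ennreal (K * e)" using K0 e by (simp add: ennreal_mult)
      then have le2: "pint m ?r (C g) \<le> ennreal ((K * e) powr ?r)"
        using r e K0 by (subst (asm) Lp_norm_le_iff[OF q(2)]) auto
      then have fin: "pint m ?r (C g) < \<infinity>" by (simp add: le_less_trans)
      have "norm (C g x) powr ?r \<le> enn2real (pint m ?r (C g)) / m x"
        by (rule pint_less_top_bound[OF fin])
      also have "\<dots> \<le> (K * e) powr ?r / m x"
        using le2 m_pos[of x] by (intro divide_right_mono) (auto simp: enn2real_leI)
      finally have "(norm (C g x) powr ?r) powr (1 / ?r) \<le> ((K * e) powr ?r * (1 / m x)) powr (1 / ?r)"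
        using r by (intro powr_mono2) auto
      also have "\<dots> = ((K * e) powr ?r) powr (1 / ?r) * (1 / m x) powr (1 / ?r)"
        by (rule powr_mult)
      also have "((K * e) powr ?r) powr (1 / ?r) = K * e" using r K0 e by (simp add: powr_powr)
      finally show ?thesis using r by (simp add: powr_powr mult_ac)
    qed
    then show ?thesis using K0 by (intro exI[of _ "(1 / m x) powr (1 / ?r) * K"]) auto
  qed
  obtain K where K: "0 \<le> K" "\<And>g e. g \<in> Lp m q \<Longrightarrow> 0 \<le> e \<Longrightarrow> pint m ?r g \<le> ennreal (e powr ?r) \<Longrightarrow> norm (A g x) \<le> K * e"
    using est[OF A] by blast
  obtain K' where K': "0 \<le> K'" "\<And>g e. g \<in> Lp m q \<Longrightarrow> 0 \<le> e \<Longrightarrow> pint m ?r g \<le> ennreal (e powr ?r) \<Longrightarrow> norm (B g x) \<le> K' * e"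
    using est[OF B] by blast
  have "norm (A f x - B f x) \<le> 0"
  proof (rule field_le_epsilon)
    fix e :: real assume e: "0 < e"
    define d where "d = e / (K + K' + 1)"
    have d: "0 < d" unfolding d_def using e K(1) K'(1) by (intro divide_pos_pos) auto
    have "pint m ?r f < \<infinity>" using f unfolding mem_Lp_iff[OF q(2)] .
    then obtain X where X: "finite X" "pint m ?r (\<lambda>x. if x \<in> X then 0 else f x) \<le> ennreal (d powr ?r)"
      using pint_tail[of ?r f "d powr ?r"] d r by auto
    define g where "g = (\<lambda>x. if x \<in> X then f x else 0)"
    define h where "h = (\<lambda>x. if x \<in> X then 0 else f x)"
    have fs: "finite {x. g x \<noteq> 0}" by (rule finite_subset[OF _ X(1)]) (auto simp: g_def)
    have g: "g \<in> Lp m q" by (rule Lp_finite_support[OF fs q(1)])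
    have h: "h \<in> Lp m q" unfolding mem_Lp_iff[OF q(2)] using X(2) by (simp add: h_def le_less_trans)
    have fgh: "f = (\<lambda>x. g x + h x)" by (auto simp: g_def h_def)
    have "A f = (\<lambda>x. A g x + A h x)" "B f = (\<lambda>x. B g x + B h x)"
      unfolding fgh using A B g h by (auto simp: bounded_op_def)
    then have "A f x - B f x = A h x - B h x" using eq[OF fs] by simp
    also have "norm \<dots> \<le> norm (A h x) + norm (B h x)" by (rule norm_triangle_ineq4)
    also have "\<dots> \<le> K * d + K' * d"
      using X(2) d by (intro add_mono K(2)[OF h] K'(2)[OF h]) (auto simp: h_def)
    also have "\<dots> \<le> (K + K' + 1) * d" using d by (simp add: algebra_simps)
    also have "\<dots> = e" unfolding d_def using K(1) K'(1) by (simp add: add_nonneg_pos less_imp_neq[symmetric])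
    finally show "norm (A f x - B f x) \<le> 0 + e" by simp
  qed
  then show "A f x = B f x" by simp
qed

lemma Lp_extension_eq:
  assumes c: "summable (\<lambda>n. real (Suc n) * norm (c n))" and q: "1 \<le> q" "q \<noteq> \<infinity>"
  shows "Lp_extension m q (restrict (Sop c) L2) = restrict (Sop c) (Lp m q)"
  unfolding Lp_extension_def
proof (rule the_equality)
  have b: "bounded_op m q (restrict (Sop c) (Lp m q))" by (rule bounded_op_Sop[OF c q(1)])
  then show "restrict (Sop c) (Lp m q) \<in> extensional (Lp m q) \<and> bounded_op m q (restrict (Sop c) (Lp m q)) \<and>
     (\<forall>f\<in>L2 \<inter> Lp m q. restrict (Sop c) (Lp m q) f = restrict (Sop c) L2 f)" by simp
  fix B assume B: "B \<in> extensional (Lp m q) \<and> bounded_op m q B \<and> (\<forall>f\<in>L2 \<inter> Lp m q. B f = restrict (Sop c) L2 f)"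
  show "B = restrict (Sop c) (Lp m q)"
  proof (rule extensionalityI[of _ "Lp m q"])
    fix f assume f: "f \<in> Lp m q"
    show "B f = restrict (Sop c) (Lp m q) f"
    proof (rule Lp_bounded_op_unique[OF q _ b _ f])
      fix g :: "'a \<Rightarrow> complex" assume g: "finite {x. g x \<noteq> 0}"
      show "B g = restrict (Sop c) (Lp m q) g"
        using B Lp_finite_support[OF g q(1)] Lp_finite_support[OF g ge_2] by simp
    qed (use B in simp)
  qed (use B in auto)
qed

text \<open>Taking the adjoint conjugates the coefficients once more, which undoes the conjugation
  of \<open>F\<close> in \<open>Lp_calculus\<close>. Uniqueness holds because the point masses
  belong to L^1 and separate functions.\<close>

lemma L1_adjoint_eq:
  assumes c: "summable (\<lambda>n. real (Suc n) * norm (c n))"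
  shows "L1_adjoint m (restrict (Sop (\<lambda>n. cnj (c n))) (Lp m 1)) = restrict (Sop c) (Lp m \<infinity>)"
  unfolding L1_adjoint_def
proof (rule the_equality)
  have d: "dual \<infinity> 1" by (simp add: dual_def)
  have b: "bounded_op m \<infinity> (restrict (Sop c) (Lp m \<infinity>))" by (rule bounded_op_Sop[OF c]) simp
  have main: "\<forall>f\<in>Lp m \<infinity>. \<forall>g\<in>Lp m 1. pairing m (restrict (Sop c) (Lp m \<infinity>) f) g = pairing m f (restrict (Sop (\<lambda>n. cnj (c n))) (Lp m 1) g)"
    using pairing_Sop[OF c d] by simp
  show "restrict (Sop c) (Lp m \<infinity>) \<in> extensional (Lp m \<infinity>) \<and> bounded_op m \<infinity> (restrict (Sop c) (Lp m \<infinity>)) \<and>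
     (\<forall>f\<in>Lp m \<infinity>. \<forall>g\<in>Lp m 1. pairing m (restrict (Sop c) (Lp m \<infinity>) f) g = pairing m f (restrict (Sop (\<lambda>n. cnj (c n))) (Lp m 1) g))"
    using b main by (intro conjI restrict_extensional)
  fix B assume B: "B \<in> extensional (Lp m \<infinity>) \<and> bounded_op m \<infinity> B \<and>
    (\<forall>f\<in>Lp m \<infinity>. \<forall>g\<in>Lp m 1. pairing m (B f) g = pairing m f (restrict (Sop (\<lambda>n. cnj (c n))) (Lp m 1) g))"
  show "B = restrict (Sop c) (Lp m \<infinity>)"
  proof (rule extensionalityI[of _ "Lp m \<infinity>"])
    fix f assume f: "f \<in> Lp m \<infinity>"
    show "B f = restrict (Sop c) (Lp m \<infinity>) f"
    proof (rule pairing_eqI[of 1])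
      fix g assume g: "g \<in> Lp m 1"
      have "pairing m (B f) g = pairing m f (restrict (Sop (\<lambda>n. cnj (c n))) (Lp m 1) g)" using B f g by blast
      then show "pairing m (B f) g = pairing m (restrict (Sop c) (Lp m \<infinity>) f) g" using main f g by metis
    qed simp
  qed (use B in blast, simp)
qed

lemma expansion_cnj:
  assumes F: "expansion F c"
  shows "expansion (\<lambda>t. cnj (F t)) (\<lambda>n. cnj (c n))"
  unfolding expansion_def
proof (intro conjI ballI)
  have [measurable]: "F \<in> borel_measurable borel" using F by (simp add: expansion_def)
  show "(\<lambda>t. cnj (F t)) \<in> borel_measurable borel" by measurable
  show "summable (\<lambda>n. real (Suc n) * norm (cnj (c n)))" using F by (simp add: expansion_def)
  fix x :: real assume "x \<in> {-1..1}"
  then have "(\<lambda>n. c n * complex_of_real (chebU n x)) sums F (1 - x)" using F by (simp add: expansion_def)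
  then have "(\<lambda>n. cnj (c n * complex_of_real (chebU n x))) sums cnj (F (1 - x))" by (simp only: sums_cnj)
  then show "(\<lambda>n. cnj (c n) * complex_of_real (chebU n x)) sums cnj (F (1 - x))" by simp
qed

lemma Lp_calculus_eq:
  assumes F: "expansion F c" and q: "1 \<le> q"
  shows "Lp_calculus m q (flow_laplacian T m) F = restrict (Sop c) (Lp m q)"
proof (cases "q = \<infinity>")
  case True
  have c: "summable (\<lambda>n. real (Suc n) * norm (c n))" using F by (simp add: expansion_def)
  have c': "summable (\<lambda>n. real (Suc n) * norm (cnj (c n)))" using c by simp
  show ?thesis
    unfolding Lp_calculus_def True
    by (simp only: simp_thms if_True borel_calculus_eq[OF expansion_cnj[OF F]])
       (subst Lp_extension_eq[OF c'], simp, simp, rule L1_adjoint_eq[OF c])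
next
  case False
  have c: "summable (\<lambda>n. real (Suc n) * norm (c n))" using F by (simp add: expansion_def)
  show ?thesis
    unfolding Lp_calculus_def using False by (simp only: if_False borel_calculus_eq[OF F] Lp_extension_eq[OF c q False])
qed

lemma calculus_norm_eq:
  assumes F: "expansion F c" and q: "1 \<le> q"
  shows "calculus_norm T m q F = (SUP f\<in>{f \<in> Lp m q. Lp_norm m q f \<le> 1}. Lp_norm m q (Sop c f))"
  unfolding calculus_norm_def Lp_calculus_eq[OF F q] op_norm_def by (rule SUP_cong) simp_all

lemma Sop_finite_support:
  assumes c: "summable (\<lambda>n. real (Suc n) * norm (c n))" and f: "finite {y. f y \<noteq> 0}"
  shows "Sop c f x = (\<Sum>y | f y \<noteq> 0. f y * Sop c (delta y) x)"
proof -
  have main: "finite X \<Longrightarrow> Sop c (\<lambda>z. \<Sum>y\<in>X. g y * delta y z) x = (\<Sum>y\<in>X. g y * Sop c (delta y) x)" for X and g :: "'a \<Rightarrow> complex"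
  proof (induction X rule: finite_induct)
    case empty
    then show ?case using Sop_mult[OF c Lp_tame[OF Lp_delta[OF ge_2] ge_2], of 0 undefined x] by simp
  next
    case (insert y X)
    have t1: "tame (\<lambda>z. g y * delta y z)" by (rule tame_mult[OF Lp_tame[OF Lp_delta[OF ge_2] ge_2]])
    have t2: "tame (\<lambda>z. \<Sum>y\<in>X. g y * delta y z)"
      by (rule Lp_tame[OF Lp_finite_support[OF _ ge_2] ge_2], rule finite_subset[OF _ insert(1)]) (auto simp: delta_def intro!: sum.neutral)
    have "Sop c (\<lambda>z. g y * delta y z + (\<Sum>y\<in>X. g y * delta y z)) x = Sop c (\<lambda>z. g y * delta y z) x + Sop c (\<lambda>z. \<Sum>y\<in>X. g y * delta y z) x"
      by (rule Sop_add[OF c t1 t2])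
    also have "Sop c (\<lambda>z. g y * delta y z) x = g y * Sop c (delta y) x"
      by (rule Sop_mult[OF c Lp_tame[OF Lp_delta[OF ge_2] ge_2]])
    finally show ?case using insert by simp
  qed
  have "f = (\<lambda>z. \<Sum>y | f y \<noteq> 0. f y * delta y z)"
  proof
    fix z
    have "(\<Sum>y | f y \<noteq> 0. f y * delta y z) = (\<Sum>y | f y \<noteq> 0. if y = z then f y else 0)"
      by (rule sum.cong) (auto simp: delta_def)
    then show "f z = (\<Sum>y | f y \<noteq> 0. f y * delta y z)" using f by (simp add: sum.delta)
  qed
  then have "Sop c f x = Sop c (\<lambda>z. \<Sum>y | f y \<noteq> 0. f y * delta y z) x" by (rule arg_cong)
  then show ?thesis using main[OF f, of f] by simp
qed

text \<open>The kernel is read off at \<open>delta y\<close>; the division cancels the factor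
  \<open>m y\<close> in the defining sum.\<close>

lemma calculus_kernel_eq:
  assumes F: "expansion F c"
  shows "calculus_kernel T m F x y = Sop c (delta y) x / m y"
proof -
  have c: "summable (\<lambda>n. real (Suc n) * norm (c n))" using F by (simp add: expansion_def)
  let ?K = "\<lambda>x y. Sop c (delta y) x / complex_of_real (m y)"
  have "calculus_kernel T m F = ?K"
    unfolding calculus_kernel_def borel_calculus_eq[OF F] kernel_def
  proof (rule the_equality)
    show main: "\<forall>f. finite {y. f y \<noteq> 0} \<longrightarrow> (\<forall>x. restrict (Sop c) L2 f x = (\<Sum>y | f y \<noteq> 0. ?K x y * f y * of_real (m y)))"
    proof (intro allI impI)
      fix f :: "'a \<Rightarrow> complex" and x assume f: "finite {y. f y \<noteq> 0}"
      have "(\<Sum>y | f y \<noteq> 0. ?K x y * f y * of_real (m y)) = (\<Sum>y | f y \<noteq> 0. f y * Sop c (delta y) x)"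
        by (rule sum.cong) simp_all
      then show "restrict (Sop c) L2 f x = (\<Sum>y | f y \<noteq> 0. ?K x y * f y * of_real (m y))"
        using Lp_finite_support[OF f ge_2] Sop_finite_support[OF c f] by simp
    qed
    fix K assume K: "\<forall>f. finite {y. f y \<noteq> 0} \<longrightarrow> (\<forall>x. restrict (Sop c) L2 f x = (\<Sum>y | f y \<noteq> 0. K x y * f y * of_real (m y)))"
    show "K = ?K"
    proof (intro ext)
      fix x y :: 'a
      have supp: "{z. delta y z \<noteq> 0} = {y}" by (auto simp: delta_def)
      have "restrict (Sop c) L2 (delta y) x = K x y * delta y y * of_real (m y)"
        using K[rule_format, of "delta y" x] unfolding supp by simp
      then show "K x y = ?K x y" using Lp_delta[OF ge_2, of y] by (simp add: delta_def)
    qed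
  qed
  then show ?thesis by simp
qed

end

section \<open>Transfer from homogeneous trees\<close>

lemma homogeneous_flow_tree:
  assumes T: "is_homogeneous_tree q T" and q: "1 \<le> q"
  shows "flow_tree T (canonical_flow q T)"
proof -
  interpret rooted_tree T using T by (unfold_locales) (simp add: is_homogeneous_tree_def)
  have "0 < canonical_flow q T x \<and> canonical_flow q T x = (\<Sum>y\<in>succs T x. canonical_flow q T y)" for x
  proof
    show "0 < canonical_flow q T x" using q by (simp add: canonical_flow_def)
    have "canonical_flow q T y = canonical_flow q T x / real q" if "y \<in> succs T x" for y
    proof -
      have "level T x = level T y + 1" using that level_pred[of y] by (simp add: succs_eq)
      then show ?thesis using q by (simp add: canonical_flow_def power_int_add)
    qed
    then have "(\<Sum>y\<in>succs T x. canonical_flow q T y) = real (card (succs T x)) * (canonical_flow q T x / real q)"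
      by simp
    then show "canonical_flow q T x = (\<Sum>y\<in>succs T x. canonical_flow q T y)"
      using T q by (simp add: is_homogeneous_tree_def)
  qed
  then have "is_flow T (canonical_flow q T)" unfolding is_flow_def by blast
  then show ?thesis by unfold_locales
qed

context flow_tree
begin

lemma pred_surj: "\<exists>y. p y = x"
proof (rule ccontr)
  assume "\<not> ?thesis"
  then have "desc (Suc 0) x = {}" by (auto simp: desc_1)
  then show False using mass_desc_1[of x] m_pos[of x] by simp
qed

lemma level_surj: "\<exists>x. level T x = j"
proof -
  fix x0 :: 'a
  have down: "\<exists>y. level T y = level T x0 - int n" for n
  proof (induction n)
    case (Suc n)
    then obtain y where y: "level T y = level T x0 - int n" by blast
    obtain u where "p u = y" using pred_surj by blast
    then show ?case using y level_pred[of u] by (intro exI[of _ u]) auto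
  qed (auto intro: exI[of _ x0])
  show ?thesis
  proof (cases "level T x0 \<le> j")
    case True
    then show ?thesis using level_pred_pow[of "nat (j - level T x0)" x0] by auto
  next
    case False
    then show ?thesis using down[of "nat (level T x0 - j)"] by auto
  qed
qed

lemma level_desc: "y \<in> desc b z \<Longrightarrow> level T z = level T y + int b"
  using level_pred_pow[of b y] by (simp add: mem_desc)

text \<open>The lower bound on the depth leaves room to climb \<open>n\<close> steps from any vertex
  of \<open>X\<close> without passing the common ancestor.\<close>

lemma common_ancestor:
  assumes "finite X"
  shows "\<exists>z. \<forall>x\<in>X. \<exists>d\<ge>n. (p ^^ d) x = z"
  using assms
proof (induction X)
  case (insert x X)
  then obtain z where z: "\<And>x. x \<in> X \<Longrightarrow> \<exists>d\<ge>n. (p ^^ d) x = z" by blast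
  obtain a b where ab: "(p ^^ a) x = (p ^^ b) z" using graph_dist_confluent by blast
  have 1: "(p ^^ (n + a)) x = (p ^^ (n + b)) z" using ab by (simp add: funpow_add)
  have "\<exists>d\<ge>n. (p ^^ d) y = (p ^^ (n + b)) z" if y: "y \<in> X" for y
  proof -
    obtain d where "d \<ge> n" "(p ^^ d) y = z" using z[OF y] by blast
    then have "n + b + d \<ge> n" "(p ^^ (n + b + d)) y = (p ^^ (n + b)) z" by (simp_all add: funpow_add)
    then show ?thesis by blast
  qed
  moreover have "\<exists>d\<ge>n. (p ^^ d) x = (p ^^ (n + b)) z" using 1 by (intro exI[of _ "n + a"]) simp
  ultimately show ?case by (intro exI[of _ "(p ^^ (n + b)) z"]) blast
qed simp

text \<open>Rounding \<open>q * m y / m z\<close> down leaves a remainder. One chosen successor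
  \<open>s z\<close> takes all of it, so the numbers add up to \<open>q\<close> exactly; its ratio
  still converges, being one minus the ratios of its finitely many siblings.\<close>

lemma allocation_exists:
  "\<exists>k :: nat \<Rightarrow> 'a \<Rightarrow> nat. (\<forall>q z. (\<Sum>y\<in>desc (Suc 0) z. k q y) = q)
     \<and> (\<forall>y. (\<lambda>q. real (k q y) / real q) \<longlonglongrightarrow> m y / m (p y))"
proof -
  have "\<forall>z. \<exists>y. p y = z" using pred_surj by blast
  then obtain s where s: "\<And>z. p (s z) = z" by metis
  define u where "u q y = nat \<lfloor>real q * (m y / m (p y))\<rfloor>" for q y
  \<comment> \<open>The subtraction of natural numbers does not truncate, by \<open>sumu_q\<close>
    below.\<close>
  define k where "k q y = (if y = s (p y) then q - (\<Sum>y'\<in>desc (Suc 0) (p y) - {y}. u q y') else u q y)" for q y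
  have sdesc: "s z \<in> desc (Suc 0) z" for z by (simp add: desc_1 s)
  have u_le: "real (u q y) \<le> real q * (m y / m (p y))" for q y
    using m_pos[of y] m_pos[of "p y"] by (simp add: u_def)
  have sumu: "real (\<Sum>y'\<in>desc (Suc 0) z - {s z}. u q y') \<le> real q * (1 - m (s z) / m z)" for q z
  proof -
    have "real (\<Sum>y'\<in>desc (Suc 0) z - {s z}. u q y') \<le> (\<Sum>y'\<in>desc (Suc 0) z - {s z}. real q * (m y' / m z))"
      unfolding of_nat_sum
    proof (rule sum_mono)
      fix y assume "y \<in> desc (Suc 0) z - {s z}"
      then have "p y = z" by (simp add: desc_1)
      then show "real (u q y) \<le> real q * (m y / m z)" using u_le[of q y] by simp
    qed
    also have "\<dots> = real q * ((\<Sum>y'\<in>desc (Suc 0) z - {s z}. m y') / m z)"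
      by (simp add: sum_distrib_left sum_divide_distrib)
    also have "(\<Sum>y'\<in>desc (Suc 0) z - {s z}. m y') = m z - m (s z)"
      using mass_desc_1[of z] sum.remove[of "desc (Suc 0) z" "s z" m] sdesc[of z] by simp
    finally show ?thesis by (simp add: diff_divide_distrib)
  qed
  have sumu_q: "(\<Sum>y'\<in>desc (Suc 0) z - {s z}. u q y') \<le> q" for q z
  proof -
    have "real q * (1 - m (s z) / m z) \<le> real q * 1"
      using m_pos[of "s z"] m_pos[of z] by (intro mult_left_mono) auto
    then show ?thesis using sumu[of q z] by linarith
  qed
  have k1: "k q y = u q y" if "y \<in> desc (Suc 0) z - {s z}" for q y z
    using that by (auto simp: k_def desc_1)
  have ks: "k q (s z) = q - (\<Sum>y'\<in>desc (Suc 0) z - {s z}. u q y')" for q z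
    by (simp add: k_def s)
  have "(\<Sum>y\<in>desc (Suc 0) z. k q y) = q" for q z
  proof -
    have "(\<Sum>y\<in>desc (Suc 0) z. k q y) = k q (s z) + (\<Sum>y\<in>desc (Suc 0) z - {s z}. k q y)"
      using sum.remove[of "desc (Suc 0) z" "s z" "k q"] sdesc[of z] by simp
    also have "(\<Sum>y\<in>desc (Suc 0) z - {s z}. k q y) = (\<Sum>y\<in>desc (Suc 0) z - {s z}. u q y)"
      by (intro sum.cong refl k1)
    finally show ?thesis using sumu_q[of q z] by (simp add: ks)
  qed
  moreover have ulim: "(\<lambda>q. real (u q y) / real q) \<longlonglongrightarrow> m y / m (p y)" for y
  proof -
    have "0 < m y / m (p y)" using m_pos by simp
    then show ?thesis unfolding u_def by real_asymp
  qed
  have "(\<lambda>q. real (k q y) / real q) \<longlonglongrightarrow> m y / m (p y)" for y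
  proof (cases "y = s (p y)")
    case True
    define z where "z = p y"
    have yz: "y = s z" using True by (simp add: z_def)
    have "(\<lambda>q. 1 - (\<Sum>y'\<in>desc (Suc 0) z - {s z}. real (u q y') / real q))
        \<longlonglongrightarrow> 1 - (\<Sum>y'\<in>desc (Suc 0) z - {s z}. m y' / m (p y'))"
      by (intro tendsto_intros ulim)
    also have "(\<Sum>y'\<in>desc (Suc 0) z - {s z}. m y' / m (p y')) = (\<Sum>y'\<in>desc (Suc 0) z - {s z}. m y') / m z"
      unfolding sum_divide_distrib by (intro sum.cong refl) (simp add: desc_1)
    also have "(\<Sum>y'\<in>desc (Suc 0) z - {s z}. m y') = m z - m (s z)"
      using mass_desc_1[of z] sum.remove[of "desc (Suc 0) z" "s z" m] sdesc[of z] by simp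
    also have "1 - (m z - m (s z)) / m z = m y / m (p y)" by (simp add: yz s diff_divide_distrib)
    finally show ?thesis
    proof (rule Lim_transform_eventually)
      show "\<forall>\<^sub>F q in sequentially. 1 - (\<Sum>y'\<in>desc (Suc 0) z - {s z}. real (u q y') / real q) = real (k q y) / real q"
        using eventually_gt_at_top[of 0]
      proof eventually_elim
        case (elim q)
        then show ?case using sumu_q[of q z]
          by (simp add: yz ks of_nat_diff diff_divide_distrib sum_divide_distrib)
      qed
    qed
  next
    case False
    then have "k q y = u q y" for q by (simp add: k_def)
    then show ?thesis using ulim by simp
  qed
  ultimately show ?thesis by blast
qed

end

lemma map_with_fibre_sizes:
  assumes "finite B" "finite A" "(\<Sum>y\<in>B. k y) = card A"
  shows "\<exists>\<alpha>. (\<forall>a\<in>A. \<alpha> a \<in> B) \<and> (\<forall>y\<in>B. card {a\<in>A. \<alpha> a = y} = k y)"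
  using assms
proof (induction B arbitrary: A)
  case empty
  then show ?case by simp
next
  case (insert y B)
  have "k y \<le> card A" using insert by simp
  then obtain A' where A': "A' \<subseteq> A" "card A' = k y" using obtain_subset_with_card_n by metis
  have "(\<Sum>y\<in>B. k y) = card (A - A')"
    using insert A' by (simp add: card_Diff_subset finite_subset)
  then obtain \<alpha> where \<alpha>: "\<And>a. a \<in> A - A' \<Longrightarrow> \<alpha> a \<in> B" "\<And>z. z \<in> B \<Longrightarrow> card {a\<in>A - A'. \<alpha> a = z} = k z"
    using insert.IH[of "A - A'"] finite_Diff[OF insert.prems(1)] by blast
  define \<beta> where "\<beta> a = (if a \<in> A' then y else \<alpha> a)" for a
  have 1: "{a\<in>A. \<beta> a = y} = A'" using A' \<alpha>(1) insert(2) by (auto simp: \<beta>_def)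
  have 2: "{a\<in>A. \<beta> a = z} = {a\<in>A - A'. \<alpha> a = z}" if "z \<in> B" for z
    using that insert(2) by (auto simp: \<beta>_def)
  show ?case
    by (rule exI[of _ \<beta>]) (use 1 2 \<alpha> A' in \<open>auto simp: \<beta>_def\<close>)
qed

section \<open>Projection of a homogeneous tree of fixed degree\<close>

locale homogeneous_cover = S: flow_tree T m + H: flow_tree T' m'
  for T :: "'a rooted_tree" and m :: "'a \<Rightarrow> real" and T' :: "'b rooted_tree" and m' :: "'b \<Rightarrow> real" +
  fixes q :: nat and k :: "'a \<Rightarrow> nat" and top :: 'a and top' :: 'b
  assumes q: "1 \<le> q" and homogeneous: "card {x'. H.p x' = z'} = q"
    and mass: "H.p x' = z' \<Longrightarrow> m' x' = m' z' / real q"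
    and alloc: "(\<Sum>y\<in>S.desc (Suc 0) z. k y) = q"
    and level_top: "level T' top' = level T top"
begin

text \<open>Distributes the successors of \<open>z'\<close> among those of \<open>z\<close> in the numbers given by \<open>k\<close>.\<close>

definition sel :: "'a \<Rightarrow> 'b \<Rightarrow> 'b \<Rightarrow> 'a" where
  "sel z z' = (SOME \<alpha>. (\<forall>x'\<in>H.desc (Suc 0) z'. \<alpha> x' \<in> S.desc (Suc 0) z)
     \<and> (\<forall>y\<in>S.desc (Suc 0) z. card {x'\<in>H.desc (Suc 0) z'. \<alpha> x' = y} = k y))"

lemma sel:
  shows "H.p x' = z' \<Longrightarrow> S.p (sel z z' x') = z"
    and "S.p y = z \<Longrightarrow> card {x'\<in>H.desc (Suc 0) z'. sel z z' x' = y} = k y"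
proof -
  have "\<exists>\<alpha>. (\<forall>x'\<in>H.desc (Suc 0) z'. \<alpha> x' \<in> S.desc (Suc 0) z)
     \<and> (\<forall>y\<in>S.desc (Suc 0) z. card {x'\<in>H.desc (Suc 0) z'. \<alpha> x' = y} = k y)"
    by (rule map_with_fibre_sizes) (simp_all add: alloc H.desc_1 homogeneous H.finite_succs)
  from someI_ex[OF this]
  have *: "(\<forall>x'\<in>H.desc (Suc 0) z'. sel z z' x' \<in> S.desc (Suc 0) z)
     \<and> (\<forall>y\<in>S.desc (Suc 0) z. card {x'\<in>H.desc (Suc 0) z'. sel z z' x' = y} = k y)"
    unfolding sel_def .
  show "H.p x' = z' \<Longrightarrow> S.p (sel z z' x') = z" using * by (simp add: S.desc_1 H.desc_1)
  show "S.p y = z \<Longrightarrow> card {x'\<in>H.desc (Suc 0) z'. sel z z' x' = y} = k y" using * by (simp add: S.desc_1)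
qed

primrec proj_aux :: "nat \<Rightarrow> 'b \<Rightarrow> 'a" where
  "proj_aux 0 x' = top"
| "proj_aux (Suc d) x' = sel (proj_aux d (H.p x')) (H.p x') x'"

text \<open>The recursion descends from the level of \<open>top\<close>, and every vertex at or
  above that level goes to \<open>top\<close>. Only levels enter, not the vertex
  \<open>top'\<close>, so the map is total; it commutes with predecessors below the level of
  \<open>top\<close>.\<close>

definition proj :: "'b \<Rightarrow> 'a" where
  "proj x' = proj_aux (nat (level T top - level T' x')) x'"

lemma proj_below:
  assumes "level T' x' < level T top"
  shows "proj x' = sel (proj (H.p x')) (H.p x') x'"
proof -
  have "nat (level T top - level T' x') = Suc (nat (level T top - level T' (H.p x')))"
    using assms H.level_pred[of x'] by simp
  then show ?thesis by (simp add: proj_def)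
qed

lemma pred_proj: "level T' x' < level T top \<Longrightarrow> S.p (proj x') = proj (H.p x')"
  using sel(1) proj_below by simp

lemma pred_pow_proj: "level T' x' + int a \<le> level T top \<Longrightarrow> (S.p ^^ a) (proj x') = proj ((H.p ^^ a) x')"
proof (induction a)
  case (Suc a)
  then show ?case using pred_proj[of "(H.p ^^ a) x'"] H.level_pred_pow[of a x'] by simp
qed simp

lemma proj_top: "level T' x' = level T top \<Longrightarrow> proj x' = top"
  by (simp add: proj_def)

lemma pred_pow_proj_top:
  assumes "level T' x' + int a = level T top"
  shows "(S.p ^^ a) (proj x') = top"
  using pred_pow_proj[of x' a] proj_top[of "(H.p ^^ a) x'"] assms H.level_pred_pow[of a x'] by simp

lemma level_proj:
  assumes "level T' x' \<le> level T top"
  shows "level T (proj x') = level T' x'"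
proof -
  define a where "a = nat (level T top - level T' x')"
  have "level T' x' + int a = level T top" using assms by (simp add: a_def)
  then show ?thesis using pred_pow_proj_top[of x' a] S.level_pred_pow[of a "proj x'"] by simp
qed

lemma sum_fibre:
  fixes h :: "'a \<Rightarrow> complex"
  assumes "level T' z' \<le> level T top"
  shows "(\<Sum>x'\<in>H.desc (Suc 0) z'. h (proj x')) = (\<Sum>y\<in>S.desc (Suc 0) (proj z'). of_nat (k y) * h y)"
proof -
  have pr: "proj x' = sel (proj z') z' x'" if "x' \<in> H.desc (Suc 0) z'" for x'
    using that proj_below[of x'] assms H.level_pred[of x'] by (simp add: H.desc_1)
  have "(\<Sum>x'\<in>H.desc (Suc 0) z'. h (proj x')) = (\<Sum>x'\<in>H.desc (Suc 0) z'. h (sel (proj z') z' x'))"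
    by (intro sum.cong refl) (simp add: pr)
  also have "\<dots> = (\<Sum>y\<in>S.desc (Suc 0) (proj z'). \<Sum>x'\<in>{x'\<in>H.desc (Suc 0) z'. sel (proj z') z' x' = y}. h (sel (proj z') z' x'))"
    by (rule sum.group[OF H.finite_desc S.finite_desc, symmetric]) (auto simp: S.desc_1 H.desc_1 sel(1))
  also have "\<dots> = (\<Sum>y\<in>S.desc (Suc 0) (proj z'). of_nat (k y) * h y)"
  proof (rule sum.cong[OF refl])
    fix y assume y: "y \<in> S.desc (Suc 0) (proj z')"
    have "(\<Sum>x'\<in>{x'\<in>H.desc (Suc 0) z'. sel (proj z') z' x' = y}. h (sel (proj z') z' x'))
        = (\<Sum>x'\<in>{x'\<in>H.desc (Suc 0) z'. sel (proj z') z' x' = y}. h y)" by (intro sum.cong refl) simp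
    also have "\<dots> = of_nat (k y) * h y" using sel(2)[of y "proj z'" z'] y by (simp add: S.desc_1)
    finally show "(\<Sum>x'\<in>{x'\<in>H.desc (Suc 0) z'. sel (proj z') z' x' = y}. h (sel (proj z') z' x')) = of_nat (k y) * h y" .
  qed
  finally show ?thesis .
qed

text \<open>The weights \<open>wt\<close> play the role of the quotients \<open>m y / m ((p ^^ b) y)\<close>.\<close>

definition wt :: "nat \<Rightarrow> 'a \<Rightarrow> real" where
  "wt b y = (\<Prod>i<b. real (k ((S.p ^^ i) y)) / real q)"

definition qavg :: "nat \<Rightarrow> ('a \<Rightarrow> complex) \<Rightarrow> 'a \<Rightarrow> complex" where
  "qavg b f z = (\<Sum>y\<in>S.desc b z. f y * of_real (wt b y))"

text \<open>Each of the \<open>q\<close> successors has relative mass \<open>1 / q\<close>, and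
  \<open>k y\<close> of them project to \<open>y\<close>. One generation thus gives \<open>y\<close>
  the weight \<open>k y / q\<close>, and \<open>b\<close> generations give the product
  \<open>wt b y\<close>.\<close>

lemma avg_lift:
  assumes "level T' z' \<le> level T top" "\<And>y'. y' \<in> H.desc b z' \<Longrightarrow> f' y' = f (proj y')"
  shows "H.avg b f' z' = qavg b f (proj z')"
  using assms
proof (induction b arbitrary: z')
  case 0
  then show ?case by (simp add: qavg_def wt_def)
next
  case (Suc b)
  have IH: "H.avg b f' x' = qavg b f (proj x')" if x': "x' \<in> H.desc (Suc 0) z'" for x'
  proof (rule Suc.IH)
    show "level T' x' \<le> level T top" using H.level_desc[OF x'] Suc.prems by simp
    show "f' y' = f (proj y')" if "y' \<in> H.desc b x'" for y'
      using Suc.prems(2)[of y'] that x' by (simp add: H.mem_desc)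
  qed
  have "H.avg (Suc b) f' z' = (\<Sum>x'\<in>H.desc (Suc 0) z'. H.avg b f' x' * of_real (m' x')) / of_real (m' z')"
    by (simp add: H.avg_Suc[of b] H.avg_def[of "Suc 0"])
  also have "\<dots> = (\<Sum>x'\<in>H.desc (Suc 0) z'. qavg b f (proj x') / of_nat q)"
    unfolding sum_divide_distrib
  proof (intro sum.cong refl)
    fix x' assume x': "x' \<in> H.desc (Suc 0) z'"
    have "m' x' = m' z' / real q" using mass[of x' z'] x' by (simp add: H.desc_1)
    then show "H.avg b f' x' * of_real (m' x') / of_real (m' z') = qavg b f (proj x') / of_nat q"
      by (simp add: IH[OF x'])
  qed
  also have "\<dots> = (\<Sum>x\<in>S.desc (Suc 0) (proj z'). of_nat (k x) * (qavg b f x / of_nat q))"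
    by (rule sum_fibre) (use Suc.prems in simp)
  also have "\<dots> = (\<Sum>x\<in>S.desc (Suc 0) (proj z'). \<Sum>y\<in>S.desc b x. f y * of_real (wt (Suc b) y))"
  proof (intro sum.cong refl)
    fix x
    show "of_nat (k x) * (qavg b f x / of_nat q) = (\<Sum>y\<in>S.desc b x. f y * of_real (wt (Suc b) y))"
      unfolding qavg_def sum_divide_distrib sum_distrib_left
      by (intro sum.cong refl) (simp add: wt_def S.mem_desc)
  qed
  also have "\<dots> = qavg (Suc b) f (proj z')" by (simp add: qavg_def S.sum_desc_Suc[of _ b])
  finally show ?case .
qed

definition qUU :: "nat \<Rightarrow> ('a \<Rightarrow> complex) \<Rightarrow> 'a \<Rightarrow> complex" where
  "qUU n f x = (\<Sum>a\<le>n. qavg (n - a) f ((S.p ^^ a) x))"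

text \<open>The condition on levels keeps all ancestors visited by \<open>UU n\<close> at or below
  \<open>top'\<close>, so \<open>f'\<close> is only read at descendants of \<open>top'\<close>,
  where it is the pullback of \<open>f\<close>.\<close>

lemma UU_lift:
  assumes x': "level T' x' + int n \<le> level T top" "(H.p ^^ d) x' = top'"
    and f': "\<And>d y'. y' \<in> H.desc d top' \<Longrightarrow> f' y' = f (proj y')"
  shows "H.UU n f' x' = qUU n f (proj x')"
  unfolding H.UU_def qUU_def
proof (intro sum.cong refl)
  fix a assume a: "a \<in> {..n}"
  have l: "level T' ((H.p ^^ a) x') \<le> level T top" using a x'(1) by (simp add: H.level_pred_pow)
  have "level T' x' + int d = level T top" using x'(2) level_top H.level_pred_pow[of d x'] by simp
  then have ad: "a \<le> d" using a x'(1) by simp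
  have "H.avg (n - a) f' ((H.p ^^ a) x') = qavg (n - a) f (proj ((H.p ^^ a) x'))"
  proof (rule avg_lift[OF l])
    fix y' assume y': "y' \<in> H.desc (n - a) ((H.p ^^ a) x')"
    have "(H.p ^^ (d - a + (n - a))) y' = (H.p ^^ (d - a)) ((H.p ^^ a) x')"
      using y' by (simp add: funpow_add H.mem_desc)
    also have "\<dots> = (H.p ^^ (d - a + a)) x'" by (simp only: funpow_add o_apply)
    also have "\<dots> = top'" using ad x'(2) by simp
    finally show "f' y' = f (proj y')" using f'[of y' "d - a + (n - a)"] by (simp add: H.mem_desc)
  qed
  then show "H.avg (n - a) f' ((H.p ^^ a) x') = qavg (n - a) f ((S.p ^^ a) (proj x'))"
    using pred_pow_proj[of x' a] x'(1) a by simp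
qed

definition height :: "'a \<Rightarrow> nat" where "height x = nat (level T top - level T x)"

text \<open>Restricting to descendants of \<open>top'\<close> makes the fibre finite; the full
  preimage under \<open>proj\<close> may be infinite.\<close>

definition fibre :: "'a \<Rightarrow> 'b set" where
  "fibre x = {x' \<in> H.desc (height x) top'. proj x' = x}"

lemma finite_fibre: "finite (fibre x)"
  by (simp add: fibre_def)

lemma height_eq: "(S.p ^^ d) x = top \<Longrightarrow> height x = d"
  using S.level_pred_pow[of d x] by (simp add: height_def)

lemma level_fibre: "x' \<in> fibre x \<Longrightarrow> (S.p ^^ d) x = top \<Longrightarrow> level T' x' = level T x"
  using H.level_desc[of x' "height x" top'] level_proj[of x'] level_top
  by (auto simp: fibre_def)

text \<open>This is \<open>avg_lift\<close> for the indicator of \<open>x\<close>, read at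
  \<open>top'\<close>.\<close>

lemma mass_fibre:
  assumes x: "(S.p ^^ d) x = top"
  shows "(\<Sum>x'\<in>fibre x. m' x') = m' top' * wt d x"
proof -
  have h: "height x = d" using height_eq[OF x] .
  have "H.avg d (\<lambda>x'. if proj x' = x then 1 else 0) top' = qavg d (\<lambda>y. if y = x then 1 else 0) (proj top')"
    by (rule avg_lift) (simp_all add: level_top)
  also have "proj top' = top" by (rule proj_top[OF level_top])
  also have "qavg d (\<lambda>y. if y = x then 1 else 0) top = (\<Sum>y\<in>S.desc d top. if y = x then of_real (wt d x) else 0)"
    unfolding qavg_def by (intro sum.cong refl) simp
  also have "\<dots> = of_real (wt d x)" using x by (simp add: S.mem_desc)
  finally have 1: "H.avg d (\<lambda>x'. if proj x' = x then 1 else 0) top' = of_real (wt d x)" .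
  have "(\<Sum>y\<in>H.desc d top'. (if proj y = x then 1 else 0) * complex_of_real (m' y))
      = (\<Sum>y\<in>H.desc d top'. if proj y = x then complex_of_real (m' y) else 0)"
    by (intro sum.cong refl) simp
  also have "\<dots> = (\<Sum>x'\<in>fibre x. of_real (m' x'))"
    by (simp add: fibre_def h sum.inter_filter)
  finally have "H.avg d (\<lambda>x'. if proj x' = x then 1 else 0) top' = of_real ((\<Sum>x'\<in>fibre x. m' x') / m' top')"
    by (simp add: H.avg_def)
  with 1 have "(\<Sum>x'\<in>fibre x. m' x') / m' top' = wt d x" by (metis of_real_eq_iff)
  then show ?thesis using H.m_pos[of top'] by (simp add: field_simps)
qed

text \<open>Projected vertices meet no later than the vertices themselves. Either the common
  ancestor can be projected, or it lies above \<open>top'\<close>, and then \<open>x\<close> and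
  \<open>y\<close> have already met at \<open>top\<close>.\<close>

lemma dist_fibre:
  assumes x: "(S.p ^^ d) x = top" and y: "(S.p ^^ e) y = top"
    and x': "x' \<in> fibre x" and y': "y' \<in> fibre y"
  shows "graph_dist (edges T) x y \<le> graph_dist (edges T') x' y'"
proof -
  obtain a b where ab: "(H.p ^^ a) x' = (H.p ^^ b) y'" "a + b \<le> graph_dist (edges T') x' y'"
    using H.graph_dist_confluent by blast
  have lx: "level T x + int d = level T top" and ly: "level T y + int e = level T top"
    using S.level_pred_pow[of d x] S.level_pred_pow[of e y] x y by simp_all
  have lx': "level T' x' = level T x" and ly': "level T' y' = level T y"
    using level_fibre[OF x' x] level_fibre[OF y' y] by auto
  have px: "proj x' = x" "proj y' = y" using x' y' by (auto simp: fibre_def)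
  have leq: "level T x + int a = level T y + int b"
    using arg_cong[OF ab(1), of "level T'"] by (simp add: H.level_pred_pow lx' ly')
  show ?thesis
  proof (cases "a \<le> d")
    case True
    then have "(S.p ^^ a) x = (S.p ^^ b) y"
      using pred_pow_proj[of x' a] pred_pow_proj[of y' b] ab(1) lx ly leq lx' ly' by (simp add: px)
    from S.graph_dist_le[OF this] show ?thesis using ab(2) by simp
  next
    case False
    have "(S.p ^^ d) x = (S.p ^^ e) y" using x y by simp
    from S.graph_dist_le[OF this] show ?thesis using ab(2) False lx ly leq by simp
  qed
qed

end

text \<open>Both series share the majorant \<open>s n * B\<close>, so from index \<open>N\<close> on
  their difference is controlled by the tail of \<open>s\<close> alone, whatever \<open>u\<close>
  and \<open>v\<close> are.\<close>

lemma norm_suminf_diff_le: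
  fixes u v :: "nat \<Rightarrow> complex"
  assumes s: "summable s" and u: "\<And>n. norm (u n) \<le> s n * B" and v: "\<And>n. norm (v n) \<le> s n * B"
  shows "norm (suminf u - suminf v) \<le> (\<Sum>n<N. norm (u n - v n)) + (\<Sum>n. s (n + N)) * (2 * B)"
proof -
  have sB: "summable (\<lambda>n. s n * B)" using s by (rule summable_mult2)
  have su: "summable u" by (rule summable_comparison_test[OF _ sB]) (use u in auto)
  have sv: "summable v" by (rule summable_comparison_test[OF _ sB]) (use v in auto)
  have sN: "summable (\<lambda>n. s (n + N) * (2 * B))" using s by (intro summable_mult2) (simp add: summable_iff_shift)
  have le: "norm (u (n + N) - v (n + N)) \<le> s (n + N) * (2 * B)" for n
    using norm_triangle_ineq4[of "u (n + N)" "v (n + N)"] u[of "n + N"] v[of "n + N"] by simp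
  have "suminf u - suminf v = (\<Sum>n. u n - v n)" by (rule suminf_diff[OF su sv])
  also have "\<dots> = (\<Sum>n. u (n + N) - v (n + N)) + (\<Sum>n<N. u n - v n)"
    by (rule suminf_split_initial_segment[OF summable_diff[OF su sv]])
  finally have "norm (suminf u - suminf v) \<le> norm (\<Sum>n. u (n + N) - v (n + N)) + norm (\<Sum>n<N. u n - v n)"
    by (simp add: norm_triangle_ineq)
  moreover have "norm (\<Sum>n. u (n + N) - v (n + N)) \<le> (\<Sum>n. s (n + N) * (2 * B))"
    by (rule norm_suminf_le[OF le sN])
  moreover have "(\<Sum>n. s (n + N) * (2 * B)) = (\<Sum>n. s (n + N)) * (2 * B)"
    by (rule suminf_mult2[symmetric]) (use s in \<open>simp add: summable_iff_shift\<close>)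
  moreover have "norm (\<Sum>n<N. u n - v n) \<le> (\<Sum>n<N. norm (u n - v n))" by (rule norm_sum)
  ultimately show ?thesis by linarith
qed

text \<open>The pullback of \<open>f\<close> along a map with fibres \<open>V x\<close> over
  \<open>X\<close>, and zero elsewhere. Formulating it through the sets lets the limit arguments
  forget the map; for disjoint fibres at most one summand is nonzero.\<close>

definition lift :: "'a set \<Rightarrow> ('a \<Rightarrow> 'b set) \<Rightarrow> ('a \<Rightarrow> complex) \<Rightarrow> 'b \<Rightarrow> complex" where
  "lift X V f y' = (\<Sum>x\<in>X. if y' \<in> V x then f x else 0)"

lemma lift_eq:
  assumes "finite X" "x \<in> X" "y' \<in> V x" "\<forall>x z. z \<noteq> x \<longrightarrow> V x \<inter> V z = {}"
  shows "lift X V f y' = f x"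
proof -
  have "lift X V f y' = (\<Sum>z\<in>X. if z = x then f z else 0)"
    unfolding lift_def
  proof (intro sum.cong refl)
    fix z
    have "y' \<in> V z \<longleftrightarrow> z = x" using assms(3,4) by blast
    then show "(if y' \<in> V z then f z else 0) = (if z = x then f z else 0)" by simp
  qed
  then show ?thesis using assms(1,2) by simp
qed

lemma norm_lift_le:
  assumes "finite X" "\<And>x. norm (f x) \<le> B" "\<forall>x z. z \<noteq> x \<longrightarrow> V x \<inter> V z = {}"
  shows "norm (lift X V f y') \<le> B"
proof (cases "\<exists>x\<in>X. y' \<in> V x")
  case True
  then obtain x where x: "x \<in> X" "y' \<in> V x" by blast
  have "lift X V f y' = f x" by (rule lift_eq[OF assms(1) x assms(3)])
  then show ?thesis using assms(2)[of x] by simp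
next
  case False
  then have "lift X V f y' = 0" unfolding lift_def by (intro sum.neutral) auto
  then show ?thesis using order_trans[OF norm_ge_zero assms(2)] by simp
qed

lemma (in homogeneous_cover) fibre_disjoint: "\<forall>x z. z \<noteq> x \<longrightarrow> fibre x \<inter> fibre z = {}"
  by (auto simp: fibre_def)

lemma (in homogeneous_cover) lift_fibre:
  assumes X: "finite X" "{x. f x \<noteq> 0} \<subseteq> X" and y': "y' \<in> H.desc d top'"
  shows "lift X fibre f y' = f (proj y')"
proof -
  have "level T' y' + int d = level T top" using H.level_desc[OF y'] level_top by simp
  from height_eq[OF pred_pow_proj_top[OF this]] y' have "y' \<in> fibre (proj y')" by (simp add: fibre_def)
  then show ?thesis
  proof (cases "proj y' \<in> X")
    case True
    then show ?thesis using lift_eq[OF X(1) True \<open>y' \<in> fibre (proj y')\<close> fibre_disjoint] by simp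
  next
    case False
    then have "lift X fibre f y' = 0" unfolding lift_def by (intro sum.neutral) (auto simp: fibre_def)
    then show ?thesis using False X(2) by auto
  qed
qed

section \<open>Comparison with the family of homogeneous trees\<close>

locale homogeneous_family = flow_tree T m for T :: "'a rooted_tree" and m :: "'a \<Rightarrow> real" +
  fixes \<T> :: "nat \<Rightarrow> 'b rooted_tree"
  assumes homogeneous: "\<And>q. q \<ge> 1 \<Longrightarrow> is_homogeneous_tree q (\<T> q)"
begin

abbreviation mq :: "nat \<Rightarrow> 'b \<Rightarrow> real" where "mq q \<equiv> canonical_flow q (\<T> q)"
abbreviation Sq :: "nat \<Rightarrow> (nat \<Rightarrow> complex) \<Rightarrow> ('b \<Rightarrow> complex) \<Rightarrow> 'b \<Rightarrow> complex" where
  "Sq q \<equiv> flow_tree.Sop (\<T> q) (mq q)"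

lemma flow_tree_q: "1 \<le> q \<Longrightarrow> flow_tree (\<T> q) (mq q)"
  by (rule homogeneous_flow_tree[OF homogeneous])

text \<open>All that the limit arguments use of the projection. The masses of the fibres are
  \<open>\<kappa> x\<close> up to one common factor \<open>C\<close>: that factor depends on
  \<open>q\<close> but cancels from every inequality, whereas \<kappa> converges to a multiple of
  \<open>m\<close>.\<close>

definition transfers :: "nat \<Rightarrow> (nat \<Rightarrow> complex) \<Rightarrow> ('a \<Rightarrow> complex) \<Rightarrow> real \<Rightarrow> 'a set \<Rightarrow> ('a \<Rightarrow> real)
    \<Rightarrow> ('a \<Rightarrow> 'b set) \<Rightarrow> real \<Rightarrow> bool" where
  "transfers q c f e X \<kappa> V C \<longleftrightarrow> 0 < C \<and> (\<forall>x z. z \<noteq> x \<longrightarrow> V x \<inter> V z = {}) \<and>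
     (\<forall>x\<in>X. finite (V x) \<and> (\<Sum>x'\<in>V x. mq q x') = C * \<kappa> x \<and>
       (\<forall>x'\<in>V x. level (\<T> q) x' = level T x \<and> norm (Sq q c (lift X V f) x' - Sop c f x) \<le> e \<and>
         (\<forall>y\<in>X. \<forall>y'\<in>V y. graph_dist (edges T) x y \<le> graph_dist (edges (\<T> q)) x' y')))"

lemma prod_ratio: "(\<Prod>i<d. m ((p ^^ i) y) / m (p ((p ^^ i) y))) = m y / m ((p ^^ d) y)"
  by (induction d) simp_all

text \<open>The series is cut at an \<open>N\<close> that does not depend on \<open>q\<close>:
  lifting does not increase the bound \<open>B\<close> on \<open>f\<close>, so both tails have the
  same majorant. The vertex \<open>top\<close> lies at least \<open>N\<close> generations above
  \<open>X\<close>, hence the first \<open>N\<close> terms on the homogeneous tree are finite sums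
  over the weights \<open>W\<close>, and these converge.\<close>

lemma transfer_exists:
  assumes c: "summable (\<lambda>n. real (Suc n) * norm (c n))"
    and X: "finite X" "{x. f x \<noteq> 0} \<subseteq> X" and e: "0 < e"
  shows "\<exists>\<kappa> K. 0 < K \<and> (\<forall>x\<in>X. (\<lambda>q. \<kappa> q x) \<longlonglongrightarrow> m x * K) \<and>
     (\<forall>\<^sub>F q in sequentially. 1 \<le> q \<and> (\<exists>V C. transfers q c f e X (\<kappa> q) V C))"
proof -
  define B where "B = (\<Sum>x\<in>X. norm (f x))"
  have B0: "0 \<le> B" unfolding B_def by (simp add: sum_nonneg)
  have B: "norm (f x) \<le> B" for x
  proof (cases "x \<in> X")
    case True
    then show ?thesis unfolding B_def using X(1) by (intro member_le_sum) auto
  next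
    case False
    then have "f x = 0" using X(2) by blast
    then show ?thesis using B0 by simp
  qed
  define s where "s n = real (Suc n) * norm (c n)" for n
  have s: "summable s" using c by (simp add: s_def[abs_def])
  \<comment> \<open>\<open>B + 1\<close> in place of \<open>B\<close> covers the case
    \<open>f = 0\<close>. Each of the two tails and the initial segments together must cost at most
    \<open>e\<close>.\<close>
  have "0 < e / (4 * (B + 1))" using e B0 by simp
  from suminf_exist_split[OF this s] obtain N where N: "norm (\<Sum>n. s (n + N)) < e / (4 * (B + 1))" by (metis order_refl)
  have "(\<Sum>n. s (n + N)) * (2 * B) \<le> e / (4 * (B + 1)) * (2 * (B + 1))"
    using N B0 e by (intro mult_mono) auto
  also have "\<dots> = e / 2" using B0 by (simp add: field_simps)
  finally have tail: "(\<Sum>n. s (n + N)) * (2 * B) \<le> e / 2" .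
  obtain top where top: "\<forall>x\<in>X. \<exists>d\<ge>N. (p ^^ d) x = top" using common_ancestor[OF X(1)] by (rule exE)
  obtain k :: "nat \<Rightarrow> 'a \<Rightarrow> nat" where k0: "(\<forall>q z. (\<Sum>y\<in>desc (Suc 0) z. k q y) = q)
     \<and> (\<forall>y. (\<lambda>q. real (k q y) / real q) \<longlonglongrightarrow> m y / m (p y))" using allocation_exists by (rule exE)
  note k = conjunct1[OF k0, rule_format] conjunct2[OF k0, rule_format]
  define W where "W q b y = (\<Prod>i<b. real (k q ((p ^^ i) y)) / real q)" for q b y
  have W: "(\<lambda>q. W q b y) \<longlonglongrightarrow> m y / m ((p ^^ b) y)" for b y
  proof -
    have "(\<lambda>q. W q b y) \<longlonglongrightarrow> (\<Prod>i<b. m ((p ^^ i) y) / m (p ((p ^^ i) y)))"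
      unfolding W_def by (rule tendsto_prod) (rule k(2))
    then show ?thesis by (simp only: prod_ratio)
  qed
  \<comment> \<open>The operator \<open>qUU\<close> of the projection, written outside its locale so
    that the limit in \<open>q\<close> can be taken.\<close>
  define QU where "QU q n x = (\<Sum>a\<le>n. \<Sum>y\<in>desc (n - a) ((p ^^ a) x). f y * complex_of_real (W q (n - a) y))" for q n x
  have QU: "(\<lambda>q. QU q n x) \<longlonglongrightarrow> UU n f x" for n x
  proof -
    have "(\<lambda>q. QU q n x) \<longlonglongrightarrow> (\<Sum>a\<le>n. \<Sum>y\<in>desc (n - a) ((p ^^ a) x). f y * complex_of_real (m y / m ((p ^^ (n - a)) y)))"
      unfolding QU_def by (intro tendsto_intros W)
    also have "(\<Sum>a\<le>n. \<Sum>y\<in>desc (n - a) ((p ^^ a) x). f y * complex_of_real (m y / m ((p ^^ (n - a)) y))) = UU n f x"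
      unfolding UU_def avg_def sum_divide_distrib
      by (intro sum.cong refl) (simp add: mem_desc)
    finally show ?thesis .
  qed
  have "\<forall>\<^sub>F q in sequentially. (\<Sum>n<N. norm (c n * QU q n x - c n * UU n f x)) < e / 2" for x
  proof -
    have "(\<lambda>q. \<Sum>n<N. norm (c n * QU q n x - c n * UU n f x)) \<longlonglongrightarrow> (\<Sum>n<N. norm (c n * UU n f x - c n * UU n f x))"
      by (intro tendsto_intros QU)
    from order_tendstoD(2)[OF this, of "e / 2"] show ?thesis using e by simp
  qed
  then have "\<forall>\<^sub>F q in sequentially. \<forall>x\<in>X. (\<Sum>n<N. norm (c n * QU q n x - c n * UU n f x)) < e / 2"
    by (intro eventually_ball_finite[OF X(1)] ballI)
  then have ev: "\<forall>\<^sub>F q in sequentially. 1 \<le> q \<and> (\<forall>x\<in>X. (\<Sum>n<N. norm (c n * QU q n x - c n * UU n f x)) < e / 2)"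
    using eventually_ge_at_top[of 1] by eventually_elim blast
  define ht where "ht x = nat (level T top - level T x)" for x
  have ht: "(p ^^ ht x) x = top" "N \<le> ht x" if x: "x \<in> X" for x
  proof -
    obtain d where d: "d \<ge> N" "(p ^^ d) x = top" using bspec[OF top x] by (elim exE conjE)
    have "ht x = d" using level_pred_pow[of d x] d(2) by (simp add: ht_def)
    then show "(p ^^ ht x) x = top" "N \<le> ht x" using d by auto
  qed
  have main: "\<exists>V C. transfers q c f e X (\<lambda>x. W q (ht x) x) V C"
    if q: "1 \<le> q" and est: "\<And>x. x \<in> X \<Longrightarrow> (\<Sum>n<N. norm (c n * QU q n x - c n * UU n f x)) < e / 2" for q
  proof -
    interpret H: flow_tree "\<T> q" "mq q" by (rule flow_tree_q[OF q])
    obtain top' where top': "level (\<T> q) top' = level T top" using H.level_surj by blast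
    interpret cover: homogeneous_cover T m "\<T> q" "mq q" q "k q" top top'
    proof
      show "card {x'. H.p x' = z'} = q" for z'
        using homogeneous[OF q] by (simp add: is_homogeneous_tree_def H.succs_eq)
      show "mq q x' = mq q z' / real q" if "H.p x' = z'" for x' z'
        using H.level_pred[of x'] q that by (auto simp: canonical_flow_def power_int_add)
    qed (use q k(1) top' in auto)
    have WW: "cover.wt b y = W q b y" for b y by (simp add: cover.wt_def W_def)
    have hh: "cover.height x = ht x" for x by (simp add: cover.height_def ht_def)
    have QQ: "cover.qUU n f x = QU q n x" for n x by (simp add: cover.qUU_def cover.qavg_def QU_def WW)
    have "transfers q c f e X (\<lambda>x. W q (ht x) x) cover.fibre (mq q top')"
      unfolding transfers_def
    proof (intro conjI allI impI ballI)
      show "0 < mq q top'" by (rule H.m_pos)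
      show "cover.fibre x \<inter> cover.fibre z = {}" if "z \<noteq> x" for x z
        using cover.fibre_disjoint that by blast
      fix x assume x: "x \<in> X"
      show "finite (cover.fibre x)" by (rule cover.finite_fibre)
      show "(\<Sum>x'\<in>cover.fibre x. mq q x') = mq q top' * W q (ht x) x"
        using cover.mass_fibre[OF ht(1)[OF x]] by (simp add: WW)
      fix x' assume x': "x' \<in> cover.fibre x"
      show lev: "level (\<T> q) x' = level T x" by (rule cover.level_fibre[OF x' ht(1)[OF x]])
      show "graph_dist (edges T) x y \<le> graph_dist (edges (\<T> q)) x' y'"
        if "y \<in> X" "y' \<in> cover.fibre y" for y y'
        by (rule cover.dist_fibre[OF ht(1)[OF x] ht(1)[OF that(1)] x' that(2)])
      let ?f' = "lift X cover.fibre f"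
      have fB: "norm (?f' y') \<le> B" for y' by (rule norm_lift_le[OF X(1) B cover.fibre_disjoint])
      have px: "cover.proj x' = x" "(H.p ^^ ht x) x' = top'" using x' by (auto simp: cover.fibre_def H.mem_desc hh)
      have eq: "H.UU n ?f' x' = QU q n x" if "n < N" for n
      proof -
        have "level (\<T> q) x' + int n \<le> level T top"
          using that ht[OF x] level_pred_pow[of "ht x" x] lev by simp
        from cover.UU_lift[OF this px(2), of ?f' f] show ?thesis
          using cover.lift_fibre[OF X] by (simp add: QQ px(1))
      qed
      have 1: "norm (c n * H.UU n ?f' x') \<le> s n * B" for n
        using mult_left_mono[OF H.bounded_UU[OF fB], of "norm (c n)"] by (simp add: norm_mult s_def mult_ac)
      have 2: "norm (c n * UU n f x) \<le> s n * B" for n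
        using mult_left_mono[OF bounded_UU[OF B], of "norm (c n)"] by (simp add: norm_mult s_def mult_ac)
      have "norm (H.Sop c ?f' x' - Sop c f x)
          \<le> (\<Sum>n<N. norm (c n * H.UU n ?f' x' - c n * UU n f x)) + (\<Sum>n. s (n + N)) * (2 * B)"
        unfolding H.Sop_def Sop_def by (rule norm_suminf_diff_le[OF s 1 2])
      moreover have "(\<Sum>n<N. norm (c n * H.UU n ?f' x' - c n * UU n f x)) = (\<Sum>n<N. norm (c n * QU q n x - c n * UU n f x))"
        by (intro sum.cong refl) (simp add: eq)
      ultimately show "norm (H.Sop c ?f' x' - Sop c f x) \<le> e"
        using est[OF x] tail by linarith
    qed
    then show ?thesis by blast
  qed
  show ?thesis
  proof (intro exI conjI)
    show "0 < 1 / m top" using m_pos by simp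
    show "\<forall>x\<in>X. (\<lambda>q. W q (ht x) x) \<longlonglongrightarrow> m x * (1 / m top)"
      using W ht(1) by fastforce
    show "\<forall>\<^sub>F q in sequentially. 1 \<le> q \<and> (\<exists>V C. transfers q c f e X (\<lambda>x. W q (ht x) x) V C)"
      using ev by eventually_elim (use main in blast)
  qed
qed

end

section \<open>Testing norms on finite sets, and truncation\<close>

lemma sum_le_nn_integral_count_space:
  fixes h :: "'b \<Rightarrow> real"
  assumes h: "\<And>x. 0 \<le> h x" and X: "finite X"
  shows "ennreal (sum h X) \<le> (\<integral>\<^sup>+x. ennreal (h x) \<partial>count_space UNIV)"
proof -
  have "ennreal (sum h X) = (\<Sum>x\<in>X. ennreal (h x))" using h by (simp add: sum_ennreal)
  also have "\<dots> = (\<integral>\<^sup>+x. ennreal (h x) \<partial>count_space X)" by (rule nn_integral_count_space_finite[OF X, symmetric])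
  also have "\<dots> = (\<integral>\<^sup>+x. ennreal (h x) * indicator X x \<partial>count_space UNIV)"
    by (simp add: nn_integral_count_space_indicator)
  also have "\<dots> \<le> (\<integral>\<^sup>+x. ennreal (h x) \<partial>count_space UNIV)"
    by (intro nn_integral_mono) (auto simp: indicator_def)
  finally show ?thesis .
qed

context flow_tree
begin

lemma nn_integral_flow_le_iff:
  assumes h: "\<And>x. 0 \<le> h x" and K: "0 \<le> K"
  shows "(\<integral>\<^sup>+x. ennreal (h x) \<partial>flow_measure m) \<le> ennreal K \<longleftrightarrow> (\<forall>X. finite X \<longrightarrow> (\<Sum>x\<in>X. h x * m x) \<le> K)"
proof -
  have nn: "0 \<le> h x * m x" for x using h[of x] m_pos[of x] by simp
  have eq: "(\<integral>\<^sup>+x. ennreal (h x) \<partial>flow_measure m) = (\<integral>\<^sup>+x. ennreal (h x * m x) \<partial>count_space UNIV)"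
    unfolding nn_integral_flow
    by (intro nn_integral_cong) (use h m_pos in \<open>simp add: ennreal_mult less_imp_le mult.commute\<close>)
  show ?thesis unfolding eq
  proof (intro iffI allI impI)
    fix X :: "'a set" assume a: "(\<integral>\<^sup>+x. ennreal (h x * m x) \<partial>count_space UNIV) \<le> ennreal K" and X: "finite X"
    from order_trans[OF sum_le_nn_integral_count_space[OF nn X] a] show "(\<Sum>x\<in>X. h x * m x) \<le> K"
      using K by (simp add: ennreal_le_iff)
  next
    assume "\<forall>X. finite X \<longrightarrow> (\<Sum>x\<in>X. h x * m x) \<le> K"
    then show "(\<integral>\<^sup>+x. ennreal (h x * m x) \<partial>count_space UNIV) \<le> ennreal K"
      by (intro nn_integral_count_space_le_finite nn) simp
  qed
qed

lemma Lp_norm_le_iff_sums: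
  assumes q: "1 \<le> q" "q \<noteq> \<infinity>" and C: "0 \<le> C"
  shows "Lp_norm m q f \<le> ennreal C \<longleftrightarrow>
    (\<forall>X. finite X \<longrightarrow> (\<Sum>x\<in>X. norm (f x) powr enn2real q * m x) \<le> C powr enn2real q)"
proof -
  have r: "0 < enn2real q" using ennreal_real_ge_1[OF q] by simp
  show ?thesis unfolding Lp_norm_le_iff[OF q(2) r C] pint_def
    by (intro nn_integral_flow_le_iff) simp_all
qed

text \<open>Takes the place of density, which fails for \<open>q = \<infinity>\<close>: only the
  values at the finitely many vertices of \<open>X\<close> have to be kept. \<open>Y\<close>
  contains every vertex read by the first \<open>N\<close> operators at \<open>X\<close>, and the
  tail is small uniformly for functions dominated by \<open>|f|\<close>, because \<open>|f|\<close>
  is tame too.\<close>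

lemma Sop_truncate:
  assumes c: "summable (\<lambda>n. real (Suc n) * norm (c n))" and f: "f \<in> Lp m q" "1 \<le> q"
    and X: "finite X" and e: "0 < e"
  shows "\<exists>Y. finite Y \<and> X \<subseteq> Y \<and> (\<forall>x\<in>X. norm (Sop c (\<lambda>y. if y \<in> Y then f y else 0) x - Sop c f x) \<le> e)"
proof -
  let ?g = "\<lambda>y. complex_of_real (norm (f y))"
  have "Lp_norm m q ?g = Lp_norm m q f" unfolding Lp_norm_def by simp
  then have "?g \<in> Lp m q" using f(1) unfolding Lp_def by simp
  then have "tame ?g" using f(2) by (rule Lp_tame)
  then have "\<forall>x. \<exists>C. \<forall>a b. norm (avg b ?g ((p ^^ a) x)) \<le> C" by (simp add: tame_def)
  from choice[OF this] obtain C where C: "\<And>x a b. norm (avg b ?g ((p ^^ a) x)) \<le> C x" by blast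
  have avg_g: "norm (avg b ?g z) = avg_real b (\<lambda>y. norm (f y)) z" for b z
  proof -
    have "avg b ?g z = of_real (avg_real b (\<lambda>y. norm (f y)) z)" by (simp add: avg_def avg_real_def)
    then show ?thesis by (simp add: avg_real_nonneg)
  qed
  have bd: "norm (UU n h x) \<le> real (Suc n) * C x" if h: "\<And>y. norm (h y) \<le> norm (f y)" for n x h
  proof -
    have "norm (avg (n - a) h ((p ^^ a) x)) \<le> C x" for a
    proof -
      have "norm (avg (n - a) h ((p ^^ a) x)) \<le> avg_real (n - a) (\<lambda>y. norm (h y)) ((p ^^ a) x)" by (rule norm_avg_le)
      also have "\<dots> \<le> avg_real (n - a) (\<lambda>y. norm (f y)) ((p ^^ a) x)"
        unfolding avg_real_def using h less_imp_le[OF m_pos] by (intro divide_right_mono sum_mono mult_right_mono)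
      finally show ?thesis using C[where a = a and b = "n - a" and x = x] by (simp add: avg_g)
    qed
    then have "norm (UU n h x) \<le> (\<Sum>a\<le>n. C x)" unfolding UU_def by (intro order_trans[OF norm_sum] sum_mono)
    then show ?thesis by simp
  qed
  define s where "s n = real (Suc n) * norm (c n)" for n
  have s: "summable s" using c by (simp add: s_def[abs_def])
  have bds: "norm (c n * UU n h x) \<le> s n * C x" if h: "\<And>y. norm (h y) \<le> norm (f y)" for n x h
    using mult_left_mono[OF bd[OF h], of "norm (c n)"] by (simp add: norm_mult s_def mult_ac)
  have "\<forall>\<^sub>F N in sequentially. (\<Sum>n. s (n + N)) * (2 * C x) < e" for x
  proof -
    have "(\<lambda>N. suminf s - (\<Sum>n<N. s n)) \<longlonglongrightarrow> suminf s - suminf s"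
      by (intro tendsto_diff tendsto_const summable_LIMSEQ[OF s])
    then have "(\<lambda>N. \<Sum>n. s (n + N)) \<longlonglongrightarrow> 0" by (simp add: suminf_minus_initial_segment[OF s])
    then have "(\<lambda>N. (\<Sum>n. s (n + N)) * (2 * C x)) \<longlonglongrightarrow> 0 * (2 * C x)" by (rule tendsto_mult_right)
    from order_tendstoD(2)[OF this, of e] show ?thesis using e by simp
  qed
  then have "\<forall>\<^sub>F N in sequentially. \<forall>x\<in>X. (\<Sum>n. s (n + N)) * (2 * C x) < e"
    by (intro eventually_ball_finite[OF X] ballI)
  then obtain N where N: "\<And>x. x \<in> X \<Longrightarrow> (\<Sum>n. s (n + N)) * (2 * C x) < e"
    by (auto simp: eventually_sequentially)
  define Y where "Y = X \<union> (\<Union>x\<in>X. \<Union>n<N. \<Union>a\<le>n. desc (n - a) ((p ^^ a) x))"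
  let ?h = "\<lambda>y. if y \<in> Y then f y else 0"
  have "norm (Sop c ?h x - Sop c f x) \<le> e" if x: "x \<in> X" for x
  proof -
    have eq: "UU n ?h x = UU n f x" if n: "n < N" for n
      unfolding UU_def avg_def
    proof (intro sum.cong refl arg_cong2[of _ _ _ _ "(/)"])
      fix a y assume a: "a \<in> {..n}" and y: "y \<in> desc (n - a) ((p ^^ a) x)"
      have "y \<in> Y" unfolding Y_def using x n a y by blast
      then show "(if y \<in> Y then f y else 0) * complex_of_real (m y) = f y * complex_of_real (m y)" by simp
    qed
    have "norm (Sop c ?h x - Sop c f x)
        \<le> (\<Sum>n<N. norm (c n * UU n ?h x - c n * UU n f x)) + (\<Sum>n. s (n + N)) * (2 * C x)"
      unfolding Sop_def by (rule norm_suminf_diff_le[OF s bds bds]) simp_all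
    also have "(\<Sum>n<N. norm (c n * UU n ?h x - c n * UU n f x)) = 0" by (intro sum.neutral) (simp add: eq)
    finally show ?thesis using N[OF x] by simp
  qed
  moreover have "finite Y" "X \<subseteq> Y" using X by (auto simp: Y_def)
  ultimately show ?thesis by blast
qed

end

section \<open>Passage to the limit in the degree\<close>

lemma tendsto_le_frequently:
  fixes u v :: "nat \<Rightarrow> real"
  assumes "u \<longlonglongrightarrow> a" "v \<longlonglongrightarrow> b" "\<exists>\<^sub>F q in sequentially. u q \<le> v q"
  shows "a \<le> b"
proof (rule ccontr)
  assume "\<not> a \<le> b"
  then obtain t where t: "b < t" "t < a" using dense by (auto simp: not_le)
  have "\<forall>\<^sub>F q in sequentially. v q < u q"
    using order_tendstoD(2)[OF assms(2) t(1)] order_tendstoD(1)[OF assms(1) t(2)] by eventually_elim simp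
  then show False using assms(3) by (simp add: frequently_def not_le)
qed

lemma tendsto_powr_max_diff:
  fixes A r :: real
  assumes "0 \<le> A" "0 < r"
  shows "((\<lambda>e. max 0 (A - e) powr r) \<longlongrightarrow> A powr r) (at_right 0)"
proof -
  have "((\<lambda>e. max 0 (A - e)) \<longlongrightarrow> max 0 (A - 0)) (at_right 0)"
    by (intro tendsto_intros)
  then have "((\<lambda>e. max 0 (A - e)) \<longlongrightarrow> A) (at_right 0)" using assms by simp
  then show ?thesis using assms by (intro tendsto_powr') auto
qed

context homogeneous_family
begin

text \<open>For fixed \<open>e\<close>, letting \<open>q\<close> grow along the infinitely many good
  degrees replaces \<kappa> by a multiple of \<open>m\<close>; only afterwards does \<open>e\<close>
  tend to zero. The \<open>max 0\<close> keeps the argument of \<phi> nonnegative, as the powers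
  require.\<close>

lemma transfer_limit:
  fixes \<phi> :: "'a \<Rightarrow> real \<Rightarrow> real"
  assumes c: "summable (\<lambda>n. real (Suc n) * norm (c n))"
    and X: "finite X" "{x. f x \<noteq> 0} \<subseteq> X"
    and P: "\<exists>\<^sub>F q in sequentially. P q"
    and step: "\<And>q \<kappa> V C e. 1 \<le> q \<Longrightarrow> P q \<Longrightarrow> transfers q c f e X \<kappa> V C \<Longrightarrow>
      (\<Sum>x\<in>X. \<phi> x (max 0 (norm (Sop c f x) - e)) * \<kappa> x) \<le> (\<Sum>x\<in>X. \<psi> x * \<kappa> x)"
    and \<phi>: "\<And>x. x \<in> X \<Longrightarrow> ((\<lambda>e. \<phi> x (max 0 (norm (Sop c f x) - e))) \<longlongrightarrow> \<phi> x (norm (Sop c f x))) (at_right 0)"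
  shows "(\<Sum>x\<in>X. \<phi> x (norm (Sop c f x)) * m x) \<le> (\<Sum>x\<in>X. \<psi> x * m x)"
proof -
  have main: "(\<Sum>x\<in>X. \<phi> x (max 0 (norm (Sop c f x) - e)) * m x) \<le> (\<Sum>x\<in>X. \<psi> x * m x)" if e: "0 < e" for e
  proof -
    obtain \<kappa> K where K: "0 < K" "\<forall>x\<in>X. (\<lambda>q. \<kappa> q x) \<longlonglongrightarrow> m x * K"
      "\<forall>\<^sub>F q in sequentially. 1 \<le> q \<and> (\<exists>V C. transfers q c f e X (\<kappa> q) V C)"
      using transfer_exists[OF c X e] by (elim exE conjE)
    have "\<exists>\<^sub>F q in sequentially. (\<Sum>x\<in>X. \<phi> x (max 0 (norm (Sop c f x) - e)) * \<kappa> q x) \<le> (\<Sum>x\<in>X. \<psi> x * \<kappa> q x)"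
    proof (rule frequently_rev_mp[OF P])
      show "\<forall>\<^sub>F q in sequentially. P q \<longrightarrow> (\<Sum>x\<in>X. \<phi> x (max 0 (norm (Sop c f x) - e)) * \<kappa> q x) \<le> (\<Sum>x\<in>X. \<psi> x * \<kappa> q x)"
        using K(3) by eventually_elim (use step in blast)
    qed
    note freq = this
    have lim: "(\<lambda>q. \<Sum>x\<in>X. t x * \<kappa> q x) \<longlonglongrightarrow> (\<Sum>x\<in>X. t x * (m x * K))" for t
      by (rule tendsto_sum, rule tendsto_mult_left, erule bspec[OF K(2)])
    have "(\<Sum>x\<in>X. \<phi> x (max 0 (norm (Sop c f x) - e)) * (m x * K)) \<le> (\<Sum>x\<in>X. \<psi> x * (m x * K))"
      by (rule tendsto_le_frequently[OF lim lim freq])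
    then have "(\<Sum>x\<in>X. \<phi> x (max 0 (norm (Sop c f x) - e)) * m x) * K \<le> (\<Sum>x\<in>X. \<psi> x * m x) * K"
      by (simp add: sum_distrib_right mult.assoc)
    then show ?thesis using K(1) by simp
  qed
  have "((\<lambda>e. \<Sum>x\<in>X. \<phi> x (max 0 (norm (Sop c f x) - e)) * m x) \<longlongrightarrow> (\<Sum>x\<in>X. \<phi> x (norm (Sop c f x)) * m x)) (at_right 0)"
    by (intro tendsto_sum tendsto_mult_right \<phi>)
  then show ?thesis
  proof (rule tendsto_upperbound)
    show "\<forall>\<^sub>F e in at_right 0. (\<Sum>x\<in>X. \<phi> x (max 0 (norm (Sop c f x) - e)) * m x) \<le> (\<Sum>x\<in>X. \<psi> x * m x)"
      unfolding eventually_at_right_field using main by (intro exI[of _ 1]) auto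
  qed simp
qed

lemma transfersD:
  assumes "transfers q c f e X \<kappa> V C"
  shows "0 < C" "\<forall>x z. z \<noteq> x \<longrightarrow> V x \<inter> V z = {}" "\<And>x. x \<in> X \<Longrightarrow> finite (V x)"
  using assms unfolding transfers_def by blast+

lemma transfers_fibre_sum:
  assumes tr: "transfers q c f e X \<kappa> V C" and X: "finite X"
  shows "(\<Sum>x'\<in>(\<Union>x\<in>X. V x). h x') = (\<Sum>x\<in>X. \<Sum>x'\<in>V x. h x')"
proof (rule sum.UNION_disjoint[OF X])
  show "\<forall>x\<in>X. finite (V x)" using tr unfolding transfers_def by blast
  show "\<forall>x\<in>X. \<forall>z\<in>X. x \<noteq> z \<longrightarrow> V x \<inter> V z = {}" using tr unfolding transfers_def by blast
qed

lemma transfers_lift: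
  assumes tr: "transfers q c f e X \<kappa> V C" and X: "finite X" and x: "x \<in> X" "x' \<in> V x"
  shows "lift X V f x' = f x"
  by (rule lift_eq[of X x x' V, OF X x]) (use tr in \<open>simp add: transfers_def\<close>)

lemma transfers_near:
  assumes tr: "transfers q c f e X \<kappa> V C" and x: "x \<in> X" "x' \<in> V x"
  shows "max 0 (norm (Sop c f x) - e) \<le> norm (Sq q c (lift X V f) x')"
proof -
  have "norm (Sq q c (lift X V f) x' - Sop c f x) \<le> e" using tr x unfolding transfers_def by blast
  then have "norm (Sop c f x - Sq q c (lift X V f) x') \<le> e" by (simp only: norm_minus_commute)
  then have "norm (Sop c f x) - norm (Sq q c (lift X V f) x') \<le> e" using norm_triangle_ineq2 order_trans by blast
  then show ?thesis by simp
qed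

lemma transfers_mass:
  assumes tr: "transfers q c f e X \<kappa> V C" and x: "x \<in> X"
  shows "C * (t * \<kappa> x) = (\<Sum>x'\<in>V x. t * mq q x')"
proof -
  have "(\<Sum>x'\<in>V x. mq q x') = C * \<kappa> x" using tr x unfolding transfers_def by blast
  then show ?thesis by (simp add: sum_distrib_left[symmetric])
qed

lemma lift_support: "{y'. lift X V f y' \<noteq> 0} \<subseteq> (\<Union>x\<in>X. V x)"
proof
  fix y' assume y': "y' \<in> {y'. lift X V f y' \<noteq> 0}"
  show "y' \<in> (\<Union>x\<in>X. V x)"
  proof (rule ccontr)
    assume "y' \<notin> (\<Union>x\<in>X. V x)"
    then have "lift X V f y' = 0" unfolding lift_def by (intro sum.neutral) auto
    then show False using y' by simp
  qed
qed

text \<open>The assumed bound is tested on the lift of \<open>f\<close>, which has finite support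
  and whose power sum is \<open>C\<close> times that of \<open>f\<close> with weights \<kappa>. The
  same \<open>C\<close> appears on the other side and cancels.\<close>

lemma Lp_bound_finite_support:
  assumes c: "summable (\<lambda>n. real (Suc n) * norm (c n))"
    and X: "finite X" "{x. f x \<noteq> 0} \<subseteq> X" and r: "1 \<le> r" "r \<noteq> \<infinity>" and M: "0 \<le> M"
    and P: "\<exists>\<^sub>F q in sequentially. \<forall>g B. finite {x. g x \<noteq> 0} \<longrightarrow> 0 < B \<longrightarrow> Lp_norm (mq q) r g \<le> ennreal B
      \<longrightarrow> Lp_norm (mq q) r (Sq q c g) \<le> ennreal (M * B)"
  shows "(\<Sum>x\<in>X. norm (Sop c f x) powr enn2real r * m x) \<le> (\<Sum>x\<in>X. M powr enn2real r * norm (f x) powr enn2real r * m x)"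
proof (rule transfer_limit[OF c X P, of "\<lambda>x t. t powr enn2real r"])
  let ?r = "enn2real r"
  have r1: "1 \<le> ?r" using ennreal_real_ge_1[OF r] .
  fix q \<kappa> and V :: "'a \<Rightarrow> 'b set" and C e
  assume q: "1 \<le> q" and bd: "\<forall>g B. finite {x. g x \<noteq> 0} \<longrightarrow> 0 < B \<longrightarrow> Lp_norm (mq q) r g \<le> ennreal B
      \<longrightarrow> Lp_norm (mq q) r (Sq q c g) \<le> ennreal (M * B)"
    and tr: "transfers q c f e X \<kappa> V C"
  interpret H: flow_tree "\<T> q" "mq q" by (rule flow_tree_q[OF q])
  define U where "U = (\<Union>x\<in>X. V x)"
  have U: "finite U" unfolding U_def by (rule finite_UN_I[OF X(1) transfersD(3)[OF tr]])
  have C: "0 < C" by (rule transfersD(1)[OF tr])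
  let ?g = "lift X V f"
  define I where "I = (\<Sum>x'\<in>U. norm (?g x') powr ?r * mq q x')"
  have I0: "0 \<le> I" unfolding I_def using H.m_pos by (intro sum_nonneg) (simp add: less_imp_le)
  have I: "I = C * (\<Sum>x\<in>X. norm (f x) powr ?r * \<kappa> x)"
    unfolding I_def U_def transfers_fibre_sum[OF tr X(1)] sum_distrib_left
  proof (intro sum.cong refl)
    fix x assume x: "x \<in> X"
    show "(\<Sum>x'\<in>V x. norm (?g x') powr ?r * mq q x') = C * (norm (f x) powr ?r * \<kappa> x)"
      unfolding transfers_mass[OF tr x] using transfers_lift[OF tr X(1) x] by (intro sum.cong refl) simp
  qed
  have supp: "{x'. ?g x' \<noteq> 0} \<subseteq> U" unfolding U_def by (rule lift_support)
  have main: "(\<Sum>x'\<in>U. norm (H.Sop c ?g x') powr ?r * mq q x') \<le> M powr ?r * t" if t: "0 < t" "I \<le> t" for t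
  proof -
    define B where "B = t powr (1 / ?r)"
    have B: "0 < B" "B powr ?r = t" using t r1 by (simp_all add: B_def powr_powr)
    have "Lp_norm (mq q) r ?g \<le> ennreal B"
      unfolding H.Lp_norm_le_iff_sums[OF r less_imp_le[OF B(1)]] B(2)
    proof (intro allI impI)
      fix Y :: "'b set" assume Y: "finite Y"
      have "(\<Sum>x\<in>Y. norm (?g x) powr ?r * mq q x) = (\<Sum>x\<in>Y \<inter> U. norm (?g x) powr ?r * mq q x)"
        by (rule sum.mono_neutral_right[OF Y]) (use supp in auto)
      also have "\<dots> \<le> I" unfolding I_def
        by (rule sum_mono2[OF U]) (use H.m_pos in \<open>auto simp: less_imp_le\<close>)
      finally show "(\<Sum>x\<in>Y. norm (?g x) powr ?r * mq q x) \<le> t" using t(2) by simp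
    qed
    then have "Lp_norm (mq q) r (H.Sop c ?g) \<le> ennreal (M * B)"
      using bd[rule_format, OF finite_subset[OF supp U] B(1)] by simp
    then have "(\<Sum>x'\<in>U. norm (H.Sop c ?g x') powr ?r * mq q x') \<le> (M * B) powr ?r"
      using H.Lp_norm_le_iff_sums[OF r, of "M * B" "H.Sop c ?g"] U M B(1) by simp
    then show ?thesis using M B by (simp add: powr_mult)
  qed
  \<comment> \<open>The assumption speaks of positive \<open>B\<close> only, so for
    \<open>I = 0\<close> the estimate is used for every \<open>t > 0\<close> and \<open>t\<close>
    tends to zero.\<close>
  have main': "(\<Sum>x'\<in>U. norm (H.Sop c ?g x') powr ?r * mq q x') \<le> M powr ?r * I"
  proof (cases "I = 0")
    case False
    then show ?thesis using main[of I] I0 by simp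
  next
    case True
    have "((\<lambda>t. M powr ?r * t) \<longlongrightarrow> M powr ?r * 0) (at_right 0)" by (intro tendsto_intros)
    then show ?thesis unfolding True
      by (rule tendsto_lowerbound)
        (use main True in \<open>auto simp: eventually_at_right_field intro!: exI[of _ 1]\<close>)
  qed
  have "C * (\<Sum>x\<in>X. max 0 (norm (Sop c f x) - e) powr ?r * \<kappa> x)
      = (\<Sum>x\<in>X. \<Sum>x'\<in>V x. max 0 (norm (Sop c f x) - e) powr ?r * mq q x')"
    unfolding sum_distrib_left by (intro sum.cong refl transfers_mass[OF tr])
  also have "\<dots> \<le> (\<Sum>x\<in>X. \<Sum>x'\<in>V x. norm (H.Sop c ?g x') powr ?r * mq q x')"
  proof (intro sum_mono mult_right_mono)
    fix x x' assume "x \<in> X" "x' \<in> V x"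
    from transfers_near[OF tr this] show "max 0 (norm (Sop c f x) - e) powr ?r \<le> norm (H.Sop c ?g x') powr ?r"
      using r1 by (intro powr_mono2) simp_all
  qed (use H.m_pos in \<open>simp add: less_imp_le\<close>)
  also have "\<dots> \<le> M powr ?r * I"
    using main' unfolding U_def transfers_fibre_sum[OF tr X(1)] .
  also have "\<dots> = C * (\<Sum>x\<in>X. M powr ?r * norm (f x) powr ?r * \<kappa> x)"
    unfolding I sum_distrib_left by (intro sum.cong refl) (simp add: mult_ac)
  finally show "(\<Sum>x\<in>X. max 0 (norm (Sop c f x) - e) powr ?r * \<kappa> x) \<le> (\<Sum>x\<in>X. M powr ?r * norm (f x) powr ?r * \<kappa> x)"
    using C by simp
next
  show "((\<lambda>e. max 0 (norm (Sop c f x) - e) powr enn2real r) \<longlongrightarrow> norm (Sop c f x) powr enn2real r) (at_right 0)" for x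
    using ennreal_real_ge_1[OF r] by (intro tendsto_powr_max_diff) auto
qed

text \<open>A family of test functions vanishing off \<open>x\<close> isolates a single vertex. The
  inequality stays multiplied by \<open>\<kappa> x\<close>, which might be zero for some
  \<open>q\<close>; division happens after the limit, by \<open>m x > 0\<close>.\<close>

lemma sup_bound_finite_support:
  assumes c: "summable (\<lambda>n. real (Suc n) * norm (c n))"
    and f: "finite {x. f x \<noteq> 0}" "\<And>x. norm (f x) \<le> B" and B: "0 < B" and M: "0 \<le> M"
    and P: "\<exists>\<^sub>F q in sequentially. \<forall>g B. finite {x. g x \<noteq> 0} \<longrightarrow> 0 < B \<longrightarrow> Lp_norm (mq q) \<infinity> g \<le> ennreal B
      \<longrightarrow> Lp_norm (mq q) \<infinity> (Sq q c g) \<le> ennreal (M * B)"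
  shows "norm (Sop c f x) \<le> M * B"
proof -
  define X where "X = insert x {x. f x \<noteq> 0}"
  have X: "finite X" "{x. f x \<noteq> 0} \<subseteq> X" using f(1) by (auto simp: X_def)
  have "(\<Sum>z\<in>X. (if z = x then norm (Sop c f z) else 0) * m z) \<le> (\<Sum>z\<in>X. (if z = x then M * B else 0) * m z)"
  proof (rule transfer_limit[OF c X P, of "\<lambda>z t. if z = x then t else 0"])
    fix q \<kappa> and V :: "'a \<Rightarrow> 'b set" and C e
    assume q: "1 \<le> q" and bd: "\<forall>g B. finite {x. g x \<noteq> 0} \<longrightarrow> 0 < B \<longrightarrow> Lp_norm (mq q) \<infinity> g \<le> ennreal B
        \<longrightarrow> Lp_norm (mq q) \<infinity> (Sq q c g) \<le> ennreal (M * B)"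
      and tr: "transfers q c f e X \<kappa> V C"
    interpret H: flow_tree "\<T> q" "mq q" by (rule flow_tree_q[OF q])
    let ?g = "lift X V f"
    have "finite (\<Union>x\<in>X. V x)" by (rule finite_UN_I[OF X(1) transfersD(3)[OF tr]])
    then have fin: "finite {x'. ?g x' \<noteq> 0}" by (rule finite_subset[OF lift_support])
    have "Lp_norm (mq q) \<infinity> ?g \<le> ennreal B"
      unfolding Lp_norm_infinity_le_iff[OF less_imp_le[OF B]]
      by (rule allI, rule norm_lift_le[of X f B V, OF X(1) f(2) transfersD(2)[OF tr]])
    then have "Lp_norm (mq q) \<infinity> (H.Sop c ?g) \<le> ennreal (M * B)" using bd B fin by blast
    moreover have "0 \<le> M * B" using M B by simp
    ultimately have Sg: "norm (H.Sop c ?g x') \<le> M * B" for x'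
      using Lp_norm_infinity_le_iff[of "M * B" "mq q" "H.Sop c ?g"] by blast
    have x: "x \<in> X" by (simp add: X_def)
    have C: "0 < C" by (rule transfersD(1)[OF tr])
    have "C * (max 0 (norm (Sop c f x) - e) * \<kappa> x) = (\<Sum>x'\<in>V x. max 0 (norm (Sop c f x) - e) * mq q x')"
      by (rule transfers_mass[OF tr x])
    also have "\<dots> \<le> (\<Sum>x'\<in>V x. M * B * mq q x')"
      using order_trans[OF transfers_near[OF tr x] Sg] H.m_pos
      by (intro sum_mono mult_right_mono) (simp_all add: less_imp_le)
    also have "\<dots> = C * (M * B * \<kappa> x)" by (rule transfers_mass[OF tr x, symmetric])
    finally have "max 0 (norm (Sop c f x) - e) * \<kappa> x \<le> M * B * \<kappa> x" using C by simp
    moreover have "(\<Sum>z\<in>X. (if z = x then t z else 0) * \<kappa> z) = t x * \<kappa> x" for t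
    proof -
      have "(\<Sum>z\<in>X. (if z = x then t z else 0) * \<kappa> z) = (\<Sum>z\<in>X. if z = x then t z * \<kappa> z else 0)"
        by (intro sum.cong refl) simp
      then show ?thesis using X(1) x by simp
    qed
    ultimately show "(\<Sum>z\<in>X. (if z = x then max 0 (norm (Sop c f z) - e) else 0) * \<kappa> z)
        \<le> (\<Sum>z\<in>X. (if z = x then M * B else 0) * \<kappa> z)" by simp
  next
    show "((\<lambda>e. if z = x then max 0 (norm (Sop c f z) - e) else 0) \<longlongrightarrow> (if z = x then norm (Sop c f z) else 0)) (at_right 0)" for z
    proof -
      have "((\<lambda>e. max 0 (norm (Sop c f z) - e)) \<longlongrightarrow> max 0 (norm (Sop c f z) - 0)) (at_right 0)" by (intro tendsto_intros)
      then show ?thesis by (cases "z = x") simp_all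
    qed
  qed
  moreover have "(\<Sum>z\<in>X. (if z = x then t z else 0) * m z) = t x * m x" for t
  proof -
    have "(\<Sum>z\<in>X. (if z = x then t z else 0) * m z) = (\<Sum>z\<in>X. if z = x then t z * m z else 0)"
      by (intro sum.cong refl) simp
    then show ?thesis using X(1) by (simp add: X_def)
  qed
  ultimately show ?thesis using m_pos[of x] by simp
qed

end

context homogeneous_family
begin

text \<open>The lift of \<open>delta y\<close> is the indicator of the fibre over \<open>y\<close>,
  so the column bounds of all \<open>y'\<close> in that fibre are added up. Levels agree, and
  distances between fibres are at least those in \<open>T\<close>, so a weight increasing in the
  distance compares in the right direction.\<close>

lemma weighted_kernel_bound:
  fixes w :: "nat \<Rightarrow> int \<Rightarrow> int \<Rightarrow> real"
  assumes c: "summable (\<lambda>n. real (Suc n) * norm (c n))" and X: "finite X" "y \<in> X"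
    and w: "\<And>n i j. 0 \<le> w n i j" "\<And>i j. mono (\<lambda>n. w n i j)"
    and P: "\<exists>\<^sub>F q in sequentially. \<forall>y' U. finite U \<longrightarrow>
      (\<Sum>x'\<in>U. w (graph_dist (edges (\<T> q)) x' y') (level (\<T> q) x') (level (\<T> q) y')
        * norm (Sq q c (delta y') x') * mq q x') \<le> M * mq q y'"
  shows "(\<Sum>x\<in>X. w (graph_dist (edges T) x y) (level T x) (level T y) * norm (Sop c (delta y) x) * m x) \<le> M * m y"
proof -
  let ?w = "\<lambda>x. w (graph_dist (edges T) x y) (level T x) (level T y)"
  have supp: "{x. delta y x \<noteq> 0} \<subseteq> X" using X(2) by (auto simp: delta_def)
  have sum_y: "(\<Sum>x\<in>X. (if x = y then M else 0) * t x) = M * t y" for t :: "'a \<Rightarrow> real"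
  proof -
    have "(\<Sum>x\<in>X. (if x = y then M else 0) * t x) = (\<Sum>x\<in>X. if x = y then M * t x else 0)"
      by (intro sum.cong refl) simp
    then show ?thesis using X by simp
  qed
  have "(\<Sum>x\<in>X. ?w x * norm (Sop c (delta y) x) * m x) \<le> (\<Sum>x\<in>X. (if x = y then M else 0) * m x)"
  proof (rule transfer_limit[OF c X(1) supp P, of "\<lambda>x t. ?w x * t"])
    fix q \<kappa> and V :: "'a \<Rightarrow> 'b set" and C e
    let ?w' = "\<lambda>x' y'. w (graph_dist (edges (\<T> q)) x' y') (level (\<T> q) x') (level (\<T> q) y')"
    assume q: "1 \<le> q" and tr: "transfers q c (delta y) e X \<kappa> V C"
      and bd: "\<forall>y' U. finite U \<longrightarrow> (\<Sum>x'\<in>U. ?w' x' y' * norm (Sq q c (delta y') x') * mq q x') \<le> M * mq q y'"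
    interpret H: flow_tree "\<T> q" "mq q" by (rule flow_tree_q[OF q])
    let ?g = "lift X V (delta y)"
    define U where "U = (\<Union>x\<in>X. V x)"
    have U: "finite U" unfolding U_def by (rule finite_UN_I[OF X(1) transfersD(3)[OF tr]])
    have C: "0 < C" by (rule transfersD(1)[OF tr])
    have supp_g: "{y'. ?g y' \<noteq> 0} = V y"
    proof
      show "{y'. ?g y' \<noteq> 0} \<subseteq> V y"
      proof
        fix y' assume y': "y' \<in> {y'. ?g y' \<noteq> 0}"
        then obtain z where z: "z \<in> X" "y' \<in> V z" using lift_support[of X V "delta y"] by auto
        have "?g y' = delta y z" by (rule transfers_lift[OF tr X(1) z])
        then have "z = y" using y' by (auto simp: delta_def split: if_splits)
        then show "y' \<in> V y" using z by simp
      qed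
      show "V y \<subseteq> {y'. ?g y' \<noteq> 0}" using transfers_lift[OF tr X] by (auto simp: delta_def)
    qed
    have fin: "finite {y'. ?g y' \<noteq> 0}" unfolding supp_g by (rule transfersD(3)[OF tr X(2)])
    have Sg: "norm (H.Sop c ?g x') \<le> (\<Sum>y'\<in>V y. norm (H.Sop c (delta y') x'))" for x'
    proof -
      have "H.Sop c ?g x' = (\<Sum>y'\<in>V y. ?g y' * H.Sop c (delta y') x')"
        using H.Sop_finite_support[OF c fin] by (simp only: supp_g)
      also have "\<dots> = (\<Sum>y'\<in>V y. H.Sop c (delta y') x')"
        by (intro sum.cong refl) (simp add: transfers_lift[OF tr X] delta_def)
      finally show ?thesis by (simp add: norm_sum)
    qed
    have ww: "?w x \<le> ?w' x' y'" if x: "x \<in> X" "x' \<in> V x" and y': "y' \<in> V y" for x x' y'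
    proof -
      have "level (\<T> q) x' = level T x" "level (\<T> q) y' = level T y"
        "graph_dist (edges T) x y \<le> graph_dist (edges (\<T> q)) x' y'"
        using tr x y' X(2) unfolding transfers_def by blast+
      then show ?thesis using monoD[OF w(2)] by simp
    qed
    have "C * (\<Sum>x\<in>X. ?w x * max 0 (norm (Sop c (delta y) x) - e) * \<kappa> x)
        = (\<Sum>x\<in>X. \<Sum>x'\<in>V x. ?w x * max 0 (norm (Sop c (delta y) x) - e) * mq q x')"
      unfolding sum_distrib_left by (intro sum.cong refl transfers_mass[OF tr])
    also have "\<dots> \<le> (\<Sum>x\<in>X. \<Sum>x'\<in>V x. \<Sum>y'\<in>V y. ?w' x' y' * norm (H.Sop c (delta y') x') * mq q x')"
    proof (intro sum_mono)
      fix x x' assume x: "x \<in> X" "x' \<in> V x"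
      have "?w x * max 0 (norm (Sop c (delta y) x) - e) \<le> ?w x * (\<Sum>y'\<in>V y. norm (H.Sop c (delta y') x'))"
        using order_trans[OF transfers_near[OF tr x] Sg] by (intro mult_left_mono w(1))
      also have "\<dots> \<le> (\<Sum>y'\<in>V y. ?w' x' y' * norm (H.Sop c (delta y') x'))"
        unfolding sum_distrib_left by (intro sum_mono mult_right_mono ww[OF x]) simp_all
      finally show "?w x * max 0 (norm (Sop c (delta y) x) - e) * mq q x'
          \<le> (\<Sum>y'\<in>V y. ?w' x' y' * norm (H.Sop c (delta y') x') * mq q x')"
        unfolding sum_distrib_right[symmetric] using H.m_pos[of x'] by (intro mult_right_mono) simp_all
    qed
    also have "\<dots> = (\<Sum>x'\<in>U. \<Sum>y'\<in>V y. ?w' x' y' * norm (H.Sop c (delta y') x') * mq q x')"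
      unfolding U_def by (rule transfers_fibre_sum[OF tr X(1), symmetric])
    \<comment> \<open>After the exchange the inner sum is the column at a fixed \<open>y'\<close>,
      to which the assumed bound applies.\<close>
    also have "\<dots> = (\<Sum>y'\<in>V y. \<Sum>x'\<in>U. ?w' x' y' * norm (H.Sop c (delta y') x') * mq q x')"
      by (rule sum.swap)
    also have "\<dots> \<le> (\<Sum>y'\<in>V y. M * mq q y')" using bd U by (intro sum_mono) blast
    also have "\<dots> = C * (M * \<kappa> y)" by (rule transfers_mass[OF tr X(2), symmetric])
    finally show "(\<Sum>x\<in>X. ?w x * max 0 (norm (Sop c (delta y) x) - e) * \<kappa> x) \<le> (\<Sum>x\<in>X. (if x = y then M else 0) * \<kappa> x)"
      using C by (simp add: sum_y)
  next
    fix x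
    have "((\<lambda>e. ?w x * max 0 (norm (Sop c (delta y) x) - e)) \<longlongrightarrow> ?w x * max 0 (norm (Sop c (delta y) x) - 0)) (at_right 0)"
      by (intro tendsto_intros)
    then show "((\<lambda>e. ?w x * max 0 (norm (Sop c (delta y) x) - e)) \<longlongrightarrow> ?w x * norm (Sop c (delta y) x)) (at_right 0)"
      by simp
  qed
  then show ?thesis by (simp only: sum_y)
qed

text \<open>The norm of the image is tested on a finite set, and \<open>f\<close> is truncated to a
  finite set containing it. The truncated function is covered by the bounds for finite support, and
  its image is within \<open>e\<close> of the original on the test set.\<close>

lemma Lp_norm_Sop_le_of_frequently:
  assumes c: "summable (\<lambda>n. real (Suc n) * norm (c n))" and r: "1 \<le> r" and M: "0 \<le> M"
    and P: "\<exists>\<^sub>F q in sequentially. \<forall>g B. finite {x. g x \<noteq> 0} \<longrightarrow> 0 < B \<longrightarrow> Lp_norm (mq q) r g \<le> ennreal B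
      \<longrightarrow> Lp_norm (mq q) r (Sq q c g) \<le> ennreal (M * B)"
    and f: "f \<in> Lp m r" "Lp_norm m r f \<le> 1"
  shows "Lp_norm m r (Sop c f) \<le> ennreal M"
proof -
  define h where "h Y y = (if y \<in> Y then f y else 0)" for Y y
  have f1: "Lp_norm m r f \<le> ennreal 1" using f(2) by simp
  have near: "max 0 (norm (Sop c f x) - e) \<le> norm (Sop c (h Y) x)"
    if "norm (Sop c (h Y) x - Sop c f x) \<le> e" for x e Y
  proof -
    have "norm (Sop c f x - Sop c (h Y) x) \<le> e" using that by (simp only: norm_minus_commute)
    then have "norm (Sop c f x) - norm (Sop c (h Y) x) \<le> e" using norm_triangle_ineq2 order_trans by blast
    then show ?thesis by simp
  qed
  have trunc: "\<exists>Y. finite Y \<and> X \<subseteq> Y \<and> (\<forall>x\<in>X. norm (Sop c (h Y) x - Sop c f x) \<le> e)" if "finite X" "0 < e" for X e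
    using Sop_truncate[OF c f(1) r that] unfolding h_def[abs_def] .
  show ?thesis
  proof (cases "r = \<infinity>")
    case True
    have f1': "norm (f x) \<le> 1" for x using f1 unfolding True by (subst (asm) Lp_norm_infinity_le_iff) simp_all
    show ?thesis unfolding True Lp_norm_infinity_le_iff[OF M]
    proof
      fix x
      show "norm (Sop c f x) \<le> M"
      proof (rule field_le_epsilon)
        fix e :: real assume e: "0 < e"
        obtain Y where Y: "finite Y" "norm (Sop c (h Y) x - Sop c f x) \<le> e" using trunc[of "{x}" e] e by auto
        have "finite {y. h Y y \<noteq> 0}" by (rule finite_subset[OF _ Y(1)]) (auto simp: h_def)
        moreover have "norm (h Y y) \<le> 1" for y using f1'[of y] by (simp add: h_def)
        ultimately have "norm (Sop c (h Y) x) \<le> M * 1"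
          by (rule sup_bound_finite_support[OF c _ _ _ M P[unfolded True]]) simp
        then show "norm (Sop c f x) \<le> M + e" using near[OF Y(2)] by simp
      qed
    qed
  next
    case False
    let ?r = "enn2real r"
    have r1: "1 \<le> ?r" using ennreal_real_ge_1[OF r False] .
    show ?thesis unfolding Lp_norm_le_iff_sums[OF r False M]
    proof (intro allI impI)
      fix X :: "'a set" assume X: "finite X"
      have main: "(\<Sum>x\<in>X. max 0 (norm (Sop c f x) - e) powr ?r * m x) \<le> M powr ?r" if e: "0 < e" for e
      proof -
        obtain Y where Y: "finite Y" "X \<subseteq> Y" "\<And>x. x \<in> X \<Longrightarrow> norm (Sop c (h Y) x - Sop c f x) \<le> e"
          using trunc[OF X e] by blast
        have supp: "{y. h Y y \<noteq> 0} \<subseteq> Y" by (auto simp: h_def)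
        have "(\<Sum>x\<in>X. max 0 (norm (Sop c f x) - e) powr ?r * m x) \<le> (\<Sum>x\<in>X. norm (Sop c (h Y) x) powr ?r * m x)"
        proof (intro sum_mono mult_right_mono)
          fix x assume "x \<in> X"
          from near[OF Y(3)[OF this]] show "max 0 (norm (Sop c f x) - e) powr ?r \<le> norm (Sop c (h Y) x) powr ?r"
            using r1 by (intro powr_mono2) simp_all
        qed (use m_pos in \<open>simp add: less_imp_le\<close>)
        also have "\<dots> \<le> (\<Sum>x\<in>Y. norm (Sop c (h Y) x) powr ?r * m x)"
          by (rule sum_mono2[OF Y(1,2)]) (use m_pos in \<open>simp add: less_imp_le\<close>)
        also have "\<dots> \<le> (\<Sum>x\<in>Y. M powr ?r * norm (h Y x) powr ?r * m x)"
          by (rule Lp_bound_finite_support[OF c Y(1) supp r False M P])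
        also have "\<dots> = M powr ?r * (\<Sum>x\<in>Y. norm (f x) powr ?r * m x)"
          unfolding sum_distrib_left by (intro sum.cong refl) (simp add: h_def)
        also have "\<dots> \<le> M powr ?r * 1"
          using f1 Y(1) unfolding Lp_norm_le_iff_sums[OF r False zero_le_one] by (intro mult_left_mono) simp_all
        finally show ?thesis by simp
      qed
      have "((\<lambda>e. \<Sum>x\<in>X. max 0 (norm (Sop c f x) - e) powr ?r * m x) \<longlongrightarrow> (\<Sum>x\<in>X. norm (Sop c f x) powr ?r * m x)) (at_right 0)"
        using r1 by (intro tendsto_sum tendsto_mult_right tendsto_powr_max_diff) simp_all
      then show "(\<Sum>x\<in>X. norm (Sop c f x) powr ?r * m x) \<le> M powr ?r"
      proof (rule tendsto_upperbound)
        show "\<forall>\<^sub>F e in at_right 0. (\<Sum>x\<in>X. max 0 (norm (Sop c f x) - e) powr ?r * m x) \<le> M powr ?r"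
          unfolding eventually_at_right_field using main by (intro exI[of _ 1]) auto
      qed simp
    qed
  qed
qed

text \<open>Every finite \<open>M\<close> strictly above the liminf bounds \<open>u q\<close> for
  infinitely many \<open>q\<close>, and \<open>a\<close> lies below all such \<open>M\<close>.
  Degrees below one are discarded, since the family is homogeneous from degree one on.\<close>

lemma le_liminf_transfer:
  fixes u :: "nat \<Rightarrow> ennreal"
  assumes "\<And>M. 0 \<le> M \<Longrightarrow> \<exists>\<^sub>F q in sequentially. 1 \<le> q \<and> u q \<le> ennreal M \<Longrightarrow> a \<le> ennreal M"
  shows "a \<le> liminf u"
proof (rule dense_ge)
  fix t assume t: "liminf u < t"
  show "a \<le> t"
  proof (cases t)
    case (real M)
    have "\<exists>\<^sub>F q in sequentially. u q \<le> t"
    proof (rule ccontr)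
      assume "\<not> ?thesis"
      then have "\<forall>\<^sub>F q in sequentially. t \<le> u q"
        by (auto simp: not_frequently not_le elim!: eventually_mono)
      then have "t \<le> liminf u" by (rule Liminf_bounded)
      then show False using t by simp
    qed
    then have "\<exists>\<^sub>F q in sequentially. 1 \<le> q \<and> u q \<le> t"
    proof (rule frequently_rev_mp)
      show "\<forall>\<^sub>F q in sequentially. u q \<le> t \<longrightarrow> 1 \<le> q \<and> u q \<le> t"
        using eventually_ge_at_top[of 1] by eventually_elim blast
    qed
    then show ?thesis using assms[of M] real by simp
  qed simp
qed

lemma calculus_norm_le_liminf:
  assumes F: "expansion F c" and r: "1 \<le> r"
  shows "calculus_norm T m r F \<le> liminf (\<lambda>q. calculus_norm (\<T> q) (mq q) r F)"
proof (rule le_liminf_transfer)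
  fix M :: real assume M: "0 \<le> M" and fr: "\<exists>\<^sub>F q in sequentially. 1 \<le> q \<and> calculus_norm (\<T> q) (mq q) r F \<le> ennreal M"
  have c: "summable (\<lambda>n. real (Suc n) * norm (c n))" using F by (simp add: expansion_def)
  have bound: "\<forall>g B. finite {x. g x \<noteq> 0} \<longrightarrow> 0 < B \<longrightarrow> Lp_norm (mq q) r g \<le> ennreal B
      \<longrightarrow> Lp_norm (mq q) r (Sq q c g) \<le> ennreal (M * B)"
    if q: "1 \<le> q" and le: "calculus_norm (\<T> q) (mq q) r F \<le> ennreal M" for q
  proof (intro allI impI)
    interpret H: flow_tree "\<T> q" "mq q" by (rule flow_tree_q[OF q])
    fix g :: "'b \<Rightarrow> complex" and B :: real
    assume fin: "finite {x. g x \<noteq> 0}" and B: "0 < B" and g: "Lp_norm (mq q) r g \<le> ennreal B"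
    \<comment> \<open>The operator norm is a supremum over the unit ball, so \<open>g\<close> is
      scaled into it and the result scaled back.\<close>
    let ?g = "\<lambda>x. complex_of_real (1 / B) * g x"
    have gL: "g \<in> Lp (mq q) r" by (rule H.Lp_finite_support[OF fin r])
    have "Lp_norm (mq q) r ?g = ennreal (1 / B) * Lp_norm (mq q) r g"
      using Lp_norm_mult[OF r, of "mq q" "complex_of_real (1 / B)" g] B by (simp add: norm_divide)
    also have "\<dots> \<le> ennreal (1 / B) * ennreal B" by (rule mult_left_mono[OF g]) simp
    also have "\<dots> = 1" using B by (simp add: ennreal_mult[symmetric])
    finally have g1: "Lp_norm (mq q) r ?g \<le> 1" .
    have "?g \<in> Lp (mq q) r" using g1 by (simp add: Lp_def le_less_trans)
    then have "Lp_norm (mq q) r (H.Sop c ?g) \<le> calculus_norm (\<T> q) (mq q) r F"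
      unfolding H.calculus_norm_eq[OF F r] using g1 by (intro SUP_upper) simp
    then have *: "Lp_norm (mq q) r (H.Sop c ?g) \<le> ennreal M" using le by (rule order_trans)
    have "H.Sop c g = (\<lambda>x. complex_of_real B * H.Sop c ?g x)"
      unfolding H.Sop_mult[OF c H.Lp_tame[OF gL r]] using B by (simp add: mult.assoc[symmetric])
    then have "Lp_norm (mq q) r (H.Sop c g) = ennreal B * Lp_norm (mq q) r (H.Sop c ?g)"
      using Lp_norm_mult[OF r, of "mq q" "complex_of_real B" "H.Sop c ?g"] B by simp
    also have "\<dots> \<le> ennreal B * ennreal M" by (rule mult_left_mono[OF *]) simp
    also have "\<dots> = ennreal (M * B)" using M B by (simp add: ennreal_mult[symmetric] mult.commute)
    finally show "Lp_norm (mq q) r (H.Sop c g) \<le> ennreal (M * B)" .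
  qed
  have P: "\<exists>\<^sub>F q in sequentially. \<forall>g B. finite {x. g x \<noteq> 0} \<longrightarrow> 0 < B \<longrightarrow> Lp_norm (mq q) r g \<le> ennreal B
      \<longrightarrow> Lp_norm (mq q) r (Sq q c g) \<le> ennreal (M * B)"
    by (rule frequently_mono[OF _ fr]) (use bound in blast)
  show "calculus_norm T m r F \<le> ennreal M"
    unfolding calculus_norm_eq[OF F r] by (rule SUP_least) (use Lp_norm_Sop_le_of_frequently[OF c r M P] in blast)
qed

lemma weighted_kernel_le_liminf:
  assumes F: "expansion F c"
    and w: "\<And>n i j. 0 \<le> w n i j" "\<And>i j. mono (\<lambda>n. w n i j)"
  shows "weighted_kernel_sup T m w F \<le> liminf (\<lambda>q. weighted_kernel_sup (\<T> q) (mq q) w F)"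
proof (rule le_liminf_transfer)
  fix M :: real assume M: "0 \<le> M" and fr: "\<exists>\<^sub>F q in sequentially. 1 \<le> q \<and> weighted_kernel_sup (\<T> q) (mq q) w F \<le> ennreal M"
  have c: "summable (\<lambda>n. real (Suc n) * norm (c n))" using F by (simp add: expansion_def)
  have bound: "\<forall>y' U. finite U \<longrightarrow>
      (\<Sum>x'\<in>U. w (graph_dist (edges (\<T> q)) x' y') (level (\<T> q) x') (level (\<T> q) y')
        * norm (Sq q c (delta y') x') * mq q x') \<le> M * mq q y'"
    if q: "1 \<le> q" and le: "weighted_kernel_sup (\<T> q) (mq q) w F \<le> ennreal M" for q
  proof (intro allI impI)
    interpret H: flow_tree "\<T> q" "mq q" by (rule flow_tree_q[OF q])
    fix y' and U :: "'b set" assume U: "finite U"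
    let ?w = "\<lambda>x'. w (graph_dist (edges (\<T> q)) x' y') (level (\<T> q) x') (level (\<T> q) y')"
    have "(\<integral>\<^sup>+x'. ennreal (?w x' * norm (calculus_kernel (\<T> q) (mq q) F x' y')) \<partial>flow_measure (mq q)) \<le> ennreal M"
      using le unfolding weighted_kernel_sup_def SUP_le_iff by blast
    then have "(\<Sum>x'\<in>U. ?w x' * norm (calculus_kernel (\<T> q) (mq q) F x' y') * mq q x') \<le> M"
      using U M w(1) by (subst (asm) H.nn_integral_flow_le_iff) simp_all
    \<comment> \<open>The kernel is the column of \<open>Sop\<close> divided by the mass of
      \<open>y'\<close>; multiplying by that mass gives the form used in the transfer.\<close>
    then have "(\<Sum>x'\<in>U. ?w x' * norm (calculus_kernel (\<T> q) (mq q) F x' y') * mq q x') * mq q y' \<le> M * mq q y'"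
      using H.m_pos[of y'] by (intro mult_right_mono) simp_all
    moreover have "(\<Sum>x'\<in>U. ?w x' * norm (calculus_kernel (\<T> q) (mq q) F x' y') * mq q x') * mq q y'
        = (\<Sum>x'\<in>U. ?w x' * norm (H.Sop c (delta y') x') * mq q x')"
      unfolding sum_distrib_right
      by (intro sum.cong refl) (use H.m_pos[of y'] in \<open>simp add: H.calculus_kernel_eq[OF F] norm_divide\<close>)
    ultimately show "(\<Sum>x'\<in>U. ?w x' * norm (H.Sop c (delta y') x') * mq q x') \<le> M * mq q y'" by simp
  qed
  have P: "\<exists>\<^sub>F q in sequentially. \<forall>y' U. finite U \<longrightarrow>
      (\<Sum>x'\<in>U. w (graph_dist (edges (\<T> q)) x' y') (level (\<T> q) x') (level (\<T> q) y')
        * norm (Sq q c (delta y') x') * mq q x') \<le> M * mq q y'"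
    by (rule frequently_mono[OF _ fr]) (use bound in blast)
  show "weighted_kernel_sup T m w F \<le> ennreal M"
    unfolding weighted_kernel_sup_def
  proof (rule SUP_least)
    fix y
    let ?w = "\<lambda>x. w (graph_dist (edges T) x y) (level T x) (level T y)"
    show "(\<integral>\<^sup>+x. ennreal (?w x * norm (calculus_kernel T m F x y)) \<partial>flow_measure m) \<le> ennreal M"
    proof (subst nn_integral_flow_le_iff)
      show "\<forall>X. finite X \<longrightarrow> (\<Sum>x\<in>X. ?w x * norm (calculus_kernel T m F x y) * m x) \<le> M"
      proof (intro allI impI)
        fix X :: "'a set" assume X: "finite X"
        have "(\<Sum>x\<in>X. ?w x * norm (calculus_kernel T m F x y) * m x) * m y
            = (\<Sum>x\<in>X. ?w x * norm (Sop c (delta y) x) * m x)"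
          unfolding sum_distrib_right
          by (intro sum.cong refl) (use m_pos[of y] in \<open>simp add: calculus_kernel_eq[OF F] norm_divide\<close>)
        \<comment> \<open>The test set must contain \<open>y\<close>, the support of
          \<open>delta y\<close>; the added term is nonnegative.\<close>
        also have "\<dots> \<le> (\<Sum>x\<in>insert y X. ?w x * norm (Sop c (delta y) x) * m x)"
          by (rule sum_mono2) (use X w(1) m_pos in \<open>auto simp: less_imp_le\<close>)
        also have "\<dots> \<le> M * m y"
          by (rule weighted_kernel_bound[OF c _ _ w P]) (use X in simp_all)
        finally show "(\<Sum>x\<in>X. ?w x * norm (calculus_kernel T m F x y) * m x) \<le> M"
          using m_pos[of y] by simp
      qed
    qed (use w(1) M in simp_all)
  qed
qed

end

theorem theorem5p11:
  fixes T :: "'a rooted_tree" and m :: "'a \<Rightarrow> real"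
    and \<T> :: "nat \<Rightarrow> 'b rooted_tree"
    and F :: "real \<Rightarrow> complex" and \<epsilon> :: real
  assumes "is_flow_tree T m"
    and "\<And>q. q \<ge> 1 \<Longrightarrow> is_homogeneous_tree q (\<T> q)"
    and "\<epsilon> > 0"
    and "F \<in> L2_sobolev (3/2 + \<epsilon>)"
    and "continuous_on UNIV F"
  shows "(\<forall>p::ennreal. p \<ge> 1 \<longrightarrow>
            calculus_norm T m p F
              \<le> liminf (\<lambda>q. calculus_norm (\<T> q) (canonical_flow q (\<T> q)) p F))
       \<and> (\<forall>w :: nat \<Rightarrow> int \<Rightarrow> int \<Rightarrow> real.
            (\<forall>n i j. w n i j \<ge> 0) \<longrightarrow> (\<forall>i j. mono (\<lambda>n. w n i j)) \<longrightarrow>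
            weighted_kernel_sup T m w F
              \<le> liminf (\<lambda>q. weighted_kernel_sup (\<T> q) (canonical_flow q (\<T> q)) w F))"
proof -
  obtain c where c: "summable (\<lambda>n. real (Suc n) * norm (c n))"
    "\<forall>x\<in>{-1..1}. (\<lambda>n. c n * complex_of_real (chebU n x)) sums F (1 - x)"
    using sobolev_chebyshev_expansion[OF assms(3-5)] by blast
  \<comment> \<open>Both estimates hold for every function with such an expansion, on all the trees
    with the same coefficients \<open>c\<close>.\<close>
  have F: "expansion F c" using c assms(4) by (simp add: expansion_def L2_sobolev_def)
  interpret homogeneous_family T m \<T>
    by unfold_locales (use assms(1,2) in \<open>auto simp only: is_flow_tree_def\<close>)
  show ?thesis using calculus_norm_le_liminf[OF F] weighted_kernel_le_liminf[OF F] by blast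
qed

end
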